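(* Let $(X,\sigma)$ be a measure space with sigma-finite measure and let $\mathbf A$ be a non-negative self-adjoint operator in $L^2(X,\sigma)$ such that, for every $t>0$, the operator $e^{-t\mathbf A}$ is positivity preserving and bounded from $L^1(X)$ to $L^\infty(X)$. Suppose that there are exponents $\delta\ge0$ and $D$ with $$M_{\mathbf A}(t)=O(t^{-\delta/2}),\ t\to0;\qquad M_{\mathbf A}(t)=O(t^{-D/2}),\ t\to\infty,$$ and $D>\delta$, $D>2$. Then for any $V\ge0$, $V\in L^{D/2}(X)$, the Birman–Schwinger operator satisfies $\mathbf B_V\in\Sigma^{(0)}_{D/2}$.
   Context: Under the stated assumptions $e^{-t\mathbf A}$ is an integral operator with kernel $P(t;x,y)\in L^\infty(X\times X)$ for $t>0$, and $M_{\mathbf A}(t)=\|P(t;\cdot,\cdot)\|_{L^\infty(X\times X)}$. Let $\mathbf a$ be the quadratic form of $\mathbf A$. Under the assumptions one has $\|u\|^2_{L^p}\le C\mathbf a[u]$ for $u\in\mathrm{Dom}(\mathbf a)$, $p=2D/(D-2)$; $H_{\mathbf a}$ denotes the completion of $\mathrm{Dom}(\mathbf a)$ in the norm $\sqrt{\mathbf a[u]}$, realized as a space of functions on $X$ embedded in $L^p$. $\mathbf B_V$ is the operator in $H_{\mathbf a}$ generated by the quadratic form $\mathbf b_V[u]=\int_XV|u|^2d\sigma$ (so that the form of $\mathbf B_V$ in the inner product of $H_{\mathbf a}$ is $\mathbf b_V$). $\Sigma_p^{(0)}$ is the class of compact operators $T$ whose singular numbers satisfy $s_n(T)=o(n^{-1/p})$.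 *)

theory Defs
  imports "HOL-Probability.Probability" "HOL-Library.Landau_Symbols"
begin

text \<open>
  Elements of function spaces over a measure \<open>\<sigma>\<close> are represented by functions, and two functions
  that agree almost everywhere represent the same element.  (Possibly unbounded) operators are
  represented by their graphs.  The graphs used below are closed under changing either component on
  a null set, so they encode single-valued operators on equivalence classes.
\<close>

type_synonym 'a fn = "'a \<Rightarrow> complex"
type_synonym 'a graph = "('a fn \<times> 'a fn) set"
type_synonym 'a ip = "'a fn \<Rightarrow> 'a fn \<Rightarrow> complex"


section \<open>Lebesgue spaces\<close>

definition Lp :: "'a measure \<Rightarrow> real \<Rightarrow> ('a \<Rightarrow> 'b::{banach, second_countable_topology}) set"
  where "Lp \<sigma> p = {f \<in> borel_measurable \<sigma>. integrable \<sigma> (\<lambda>x. norm (f x) powr p)}"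

definition L2_inner :: "'a measure \<Rightarrow> 'a ip"
  where "L2_inner \<sigma> u v = (LINT x|\<sigma>. u x * cnj (v x))"


section \<open>Operators in a space H with (semi-)inner product ip\<close>

definition ip_norm :: "'a ip \<Rightarrow> 'a fn \<Rightarrow> real"
  where "ip_norm ip u = sqrt (Re (ip u u))"

definition adjoint_op :: "'a fn set \<Rightarrow> 'a ip \<Rightarrow> 'a graph \<Rightarrow> 'a graph"
  where "adjoint_op H ip T =
    {(v, w). v \<in> H \<and> w \<in> H \<and> (\<forall>(u, u') \<in> T. ip u' v = ip u w)}"

definition densely_defined :: "'a fn set \<Rightarrow> 'a ip \<Rightarrow> 'a graph \<Rightarrow> bool"
  where "densely_defined H ip T \<longleftrightarrow>
    (\<forall>u\<in>H. \<forall>\<epsilon>>0. \<exists>v\<in>Domain T. ip_norm ip (\<lambda>x. u x - v x) < \<epsilon>)"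

text \<open>Equality with the adjoint already makes the graph a closed linear subspace of \<open>H \<times> H\<close>;
  density of the domain makes it single-valued.\<close>

definition self_adjoint_op :: "'a fn set \<Rightarrow> 'a ip \<Rightarrow> 'a graph \<Rightarrow> bool"
  where "self_adjoint_op H ip T \<longleftrightarrow>
    T \<subseteq> H \<times> H \<and> densely_defined H ip T \<and> adjoint_op H ip T = T"

definition nonneg_op :: "'a ip \<Rightarrow> 'a graph \<Rightarrow> bool"
  where "nonneg_op ip T \<longleftrightarrow> (\<forall>(u, v) \<in> T. 0 \<le> Re (ip v u))"

definition linear_op :: "'a fn set \<Rightarrow> 'a ip \<Rightarrow> 'a graph \<Rightarrow> bool"
  where "linear_op H ip T \<longleftrightarrow>
    T \<subseteq> H \<times> H \<and> Domain T = H \<and>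
    (\<forall>(u, v) \<in> T. \<forall>(u', v') \<in> T. \<forall>c. (\<lambda>x. c * u x + u' x, \<lambda>x. c * v x + v' x) \<in> T) \<and>
    (\<forall>(u, v) \<in> T. ip_norm ip u = 0 \<longrightarrow> ip_norm ip v = 0)"

definition compact_op :: "'a fn set \<Rightarrow> 'a ip \<Rightarrow> 'a graph \<Rightarrow> bool"
  where "compact_op H ip T \<longleftrightarrow>
    linear_op H ip T \<and>
    (\<forall>u v. (\<forall>n::nat. (u n, v n) \<in> T) \<and> (\<exists>C. \<forall>n. ip_norm ip (u n) \<le> C) \<longrightarrow>
      (\<exists>r w. strict_mono r \<and> w \<in> H \<and> (\<lambda>n. ip_norm ip (\<lambda>x. v (r n) x - w x)) \<longlonglongrightarrow> 0))"

text \<open>The singular numbers \<open>s\<^sub>1 \<ge> s\<^sub>2 \<ge> \<dots>\<close> are the square roots of the eigenvalues of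
  \<open>T\<^sup>*T\<close>, repeated according to multiplicity and continued by 0.  Thus \<open>s\<^sub>n\<close> (for \<open>n \<ge> 1\<close>) is the
  largest \<open>s\<close> such that \<open>T\<^sup>*T\<close> has \<open>n\<close> orthonormal eigenvectors with eigenvalues at least
  \<open>s\<^sup>2\<close>.  The graph of \<open>T\<^sup>*T\<close> is the relational composition \<open>T O T\<^sup>*\<close>.\<close>

definition eigenvector_op :: "'a ip \<Rightarrow> 'a graph \<Rightarrow> real \<Rightarrow> 'a fn \<Rightarrow> bool"
  where "eigenvector_op ip T \<mu> e \<longleftrightarrow> ip_norm ip e \<noteq> 0 \<and> (e, \<lambda>x. of_real \<mu> * e x) \<in> T"

definition singular_number :: "'a fn set \<Rightarrow> 'a ip \<Rightarrow> 'a graph \<Rightarrow> nat \<Rightarrow> real"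
  where "singular_number H ip T n =
    Sup {s. s = 0 \<or> s > 0 \<and>
      (\<exists>e \<mu>. (\<forall>i<n. eigenvector_op ip (T O adjoint_op H ip T) (\<mu> i) (e i) \<and> \<mu> i \<ge> s\<^sup>2) \<and>
             (\<forall>i<n. \<forall>j<n. ip (e i) (e j) = (if i = j then 1 else 0)))}"

definition Sigma0 :: "'a fn set \<Rightarrow> 'a ip \<Rightarrow> real \<Rightarrow> 'a graph set"
  where "Sigma0 H ip p =
    {T. compact_op H ip T \<and> singular_number H ip T \<in> o(\<lambda>n. real n powr (- 1 / p))}"


section \<open>Functional calculus\<close>

text \<open>Projection-valued Borel measures on the real line.  Idempotence of \<open>E B\<close> is the case
  \<open>B = C\<close> of multiplicativity; linearity (up to null sets) follows from symmetry.\<close>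

definition projection_valued_measure ::
    "'a measure \<Rightarrow> (real set \<Rightarrow> 'a fn \<Rightarrow> 'a fn) \<Rightarrow> bool"
  where "projection_valued_measure \<sigma> E \<longleftrightarrow>
    (\<forall>B\<in>sets borel. \<forall>u\<in>Lp \<sigma> 2. E B u \<in> Lp \<sigma> 2) \<and>
    (\<forall>B\<in>sets borel. \<forall>u\<in>Lp \<sigma> 2. \<forall>v\<in>Lp \<sigma> 2.
        L2_inner \<sigma> (E B u) v = L2_inner \<sigma> u (E B v)) \<and>
    (\<forall>B\<in>sets borel. \<forall>C\<in>sets borel. \<forall>u\<in>Lp \<sigma> 2.
        AE x in \<sigma>. E B (E C u) x = E (B \<inter> C) u x) \<and>
    (\<forall>u\<in>Lp \<sigma> 2. AE x in \<sigma>. E UNIV u x = u x) \<and>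
    (\<forall>B :: nat \<Rightarrow> real set. range B \<subseteq> sets borel \<and> disjoint_family B \<longrightarrow>
        (\<forall>u\<in>Lp \<sigma> 2.
          (\<lambda>i. L2_inner \<sigma> (E (B i) u) u) sums L2_inner \<sigma> (E (\<Union>i. B i) u) u))"

definition scalar_measure ::
    "'a measure \<Rightarrow> (real set \<Rightarrow> 'a fn \<Rightarrow> 'a fn) \<Rightarrow> 'a fn \<Rightarrow> real measure"
  where "scalar_measure \<sigma> E u =
    measure_of UNIV (sets borel) (\<lambda>B. ennreal (Re (L2_inner \<sigma> (E B u) u)))"

definition spectral_domain ::
    "'a measure \<Rightarrow> (real set \<Rightarrow> 'a fn \<Rightarrow> 'a fn) \<Rightarrow> (real \<Rightarrow> real) \<Rightarrow> 'a fn set"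
  where "spectral_domain \<sigma> E f =
    {u \<in> Lp \<sigma> 2. integrable (scalar_measure \<sigma> E u) (\<lambda>s. (f s)\<^sup>2)}"

text \<open>The operator \<open>\<integral> f dE\<close> on its natural domain.  The complex measure \<open>B \<mapsto> \<langle>E B u, w\<rangle>\<close> is
  expressed by polarization through the measures \<open>B \<mapsto> \<langle>E B z, z\<rangle>\<close>; testing against \<open>w\<close>
  in the (dense) domain determines the value.\<close>

definition spectral_integral ::
    "'a measure \<Rightarrow> (real set \<Rightarrow> 'a fn \<Rightarrow> 'a fn) \<Rightarrow> (real \<Rightarrow> real) \<Rightarrow> 'a graph"
  where "spectral_integral \<sigma> E f =
    {(u, v). u \<in> spectral_domain \<sigma> E f \<and> v \<in> Lp \<sigma> 2 \<and>
      (\<forall>w \<in> spectral_domain \<sigma> E f.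
        L2_inner \<sigma> v w =
          (\<Sum>k<4. \<i> ^ k * of_real (LINT s|scalar_measure \<sigma> E (\<lambda>x. u x + \<i> ^ k * w x). f s)) / 4)}"

text \<open>\<open>f(A) = \<integral> f dE\<close> where \<open>A = \<integral> s dE(s)\<close>; the spectral measure \<open>E\<close> of a self-adjoint \<open>A\<close>
  exists and is unique up to null sets.\<close>

definition fun_calc :: "'a measure \<Rightarrow> 'a graph \<Rightarrow> (real \<Rightarrow> real) \<Rightarrow> 'a graph"
  where "fun_calc \<sigma> A f =
    {(u, v). \<exists>E. projection_valued_measure \<sigma> E \<and> A = spectral_integral \<sigma> E (\<lambda>s. s) \<and>
      (u, v) \<in> spectral_integral \<sigma> E f}"

definition exp_op :: "'a measure \<Rightarrow> 'a graph \<Rightarrow> real \<Rightarrow> 'a graph"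
  where "exp_op \<sigma> A t = fun_calc \<sigma> A (\<lambda>s. exp (- t * s))"


section \<open>Properties of the semigroup and its kernel\<close>

definition positivity_preserving :: "'a measure \<Rightarrow> 'a graph \<Rightarrow> bool"
  where "positivity_preserving \<sigma> T \<longleftrightarrow>
    (\<forall>(u, v) \<in> T. (AE x in \<sigma>. u x \<in> nonneg_Reals) \<longrightarrow> (AE x in \<sigma>. v x \<in> nonneg_Reals))"

text \<open>For an operator \<open>T\<close> in \<open>L\<^sup>2\<close>, boundedness from \<open>L\<^sup>1\<close> to \<open>L\<^sup>\<infinity>\<close> refers to the dense subspace
  \<open>L\<^sup>1 \<inter> L\<^sup>2\<close> of \<open>L\<^sup>1\<close>.\<close>

definition bounded_L1_Linf :: "'a measure \<Rightarrow> 'a graph \<Rightarrow> bool"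
  where "bounded_L1_Linf \<sigma> T \<longleftrightarrow>
    (\<exists>C. \<forall>u \<in> Lp \<sigma> 1 \<inter> Lp \<sigma> 2. \<exists>v. (u, v) \<in> T \<and>
      (AE x in \<sigma>. norm (v x) \<le> C * (LINT y|\<sigma>. norm (u y))))"

definition integral_kernel :: "'a measure \<Rightarrow> 'a graph \<Rightarrow> ('a \<times> 'a \<Rightarrow> complex) \<Rightarrow> bool"
  where "integral_kernel \<sigma> T P \<longleftrightarrow>
    P \<in> borel_measurable (\<sigma> \<Otimes>\<^sub>M \<sigma>) \<and>
    esssup (\<sigma> \<Otimes>\<^sub>M \<sigma>) (\<lambda>z. ennreal (norm (P z))) < \<infinity> \<and>
    (\<forall>u \<in> Lp \<sigma> 1 \<inter> Lp \<sigma> 2. (u, \<lambda>x. LINT y|\<sigma>. P (x, y) * u y) \<in> T)"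

text \<open>\<open>M\<^sub>A(t)\<close> is the \<open>L\<^sup>\<infinity>(X \<times> X)\<close> norm of the kernel of \<open>e\<^bsup>-tA\<^esup>\<close>.  The kernel is unique up to null
  sets, so the infimum runs over a single value (it would be \<open>\<infinity>\<close> if there were no bounded
  kernel).\<close>

definition heat_bound :: "'a measure \<Rightarrow> 'a graph \<Rightarrow> real \<Rightarrow> ennreal"
  where "heat_bound \<sigma> A t =
    (INF P \<in> Collect (integral_kernel \<sigma> (exp_op \<sigma> A t)).
      esssup (\<sigma> \<Otimes>\<^sub>M \<sigma>) (\<lambda>z. ennreal (norm (P z))))"


section \<open>The quadratic form, its completion and the Birman--Schwinger operator\<close>

text \<open>\<open>a[u, v] = \<langle>A\<^bsup>1/2\<^esup> u, A\<^bsup>1/2\<^esup> v\<rangle>\<close> on \<open>Dom a = Dom A\<^bsup>1/2\<^esup>\<close>.\<close>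

definition form_domain :: "'a measure \<Rightarrow> 'a graph \<Rightarrow> 'a fn set"
  where "form_domain \<sigma> A = Domain (fun_calc \<sigma> A sqrt)"

definition form :: "'a measure \<Rightarrow> 'a graph \<Rightarrow> 'a ip"
  where "form \<sigma> A u v =
    (THE c. \<exists>u' v'. (u, u') \<in> fun_calc \<sigma> A sqrt \<and> (v, v') \<in> fun_calc \<sigma> A sqrt \<and>
      c = L2_inner \<sigma> u' v')"

text \<open>\<open>U\<close> represents an element of the completion of \<open>Dom a\<close> in the norm \<open>a[u]\<^bsup>1/2\<^esup>\<close>, and \<open>u\<close> is
  its realization in \<open>L\<^sup>p\<close>.  The distance is a nonnegative integral, because the Bochner integral of
  a non-integrable function would be 0.\<close>

definition form_approx ::
    "'a measure \<Rightarrow> 'a graph \<Rightarrow> real \<Rightarrow> (nat \<Rightarrow> 'a fn) \<Rightarrow> 'a fn \<Rightarrow> bool"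
  where "form_approx \<sigma> A p U u \<longleftrightarrow>
    (\<forall>n. U n \<in> form_domain \<sigma> A) \<and>
    (\<forall>\<epsilon>>0. \<exists>N. \<forall>m\<ge>N. \<forall>n\<ge>N. ip_norm (form \<sigma> A) (\<lambda>x. U m x - U n x) < \<epsilon>) \<and>
    u \<in> Lp \<sigma> p \<and>
    (\<lambda>n. \<integral>\<^sup>+ x. ennreal (norm (U n x - u x) powr p) \<partial>\<sigma>) \<longlonglongrightarrow> 0"

definition form_space :: "'a measure \<Rightarrow> 'a graph \<Rightarrow> real \<Rightarrow> 'a fn set"
  where "form_space \<sigma> A p = {u. \<exists>U. form_approx \<sigma> A p U u}"

definition form_space_inner :: "'a measure \<Rightarrow> 'a graph \<Rightarrow> real \<Rightarrow> 'a ip"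
  where "form_space_inner \<sigma> A p u v =
    (THE c. \<exists>U W. form_approx \<sigma> A p U u \<and> form_approx \<sigma> A p W v \<and>
      (\<lambda>n. form \<sigma> A (U n) (W n)) \<longlonglongrightarrow> c)"

definition potential_form :: "'a measure \<Rightarrow> ('a \<Rightarrow> real) \<Rightarrow> 'a ip"
  where "potential_form \<sigma> V u v = (LINT x|\<sigma>. of_real (V x) * u x * cnj (v x))"

definition birman_schwinger ::
    "'a measure \<Rightarrow> 'a graph \<Rightarrow> real \<Rightarrow> ('a \<Rightarrow> real) \<Rightarrow> 'a graph"
  where "birman_schwinger \<sigma> A p V =
    {(u, w). u \<in> form_space \<sigma> A p \<and> w \<in> form_space \<sigma> A p \<and>
      (\<forall>v \<in> form_space \<sigma> A p. form_space_inner \<sigma> A p w v = potential_form \<sigma> V u v)}"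

end

theory Submission
  imports Defs "HOL-Library.Function_Algebras" "HOL-Complex_Analysis.Great_Picard"
begin

text \<open>
  Write \<open>N\<close> for the number of vectors in an orthonormal system \<open>e\<^sub>1, \<dots>, e\<^sub>N\<close> of \<open>H\<^sub>a\<close> and
  \<open>\<rho> = \<Sum>\<bar>e\<^sub>i\<bar>\<^sup>2\<close> for its density.  Everything follows from the trace bound
  \<open>\<Sum> b\<^sub>V[e\<^sub>i] = \<integral> V \<rho> d\<sigma> = o(N\<^bsup>1-2/D\<^esup>)\<close>, uniformly in the system.  Since \<open>B\<^sub>V\<close> is
  non-negative, eigenvectors \<open>e\<^sub>i\<close> of \<open>B\<^sub>V\<^sup>* B\<^sub>V\<close> with eigenvalues at least \<open>s\<^sup>2\<close> satisfy
  \<open>b\<^sub>V[e\<^sub>i] \<ge> s\<close>, so the trace bound gives \<open>n s\<^sub>n = o(n\<^bsup>1-2/D\<^esup>)\<close> (\<open>singular_number_bounds\<close>).  It also gives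
  compactness: orthonormal vectors on which \<open>b\<^sub>V\<close> exceeds a fixed \<open>\<epsilon>\<close> can only be chosen finitely often, so the
  form is small on the complement of a finite-dimensional space (\<open>small_on_complement\<close>, \<open>gen_compact\<close>).

  The trace bound comes from the heat kernel.  With \<open>E\<close> the spectral measure of \<open>A\<close> and \<open>\<Lambda> = 1/t\<close>, the kernel
  bound says that \<open>E(-\<infinity>, \<Lambda>]\<close> maps \<open>L\<^sup>1\<close> to \<open>L\<^sup>2\<close> with squared norm \<open>O(\<Lambda>\<^bsup>d/2\<^esup>)\<close>, for every \<open>d > 2\<close> between \<open>\<delta>\<close> and
  \<open>D\<close> (\<open>heat_bounds_spectral_bound\<close>).  By duality the low-energy part of a function of finite energy is
  bounded (\<open>low_energy_bounded\<close>).  Following Rumin and Frank, one compares at each point \<open>\<rho>\<close> with its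
  low-energy part at an energy adapted to the value of \<open>\<rho>\<close> there, and obtains
  \<open>\<integral> \<rho>\<^bsup>d/(d-2)\<^esup> \<le> const N\<close> (\<open>rumin_frank\<close>); the case \<open>N = 1\<close> is the Sobolev inequality.  Hoelder's inequality
  then bounds \<open>\<integral> V \<rho>\<close> by \<open>const \<parallel>V\<parallel> N\<^bsup>1-2/d\<^esup>\<close> with the norm of \<open>L\<^bsup>d/2\<^esup>\<close>.  To replace \<open>O\<close> by \<open>o\<close>, cut \<open>V\<close> at a
  small height: the lower part has small norm in \<open>L\<^bsup>D/2\<^esup>\<close>, and the upper part lies in \<open>L\<^bsup>d'/2\<^esup>\<close> for an exponent
  \<open>d' < D\<close>, where the bound is of lower order (\<open>trace_split\<close>).  This is where \<open>\<delta> < D\<close> enters.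

  Two points concern the objects themselves.  The functional calculus ranges over all spectral measures
  representing \<open>A\<close>; they agree because the subspace of \<open>E[m - r, m + r]\<close> is determined by the growth of
  \<open>(A - m)\<^sup>n\<close> (\<open>spectral_measure_unique\<close>).  And \<open>H\<^sub>a\<close> is a space of functions only if the energy is
  closable with respect to \<open>L\<^sup>p\<close>: a sequence \<open>Z\<^sub>n\<close> that is Cauchy in energy and tends to 0 in \<open>L\<^sup>p\<close> must tend to 0 in
  energy.  This is where positivity of the semigroup is used (\<open>closable\<close>): it allows one to
  dominate the part of \<open>Z\<^sub>n\<close> that exceeds \<open>2 \<bar>Z\<^sub>N\<bar>\<close> by a function whose energy is comparable to that of \<open>Z\<^sub>n - Z\<^sub>N\<close>.
\<close>

section \<open>Spaces with a semi-inner product\<close>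

text \<open>The inner product may be degenerate and is specified on the carrier \<open>H\<close> only, so that the carriers can be
  sets of functions, where functions vanishing almost everywhere have norm 0 without being 0.\<close>

locale sip = vector_space scale
  for scale :: "complex \<Rightarrow> 'v::ab_group_add \<Rightarrow> 'v" (infixr "*s" 75) +
  fixes H :: "'v set" and ip :: "'v \<Rightarrow> 'v \<Rightarrow> complex"
  assumes zero_mem [simp]: "0 \<in> H"
    and add_mem [simp]: "u \<in> H \<Longrightarrow> v \<in> H \<Longrightarrow> u + v \<in> H"
    and scale_mem [simp]: "u \<in> H \<Longrightarrow> c *s u \<in> H"
    and ip_add_left: "u \<in> H \<Longrightarrow> v \<in> H \<Longrightarrow> w \<in> H \<Longrightarrow> ip (u + v) w = ip u w + ip v w"
    and ip_scale_left: "u \<in> H \<Longrightarrow> w \<in> H \<Longrightarrow> ip (c *s u) w = c * ip u w"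
    and ip_commute: "u \<in> H \<Longrightarrow> v \<in> H \<Longrightarrow> ip v u = cnj (ip u v)"
    and ip_nonneg: "u \<in> H \<Longrightarrow> 0 \<le> Re (ip u u)"
begin

definition nrm :: "'v \<Rightarrow> real" where "nrm u = sqrt (Re (ip u u))"

definition orthonormal :: "(nat \<Rightarrow> 'v) \<Rightarrow> nat \<Rightarrow> bool"
  where "orthonormal e n \<longleftrightarrow> (\<forall>i<n. e i \<in> H) \<and>
    (\<forall>i<n. \<forall>j<n. ip (e i) (e j) = (if i = j then 1 else 0))"

lemma uminus_mem [simp]: "u \<in> H \<Longrightarrow> - u \<in> H"
  using scale_mem[of u "-1"] by simp

lemma diff_mem [simp]: "u \<in> H \<Longrightarrow> v \<in> H \<Longrightarrow> u - v \<in> H"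
  using add_mem[of u "- v"] by simp

lemma sum_mem [simp]: "(\<And>i. i \<in> I \<Longrightarrow> f i \<in> H) \<Longrightarrow> sum f I \<in> H"
  by (induction I rule: infinite_finite_induct) auto

lemma ip_uminus_left: "u \<in> H \<Longrightarrow> w \<in> H \<Longrightarrow> ip (- u) w = - ip u w"
  using ip_scale_left[of u w "-1"] by simp

lemma ip_diff_left: "u \<in> H \<Longrightarrow> v \<in> H \<Longrightarrow> w \<in> H \<Longrightarrow> ip (u - v) w = ip u w - ip v w"
  using ip_add_left[of u "- v" w] by (simp add: ip_uminus_left)

lemma ip_add_right: "u \<in> H \<Longrightarrow> v \<in> H \<Longrightarrow> w \<in> H \<Longrightarrow> ip w (u + v) = ip w u + ip w v"
  using ip_commute[of "u + v" w] ip_commute[of u w] ip_commute[of v w] by (simp add: ip_add_left)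

lemma ip_scale_right: "u \<in> H \<Longrightarrow> w \<in> H \<Longrightarrow> ip w (c *s u) = cnj c * ip w u"
  using ip_commute[of "c *s u" w] ip_commute[of u w] by (simp add: ip_scale_left)

lemma ip_diff_right: "u \<in> H \<Longrightarrow> v \<in> H \<Longrightarrow> w \<in> H \<Longrightarrow> ip w (u - v) = ip w u - ip w v"
  using ip_commute[of "u - v" w] ip_commute[of u w] ip_commute[of v w] by (simp add: ip_diff_left)

lemma ip_zero_left [simp]: "w \<in> H \<Longrightarrow> ip 0 w = 0"
  using ip_add_left[of 0 0 w] by simp

lemma ip_zero_right [simp]: "w \<in> H \<Longrightarrow> ip w 0 = 0"
  using ip_add_right[of 0 0 w] by simp

lemma ip_sum_left:
  "w \<in> H \<Longrightarrow> (\<And>i. i \<in> I \<Longrightarrow> f i \<in> H) \<Longrightarrow> ip (sum f I) w = (\<Sum>i\<in>I. ip (f i) w)"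
  by (induction I rule: infinite_finite_induct) (auto simp: ip_add_left)

lemma ip_sum_right:
  "w \<in> H \<Longrightarrow> (\<And>i. i \<in> I \<Longrightarrow> f i \<in> H) \<Longrightarrow> ip w (sum f I) = (\<Sum>i\<in>I. ip w (f i))"
  by (induction I rule: infinite_finite_induct) (auto simp: ip_add_right)

lemma Im_ip_self [simp]: "u \<in> H \<Longrightarrow> Im (ip u u) = 0"
  using ip_commute[of u u] by (metis Reals_cnj_iff complex_is_Real_iff)

lemma nrm_nonneg [simp]: "u \<in> H \<Longrightarrow> 0 \<le> nrm u"
  by (simp add: nrm_def ip_nonneg)

lemma nrm_sq: "u \<in> H \<Longrightarrow> (nrm u)\<^sup>2 = Re (ip u u)"
  by (simp add: nrm_def ip_nonneg)

lemma ip_self: "u \<in> H \<Longrightarrow> ip u u = of_real ((nrm u)\<^sup>2)"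
  by (simp add: nrm_sq complex_eq_iff)

lemma nrm_scale: "u \<in> H \<Longrightarrow> nrm (c *s u) = cmod c * nrm u"
proof -
  assume u: "u \<in> H"
  have "ip (c *s u) (c *s u) = of_real ((cmod c)\<^sup>2) * ip u u"
    using u complex_norm_square[of c] by (simp add: ip_scale_left ip_scale_right)
  then have "Re (ip (c *s u) (c *s u)) = (cmod c)\<^sup>2 * Re (ip u u)"
    by simp
  then show ?thesis by (simp add: nrm_def real_sqrt_mult)
qed

lemma nrm_zero [simp]: "nrm 0 = 0"
  by (simp add: nrm_def)

lemma nrm_uminus: "u \<in> H \<Longrightarrow> nrm (- u) = nrm u"
  using nrm_scale[of u "-1"] by simp

lemma nrm_minus_commute: "u \<in> H \<Longrightarrow> v \<in> H \<Longrightarrow> nrm (u - v) = nrm (v - u)"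
  using nrm_uminus[of "u - v"] by simp

lemma nrm_sq_add:
  assumes "u \<in> H" "v \<in> H"
  shows "(nrm (u + v))\<^sup>2 = (nrm u)\<^sup>2 + 2 * Re (ip u v) + (nrm v)\<^sup>2"
proof -
  have "Re (ip v u) = Re (ip u v)" using ip_commute[of u v] assms by simp
  then show ?thesis using assms by (simp add: nrm_sq ip_add_left ip_add_right)
qed

lemma nrm_sq_diff:
  assumes "u \<in> H" "v \<in> H"
  shows "(nrm (u - v))\<^sup>2 = (nrm u)\<^sup>2 - 2 * Re (ip u v) + (nrm v)\<^sup>2"
proof -
  have "Re (ip v u) = Re (ip u v)" using ip_commute[of u v] assms by simp
  then show ?thesis using assms by (simp add: nrm_sq ip_diff_left ip_diff_right)
qed

lemma cauchy_schwarz: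
  assumes u: "u \<in> H" and v: "v \<in> H"
  shows "cmod (ip u v) \<le> nrm u * nrm v"
proof -
  let ?b = "ip u v"
  have q: "0 \<le> (nrm u)\<^sup>2 - 2 * t * (cmod ?b)\<^sup>2 + t\<^sup>2 * (cmod ?b)\<^sup>2 * (nrm v)\<^sup>2" for t :: real
  proof -
    have "(nrm (u - (of_real t * ?b) *s v))\<^sup>2
        = (nrm u)\<^sup>2 - 2 * Re (ip u ((of_real t * ?b) *s v)) + (nrm ((of_real t * ?b) *s v))\<^sup>2"
      using u v by (intro nrm_sq_diff) auto
    also have "ip u ((of_real t * ?b) *s v) = of_real (t * (cmod ?b)\<^sup>2)"
      using u v complex_norm_square[of ?b] by (simp add: ip_scale_right mult.assoc mult.commute)
    also have "(nrm ((of_real t * ?b) *s v))\<^sup>2 = t\<^sup>2 * (cmod ?b)\<^sup>2 * (nrm v)\<^sup>2"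
      using v by (simp add: nrm_scale norm_mult power_mult_distrib)
    finally have "(nrm (u - (of_real t * ?b) *s v))\<^sup>2
      = (nrm u)\<^sup>2 - 2 * t * (cmod ?b)\<^sup>2 + t\<^sup>2 * (cmod ?b)\<^sup>2 * (nrm v)\<^sup>2"
      by (simp add: Re_complex_of_real)
    then show ?thesis by (metis zero_le_power2)
  qed
  have "(cmod ?b)\<^sup>2 \<le> (nrm u)\<^sup>2 * (nrm v)\<^sup>2"
  proof (cases "nrm v = 0")
    case True
    have "(cmod ?b)\<^sup>2 = 0"
    proof (rule ccontr)
      assume *: "(cmod ?b)\<^sup>2 \<noteq> 0"
      then show False using q[of "((nrm u)\<^sup>2 + 1) / (2 * (cmod ?b)\<^sup>2)"] True by (simp add: field_simps)
    qed
    with True show ?thesis by simp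
  next
    case False
    let ?n = "(nrm v)\<^sup>2"
    have n0: "?n > 0" using False by simp
    have "(1 / ?n)\<^sup>2 * (cmod ?b)\<^sup>2 * ?n = (cmod ?b)\<^sup>2 / ?n"
      using n0 by (simp add: power2_eq_square)
    then have "(cmod ?b)\<^sup>2 / ?n \<le> (nrm u)\<^sup>2"
      using q[of "1 / ?n"] by simp
    then show ?thesis using n0 by (simp add: pos_divide_le_eq)
  qed
  then have "(cmod ?b)\<^sup>2 \<le> (nrm u * nrm v)\<^sup>2" by (simp add: power_mult_distrib)
  moreover have "0 \<le> nrm u * nrm v" using u v by simp
  ultimately show ?thesis by (rule power2_le_imp_le)
qed

lemma nrm_triangle:
  assumes u: "u \<in> H" and v: "v \<in> H"
  shows "nrm (u + v) \<le> nrm u + nrm v"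
proof -
  have "Re (ip u v) \<le> nrm u * nrm v"
    using cauchy_schwarz[OF u v] complex_Re_le_cmod[of "ip u v"] by linarith
  then have "(nrm (u + v))\<^sup>2 \<le> (nrm u + nrm v)\<^sup>2"
    using u v by (simp add: nrm_sq_add power2_sum)
  then show ?thesis by (rule power2_le_imp_le) (use u v in simp)
qed

lemma nrm_triangle_diff: "u \<in> H \<Longrightarrow> v \<in> H \<Longrightarrow> nrm (u - v) \<le> nrm u + nrm v"
  using nrm_triangle[of u "- v"] by (simp add: nrm_uminus)

lemma nrm_triangle3:
  "u \<in> H \<Longrightarrow> v \<in> H \<Longrightarrow> w \<in> H \<Longrightarrow> nrm (u - w) \<le> nrm (u - v) + nrm (v - w)"
  using nrm_triangle[of "u - v" "v - w"] by simp

lemma nrm_diff_abs: "u \<in> H \<Longrightarrow> v \<in> H \<Longrightarrow> \<bar>nrm u - nrm v\<bar> \<le> nrm (u - v)"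
  using nrm_triangle[of "u - v" v] nrm_triangle[of "v - u" u] nrm_minus_commute[of u v] by simp

lemma nrm_sum_le: "(\<And>i. i \<in> I \<Longrightarrow> f i \<in> H) \<Longrightarrow> nrm (sum f I) \<le> (\<Sum>i\<in>I. nrm (f i))"
proof (induction I rule: infinite_finite_induct)
  case (insert x F)
  then show ?case using nrm_triangle[of "f x" "sum f F"] by fastforce
qed auto

lemma nrm_sq_parallelogram: "u \<in> H \<Longrightarrow> v \<in> H \<Longrightarrow>
    (nrm (u + v))\<^sup>2 + (nrm (u - v))\<^sup>2 = 2 * (nrm u)\<^sup>2 + 2 * (nrm v)\<^sup>2"
  by (simp add: nrm_sq_add nrm_sq_diff)

lemma nrm_eq_0_if_weak:
  assumes "u \<in> H" "\<And>w. w \<in> H \<Longrightarrow> ip u w = 0" shows "nrm u = 0"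
  using assms by (simp add: nrm_def)

lemma nrm_eq_if_weak:
  assumes "x \<in> H" "y \<in> H" "\<And>w. w \<in> H \<Longrightarrow> ip x w = ip y w" shows "nrm x = nrm y"
proof -
  have "ip x x = ip y x" "ip y x = cnj (ip x y)" "ip x y = ip y y"
    using assms ip_commute[of x y] by auto
  then show ?thesis by (simp add: nrm_def)
qed

lemma nrm_tendsto:
  assumes "\<And>n. U n \<in> H" "u \<in> H" "(\<lambda>n. nrm (U n - u)) \<longlonglongrightarrow> 0"
  shows "(\<lambda>n. nrm (U n)) \<longlonglongrightarrow> nrm u"
proof -
  have "(\<lambda>n. nrm (U n) - nrm u) \<longlonglongrightarrow> 0"
    by (rule Lim_null_comparison[OF _ assms(3)]) (use assms nrm_diff_abs in auto)
  then show ?thesis by (rule LIM_zero_cancel)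
qed

lemma orthogonal_remainder:
  assumes u: "u \<in> H" and e: "orthonormal e n"
  defines "r \<equiv> u - (\<Sum>i<n. ip u (e i) *s e i)"
  shows "r \<in> H" "\<And>j. j < n \<Longrightarrow> ip r (e j) = 0" "nrm r \<le> nrm u"
proof -
  let ?p = "\<Sum>i<n. ip u (e i) *s e i"
  have eH: "e i \<in> H" if "i < n" for i using e that by (simp add: orthonormal_def)
  have pH: "?p \<in> H" by (intro sum_mem scale_mem eH) simp
  show rH: "r \<in> H" using u pH by (simp add: r_def)
  show orth: "ip r (e j) = 0" if j: "j < n" for j
  proof -
    have "ip ?p (e j) = (\<Sum>i<n. ip u (e i) * ip (e i) (e j))"
      by (subst ip_sum_left) (use eH j in \<open>auto simp: ip_scale_left\<close>)
    also have "\<dots> = (\<Sum>i<n. if i = j then ip u (e j) else 0)"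
      using e j by (intro sum.cong) (auto simp: orthonormal_def)
    also have "\<dots> = ip u (e j)" using j by simp
    finally show ?thesis using u pH eH j by (simp add: r_def ip_diff_left)
  qed
  have "ip r ?p = 0"
    by (subst ip_sum_right) (use rH eH orth in \<open>auto simp: ip_scale_right\<close>)
  then have "(nrm (r + ?p))\<^sup>2 = (nrm r)\<^sup>2 + (nrm ?p)\<^sup>2"
    using rH pH by (simp add: nrm_sq_add)
  then have "(nrm r)\<^sup>2 \<le> (nrm u)\<^sup>2" by (simp add: r_def)
  then show "nrm r \<le> nrm u" by (rule power2_le_imp_le) (use u in simp)
qed

end

locale complete_sip = sip +
  assumes complete: "\<And>U. (\<And>n::nat. U n \<in> H) \<Longrightarrow>
      (\<And>\<epsilon>. \<epsilon> > 0 \<Longrightarrow> \<exists>N. \<forall>m\<ge>N. \<forall>n\<ge>N. nrm (U m - U n) < \<epsilon>) \<Longrightarrow>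
      \<exists>u\<in>H. (\<lambda>n. nrm (U n - u)) \<longlonglongrightarrow> 0"
begin

text \<open>A minimising sequence for \<open>\<parallel>w\<parallel>\<^sup>2 - 2 Re \<phi>(w)\<close> is Cauchy by the parallelogram identity, and the
  stationarity of its limit is the representation.\<close>

lemma riesz_representation:
  assumes add: "\<And>v w. v \<in> H \<Longrightarrow> w \<in> H \<Longrightarrow> \<phi> (v + w) = \<phi> v + \<phi> w"
    and scal: "\<And>c w. w \<in> H \<Longrightarrow> \<phi> (c *s w) = cnj c * \<phi> w"
    and bdd: "\<And>w. w \<in> H \<Longrightarrow> cmod (\<phi> w) \<le> K * nrm w"
  shows "\<exists>y\<in>H. \<forall>w\<in>H. ip y w = \<phi> w"
proof -
  define F where "F w = (nrm w)\<^sup>2 - 2 * Re (\<phi> w)" for w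
  have low: "- (K\<^sup>2) \<le> F w" if "w \<in> H" for w
  proof -
    have "Re (\<phi> w) \<le> K * nrm w" using bdd[OF that] complex_Re_le_cmod[of "\<phi> w"] by linarith
    moreover have "0 \<le> (nrm w - K)\<^sup>2" by simp
    ultimately show ?thesis by (simp add: F_def power2_diff mult.commute)
  qed
  define m where "m = Inf (F ` H)"
  have bb: "bdd_below (F ` H)" using low by (auto intro!: bdd_belowI[of _ "- (K\<^sup>2)"])
  have m_le: "m \<le> F w" if "w \<in> H" for w unfolding m_def using bb that by (simp add: cInf_lower)
  have "\<exists>w\<in>H. F w < m + 1 / real (Suc n)" for n
  proof -
    have ne: "F ` H \<noteq> {}" using zero_mem by blast
    have "Inf (F ` H) < m + 1 / real (Suc n)" by (simp add: m_def)
    then show ?thesis using cInf_less_iff[OF ne bb] by auto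
  qed
  then obtain U where U: "\<And>n. U n \<in> H" "\<And>n. F (U n) < m + 1 / real (Suc n)" by metis
  have phidiv: "\<phi> ((1/2) *s (u + v)) = (\<phi> u + \<phi> v) / 2" if "u \<in> H" "v \<in> H" for u v
    using that by (simp add: scal add)
  have par: "(nrm (u - v))\<^sup>2 = 2 * F u + 2 * F v - 4 * F ((1/2) *s (u + v))" if "u \<in> H" "v \<in> H" for u v
  proof -
    have "(nrm ((1/2) *s (u + v)))\<^sup>2 = (nrm (u + v))\<^sup>2 / 4"
      using that by (simp add: nrm_scale power_divide)
    then show ?thesis using nrm_sq_parallelogram[OF that] that
      unfolding F_def phidiv[OF that] by (simp add: algebra_simps)
  qed
  have cau: "\<exists>N. \<forall>i\<ge>N. \<forall>j\<ge>N. nrm (U i - U j) < \<epsilon>" if e: "\<epsilon> > 0" for \<epsilon>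
  proof -
    obtain N where N: "1 / real (Suc N) < \<epsilon>\<^sup>2 / 4"
      using reals_Archimedean[of "\<epsilon>\<^sup>2 / 4"] e by (auto simp: inverse_eq_divide)
    have "nrm (U i - U j) < \<epsilon>" if "i \<ge> N" "j \<ge> N" for i j
    proof -
      have b: "F (U k) < m + \<epsilon>\<^sup>2 / 4" if "k \<ge> N" for k
      proof -
        have "1 / real (Suc k) \<le> 1 / real (Suc N)" using that by (simp add: frac_le)
        then show ?thesis using U(2)[of k] N by linarith
      qed
      have "m \<le> F ((1/2) *s (U i + U j))" using U by (intro m_le) auto
      then have "(nrm (U i - U j))\<^sup>2 < \<epsilon>\<^sup>2"
        using par[OF U(1) U(1), of i j] b[OF that(1)] b[OF that(2)] by linarith
      then show ?thesis by (rule power2_less_imp_less) (use e in simp)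
    qed
    then show ?thesis by blast
  qed
  obtain y where y: "y \<in> H" and Uy: "(\<lambda>n. nrm (U n - y)) \<longlonglongrightarrow> 0"
    using complete[OF U(1) cau] by blast
  have phi_lim: "(\<lambda>n. \<phi> (U n)) \<longlonglongrightarrow> \<phi> y"
  proof -
    have "(\<lambda>n. \<phi> (U n) - \<phi> y) \<longlonglongrightarrow> 0"
    proof (rule Lim_null_comparison)
      have "\<phi> (U n) - \<phi> y = \<phi> (U n - y)" for n
        using add[of "U n - y" y] U y by simp
      then show "\<forall>\<^sub>F n in sequentially. norm (\<phi> (U n) - \<phi> y) \<le> K * nrm (U n - y)"
        using bdd U y by simp
      show "(\<lambda>n. K * nrm (U n - y)) \<longlonglongrightarrow> 0"
        using tendsto_mult_left[OF Uy, of K] by simp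
    qed
    then show ?thesis by (rule LIM_zero_cancel)
  qed
  have "(\<lambda>n. F (U n)) \<longlonglongrightarrow> F y" unfolding F_def
    by (intro tendsto_intros phi_lim nrm_tendsto U y Uy)
  moreover have "(\<lambda>n. F (U n)) \<longlonglongrightarrow> m"
  proof (rule tendsto_sandwich[OF _ _ tendsto_const])
    show "\<forall>\<^sub>F n in sequentially. m \<le> F (U n)" using m_le U by simp
    show "\<forall>\<^sub>F n in sequentially. F (U n) \<le> m + 1 / real (Suc n)" using less_imp_le[OF U(2)] by (intro always_eventually allI)
    show "(\<lambda>n. m + 1 / real (Suc n)) \<longlonglongrightarrow> m"
      using tendsto_add[OF tendsto_const LIMSEQ_Suc[OF lim_inverse_n'], of m] by simp
  qed
  ultimately have Fy: "F y = m" using LIMSEQ_unique by blast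
  have "ip y w = \<phi> w" if w: "w \<in> H" for w
  proof -
    define d where "d = ip y w - \<phi> w"
    \<comment> \<open>Stationarity at the minimiser, in the direction \<open>- d w\<close>.\<close>
    have ineq: "0 \<le> - 2 * t * (cmod d)\<^sup>2 + t\<^sup>2 * ((cmod d)\<^sup>2 * (nrm w)\<^sup>2)" for t :: real
    proof -
      let ?c = "- (of_real t * d)"
      have "F (y + c *s w) = F y + 2 * Re (cnj c * d) + (nrm (c *s w))\<^sup>2" for c
      proof -
        have "F (y + c *s w) = (nrm y)\<^sup>2 + 2 * Re (ip y (c *s w)) + (nrm (c *s w))\<^sup>2
            - 2 * Re (\<phi> y + \<phi> (c *s w))"
          unfolding F_def using y w by (subst nrm_sq_add, simp, simp, subst add) auto
        then show ?thesis
          using y w by (simp add: F_def d_def ip_scale_right scal algebra_simps)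
      qed
      from this[of ?c] have "F (y + ?c *s w) = F y + 2 * Re (cnj ?c * d) + (nrm (?c *s w))\<^sup>2" .
      also have "(nrm (?c *s w))\<^sup>2 = t\<^sup>2 * ((cmod d)\<^sup>2 * (nrm w)\<^sup>2)"
        by (simp only: nrm_scale[OF w] norm_minus_cancel norm_mult norm_of_real power_mult_distrib
            power2_abs mult.assoc)
      also have "cnj ?c * d = of_real (- t * (cmod d)\<^sup>2)"
        using complex_norm_square[of d] by (simp add: mult.assoc mult.commute)
      finally have "F (y + ?c *s w) = m + 2 * (- t * (cmod d)\<^sup>2) + t\<^sup>2 * ((cmod d)\<^sup>2 * (nrm w)\<^sup>2)"
        unfolding Fy by (simp only: Re_complex_of_real)
      moreover have "m \<le> F (y + ?c *s w)" using y w by (intro m_le) auto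
      ultimately show ?thesis by simp
    qed
    have "(cmod d)\<^sup>2 = 0"
    proof (rule ccontr)
      assume "(cmod d)\<^sup>2 \<noteq> 0"
      then have dp: "(cmod d)\<^sup>2 > 0" by simp
      let ?t = "1 / (1 + (nrm w)\<^sup>2)"
      have tp: "?t > 0" by (simp add: add_pos_nonneg)
      have "0 \<le> ?t * (cmod d)\<^sup>2 * (- 2 + ?t * (nrm w)\<^sup>2)"
        using ineq[of ?t] by (simp add: power2_eq_square algebra_simps)
      moreover have "?t * (nrm w)\<^sup>2 \<le> 1" by (simp add: field_simps add_pos_nonneg)
      ultimately show False
        using mult_pos_neg[OF mult_pos_pos[OF tp dp], of "- 2 + ?t * (nrm w)\<^sup>2"] by linarith
    qed
    then show ?thesis by (simp add: d_def)
  qed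
  with y show ?thesis by blast
qed

end

section \<open>Operators generated by a form that is small on long orthonormal systems\<close>

text \<open>A bounded non-negative form \<open>b\<close> whose averages along orthonormal systems of length \<open>n\<close> are at most
  \<open>\<beta> n / n\<close>, which tends to 0.  This replaces spectral theory in the proof that \<open>b\<close> generates a compact
  operator.\<close>

locale form_operator = complete_sip scale H ip + B: sip scale H b
  for scale :: "complex \<Rightarrow> 'v::ab_group_add \<Rightarrow> 'v" (infixr "*s" 75) and H ip b +
  fixes K :: real and \<beta> :: "nat \<Rightarrow> real"
  assumes bounded: "u \<in> H \<Longrightarrow> B.nrm u \<le> K * nrm u"
    and trace_bound: "orthonormal e n \<Longrightarrow> (\<Sum>i<n. (B.nrm (e i))\<^sup>2) \<le> \<beta> n"
    and average_small: "(\<lambda>n. \<beta> n / real n) \<longlonglongrightarrow> 0"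
begin

text \<open>A relation, as the value of the operator is determined only up to vectors of norm 0.\<close>

definition gen :: "('v \<times> 'v) set"
  where "gen = {(u, w). u \<in> H \<and> w \<in> H \<and> (\<forall>v\<in>H. ip w v = b u v)}"

lemma Domain_gen: "Domain gen = H"
proof
  show "H \<subseteq> Domain gen"
  proof
    fix u assume u: "u \<in> H"
    have "\<exists>y\<in>H. \<forall>w\<in>H. ip y w = b u w"
    proof (rule riesz_representation[where K = "\<bar>K\<bar> * \<bar>K\<bar> * nrm u"])
      fix w assume w: "w \<in> H"
      have k: "B.nrm v \<le> \<bar>K\<bar> * nrm v" if "v \<in> H" for v
        using bounded[OF that] mult_right_mono[OF abs_ge_self[of K] nrm_nonneg[OF that]] by linarith
      have "cmod (b u w) \<le> B.nrm u * B.nrm w" by (rule B.cauchy_schwarz[OF u w])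
      also have "\<dots> \<le> (\<bar>K\<bar> * nrm u) * (\<bar>K\<bar> * nrm w)"
        by (intro mult_mono k u w B.nrm_nonneg mult_nonneg_nonneg nrm_nonneg) auto
      finally show "cmod (b u w) \<le> \<bar>K\<bar> * \<bar>K\<bar> * nrm u * nrm w" by (simp add: mult_ac)
    qed (use u in \<open>auto simp: B.ip_add_right B.ip_scale_right\<close>)
    then show "u \<in> Domain gen" using u by (auto simp: gen_def)
  qed
qed (auto simp: gen_def)

lemma gen_linear: "(u, v) \<in> gen \<Longrightarrow> (u', v') \<in> gen \<Longrightarrow> (c *s u + u', c *s v + v') \<in> gen"
  by (auto simp: gen_def ip_add_left ip_scale_left B.ip_add_left B.ip_scale_left)

lemma gen_diff: "(u, v) \<in> gen \<Longrightarrow> (u', v') \<in> gen \<Longrightarrow> (u - u', v - v') \<in> gen"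
  by (auto simp: gen_def ip_diff_left B.ip_diff_left)

text \<open>The operator is bounded even from the weaker seminorm of \<open>b\<close>, so sequences that are Cauchy for \<open>b\<close> have
  convergent images.\<close>

lemma gen_nrm_le:
  assumes uw: "(u, w) \<in> gen" shows "nrm w \<le> \<bar>K\<bar> * B.nrm u"
proof -
  have H: "u \<in> H" "w \<in> H" using uw by (auto simp: gen_def)
  have "(nrm w)\<^sup>2 = cmod (b u w)"
  proof -
    have "b u w = of_real ((nrm w)\<^sup>2)" using uw H ip_self[OF H(2)] by (auto simp: gen_def)
    then show ?thesis by (simp add: norm_of_real del: of_real_power)
  qed
  also have "\<dots> \<le> B.nrm u * B.nrm w" by (rule B.cauchy_schwarz[OF H])
  also have "\<dots> \<le> B.nrm u * (\<bar>K\<bar> * nrm w)"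
    using order_trans[OF bounded[OF H(2)] mult_right_mono[OF abs_ge_self[of K] nrm_nonneg[OF H(2)]]] H
    by (intro mult_left_mono) auto
  finally have "nrm w * nrm w \<le> (\<bar>K\<bar> * B.nrm u) * nrm w" by (simp add: power2_eq_square mult_ac)
  then show ?thesis using H by (cases "nrm w = 0") (auto dest: mult_right_le_imp_le simp: less_le)
qed

lemma gen_null: "(u, w) \<in> gen \<Longrightarrow> nrm u = 0 \<Longrightarrow> nrm w = 0"
proof -
  assume a: "(u, w) \<in> gen" "nrm u = 0"
  then have H: "u \<in> H" "w \<in> H" by (auto simp: gen_def)
  have "B.nrm u \<le> 0" using bounded[OF H(1)] a by simp
  then have "B.nrm u = 0" using B.nrm_nonneg[OF H(1)] by simp
  then show "nrm w = 0" using gen_nrm_le[OF a(1)] nrm_nonneg[OF H(2)] by simp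
qed

text \<open>Choosing orthonormal vectors on which the form is at least \<open>\<epsilon>\<close> has to stop, since the
  averages of the form along orthonormal systems tend to 0.\<close>

lemma small_on_complement:
  assumes \<epsilon>: "\<epsilon> > 0"
  shows "\<exists>N e. orthonormal e N \<and>
    (\<forall>u\<in>H. (\<forall>i<N. ip u (e i) = 0) \<longrightarrow> (B.nrm u)\<^sup>2 \<le> \<epsilon> * (nrm u)\<^sup>2)"
proof -
  define P where "P n \<longleftrightarrow> (\<exists>e. orthonormal e n \<and> (\<forall>i<n. \<epsilon> \<le> (B.nrm (e i))\<^sup>2))" for n
  have "P 0" by (auto simp: P_def orthonormal_def)
  obtain M where M: "\<And>n. n \<ge> M \<Longrightarrow> \<beta> n / real n < \<epsilon>"
    using order_tendstoD(2)[OF average_small \<epsilon>] by (auto simp: eventually_sequentially)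
  have bnd: "n \<le> M" if Pn: "P n" for n
  proof (rule ccontr)
    assume "\<not> n \<le> M"
    then have n: "n > M" "n > 0" by auto
    obtain e where e: "orthonormal e n" "\<And>i. i < n \<Longrightarrow> \<epsilon> \<le> (B.nrm (e i))\<^sup>2"
      using Pn by (auto simp: P_def)
    have "real n * \<epsilon> \<le> (\<Sum>i<n. (B.nrm (e i))\<^sup>2)"
      using sum_mono[of "{..<n}" "\<lambda>_. \<epsilon>" "\<lambda>i. (B.nrm (e i))\<^sup>2"] e(2) by simp
    also have "\<dots> \<le> \<beta> n" by (rule trace_bound[OF e(1)])
    finally have "\<epsilon> \<le> \<beta> n / real n" using n by (simp add: field_simps)
    with M[of n] n show False by simp
  qed
  define N where "N = (GREATEST n. P n)"
  have PN: "P N" unfolding N_def by (rule GreatestI_nat[of P 0 M]) (use \<open>P 0\<close> bnd in auto)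
  have nPS: "\<not> P (Suc N)"
  proof
    assume "P (Suc N)"
    then have "Suc N \<le> N" unfolding N_def by (rule Greatest_le_nat[of P _ M]) (use bnd in auto)
    then show False by simp
  qed
  obtain e where e: "orthonormal e N" "\<And>i. i < N \<Longrightarrow> \<epsilon> \<le> (B.nrm (e i))\<^sup>2" using PN by (auto simp: P_def)
  have "(B.nrm u)\<^sup>2 \<le> \<epsilon> * (nrm u)\<^sup>2" if u: "u \<in> H" and orth: "\<And>i. i < N \<Longrightarrow> ip u (e i) = 0" for u
  proof (cases "nrm u = 0")
    case True
    then have "B.nrm u = 0" using bounded[OF u] B.nrm_nonneg[OF u] by simp
    then show ?thesis using True by simp
  next
    case False
    let ?c = "of_real (1 / nrm u) :: complex"
    have nu: "nrm u > 0" using False nrm_nonneg[OF u] by linarith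
    let ?v = "?c *s u"
    let ?e = "e(N := ?v)"
    have v: "?v \<in> H" using u by simp
    have vv: "ip ?v ?v = 1"
      using nu v by (simp add: ip_self nrm_scale u norm_divide)
    have ve: "ip ?v (e i) = 0" "ip (e i) ?v = 0" if "i < N" for i
    proof -
      have eH: "e i \<in> H" using e(1) that by (simp add: orthonormal_def)
      show "ip ?v (e i) = 0" using u orth that eH by (simp add: ip_scale_left)
      then show "ip (e i) ?v = 0" using ip_commute[OF v eH] by simp
    qed
    have "orthonormal ?e (Suc N)" using e(1) v vv ve by (auto simp: orthonormal_def less_Suc_eq)
    then have "\<not> \<epsilon> \<le> (B.nrm ?v)\<^sup>2" using nPS e(2) by (auto simp: P_def less_Suc_eq)
    then have "(B.nrm ?v)\<^sup>2 \<le> \<epsilon>" by simp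
    moreover have "(B.nrm ?v)\<^sup>2 = (B.nrm u)\<^sup>2 / (nrm u)\<^sup>2"
      using u nu by (simp add: B.nrm_scale norm_divide power_divide power_mult_distrib)
    ultimately have "(B.nrm u)\<^sup>2 / (nrm u)\<^sup>2 \<le> \<epsilon>" by simp
    then show ?thesis using nu by (simp add: pos_divide_le_eq)
  qed
  then show ?thesis using e(1) by blast
qed

text \<open>Along a subsequence, the coefficients with respect to all the finite systems given by
  \<open>small_on_complement\<close> converge.  A difference of two members splits into a component in the span of one such
  system, which is small because the coefficients converge, and a remainder on which \<open>b\<close> is small.  Hence
  the subsequence is Cauchy for \<open>b\<close>.\<close>

lemma gen_compact:
  assumes uv: "\<And>n. (u n, v n) \<in> gen" and C: "\<And>n. nrm (u n) \<le> C"
  shows "\<exists>r w. strict_mono (r :: nat \<Rightarrow> nat) \<and> w \<in> H \<and> (\<lambda>n. nrm (v (r n) - w)) \<longlonglongrightarrow> 0"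
proof -
  have uH: "u n \<in> H" and vH: "v n \<in> H" for n using uv by (auto simp: gen_def)
  have C0: "0 \<le> C" using C[of 0] nrm_nonneg[OF uH[of 0]] by linarith
  obtain Nf ef where ef: "\<And>k. orthonormal (ef k) (Nf k)"
    "\<And>k u. u \<in> H \<Longrightarrow> (\<And>i. i < Nf k \<Longrightarrow> ip u (ef k i) = 0) \<Longrightarrow>
      (B.nrm u)\<^sup>2 \<le> (1 / real (Suc k)) * (nrm u)\<^sup>2"
  proof -
    have "\<forall>k. \<exists>N e. orthonormal e N \<and> (\<forall>u\<in>H. (\<forall>i<N. ip u (e i) = 0) \<longrightarrow>
        (B.nrm u)\<^sup>2 \<le> (1 / real (Suc k)) * (nrm u)\<^sup>2)"
      by (intro allI small_on_complement) simp
    then obtain Nf ef where *: "\<And>k. orthonormal (ef k) (Nf k) \<and> (\<forall>u\<in>H. (\<forall>i<Nf k. ip u (ef k i) = 0) \<longrightarrow>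
        (B.nrm u)\<^sup>2 \<le> (1 / real (Suc k)) * (nrm u)\<^sup>2)" by metis
    show ?thesis by (rule that[of ef Nf]) (use * in blast)+
  qed
  have efH: "ef k i \<in> H" "nrm (ef k i) = 1" if "i < Nf k" for k i
    using ef(1)[of k] that by (auto simp: orthonormal_def nrm_def)
  define S where "S = {(k, i). i < Nf k}"
  obtain r where r: "strict_mono (r :: nat \<Rightarrow> nat)"
    "\<And>x. x \<in> S \<Longrightarrow> \<exists>l. (\<lambda>n. (\<lambda>n (k, i). ip (u n) (ef k i)) (r n) x) \<longlonglongrightarrow> l"
  proof (rule function_convergent_subsequence[of S "\<lambda>n (k, i). ip (u n) (ef k i)" C])
    show "countable S" by simp
    show "norm ((\<lambda>(k, i). ip (u n) (ef k i)) x) \<le> C" if xS: "x \<in> S" for n x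
    proof -
      obtain k i where x: "x = (k, i)" "i < Nf k" using xS by (auto simp: S_def)
      show ?thesis using cauchy_schwarz[OF uH[of n] efH(1)[OF x(2)]] C[of n] efH(2)[OF x(2)] x by simp
    qed
  qed (use that in auto)
  have bc: "\<exists>N. \<forall>m\<ge>N. \<forall>n\<ge>N. B.nrm (u (r m) - u (r n)) < \<epsilon>" if e: "\<epsilon> > 0" for \<epsilon>
  proof -
    obtain k where k: "1 / real (Suc k) < (\<epsilon> / (4 * C + 1))\<^sup>2 / 1"
      using reals_Archimedean[of "(\<epsilon> / (4 * C + 1))\<^sup>2"] e C0 by (auto simp: inverse_eq_divide)
    let ?e = "ef k" and ?N = "Nf k"
    define c where "c n i = ip (u (r n)) (?e i)" for n i
    have conv: "Cauchy (\<lambda>n. c n i)" if "i < ?N" for i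
      using r(2)[of "(k, i)"] that by (auto simp: c_def S_def intro: LIMSEQ_imp_Cauchy)
    define M where "M = (\<Sum>i<?N. B.nrm (?e i)) + 1"
    have M: "M > 0" unfolding M_def using efH by (intro add_nonneg_pos sum_nonneg B.nrm_nonneg) auto
    have "\<forall>i\<in>{..<?N}. \<exists>L. \<forall>m\<ge>L. \<forall>n\<ge>L. norm (c m i - c n i) < \<epsilon> / (2 * M)"
    proof
      fix i assume i: "i \<in> {..<?N}"
      have "\<epsilon> / (2 * M) > 0" using e M by simp
      then show "\<exists>L. \<forall>m\<ge>L. \<forall>n\<ge>L. norm (c m i - c n i) < \<epsilon> / (2 * M)"
        using conv[of i] i unfolding Cauchy_iff by blast
    qed
    then obtain L where L: "\<And>i m n. i < ?N \<Longrightarrow> m \<ge> L i \<Longrightarrow> n \<ge> L i \<Longrightarrow> norm (c m i - c n i) < \<epsilon> / (2 * M)"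
      by (metis lessThan_iff)
    define N0 where "N0 = Max (insert 0 (L ` {..<?N}))"
    have LN: "L i \<le> N0" if "i < ?N" for i unfolding N0_def using that by (intro Max_ge) auto
    have "B.nrm (u (r m) - u (r n)) < \<epsilon>" if mn: "m \<ge> N0" "n \<ge> N0" for m n
    proof -
      let ?d = "u (r m) - u (r n)"
      have dH: "?d \<in> H" using uH by simp
      define q where "q = (\<Sum>i<?N. ip ?d (?e i) *s ?e i)"
      define s where "s = ?d - q"
      note rem = orthogonal_remainder[OF dH ef(1)[of k], folded q_def s_def]
      have qH: "q \<in> H" unfolding q_def by (intro sum_mem scale_mem efH) simp
      have "nrm s \<le> 2 * C"
        using rem(3) nrm_triangle_diff[OF uH uH, of "r m" "r n"] C[of "r m"] C[of "r n"] by linarith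
      then have ns: "(nrm s)\<^sup>2 \<le> (2 * C)\<^sup>2" using rem(1) by (intro power_mono) auto
      have "(B.nrm s)\<^sup>2 \<le> (1 / real (Suc k)) * (nrm s)\<^sup>2" by (rule ef(2)[OF rem(1) rem(2)])
      also have "\<dots> \<le> (\<epsilon> / (4 * C + 1))\<^sup>2 * (2 * C)\<^sup>2"
        using k ns by (intro mult_mono) auto
      finally have "(B.nrm s)\<^sup>2 \<le> (\<epsilon> / (4 * C + 1) * (2 * C))\<^sup>2"
        by (simp only: power_mult_distrib)
      then have "B.nrm s \<le> \<epsilon> / (4 * C + 1) * (2 * C)"
        using e C0 by (intro power2_le_imp_le[of "B.nrm s"]) auto
      also have "\<dots> < \<epsilon> / 2" using e C0 by (simp add: field_simps)
      finally have s2: "B.nrm s < \<epsilon> / 2" .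
      have "B.nrm q \<le> (\<Sum>i<?N. B.nrm (ip ?d (?e i) *s ?e i))"
        unfolding q_def using efH by (intro B.nrm_sum_le) auto
      also have "\<dots> = (\<Sum>i<?N. cmod (c m i - c n i) * B.nrm (?e i))"
        using efH uH by (intro sum.cong) (auto simp: B.nrm_scale ip_diff_left c_def)
      also have "\<dots> \<le> (\<Sum>i<?N. \<epsilon> / (2 * M) * B.nrm (?e i))"
        using LN mn efH by (intro sum_mono mult_right_mono less_imp_le[OF L]) (auto intro: order_trans)
      also have "\<dots> = \<epsilon> / (2 * M) * (M - 1)" by (simp add: M_def sum_distrib_left)
      also have "\<dots> \<le> \<epsilon> / 2" using M e by (simp add: field_simps)
      finally have "B.nrm q \<le> \<epsilon> / 2" .
      moreover have "B.nrm ?d \<le> B.nrm s + B.nrm q"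
        using B.nrm_triangle[OF rem(1) qH] by (simp add: s_def)
      ultimately show ?thesis using s2 by linarith
    qed
    then show ?thesis by blast
  qed
  have "\<exists>w\<in>H. (\<lambda>n. nrm (v (r n) - w)) \<longlonglongrightarrow> 0"
  proof (rule complete)
    fix \<epsilon> :: real assume e: "\<epsilon> > 0"
    then obtain N where N: "\<And>m n. m \<ge> N \<Longrightarrow> n \<ge> N \<Longrightarrow> B.nrm (u (r m) - u (r n)) < \<epsilon> / (\<bar>K\<bar> + 1)"
      using bc[of "\<epsilon> / (\<bar>K\<bar> + 1)"] by auto
    have "nrm (v (r m) - v (r n)) < \<epsilon>" if "m \<ge> N" "n \<ge> N" for m n
    proof -
      have "nrm (v (r m) - v (r n)) \<le> \<bar>K\<bar> * B.nrm (u (r m) - u (r n))"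
        by (rule gen_nrm_le[OF gen_diff[OF uv uv]])
      also have "\<dots> \<le> \<bar>K\<bar> * (\<epsilon> / (\<bar>K\<bar> + 1))"
        using N[OF that] by (intro mult_left_mono) auto
      also have "\<dots> < \<epsilon>" using e by (simp add: field_simps)
      finally show ?thesis .
    qed
    then show "\<exists>N. \<forall>m\<ge>N. \<forall>n\<ge>N. nrm (v (r m) - v (r n)) < \<epsilon>" by blast
  qed (use vH in auto)
  then show ?thesis using r(1) by blast
qed

text \<open>For a non-negative operator \<open>T\<close>, an eigenvector \<open>e\<close> of \<open>T\<^sup>* T\<close> with eigenvalue \<open>\<mu> > 0\<close> is an
  eigenvector of \<open>T\<close>: with \<open>w = T e - \<surd>\<mu> e\<close> one finds
  \<open>\<langle>T w, w\<rangle> = - \<surd>\<mu> \<parallel>w\<parallel>\<^sup>2\<close>, so both sides vanish.\<close>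

lemma gen_eigenvector:
  assumes ey: "(e, y) \<in> gen" and \<mu>: "\<mu> > 0"
    and adj: "\<And>u u'. (u, u') \<in> gen \<Longrightarrow> ip u' y = ip u (of_real \<mu> *s e)"
  shows "(B.nrm e)\<^sup>2 = sqrt \<mu> * (nrm e)\<^sup>2"
proof -
  have H: "e \<in> H" "y \<in> H" using ey by (auto simp: gen_def)
  have byu: "b u y = of_real \<mu> * ip u e" if u: "u \<in> H" for u
  proof -
    obtain u' where "(u, u') \<in> gen" using u Domain_gen by blast
    then have "b u y = ip u' y" "ip u' y = ip u (of_real \<mu> *s e)"
      using adj H by (auto simp: gen_def)
    then show ?thesis using u H by (simp add: ip_scale_right)
  qed
  have bev: "b e v = ip y v" if "v \<in> H" for v using ey that by (auto simp: gen_def)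
  define \<kappa> where "\<kappa> = sqrt \<mu>"
  have \<kappa>: "\<kappa> > 0" "\<mu> = \<kappa>\<^sup>2" using \<mu> by (auto simp: \<kappa>_def)
  define A where "A = (nrm e)\<^sup>2"
  define X where "X = (B.nrm e)\<^sup>2"
  have ye: "ip y e = of_real X" using bev[OF H(1)] B.ip_self[OF H(1)] by (simp add: X_def)
  have ey': "ip e y = of_real X" using ip_commute[OF H(2,1)] ye by simp
  have ee: "ip e e = of_real A" by (simp add: A_def ip_self H)
  have bey: "b e y = of_real (\<mu> * A)" using byu[OF H(1)] ee by simp
  have yy: "ip y y = of_real (\<mu> * A)" using bev[OF H(2)] bey by simp
  have bye: "b y e = of_real (\<mu> * A)" using B.ip_commute[OF H] bey by simp
  have byy: "b y y = of_real (\<mu> * X)" using byu[OF H(2)] ye by simp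
  have bee: "b e e = of_real X" using bev[OF H(1)] ye by simp
  let ?w = "y - of_real \<kappa> *s e"
  have wH: "?w \<in> H" using H by simp
  have "b ?w ?w = of_real (2 * \<mu> * (X - \<kappa> * A))"
    using H \<kappa>(2) by (simp add: B.ip_diff_left B.ip_diff_right B.ip_scale_left B.ip_scale_right byy bye bey bee
        algebra_simps power2_eq_square)
  then have "0 \<le> X - \<kappa> * A" using B.ip_nonneg[OF wH] \<mu> by (simp add: zero_le_mult_iff)
  moreover have "ip ?w ?w = of_real (2 * \<kappa> * (\<kappa> * A - X))"
    using H \<kappa>(2) by (simp add: ip_diff_left ip_diff_right ip_scale_left ip_scale_right yy ye ey' ee
        algebra_simps power2_eq_square)
  then have "0 \<le> \<kappa> * A - X" using ip_nonneg[OF wH] \<kappa> by (simp add: zero_le_mult_iff)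
  ultimately show ?thesis by (simp add: X_def A_def \<kappa>_def)
qed

end

section \<open>Lebesgue spaces\<close>

definition fscale :: "complex \<Rightarrow> 'a fn \<Rightarrow> 'a fn"
  where "fscale c u = (\<lambda>x. c * u x)"

lemma fscale_apply [simp]: "fscale c u x = c * u x"
  by (simp add: fscale_def)

lemma sum_fun_apply: "(\<Sum>i\<in>I. f i) x = (\<Sum>i\<in>I. (f i x :: complex))"
  by (induction I rule: infinite_finite_induct) auto

lemma vector_space_fscale: "vector_space fscale"
  by unfold_locales (auto simp: fun_eq_iff algebra_simps)

text \<open>The \<open>p\<close>-th power of the \<open>L\<^sup>p\<close> norm, with value \<open>\<infinity>\<close> outside \<open>L\<^sup>p\<close>.  For limits a triangle inequality up to a
  constant is enough.\<close>

definition Lp_int :: "'a measure \<Rightarrow> real \<Rightarrow> 'a fn \<Rightarrow> ennreal"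
  where "Lp_int \<sigma> p u = (\<integral>\<^sup>+ x. ennreal (norm (u x) powr p) \<partial>\<sigma>)"

lemma powr_norm_add_le:
  assumes "p > 0"
  shows "norm (a + b :: 'b::real_normed_vector) powr p \<le> 2 powr p * (norm a powr p + norm b powr p)"
proof -
  have "norm (a + b) \<le> 2 * max (norm a) (norm b)" using norm_triangle_ineq[of a b] by linarith
  then have "norm (a + b) powr p \<le> (2 * max (norm a) (norm b)) powr p"
    using assms by (intro powr_mono2) auto
  also have "\<dots> = 2 powr p * max (norm a) (norm b) powr p" by (simp add: powr_mult)
  also have "max (norm a) (norm b) powr p \<le> norm a powr p + norm b powr p" by (simp add: max_def)
  finally show ?thesis by simp
qed

lemma Lp_measurable: "u \<in> Lp \<sigma> p \<Longrightarrow> u \<in> borel_measurable \<sigma>"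
  by (simp add: Lp_def)

lemma Lp_iff: "u \<in> Lp \<sigma> p \<longleftrightarrow> u \<in> borel_measurable \<sigma> \<and> Lp_int \<sigma> p u < \<infinity>"
  by (auto simp: Lp_def Lp_int_def integrable_iff_bounded)

lemma Lp_int_integral:
  "u \<in> Lp \<sigma> p \<Longrightarrow> Lp_int \<sigma> p u = ennreal (LINT x|\<sigma>. norm (u x) powr p)"
  by (auto simp: Lp_def Lp_int_def intro!: nn_integral_eq_integral)

lemma Lp_int_mono:
  "(AE x in \<sigma>. norm (u x) \<le> norm (v x)) \<Longrightarrow> p > 0 \<Longrightarrow> Lp_int \<sigma> p u \<le> Lp_int \<sigma> p v"
  unfolding Lp_int_def by (intro nn_integral_mono_AE) (auto intro!: ennreal_leI powr_mono2)

lemma Lp_bound: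
  "u \<in> borel_measurable \<sigma> \<Longrightarrow> v \<in> Lp \<sigma> p \<Longrightarrow> (AE x in \<sigma>. norm (u x) \<le> norm (v x)) \<Longrightarrow> p > 0
    \<Longrightarrow> u \<in> Lp \<sigma> p" for u v :: "'a fn"
  using Lp_int_mono[of u v \<sigma> p] by (auto simp: Lp_iff)

lemma Lp_int_add:
  assumes "p > 0" "u \<in> borel_measurable \<sigma>" "v \<in> borel_measurable \<sigma>"
  shows "Lp_int \<sigma> p (u + v) \<le> ennreal (2 powr p) * (Lp_int \<sigma> p u + Lp_int \<sigma> p v)"
proof -
  have "Lp_int \<sigma> p (u + v) \<le>
      (\<integral>\<^sup>+ x. ennreal (2 powr p) * (ennreal (norm (u x) powr p) + ennreal (norm (v x) powr p)) \<partial>\<sigma>)"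
    unfolding Lp_int_def
  proof (rule nn_integral_mono)
    fix x
    have "ennreal (norm ((u + v) x) powr p) \<le> ennreal (2 powr p * (norm (u x) powr p + norm (v x) powr p))"
      using powr_norm_add_le[OF assms(1), of "u x" "v x"] by (intro ennreal_leI) simp
    then show "ennreal (norm ((u + v) x) powr p)
        \<le> ennreal (2 powr p) * (ennreal (norm (u x) powr p) + ennreal (norm (v x) powr p))"
      by (simp add: ennreal_mult ennreal_plus)
  qed
  also have "\<dots> = ennreal (2 powr p) * (Lp_int \<sigma> p u + Lp_int \<sigma> p v)"
    unfolding Lp_int_def using assms by (subst nn_integral_cmult) (auto simp: nn_integral_add)
  finally show ?thesis .
qed

lemma Lp_int_fscale:
  "u \<in> borel_measurable \<sigma> \<Longrightarrow> Lp_int \<sigma> p (fscale c u) = ennreal (cmod c powr p) * Lp_int \<sigma> p u"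
  unfolding Lp_int_def
  by (subst nn_integral_cmult[symmetric]) (auto simp: norm_mult powr_mult ennreal_mult)

lemma Lp_int_uminus: "Lp_int \<sigma> p (- u) = Lp_int \<sigma> p u"
  by (simp add: Lp_int_def)

lemma Lp_int_zero [simp]: "Lp_int \<sigma> p 0 = 0"
  by (simp add: Lp_int_def)

lemma fscale_measurable [measurable]:
  "u \<in> borel_measurable \<sigma> \<Longrightarrow> fscale c u \<in> borel_measurable \<sigma>"
  by (simp add: fscale_def)

lemma fun_add_measurable [measurable]:
  "u \<in> borel_measurable \<sigma> \<Longrightarrow> v \<in> borel_measurable \<sigma> \<Longrightarrow> u + v \<in> borel_measurable \<sigma>" for u v :: "'a fn"
  by (simp add: plus_fun_def)

lemma fun_diff_measurable [measurable]:
  "u \<in> borel_measurable \<sigma> \<Longrightarrow> v \<in> borel_measurable \<sigma> \<Longrightarrow> u - v \<in> borel_measurable \<sigma>" for u v :: "'a fn"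
  by (simp add: fun_diff_def)

lemma Lp_zero [simp]: "(0 :: 'a fn) \<in> Lp \<sigma> p"
  by (simp add: Lp_iff zero_fun_def Lp_int_def)

lemma Lp_add [simp]: "p > 0 \<Longrightarrow> u \<in> Lp \<sigma> p \<Longrightarrow> v \<in> Lp \<sigma> p \<Longrightarrow> u + v \<in> Lp \<sigma> p" for u v :: "'a fn"
  using le_less_trans[OF Lp_int_add[of p u \<sigma> v], of \<infinity>]
  by (auto simp: Lp_iff ennreal_mult_less_top)

lemma Lp_fscale [simp]: "u \<in> Lp \<sigma> p \<Longrightarrow> fscale c u \<in> Lp \<sigma> p"
  by (auto simp: Lp_iff Lp_int_fscale ennreal_mult_less_top)

lemma Lp_diff [simp]: "p > 0 \<Longrightarrow> u \<in> Lp \<sigma> p \<Longrightarrow> v \<in> Lp \<sigma> p \<Longrightarrow> u - v \<in> Lp \<sigma> p" for u v :: "'a fn"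
proof -
  assume "p > 0" "u \<in> Lp \<sigma> p" "v \<in> Lp \<sigma> p"
  then have "u + fscale (-1) v \<in> Lp \<sigma> p" by (intro Lp_add Lp_fscale)
  also have "u + fscale (-1) v = u - v" by (simp add: fun_eq_iff)
  finally show ?thesis .
qed

lemma Lp_int_eq_0:
  "u \<in> borel_measurable \<sigma> \<Longrightarrow> Lp_int \<sigma> p u = 0 \<longleftrightarrow> (AE x in \<sigma>. u x = 0)"
  unfolding Lp_int_def by (subst nn_integral_0_iff_AE) (auto simp: ennreal_eq_0_iff)

text \<open>Fatou's lemma, in the form used for limits of bounded sequences.\<close>

lemma Lp_int_limit_le:
  assumes [measurable]: "\<And>k. W k \<in> borel_measurable \<sigma>" "w \<in> borel_measurable \<sigma>"
    and lim: "AE x in \<sigma>. (\<lambda>k. W k x) \<longlonglongrightarrow> w x"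
    and ev: "\<forall>\<^sub>F k in sequentially. Lp_int \<sigma> p (W k) \<le> C" and p: "p > 0"
  shows "Lp_int \<sigma> p w \<le> C"
proof -
  have "Lp_int \<sigma> p w \<le> (\<integral>\<^sup>+ x. liminf (\<lambda>k. ennreal (norm (W k x) powr p)) \<partial>\<sigma>)"
    unfolding Lp_int_def
  proof (rule nn_integral_mono_AE)
    show "AE x in \<sigma>. ennreal (norm (w x) powr p) \<le> liminf (\<lambda>k. ennreal (norm (W k x) powr p))"
      using lim
    proof eventually_elim
      case (elim x)
      have "(\<lambda>k. norm (W k x) powr p) \<longlonglongrightarrow> norm (w x) powr p"
        using elim p by (intro tendsto_powr2 tendsto_norm tendsto_const) (auto intro: always_eventually)
      then have "(\<lambda>k. ennreal (norm (W k x) powr p)) \<longlonglongrightarrow> ennreal (norm (w x) powr p)"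
        by (rule tendsto_ennrealI)
      then show ?case using lim_imp_Liminf[OF sequentially_bot] by fastforce
    qed
  qed
  also have "\<dots> \<le> liminf (\<lambda>k. Lp_int \<sigma> p (W k))"
    unfolding Lp_int_def by (rule nn_integral_liminf) measurable
  also have "\<dots> \<le> liminf (\<lambda>_. C)" by (rule Liminf_mono[OF ev])
  also have "\<dots> = C" by (simp add: Liminf_const)
  finally show ?thesis .
qed

lemma Lp_tendsto_AE_subseq:
  assumes W: "\<And>k. W k \<in> Lp \<sigma> p" and lim: "(\<lambda>k. Lp_int \<sigma> p (W k)) \<longlonglongrightarrow> 0" and p: "p > 0"
  shows "\<exists>r::nat\<Rightarrow>nat. strict_mono r \<and> (AE x in \<sigma>. (\<lambda>k. W (r k) x) \<longlonglongrightarrow> 0)"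
proof -
  have "\<exists>r::nat\<Rightarrow>nat. strict_mono r \<and> (AE x in \<sigma>. (\<lambda>k. norm (W (r k) x) powr p) \<longlonglongrightarrow> 0)"
  proof (rule tendsto_L1_AE_subseq)
    show "integrable \<sigma> (\<lambda>x. norm (W n x) powr p)" for n using W[of n] by (simp add: Lp_def)
    have "(\<lambda>k. ennreal (LINT x|\<sigma>. norm (W k x) powr p)) \<longlonglongrightarrow> ennreal 0"
      using lim Lp_int_integral[OF W] by simp
    then show "(\<lambda>n. LINT x|\<sigma>. norm (norm (W n x) powr p)) \<longlonglongrightarrow> 0"
      by (subst (asm) tendsto_ennreal_iff) auto
  qed
  then obtain r where r: "strict_mono (r::nat\<Rightarrow>nat)" "AE x in \<sigma>. (\<lambda>k. norm (W (r k) x) powr p) \<longlonglongrightarrow> 0"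
    by blast
  have "AE x in \<sigma>. (\<lambda>k. W (r k) x) \<longlonglongrightarrow> 0"
    using r(2)
  proof eventually_elim
    case (elim x)
    have "(\<lambda>k. (norm (W (r k) x) powr p) powr (1 / p)) \<longlonglongrightarrow> 0 powr (1 / p)"
      using elim p by (intro tendsto_powr2 tendsto_const) (auto intro: always_eventually)
    then have "(\<lambda>k. norm (W (r k) x)) \<longlonglongrightarrow> 0" using p by (simp add: powr_powr)
    then show ?case by (rule tendsto_norm_zero_cancel)
  qed
  with r(1) show ?thesis by blast
qed

text \<open>Along a subsequence whose increments \<open>d\<^sub>k\<close> satisfy \<open>\<integral>(2\<^sup>k \<bar>d\<^sub>k\<bar>)\<^sup>p \<le> 2\<^sup>-\<^sup>k\<close>, almost everywhere
  \<open>\<bar>d\<^sub>k\<bar> \<le> 2\<^sup>-\<^sup>k\<close> for large \<open>k\<close>.  This gives pointwise convergence for every \<open>p > 0\<close>.\<close>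

lemma Lp_complete:
  fixes U :: "nat \<Rightarrow> 'a fn"
  assumes U: "\<And>n. U n \<in> Lp \<sigma> p" and p: "p > 0"
    and cauchy: "\<And>\<epsilon>. \<epsilon> > 0 \<Longrightarrow> \<exists>N. \<forall>m\<ge>N. \<forall>n\<ge>N. Lp_int \<sigma> p (U m - U n) < ennreal \<epsilon>"
  shows "\<exists>u\<in>Lp \<sigma> p. (\<lambda>n. Lp_int \<sigma> p (U n - u)) \<longlonglongrightarrow> 0"
proof -
  have [measurable]: "U n \<in> borel_measurable \<sigma>" for n using U Lp_measurable by blast
  \<comment> \<open>The second factor compensates the weights \<open>2\<^sup>k\<close> below.\<close>
  define \<epsilon> where "\<epsilon> k = (1/2)^k * 2 powr (- (real k * p))" for k :: nat
  have "\<forall>k. \<exists>N. \<forall>m\<ge>N. \<forall>n\<ge>N. Lp_int \<sigma> p (U m - U n) < ennreal (\<epsilon> k)"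
    by (intro allI cauchy) (simp add: \<epsilon>_def)
  then obtain N where N: "\<And>k m n. m \<ge> N k \<Longrightarrow> n \<ge> N k \<Longrightarrow> Lp_int \<sigma> p (U m - U n) < ennreal (\<epsilon> k)"
    by metis
  define r where "r k = (\<Sum>i\<le>k. N i) + k" for k
  have r_mono: "r k \<le> r (Suc k)" for k by (simp add: r_def)
  have rN: "N k \<le> r k" for k
    unfolding r_def using member_le_sum[of k "{..k}" N] by simp
  have r_ge: "k \<le> r k" for k by (simp add: r_def)
  define d where "d k = U (r (Suc k)) - U (r k)" for k
  have [measurable]: "d k \<in> borel_measurable \<sigma>" for k unfolding d_def by measurable
  have "(\<integral>\<^sup>+ x. (\<Sum>k. ennreal ((2^k * norm (d k x)) powr p)) \<partial>\<sigma>)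
      = (\<Sum>k. \<integral>\<^sup>+ x. ennreal ((2^k * norm (d k x)) powr p) \<partial>\<sigma>)"
    by (rule nn_integral_suminf) measurable
  also have "\<dots> \<le> (\<Sum>k. ennreal ((1/2)^k))"
  proof (rule suminf_le)
    fix k
    have e: "(2^k * norm (d k x)) powr p = 2 powr (real k * p) * norm (d k x) powr p" for x
      by (simp add: powr_mult powr_realpow[symmetric] powr_powr)
    have "(\<integral>\<^sup>+ x. ennreal ((2^k * norm (d k x)) powr p) \<partial>\<sigma>) = ennreal (2 powr (real k * p)) * Lp_int \<sigma> p (d k)"
      unfolding Lp_int_def e by (subst nn_integral_cmult[symmetric]) (auto simp: ennreal_mult)
    also have "\<dots> \<le> ennreal (2 powr (real k * p)) * ennreal (\<epsilon> k)"
      using N[of k "r (Suc k)" "r k"] rN[of k] r_mono[of k]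
      by (intro mult_left_mono) (auto simp: d_def)
    also have "\<dots> = ennreal ((1/2)^k)"
      by (subst ennreal_mult[symmetric]) (auto simp: \<epsilon>_def powr_minus)
    finally show "(\<integral>\<^sup>+ x. ennreal ((2^k * norm (d k x)) powr p) \<partial>\<sigma>) \<le> ennreal ((1/2)^k)" .
  qed auto
  also have "\<dots> < \<infinity>" by (subst suminf_ennreal2) (auto intro!: summable_geometric)
  finally have fin: "(\<integral>\<^sup>+ x. (\<Sum>k. ennreal ((2^k * norm (d k x)) powr p)) \<partial>\<sigma>) < \<infinity>" .
  have conv: "AE x in \<sigma>. convergent (\<lambda>k. U (r k) x)"
  proof -
    have "AE x in \<sigma>. (\<Sum>k. ennreal ((2^k * norm (d k x)) powr p)) \<noteq> \<infinity>"
      by (rule nn_integral_noteq_infinite) (use fin in auto)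
    then show ?thesis
    proof eventually_elim
      case (elim x)
      have "summable (\<lambda>k. (2^k * norm (d k x)) powr p)"
        by (rule summable_suminf_not_top) (use elim in auto)
      then have "(\<lambda>k. (2^k * norm (d k x)) powr p) \<longlonglongrightarrow> 0" by (rule summable_LIMSEQ_zero)
      then have "\<forall>\<^sub>F k in sequentially. (2^k * norm (d k x)) powr p < 1"
        by (rule order_tendstoD) simp
      then have "\<forall>\<^sub>F k in sequentially. norm (d k x) \<le> (1/2)^k"
      proof eventually_elim
        case (elim k)
        have "2^k * norm (d k x) \<le> 1"
        proof (rule ccontr)
          assume "\<not> 2^k * norm (d k x) \<le> 1"
          then have "1 powr p \<le> (2^k * norm (d k x)) powr p" using p by (intro powr_mono2) auto
          with elim show False by simp
        qed
        then show ?case by (simp add: field_simps power_divide)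
      qed
      then have "summable (\<lambda>k. d k x)"
        by (rule summable_comparison_test_ev) (simp add: summable_geometric)
      then have "convergent (\<lambda>n. \<Sum>k<n. d k x)" by (simp add: summable_iff_convergent)
      moreover have "(\<Sum>k<n. d k x) = U (r n) x - U (r 0) x" for n
        using sum_lessThan_telescope[of "\<lambda>k. U (r k) x" n] by (simp add: d_def)
      ultimately have "convergent (\<lambda>n. U (r n) x - U (r 0) x)" by simp
      then have "convergent (\<lambda>n. (U (r n) x - U (r 0) x) + U (r 0) x)"
        by (intro convergent_add convergent_const)
      then show ?case by simp
    qed
  qed
  define u where "u x = lim (\<lambda>k. U (r k) x)" for x
  have um [measurable]: "u \<in> borel_measurable \<sigma>" unfolding u_def by measurable
  have lim: "AE x in \<sigma>. (\<lambda>k. U (r k) x) \<longlonglongrightarrow> u x"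
    using conv by eventually_elim (simp add: u_def convergent_LIMSEQ_iff)
  have small: "\<exists>N. \<forall>n\<ge>N. Lp_int \<sigma> p (U n - u) \<le> ennreal e" if e0: "e > 0" for e
  proof -
    obtain M where M: "\<And>m n. m \<ge> M \<Longrightarrow> n \<ge> M \<Longrightarrow> Lp_int \<sigma> p (U m - U n) < ennreal e"
      using cauchy[OF e0] by blast
    have "Lp_int \<sigma> p (U n - u) \<le> ennreal e" if n: "n \<ge> M" for n
    proof (rule Lp_int_limit_le[OF _ _ _ _ p])
      show "AE x in \<sigma>. (\<lambda>k. (U n - U (r k)) x) \<longlonglongrightarrow> (U n - u) x"
        using lim by eventually_elim (auto intro!: tendsto_intros)
      show "\<forall>\<^sub>F k in sequentially. Lp_int \<sigma> p (U n - U (r k)) \<le> ennreal e"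
        using eventually_ge_at_top[of M]
        by eventually_elim (use M[OF n] r_ge order_trans in \<open>blast intro: less_imp_le\<close>)
    qed measurable
    then show ?thesis by blast
  qed
  have "(\<lambda>n. Lp_int \<sigma> p (U n - u)) \<longlonglongrightarrow> 0"
  proof (rule tendsto_zero_ennreal)
    fix e :: real assume "0 < e"
    then obtain N where "\<forall>n\<ge>N. Lp_int \<sigma> p (U n - u) \<le> ennreal (e/2)" using small[of "e/2"] by auto
    moreover have "ennreal (e/2) < ennreal e" using \<open>0 < e\<close> by (simp add: ennreal_lessI)
    ultimately show "\<forall>\<^sub>F n in sequentially. Lp_int \<sigma> p (U n - u) < ennreal e"
      by (auto simp: eventually_sequentially intro: le_less_trans)
  qed
  moreover have "u \<in> Lp \<sigma> p"
  proof -
    obtain n where "Lp_int \<sigma> p (U n - u) \<le> ennreal 1" using small[of 1] by auto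
    then have "U n - u \<in> Lp \<sigma> p" by (auto simp: Lp_iff less_top[symmetric] top_unique)
    with U[of n] have "U n - (U n - u) \<in> Lp \<sigma> p" by (rule Lp_diff[OF p])
    also have "U n - (U n - u) = u" by (simp add: fun_eq_iff)
    finally show ?thesis .
  qed
  ultimately show ?thesis by blast
qed

section \<open>The Hilbert space \<open>L\<^sup>2\<close>\<close>

lemma L2_integrable_sq: "u \<in> Lp \<sigma> 2 \<Longrightarrow> integrable \<sigma> (\<lambda>x. (norm (u x))\<^sup>2)" for u :: "'a fn"
  by (simp add: Lp_def powr_numeral)

lemma borel_measurable_cnj [measurable]:
  "f \<in> borel_measurable M \<Longrightarrow> (\<lambda>x. cnj (f x)) \<in> borel_measurable M"
  by (rule borel_measurable_continuous_on[of cnj]) (auto intro: continuous_intros)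

lemma L2_integrable_mult:
  assumes u: "u \<in> Lp \<sigma> 2" and v: "v \<in> Lp \<sigma> 2"
  shows "integrable \<sigma> (\<lambda>x. u x * cnj (v x))"
proof (rule Bochner_Integration.integrable_bound)
  show "integrable \<sigma> (\<lambda>x. (norm (u x))\<^sup>2 + (norm (v x))\<^sup>2)"
    by (intro Bochner_Integration.integrable_add L2_integrable_sq assms)
  show "(\<lambda>x. u x * cnj (v x)) \<in> borel_measurable \<sigma>"
    using assms[THEN Lp_measurable] by measurable
  show "AE x in \<sigma>. norm (u x * cnj (v x)) \<le> norm ((norm (u x))\<^sup>2 + (norm (v x))\<^sup>2)"
  proof (rule AE_I2)
    fix x
    have "2 * (norm (u x) * norm (v x)) \<le> (norm (u x))\<^sup>2 + (norm (v x))\<^sup>2"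
      using sum_squares_bound[of "norm (u x)" "norm (v x)"] by (simp add: mult.assoc)
    moreover have "0 \<le> norm (u x) * norm (v x)" by simp
    ultimately have "norm (u x) * norm (v x) \<le> (norm (u x))\<^sup>2 + (norm (v x))\<^sup>2" by linarith
    then show "norm (u x * cnj (v x)) \<le> norm ((norm (u x))\<^sup>2 + (norm (v x))\<^sup>2)"
      by (simp add: norm_mult)
  qed
qed

lemma sip_L2: "sip fscale (Lp \<sigma> 2) (L2_inner \<sigma>)"
proof -
  interpret vector_space "fscale :: complex \<Rightarrow> 'a fn \<Rightarrow> 'a fn" by (rule vector_space_fscale)
  show ?thesis
  proof unfold_locales
    fix u v w :: "'a fn" and c
    show "u \<in> Lp \<sigma> 2 \<Longrightarrow> v \<in> Lp \<sigma> 2 \<Longrightarrow> w \<in> Lp \<sigma> 2 \<Longrightarrow>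
        L2_inner \<sigma> (u + v) w = L2_inner \<sigma> u w + L2_inner \<sigma> v w"
      unfolding L2_inner_def by (simp add: distrib_right Bochner_Integration.integral_add L2_integrable_mult)
    show "u \<in> Lp \<sigma> 2 \<Longrightarrow> w \<in> Lp \<sigma> 2 \<Longrightarrow> L2_inner \<sigma> (fscale c u) w = c * L2_inner \<sigma> u w"
      unfolding L2_inner_def by (simp add: mult.assoc)
    show "u \<in> Lp \<sigma> 2 \<Longrightarrow> v \<in> Lp \<sigma> 2 \<Longrightarrow> L2_inner \<sigma> v u = cnj (L2_inner \<sigma> u v)"
      unfolding L2_inner_def by (subst Bochner_Integration.integral_cnj[symmetric]) (simp add: mult.commute)
    show "0 \<le> Re (L2_inner \<sigma> u u)" if "u \<in> Lp \<sigma> 2"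
    proof -
      have "L2_inner \<sigma> u u = of_real (LINT x|\<sigma>. (norm (u x))\<^sup>2)"
        unfolding L2_inner_def by (simp add: complex_norm_square[symmetric] flip: integral_complex_of_real of_real_power)
      then show ?thesis by (simp del: of_real_power)
    qed
  qed auto
qed

global_interpretation L2: sip fscale "Lp \<sigma> 2" "L2_inner \<sigma>" for \<sigma> :: "'a measure"
  by (rule sip_L2)

lemma L2_inner_self: "L2_inner \<sigma> u u = of_real (LINT x|\<sigma>. (norm (u x))\<^sup>2)"
  unfolding L2_inner_def by (simp add: complex_norm_square[symmetric] flip: integral_complex_of_real of_real_power)

lemma L2_nrm_sq: "(L2.nrm \<sigma> u)\<^sup>2 = (LINT x|\<sigma>. (norm (u x))\<^sup>2)"
  by (simp add: L2.nrm_def L2_inner_self del: of_real_power)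

lemma L2_nrm_Lp_int: "u \<in> Lp \<sigma> 2 \<Longrightarrow> Lp_int \<sigma> 2 u = ennreal ((L2.nrm \<sigma> u)\<^sup>2)"
  by (subst Lp_int_integral) (auto simp: L2_nrm_sq powr_numeral)

lemma L2_nrm_eq_0: "u \<in> Lp \<sigma> 2 \<Longrightarrow> L2.nrm \<sigma> u = 0 \<longleftrightarrow> (AE x in \<sigma>. u x = 0)"
  using L2_nrm_Lp_int[of u \<sigma>] Lp_int_eq_0[of u \<sigma> 2] Lp_measurable[of u \<sigma> 2]
  by (metis ennreal_eq_zero_iff zero_eq_power2 order_refl zero_le_power2)

lemma L2_inner_cong_AE:
  assumes "u \<in> borel_measurable \<sigma>" "u' \<in> borel_measurable \<sigma>" "v \<in> borel_measurable \<sigma>" "v' \<in> borel_measurable \<sigma>"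
    "AE x in \<sigma>. u x = u' x" "AE x in \<sigma>. v x = v' x"
  shows "L2_inner \<sigma> u v = L2_inner \<sigma> u' v'"
  unfolding L2_inner_def using assms by (intro integral_cong_AE) (auto elim: eventually_elim2)

global_interpretation L2: complete_sip fscale "Lp \<sigma> 2" "L2_inner \<sigma>" for \<sigma> :: "'a measure"
proof unfold_locales
  fix U :: "nat \<Rightarrow> 'a fn"
  assume U: "\<And>n. U n \<in> Lp \<sigma> 2"
    and c: "\<And>\<epsilon>. \<epsilon> > 0 \<Longrightarrow> \<exists>N. \<forall>m\<ge>N. \<forall>n\<ge>N. L2.nrm \<sigma> (U m - U n) < \<epsilon>"
  have "\<exists>u\<in>Lp \<sigma> 2. (\<lambda>n. Lp_int \<sigma> 2 (U n - u)) \<longlonglongrightarrow> 0"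
  proof (rule Lp_complete[OF U])
    fix \<epsilon> :: real assume e: "\<epsilon> > 0"
    then obtain N where N: "\<And>m n. m \<ge> N \<Longrightarrow> n \<ge> N \<Longrightarrow> L2.nrm \<sigma> (U m - U n) < sqrt \<epsilon>"
      using c[of "sqrt \<epsilon>"] by auto
    have "Lp_int \<sigma> 2 (U m - U n) < ennreal \<epsilon>" if "m \<ge> N" "n \<ge> N" for m n
    proof -
      have "(L2.nrm \<sigma> (U m - U n))\<^sup>2 < (sqrt \<epsilon>)\<^sup>2"
        using N[OF that] U by (intro power_strict_mono) auto
      then show ?thesis using e U by (simp add: L2_nrm_Lp_int ennreal_lessI)
    qed
    then show "\<exists>N. \<forall>m\<ge>N. \<forall>n\<ge>N. Lp_int \<sigma> 2 (U m - U n) < ennreal \<epsilon>" by blast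
  qed simp
  then obtain u where u: "u \<in> Lp \<sigma> 2" "(\<lambda>n. Lp_int \<sigma> 2 (U n - u)) \<longlonglongrightarrow> 0" by blast
  have "(\<lambda>n. ennreal ((L2.nrm \<sigma> (U n - u))\<^sup>2)) \<longlonglongrightarrow> ennreal 0"
    using u U by (simp add: L2_nrm_Lp_int)
  then have "(\<lambda>n. (L2.nrm \<sigma> (U n - u))\<^sup>2) \<longlonglongrightarrow> 0"
    by (subst (asm) tendsto_ennreal_iff) auto
  then have "(\<lambda>n. sqrt ((L2.nrm \<sigma> (U n - u))\<^sup>2)) \<longlonglongrightarrow> sqrt 0" by (rule tendsto_real_sqrt)
  then have "(\<lambda>n. L2.nrm \<sigma> (U n - u)) \<longlonglongrightarrow> 0" using u U by simp
  with u(1) show "\<exists>u\<in>Lp \<sigma> 2. (\<lambda>n. L2.nrm \<sigma> (U n - u)) \<longlonglongrightarrow> 0" by blast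
qed

lemma L2_tendsto_Lp_int:
  assumes "\<And>n. U n \<in> Lp \<sigma> 2" "u \<in> Lp \<sigma> 2"
  shows "(\<lambda>n. L2.nrm \<sigma> (U n - u)) \<longlonglongrightarrow> 0 \<longleftrightarrow> (\<lambda>n. Lp_int \<sigma> 2 (U n - u)) \<longlonglongrightarrow> 0"
proof -
  have "(\<lambda>n. L2.nrm \<sigma> (U n - u)) \<longlonglongrightarrow> 0 \<longleftrightarrow> (\<lambda>n. (L2.nrm \<sigma> (U n - u))\<^sup>2) \<longlonglongrightarrow> 0"
    using tendsto_null_power[of "\<lambda>n. L2.nrm \<sigma> (U n - u)" sequentially 2]
      tendsto_real_sqrt[of "\<lambda>n. (L2.nrm \<sigma> (U n - u))\<^sup>2" 0 sequentially] assms by auto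
  also have "\<dots> \<longleftrightarrow> (\<lambda>n. ennreal ((L2.nrm \<sigma> (U n - u))\<^sup>2)) \<longlonglongrightarrow> ennreal 0"
    by (subst tendsto_ennreal_iff) auto
  finally show ?thesis using assms by (simp add: L2_nrm_Lp_int)
qed

section \<open>Functional calculus of a projection-valued measure\<close>

definition bounded_borel :: "(real \<Rightarrow> real) \<Rightarrow> bool"
  where "bounded_borel f \<longleftrightarrow> f \<in> borel_measurable borel \<and> (\<exists>K. \<forall>s. \<bar>f s\<bar> \<le> K)"

lemma bounded_borelI: "f \<in> borel_measurable borel \<Longrightarrow> (\<And>s. \<bar>f s\<bar> \<le> K) \<Longrightarrow> bounded_borel f"
  by (auto simp: bounded_borel_def)

lemma bounded_borel_measurable: "bounded_borel f \<Longrightarrow> f \<in> borel_measurable borel"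
  by (simp add: bounded_borel_def)

lemma bounded_borel_const [simp]: "bounded_borel (\<lambda>_. c)"
  by (auto simp: bounded_borel_def)

lemma bounded_borel_indicator [simp]: "B \<in> sets borel \<Longrightarrow> bounded_borel (indicator B)"
  by (rule bounded_borelI[of _ 1]) (auto simp: indicator_def)

lemma bounded_borel_add [simp]: "bounded_borel f \<Longrightarrow> bounded_borel g \<Longrightarrow> bounded_borel (\<lambda>s. f s + g s)"
  unfolding bounded_borel_def
proof (elim conjE exE, intro conjI)
  fix K L assume "\<forall>s. \<bar>f s\<bar> \<le> K" "\<forall>s. \<bar>g s\<bar> \<le> L"
  then have "\<bar>f s + g s\<bar> \<le> K + L" for s by (meson abs_triangle_ineq add_mono order_trans)
  then show "\<exists>K. \<forall>s. \<bar>f s + g s\<bar> \<le> K" by blast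
qed auto

lemma bounded_borel_mult [simp]: "bounded_borel f \<Longrightarrow> bounded_borel g \<Longrightarrow> bounded_borel (\<lambda>s. f s * g s)"
  unfolding bounded_borel_def
proof (elim conjE exE, intro conjI)
  fix K L assume "\<forall>s. \<bar>f s\<bar> \<le> K" "\<forall>s. \<bar>g s\<bar> \<le> L"
  then have "\<bar>f s * g s\<bar> \<le> K * L" for s
    unfolding abs_mult by (intro mult_mono order_trans[OF abs_ge_zero, of _ K]) auto
  then show "\<exists>K. \<forall>s. \<bar>f s * g s\<bar> \<le> K" by blast
qed auto

lemma bounded_borel_diff [simp]: "bounded_borel f \<Longrightarrow> bounded_borel g \<Longrightarrow> bounded_borel (\<lambda>s. f s - g s)"
  using bounded_borel_add[of f "\<lambda>s. (-1) * g s"] bounded_borel_mult[of "\<lambda>_. -1" g] by simp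

lemma bounded_borel_power2 [simp]: "bounded_borel f \<Longrightarrow> bounded_borel (\<lambda>s. (f s)\<^sup>2)"
  using bounded_borel_mult[of f f] by (simp add: power2_eq_square)

text \<open>Functionals that behave like integration against a complex measure; they are determined by
  their values on indicators, which turns identities for projections into identities for the
  whole calculus.\<close>

definition measure_like :: "((real \<Rightarrow> real) \<Rightarrow> complex) \<Rightarrow> bool"
  where "measure_like \<Lambda> \<longleftrightarrow>
    (\<forall>f g. bounded_borel f \<longrightarrow> bounded_borel g \<longrightarrow> \<Lambda> (\<lambda>s. f s + g s) = \<Lambda> f + \<Lambda> g) \<and>
    (\<forall>c f. bounded_borel f \<longrightarrow> \<Lambda> (\<lambda>s. c * f s) = of_real c * \<Lambda> f) \<and>
    (\<forall>F f K. (\<forall>n. F n \<in> borel_measurable borel) \<longrightarrow> (\<forall>n s. \<bar>F n s\<bar> \<le> K) \<longrightarrow>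
      (\<forall>s. (\<lambda>n::nat. F n s) \<longlonglongrightarrow> f s) \<longrightarrow> (\<lambda>n. \<Lambda> (F n)) \<longlonglongrightarrow> \<Lambda> f)"

lemma measure_like_addD: "measure_like \<Lambda> \<Longrightarrow> bounded_borel f \<Longrightarrow> bounded_borel g \<Longrightarrow>
    \<Lambda> (\<lambda>s. f s + g s) = \<Lambda> f + \<Lambda> g"
  by (simp add: measure_like_def)

lemma measure_like_scaleD: "measure_like \<Lambda> \<Longrightarrow> bounded_borel f \<Longrightarrow> \<Lambda> (\<lambda>s. c * f s) = of_real c * \<Lambda> f"
  by (simp add: measure_like_def)

lemma measure_like_limD: "measure_like \<Lambda> \<Longrightarrow> (\<And>n. F n \<in> borel_measurable borel) \<Longrightarrow>
    (\<And>n s. \<bar>F n s\<bar> \<le> K) \<Longrightarrow> (\<And>s. (\<lambda>n::nat. F n s) \<longlonglongrightarrow> f s) \<Longrightarrow> (\<lambda>n. \<Lambda> (F n)) \<longlonglongrightarrow> \<Lambda> f"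
  unfolding measure_like_def by blast

lemma measure_likeI:
  assumes "\<And>f g. bounded_borel f \<Longrightarrow> bounded_borel g \<Longrightarrow> \<Lambda> (\<lambda>s. f s + g s) = \<Lambda> f + \<Lambda> g"
    and "\<And>c f. bounded_borel f \<Longrightarrow> \<Lambda> (\<lambda>s. c * f s) = of_real c * \<Lambda> f"
    and "\<And>F f K. (\<And>n. F n \<in> borel_measurable borel) \<Longrightarrow> (\<And>n s. \<bar>F n s\<bar> \<le> K) \<Longrightarrow>
      (\<And>s. (\<lambda>n::nat. F n s) \<longlonglongrightarrow> f s) \<Longrightarrow> (\<lambda>n. \<Lambda> (F n)) \<longlonglongrightarrow> \<Lambda> f"
  shows "measure_like \<Lambda>"
  unfolding measure_like_def using assms by (intro conjI allI impI) blast+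

lemma measure_like_plus:
  assumes L: "measure_like \<Lambda>" and L': "measure_like \<Lambda>'"
  shows "measure_like (\<lambda>f. \<Lambda> f + \<Lambda>' f)"
proof (rule measure_likeI)
  fix F :: "nat \<Rightarrow> real \<Rightarrow> real" and f K
  assume *: "\<And>n. F n \<in> borel_measurable borel" "\<And>n s. \<bar>F n s\<bar> \<le> K" "\<And>s. (\<lambda>n. F n s) \<longlonglongrightarrow> f s"
  show "(\<lambda>n. \<Lambda> (F n) + \<Lambda>' (F n)) \<longlonglongrightarrow> \<Lambda> f + \<Lambda>' f"
    by (intro tendsto_add measure_like_limD[OF L *] measure_like_limD[OF L' *])
qed (simp_all add: measure_like_addD[OF L] measure_like_addD[OF L'] measure_like_scaleD[OF L]
    measure_like_scaleD[OF L'] algebra_simps)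

lemma measure_like_mult:
  assumes L: "measure_like \<Lambda>" shows "measure_like (\<lambda>f. c * \<Lambda> f)"
proof (rule measure_likeI)
  fix F :: "nat \<Rightarrow> real \<Rightarrow> real" and f K
  assume *: "\<And>n. F n \<in> borel_measurable borel" "\<And>n s. \<bar>F n s\<bar> \<le> K" "\<And>s. (\<lambda>n. F n s) \<longlonglongrightarrow> f s"
  show "(\<lambda>n. c * \<Lambda> (F n)) \<longlonglongrightarrow> c * \<Lambda> f"
    by (intro tendsto_mult tendsto_const measure_like_limD[OF L *])
qed (simp_all add: measure_like_addD[OF L] measure_like_scaleD[OF L] algebra_simps)

lemma measure_like_cnj:
  assumes L: "measure_like \<Lambda>" shows "measure_like (\<lambda>f. cnj (\<Lambda> f))"
proof (rule measure_likeI)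
  fix F :: "nat \<Rightarrow> real \<Rightarrow> real" and f K
  assume *: "\<And>n. F n \<in> borel_measurable borel" "\<And>n s. \<bar>F n s\<bar> \<le> K" "\<And>s. (\<lambda>n. F n s) \<longlonglongrightarrow> f s"
  show "(\<lambda>n. cnj (\<Lambda> (F n))) \<longlonglongrightarrow> cnj (\<Lambda> f)"
    by (intro tendsto_cnj measure_like_limD[OF L *])
qed (simp_all add: measure_like_addD[OF L] measure_like_scaleD[OF L])

text \<open>Passing from \<open>\<Lambda>\<close> to \<open>g \<Lambda>\<close> is what makes multiplicativity of the calculus a statement about such functionals.\<close>

lemma measure_like_weight:
  assumes L: "measure_like \<Lambda>" and g: "bounded_borel g"
  shows "measure_like (\<lambda>f. \<Lambda> (\<lambda>s. f s * g s))"
  unfolding measure_like_def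
proof (intro conjI allI impI)
  fix f h assume "bounded_borel f" "bounded_borel h"
  then have "\<Lambda> (\<lambda>s. f s * g s + h s * g s) = \<Lambda> (\<lambda>s. f s * g s) + \<Lambda> (\<lambda>s. h s * g s)"
    by (intro measure_like_addD[OF L] bounded_borel_mult g)
  then show "\<Lambda> (\<lambda>s. (f s + h s) * g s) = \<Lambda> (\<lambda>s. f s * g s) + \<Lambda> (\<lambda>s. h s * g s)"
    by (simp only: distrib_right)
next
  fix c f assume f: "bounded_borel f"
  have "\<Lambda> (\<lambda>s. c * (f s * g s)) = complex_of_real c * \<Lambda> (\<lambda>s. f s * g s)"
    by (rule measure_like_scaleD[OF L bounded_borel_mult[OF f g]])
  then show "\<Lambda> (\<lambda>s. c * f s * g s) = complex_of_real c * \<Lambda> (\<lambda>s. f s * g s)"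
    by (simp only: mult.assoc)
next
  fix F :: "nat \<Rightarrow> real \<Rightarrow> real" and f K
  assume F: "\<forall>n. F n \<in> borel_measurable borel" "\<forall>n s. \<bar>F n s\<bar> \<le> K" "\<forall>s. (\<lambda>n. F n s) \<longlonglongrightarrow> f s"
  obtain L where L': "\<And>s. \<bar>g s\<bar> \<le> L" using g by (auto simp: bounded_borel_def)
  show "(\<lambda>n. \<Lambda> (\<lambda>s. F n s * g s)) \<longlonglongrightarrow> \<Lambda> (\<lambda>s. f s * g s)"
  proof (rule measure_like_limD[OF L])
    show "(\<lambda>s. F n s * g s) \<in> borel_measurable borel" for n
      using F(1) bounded_borel_measurable[OF g] by (intro borel_measurable_times) auto
    show "\<bar>F n s * g s\<bar> \<le> K * L" for n s
      unfolding abs_mult using F(2) L'[of s] by (intro mult_mono order_trans[OF abs_ge_zero, of _ K]) auto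
    show "(\<lambda>n. F n s * g s) \<longlonglongrightarrow> f s * g s" for s
      using F by (intro tendsto_intros) auto
  qed
qed

text \<open>Agreement passes from indicators to non-negative bounded functions by bounded monotone limits, and then to
  all bounded functions by splitting into positive and negative part.\<close>

lemma measure_like_ext:
  assumes L: "measure_like \<Lambda>" and L': "measure_like \<Lambda>'"
    and ind: "\<And>B. B \<in> sets borel \<Longrightarrow> \<Lambda> (indicator B) = \<Lambda>' (indicator B)"
    and f: "bounded_borel f"
  shows "\<Lambda> f = \<Lambda>' f"
proof -
  have pos: "bounded_borel g \<longrightarrow> \<Lambda> g = \<Lambda>' g" if "g \<in> borel_measurable borel" "\<And>s. 0 \<le> g s" for g
    using that
  proof (induction rule: borel_measurable_induct_real)
    case (set A)
    then show ?case using ind by simp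
  next
    case (mult g c)
    show ?case
    proof (cases "c = 0")
      case True
      then show ?thesis
        using measure_like_scaleD[OF L, of "\<lambda>_. 0" 0] measure_like_scaleD[OF L', of "\<lambda>_. 0" 0] by simp
    next
      case False
      show ?thesis
      proof
        assume "bounded_borel (\<lambda>s. c * g s)"
        then have "bounded_borel (\<lambda>s. (1 / c) * (c * g s))"
          by (rule bounded_borel_mult[OF bounded_borel_const])
        then have "bounded_borel g" using False by simp
        then show "\<Lambda> (\<lambda>s. c * g s) = \<Lambda>' (\<lambda>s. c * g s)"
          using mult.IH measure_like_scaleD[OF L] measure_like_scaleD[OF L'] by simp
      qed
    qed
  next
    case (add g h)
    show ?case
    proof
      assume "bounded_borel (\<lambda>s. h s + g s)"
      then obtain K where K: "\<And>s. \<bar>h s + g s\<bar> \<le> K" by (auto simp: bounded_borel_def)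
      have "\<bar>h s\<bar> \<le> K" "\<bar>g s\<bar> \<le> K" for s using K[of s] add.hyps(2)[of s] add.hyps(4)[of s] by auto
      then have "bounded_borel h" "bounded_borel g" using add by (auto intro!: bounded_borelI)
      then show "\<Lambda> (\<lambda>s. h s + g s) = \<Lambda>' (\<lambda>s. h s + g s)"
        using add.IH measure_like_addD[OF L] measure_like_addD[OF L'] by simp
    qed
  next
    case (seq U)
    show ?case
    proof
      assume "bounded_borel g"
      then obtain K where K: "\<And>s. \<bar>g s\<bar> \<le> K" by (auto simp: bounded_borel_def)
      have lim: "(\<lambda>i. U i s) \<longlonglongrightarrow> g s" for s using seq by simp
      have Um: "U i \<in> borel_measurable borel" and U0: "0 \<le> U i s" and inc: "incseq U"
        and IH: "bounded_borel (U i) \<longrightarrow> \<Lambda> (U i) = \<Lambda>' (U i)" for i s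
        using seq by auto
      have Ule: "U i s \<le> g s" for i s
        using inc by (intro incseq_le[OF _ lim]) (auto simp: incseq_def le_fun_def)
      then have b: "\<bar>U i s\<bar> \<le> K" for i s using U0[of i s] K[of s] Ule[of i s]
        by linarith
      then have "\<Lambda> (U i) = \<Lambda>' (U i)" for i using IH Um bounded_borelI[of "U i" K] by blast
      moreover have "(\<lambda>i. \<Lambda> (U i)) \<longlonglongrightarrow> \<Lambda> g" by (rule measure_like_limD[OF L Um b lim])
      moreover have "(\<lambda>i. \<Lambda>' (U i)) \<longlonglongrightarrow> \<Lambda>' g" by (rule measure_like_limD[OF L' Um b lim])
      ultimately show "\<Lambda> g = \<Lambda>' g" using LIMSEQ_unique by auto
    qed
  qed
  let ?p = "\<lambda>s. max (f s) 0" and ?m = "\<lambda>s. max (- f s) 0"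
  obtain K where K: "\<And>s. \<bar>f s\<bar> \<le> K" using f by (auto simp: bounded_borel_def)
  have fm [measurable]: "f \<in> borel_measurable borel" using f by (simp add: bounded_borel_def)
  have K0: "0 \<le> K" using K[of 0] by linarith
  have bp: "bounded_borel ?p"
  proof (rule bounded_borelI[of _ K])
    show "\<bar>?p s\<bar> \<le> K" for s using K[of s] K0 by linarith
  qed measurable
  have bm: "bounded_borel ?m"
  proof (rule bounded_borelI[of _ K])
    show "\<bar>?m s\<bar> \<le> K" for s using K[of s] K0 by linarith
  qed measurable
  have eq: "f = (\<lambda>s. ?p s + (-1) * ?m s)" by (auto simp: fun_eq_iff max_def)
  have "M f = M ?p + of_real (-1) * M ?m" if "measure_like M" for M :: "(real \<Rightarrow> real) \<Rightarrow> complex"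
  proof -
    have "M (\<lambda>s. ?p s + (-1) * ?m s) = M ?p + M (\<lambda>s. (-1) * ?m s)"
      by (rule measure_like_addD[OF that bp]) (intro bounded_borel_mult bm bounded_borel_const)
    also have "M (\<lambda>s. (-1) * ?m s) = of_real (-1) * M ?m" by (rule measure_like_scaleD[OF that bm])
    finally show ?thesis using eq by simp
  qed
  from this[OF L] this[OF L'] show ?thesis using pos[of ?p] pos[of ?m] bp bm by simp
qed

locale pvm =
  fixes \<sigma> :: "'a measure" and E :: "real set \<Rightarrow> 'a fn \<Rightarrow> 'a fn"
  assumes pvm: "projection_valued_measure \<sigma> E"
begin

abbreviation "\<H> \<equiv> Lp \<sigma> 2 :: 'a fn set"
abbreviation "ip \<equiv> L2_inner \<sigma>"
abbreviation "nrm \<equiv> L2.nrm \<sigma>"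
abbreviation "\<mu> \<equiv> scalar_measure \<sigma> E"

lemma E_mem [simp]: "B \<in> sets borel \<Longrightarrow> u \<in> \<H> \<Longrightarrow> E B u \<in> \<H>"
  using pvm by (simp add: projection_valued_measure_def)

lemma E_sym: "B \<in> sets borel \<Longrightarrow> u \<in> \<H> \<Longrightarrow> v \<in> \<H> \<Longrightarrow> ip (E B u) v = ip u (E B v)"
  using pvm by (simp add: projection_valued_measure_def)

lemma E_E: "B \<in> sets borel \<Longrightarrow> C \<in> sets borel \<Longrightarrow> u \<in> \<H> \<Longrightarrow> v \<in> \<H> \<Longrightarrow>
    ip (E B (E C u)) v = ip (E (B \<inter> C) u) v"
  using pvm unfolding projection_valued_measure_def
  by (intro L2_inner_cong_AE Lp_measurable[where p=2] E_mem) (auto intro!: Lp_measurable[where p=2] E_mem)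

lemma E_UNIV: "u \<in> \<H> \<Longrightarrow> v \<in> \<H> \<Longrightarrow> ip (E UNIV u) v = ip u v"
  using pvm unfolding projection_valued_measure_def
  by (intro L2_inner_cong_AE Lp_measurable[where p=2] E_mem) (auto intro!: Lp_measurable[where p=2] E_mem)

lemma E_ip_E: "B \<in> sets borel \<Longrightarrow> C \<in> sets borel \<Longrightarrow> u \<in> \<H> \<Longrightarrow> v \<in> \<H> \<Longrightarrow>
    ip (E B u) (E C v) = ip (E (B \<inter> C) u) v"
  using E_sym[of C "E B u" v] E_E[of C B u v] by (simp add: Int_commute)

lemma E_add: "B \<in> sets borel \<Longrightarrow> u \<in> \<H> \<Longrightarrow> v \<in> \<H> \<Longrightarrow> w \<in> \<H> \<Longrightarrow>
    ip (E B (u + v)) w = ip (E B u) w + ip (E B v) w"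
  by (simp add: E_sym L2.ip_add_left)

lemma E_scale: "B \<in> sets borel \<Longrightarrow> u \<in> \<H> \<Longrightarrow> w \<in> \<H> \<Longrightarrow>
    ip (E B (fscale c u)) w = c * ip (E B u) w"
  by (simp add: E_sym L2.ip_scale_left)

lemma E_self: "B \<in> sets borel \<Longrightarrow> u \<in> \<H> \<Longrightarrow> ip (E B u) u = of_real ((nrm (E B u))\<^sup>2)"
  using E_ip_E[of B B u u] L2.ip_self[of "E B u" \<sigma>] by simp

lemma E_sums:
  assumes "range B \<subseteq> sets borel" "disjoint_family B" "u \<in> \<H>"
  shows "(\<lambda>i. (nrm (E (B i) u))\<^sup>2) sums (nrm (E (\<Union>i. B i) u))\<^sup>2"
proof -
  have "(\<lambda>i. ip (E (B i) u) u) sums ip (E (\<Union>i. B i) u) u"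
    using pvm assms unfolding projection_valued_measure_def by blast
  moreover have "B i \<in> sets borel" for i using assms by auto
  ultimately have "(\<lambda>i. complex_of_real ((nrm (E (B i) u))\<^sup>2)) sums of_real ((nrm (E (\<Union>i. B i) u))\<^sup>2)"
    using assms(3) by (simp add: E_self del: of_real_power)
  then show ?thesis by (simp only: sums_of_real_iff)
qed

lemma E_empty: "u \<in> \<H> \<Longrightarrow> nrm (E {} u) = 0"
proof -
  assume u: "u \<in> \<H>"
  have "(\<lambda>i::nat. (nrm (E {} u))\<^sup>2) sums (nrm (E {} u))\<^sup>2"
    using E_sums[of "\<lambda>_. {}" u] u by (simp add: disjoint_family_on_def)
  then have "(\<lambda>i::nat. (nrm (E {} u))\<^sup>2) \<longlonglongrightarrow> 0" by (intro summable_LIMSEQ_zero sums_summable)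
  then show ?thesis by (simp add: LIMSEQ_const_iff)
qed

lemma sets_\<mu> [simp, measurable_cong]: "sets (\<mu> u) = sets borel"
  unfolding scalar_measure_def
  using sets.sigma_sets_eq[of "borel :: real measure"] by (subst sets_measure_of) auto

lemma space_\<mu> [simp]: "space (\<mu> u) = UNIV"
  using sets_eq_imp_space_eq[OF sets_\<mu>[of u]] by simp

lemma measurable_\<mu> [simp]: "measurable (\<mu> u) M = measurable borel M"
  by (rule measurable_cong_sets) auto

lemma emeasure_\<mu>:
  assumes u: "u \<in> \<H>" and B: "B \<in> sets borel"
  shows "emeasure (\<mu> u) B = ennreal ((nrm (E B u))\<^sup>2)"
proof -
  have ss: "sigma_sets UNIV (sets borel) = sets (borel :: real measure)"
    using sets.sigma_sets_eq[of "borel :: real measure"] by simp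
  have e: "Re (ip (E C u) u) = (nrm (E C u))\<^sup>2" if "C \<in> sets borel" for C
    using E_self[OF that u] by (simp only: Re_complex_of_real)
  have "emeasure (\<mu> u) B = ennreal (Re (ip (E B u) u))"
  proof (rule emeasure_measure_of[OF scalar_measure_def])
    show "positive (sets (\<mu> u)) (\<lambda>B. ennreal (Re (ip (E B u) u)))"
      using E_empty[OF u] by (simp add: positive_def e)
    show "countably_additive (sets (\<mu> u)) (\<lambda>B. ennreal (Re (ip (E B u) u)))"
    proof (rule countably_additiveI)
      fix A :: "nat \<Rightarrow> real set"
      assume A: "range A \<subseteq> sets (\<mu> u)" "disjoint_family A" "\<Union> (range A) \<in> sets (\<mu> u)"
      have Ai: "A i \<in> sets borel" for i using A by auto
      have s: "(\<lambda>i. (nrm (E (A i) u))\<^sup>2) sums (nrm (E (\<Union>i. A i) u))\<^sup>2"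
        using A u by (intro E_sums) auto
      have "(\<Sum>i. ennreal ((nrm (E (A i) u))\<^sup>2)) = ennreal ((nrm (E (\<Union>i. A i) u))\<^sup>2)"
        by (rule suminf_ennreal_eq[OF _ s]) simp
      then show "(\<Sum>i. ennreal (Re (ip (E (A i) u) u))) = ennreal (Re (ip (E (\<Union> (range A)) u) u))"
        using A(3) by (simp only: e[OF Ai] e[OF A(3)[unfolded sets_\<mu>]])
    qed
  qed (use B in auto)
  then show ?thesis by (simp only: e[OF B])
qed

lemma finite_\<mu> [simp]: "u \<in> \<H> \<Longrightarrow> finite_measure (\<mu> u)"
  by (rule finite_measureI) (simp add: emeasure_\<mu>)

lemma measure_\<mu>: "u \<in> \<H> \<Longrightarrow> B \<in> sets borel \<Longrightarrow> measure (\<mu> u) B = (nrm (E B u))\<^sup>2"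
  by (simp add: measure_def emeasure_\<mu>)

lemma measure_\<mu>_UNIV: "u \<in> \<H> \<Longrightarrow> measure (\<mu> u) UNIV = (nrm u)\<^sup>2"
proof -
  assume u: "u \<in> \<H>"
  have "complex_of_real ((nrm (E UNIV u))\<^sup>2) = of_real ((nrm u)\<^sup>2)"
    using E_self[of UNIV u] E_UNIV[OF u u] L2.ip_self[OF u] u by (simp del: of_real_power)
  then have "(nrm (E UNIV u))\<^sup>2 = (nrm u)\<^sup>2" by (simp only: of_real_eq_iff)
  then show ?thesis using measure_\<mu>[OF u, of UNIV] by simp
qed

lemma integrable_\<mu>:
  "u \<in> \<H> \<Longrightarrow> bounded_borel f \<Longrightarrow> integrable (\<mu> u) f"
proof -
  assume u: "u \<in> \<H>" and "bounded_borel f"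
  then obtain K where K: "f \<in> borel_measurable borel" "\<And>s. \<bar>f s\<bar> \<le> K" by (auto simp: bounded_borel_def)
  show "integrable (\<mu> u) f"
    by (rule finite_measure.integrable_const_bound[OF finite_\<mu>[OF u], of _ K])
      (use K in \<open>auto simp: measurable_cong_sets[OF sets_\<mu> refl]\<close>)
qed

lemma integral_\<mu>_const: "u \<in> \<H> \<Longrightarrow> (LINT s|\<mu> u. c) = c * (nrm u)\<^sup>2"
  by (simp add: measure_\<mu>_UNIV)

text \<open>The polarised integral \<open>\<integral> f d\<langle>E u, w\<rangle>\<close>.\<close>

definition SI :: "(real \<Rightarrow> real) \<Rightarrow> 'a fn \<Rightarrow> 'a fn \<Rightarrow> complex"
  where "SI f u w = (\<Sum>k<4. \<i> ^ k * of_real (LINT s|\<mu> (\<lambda>x. u x + \<i> ^ k * w x). f s)) / 4"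

lemma polar_arg: "(\<lambda>x. u x + c * w x) = u + fscale c w"
  by (simp add: fun_eq_iff)

lemma measure_like_integral: "u \<in> \<H> \<Longrightarrow> measure_like (\<lambda>f. of_real (LINT s|\<mu> u. f s))"
  unfolding measure_like_def
proof (intro conjI allI impI)
  fix F :: "nat \<Rightarrow> real \<Rightarrow> real" and f K
  assume u: "u \<in> \<H>" and F: "\<forall>n. F n \<in> borel_measurable borel" "\<forall>n s. \<bar>F n s\<bar> \<le> K" "\<forall>s. (\<lambda>n. F n s) \<longlonglongrightarrow> f s"
  have "f \<in> borel_measurable borel" using F by (intro borel_measurable_LIMSEQ_real[of _ F f]) auto
  then have "(\<lambda>n. LINT s|\<mu> u. F n s) \<longlonglongrightarrow> (LINT s|\<mu> u. f s)"
    using F by (intro integral_dominated_convergence[where w="\<lambda>_. K"])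
      (auto intro!: integrable_\<mu> u)
  then show "(\<lambda>n. complex_of_real (LINT s|\<mu> u. F n s)) \<longlonglongrightarrow> of_real (LINT s|\<mu> u. f s)"
    by (rule tendsto_of_real)
qed (auto simp: integrable_\<mu> Bochner_Integration.integral_add)

lemma measure_like_SI:
  assumes "u \<in> \<H>" "w \<in> \<H>" shows "measure_like (\<lambda>f. SI f u w)"
proof -
  have m: "measure_like (\<lambda>f. \<i> ^ k * of_real (LINT s|\<mu> (\<lambda>x. u x + \<i> ^ k * w x). f s))" for k
    using assms by (intro measure_like_mult measure_like_integral) (simp add: polar_arg)
  have "measure_like (\<lambda>f. (1/4) * (\<Sum>k<4. \<i> ^ k * of_real (LINT s|\<mu> (\<lambda>x. u x + \<i> ^ k * w x). f s)))"
    using measure_like_mult[OF measure_like_plus[OF measure_like_plus[OF measure_like_plus[OF m[of 0] m[of 1]] m[of 2]] m[of 3]], of "1/4"]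
    by (simp add: numeral_eq_Suc)
  then show ?thesis unfolding SI_def by simp
qed

text \<open>Polarisation recovers \<open>\<langle>E B u, w\<rangle>\<close>.  Together with \<open>measure_like_ext\<close> this extends identities between
  projections to bounded functions.\<close>

lemma SI_indicator:
  assumes B: "B \<in> sets borel" and u: "u \<in> \<H>" and w: "w \<in> \<H>"
  shows "SI (indicator B) u w = ip (E B u) w"
proof -
  have "complex_of_real (LINT s|\<mu> (\<lambda>x. u x + c * w x). indicator B s)
      = ip (E B u) u + cnj c * ip (E B u) w + c * ip (E B w) u + c * cnj c * ip (E B w) w" for c
  proof -
    let ?z = "u + fscale c w"
    have "complex_of_real (LINT s|\<mu> (\<lambda>x. u x + c * w x). indicator B s) = ip (E B ?z) ?z"
      using B u w by (simp add: polar_arg measure_\<mu> E_self)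
    also have "\<dots> = ip (E B u) ?z + c * ip (E B w) ?z" using B u w by (simp add: E_add E_scale)
    also have "\<dots> = ip (E B u) u + cnj c * ip (E B u) w + c * ip (E B w) u + c * cnj c * ip (E B w) w"
      using B u w by (simp add: L2.ip_add_right L2.ip_scale_right algebra_simps)
    finally show ?thesis .
  qed
  then have "SI (indicator B) u w = (\<Sum>k<4. \<i> ^ k * (ip (E B u) u + cnj (\<i> ^ k) * ip (E B u) w
      + \<i> ^ k * ip (E B w) u + \<i> ^ k * cnj (\<i> ^ k) * ip (E B w) w)) / 4"
    unfolding SI_def by (simp only:)
  also have "\<dots> = ip (E B u) w"
    by (simp add: numeral_eq_Suc lessThan_Suc algebra_simps)
  finally show ?thesis .
qed

lemma SI_add_left: "bounded_borel f \<Longrightarrow> u \<in> \<H> \<Longrightarrow> v \<in> \<H> \<Longrightarrow> w \<in> \<H> \<Longrightarrow> SI f (u + v) w = SI f u w + SI f v w"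
  by (rule measure_like_ext[of "\<lambda>f. SI f (u + v) w" "\<lambda>f. SI f u w + SI f v w"])
    (auto intro!: measure_like_SI measure_like_plus simp: SI_indicator E_add)

lemma SI_scale_left: "bounded_borel f \<Longrightarrow> u \<in> \<H> \<Longrightarrow> w \<in> \<H> \<Longrightarrow> SI f (fscale c u) w = c * SI f u w"
  by (rule measure_like_ext[of "\<lambda>f. SI f (fscale c u) w" "\<lambda>f. c * SI f u w"])
    (auto intro!: measure_like_SI measure_like_mult simp: SI_indicator E_scale)

lemma SI_commute: "bounded_borel f \<Longrightarrow> u \<in> \<H> \<Longrightarrow> w \<in> \<H> \<Longrightarrow> SI f w u = cnj (SI f u w)"
proof (rule measure_like_ext[of "\<lambda>f. SI f w u" "\<lambda>f. cnj (SI f u w)"])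
  fix B :: "real set" assume "u \<in> \<H>" "w \<in> \<H>" "B \<in> sets borel"
  then show "SI (indicator B) w u = cnj (SI (indicator B) u w)"
    using L2.ip_commute[of u \<sigma> "E B w"] by (simp add: SI_indicator E_sym)
qed (auto intro!: measure_like_SI measure_like_cnj)

lemma SI_self: "bounded_borel f \<Longrightarrow> u \<in> \<H> \<Longrightarrow> SI f u u = of_real (LINT s|\<mu> u. f s)"
  by (rule measure_like_ext[of "\<lambda>f. SI f u u" "\<lambda>f. of_real (LINT s|\<mu> u. f s)"])
    (auto intro!: measure_like_SI measure_like_integral simp: SI_indicator E_self measure_\<mu>)

lemma SI_one: "u \<in> \<H> \<Longrightarrow> w \<in> \<H> \<Longrightarrow> SI (\<lambda>_. 1) u w = ip u w"
  using SI_indicator[of UNIV u w] E_UNIV[of u w] by (simp add: indicator_def)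

lemma SI_add: "bounded_borel f \<Longrightarrow> bounded_borel g \<Longrightarrow> u \<in> \<H> \<Longrightarrow> w \<in> \<H> \<Longrightarrow>
    SI (\<lambda>s. f s + g s) u w = SI f u w + SI g u w"
  using measure_like_addD[OF measure_like_SI] by simp

lemma SI_scale: "bounded_borel f \<Longrightarrow> u \<in> \<H> \<Longrightarrow> w \<in> \<H> \<Longrightarrow> SI (\<lambda>s. c * f s) u w = of_real c * SI f u w"
  using measure_like_scaleD[OF measure_like_SI] by simp

lemma sip_SI: 
  assumes f: "bounded_borel f" "\<And>s. 0 \<le> f s" shows "sip fscale \<H> (SI f)"
proof -
  interpret vector_space "fscale :: complex \<Rightarrow> 'a fn \<Rightarrow> 'a fn" by (rule vector_space_fscale)
  show ?thesis
    by unfold_locales (auto simp: SI_add_left SI_scale_left SI_self f Bochner_Integration.integral_nonneg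
        intro!: SI_commute f)
qed

lemma integral_\<mu>_le:
  assumes "bounded_borel f" "\<And>s. f s \<le> K" "u \<in> \<H>"
  shows "(LINT s|\<mu> u. f s) \<le> K * (nrm u)\<^sup>2"
  using integral_mono[of "\<mu> u" f "\<lambda>_. K"] assms by (simp add: integrable_\<mu> integral_\<mu>_const del: Bochner_Integration.lebesgue_integral_const)

text \<open>With \<open>\<bar>f\<bar> \<le> K\<close>, the form of \<open>f + K\<close> is a semi-inner product that is at most \<open>2 K\<close> times the inner product of
  \<open>L\<^sup>2\<close>, so the Cauchy--Schwarz inequality applies to it.\<close>

lemma SI_bound:
  assumes f: "bounded_borel f"
  shows "\<exists>K. \<forall>u\<in>\<H>. \<forall>w\<in>\<H>. cmod (SI f u w) \<le> K * nrm u * nrm w"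
proof -
  obtain K where K: "\<And>s. \<bar>f s\<bar> \<le> K" using f by (auto simp: bounded_borel_def)
  have K0: "0 \<le> K" using K[of 0] by linarith
  let ?g = "\<lambda>s. f s + K"
  have g: "bounded_borel ?g" using f by simp
  have g0: "0 \<le> ?g s" for s using K[of s] by linarith
  interpret G: sip fscale \<H> "SI ?g" by (rule sip_SI[OF g g0])
  have Gn: "G.nrm u \<le> sqrt (2 * K) * nrm u" if u: "u \<in> \<H>" for u
  proof -
    have "(G.nrm u)\<^sup>2 \<le> (2 * K) * (nrm u)\<^sup>2"
      unfolding G.nrm_sq[OF u] SI_self[OF g u] Re_complex_of_real
    proof (rule integral_\<mu>_le[OF g _ u])
      show "f s + K \<le> 2 * K" for s using K[of s] by linarith
    qed
    then have "sqrt ((G.nrm u)\<^sup>2) \<le> sqrt ((2 * K) * (nrm u)\<^sup>2)" by (simp only: real_sqrt_le_iff)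
    then show ?thesis using u by (simp add: real_sqrt_mult)
  qed
  have "cmod (SI f u w) \<le> (3 * K) * nrm u * nrm w" if u: "u \<in> \<H>" and w: "w \<in> \<H>" for u w
  proof -
    have "SI ?g u w = SI f u w + SI (\<lambda>_. K * 1) u w" using f u w SI_add[of f "\<lambda>_. K"] by simp
    then have "SI f u w = SI ?g u w - of_real K * ip u w"
      using SI_scale[of "\<lambda>_. 1" u w K] u w by (simp add: SI_one)
    then have "cmod (SI f u w) \<le> cmod (SI ?g u w) + K * cmod (ip u w)"
      using norm_triangle_ineq4[of "SI ?g u w" "of_real K * ip u w"] K0 by (simp add: norm_mult)
    also have "\<dots> \<le> (sqrt (2 * K) * nrm u) * (sqrt (2 * K) * nrm w) + K * (nrm u * nrm w)"
      using G.cauchy_schwarz[OF u w] L2.cauchy_schwarz[OF u w] K0 u w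
      by (intro add_mono order_trans[OF G.cauchy_schwarz[OF u w]] mult_mono Gn mult_left_mono) auto
    also have "\<dots> = (3 * K) * nrm u * nrm w" using K0 by (simp add: algebra_simps)
    finally show ?thesis .
  qed
  then show ?thesis by blast
qed

text \<open>The operator \<open>f(A)\<close> for bounded \<open>f\<close>.  The choice is unique up to null sets.\<close>

definition \<Phi> :: "(real \<Rightarrow> real) \<Rightarrow> 'a fn \<Rightarrow> 'a fn"
  where "\<Phi> f u = (SOME y. y \<in> \<H> \<and> (\<forall>w\<in>\<H>. ip y w = SI f u w))"

lemma \<Phi>_ex:
  assumes f: "bounded_borel f" and u: "u \<in> \<H>"
  shows "\<exists>y\<in>\<H>. \<forall>w\<in>\<H>. ip y w = SI f u w"
proof -
  obtain K where K: "\<And>w. w \<in> \<H> \<Longrightarrow> cmod (SI f u w) \<le> K * nrm u * nrm w" using SI_bound[OF f] u by blast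
  have sw: "SI f u w = cnj (SI f w u)" if "w \<in> \<H>" for w using SI_commute[OF f that u] .
  show ?thesis
    by (rule L2.riesz_representation[OF _ _ K])
      (auto simp: sw SI_add_left SI_scale_left f u)
qed

lemma \<Phi>_mem [simp]: "bounded_borel f \<Longrightarrow> u \<in> \<H> \<Longrightarrow> \<Phi> f u \<in> \<H>"
  unfolding \<Phi>_def using someI_ex[of "\<lambda>y. y \<in> \<H> \<and> (\<forall>w\<in>\<H>. ip y w = SI f u w)"] \<Phi>_ex[of f u] by blast

lemma \<Phi>_ip: "bounded_borel f \<Longrightarrow> u \<in> \<H> \<Longrightarrow> w \<in> \<H> \<Longrightarrow> ip (\<Phi> f u) w = SI f u w"
  unfolding \<Phi>_def using someI_ex[of "\<lambda>y. y \<in> \<H> \<and> (\<forall>w\<in>\<H>. ip y w = SI f u w)"] \<Phi>_ex[of f u] by blast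

lemma SI_E_right:
  assumes "bounded_borel f" "B \<in> sets borel" "u \<in> \<H>" "w \<in> \<H>"
  shows "SI f u (E B w) = SI (\<lambda>s. f s * indicator B s) u w"
proof (rule measure_like_ext[of "\<lambda>f. SI f u (E B w)" "\<lambda>f. SI (\<lambda>s. f s * indicator B s) u w"])
  fix C :: "real set" assume C: "C \<in> sets borel"
  have "(\<lambda>s. indicator C s * indicator B s) = (indicator (C \<inter> B) :: real \<Rightarrow> real)"
    by (simp add: fun_eq_iff indicator_inter_arith)
  then show "SI (indicator C) u (E B w) = SI (\<lambda>s. indicator C s * indicator B s) u w"
    using assms C by (simp add: SI_indicator E_ip_E)
qed (use assms in \<open>auto intro!: measure_like_SI measure_like_weight[OF measure_like_SI]\<close>)

lemma SI_E_left:
  assumes "bounded_borel f" "B \<in> sets borel" "u \<in> \<H>" "w \<in> \<H>"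
  shows "SI f (E B u) w = SI (\<lambda>s. f s * indicator B s) u w"
proof -
  have "SI f (E B u) w = cnj (SI f w (E B u))" using assms by (intro SI_commute) auto
  also have "\<dots> = cnj (SI (\<lambda>s. f s * indicator B s) w u)" using assms by (simp add: SI_E_right)
  also have "\<dots> = SI (\<lambda>s. f s * indicator B s) u w" using assms by (intro SI_commute[symmetric]) auto
  finally show ?thesis .
qed

text \<open>Multiplicativity of the calculus, in the weak form that does not depend on the choice of representatives.\<close>

lemma SI_\<Phi>_left:
  assumes "bounded_borel f" "bounded_borel g" "u \<in> \<H>" "w \<in> \<H>"
  shows "SI f (\<Phi> g u) w = SI (\<lambda>s. f s * g s) u w"
proof (rule measure_like_ext[of "\<lambda>f. SI f (\<Phi> g u) w" "\<lambda>f. SI (\<lambda>s. f s * g s) u w"])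
  fix C :: "real set" assume C: "C \<in> sets borel"
  have "SI (indicator C) (\<Phi> g u) w = SI g u (E C w)"
    using assms C by (simp add: SI_indicator E_sym \<Phi>_ip)
  also have "\<dots> = SI (\<lambda>s. g s * indicator C s) u w" using assms C by (simp add: SI_E_right)
  finally show "SI (indicator C) (\<Phi> g u) w = SI (\<lambda>s. indicator C s * g s) u w" by (simp add: mult.commute)
qed (use assms in \<open>auto intro!: measure_like_SI measure_like_weight[OF measure_like_SI]\<close>)

lemma integral_\<mu>_\<Phi>:
  assumes "bounded_borel f" "bounded_borel g" "u \<in> \<H>"
  shows "(LINT s|\<mu> (\<Phi> g u). f s) = (LINT s|\<mu> u. f s * (g s)\<^sup>2)"
proof -
  have "complex_of_real (LINT s|\<mu> (\<Phi> g u). f s) = SI f (\<Phi> g u) (\<Phi> g u)"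
    using assms by (simp add: SI_self)
  also have "\<dots> = SI (\<lambda>s. f s * g s) u (\<Phi> g u)" using assms by (simp add: SI_\<Phi>_left)
  also have "\<dots> = cnj (SI (\<lambda>s. f s * g s) (\<Phi> g u) u)" using assms by (intro SI_commute) auto
  also have "\<dots> = cnj (SI (\<lambda>s. f s * g s * g s) u u)" using assms by (simp add: SI_\<Phi>_left)
  also have "\<dots> = of_real (LINT s|\<mu> u. f s * (g s)\<^sup>2)"
    using assms by (subst SI_self) (auto simp: power2_eq_square mult.assoc)
  finally show ?thesis by (simp only: of_real_eq_iff)
qed

lemma nrm_\<Phi>: "bounded_borel g \<Longrightarrow> u \<in> \<H> \<Longrightarrow> (nrm (\<Phi> g u))\<^sup>2 = (LINT s|\<mu> u. (g s)\<^sup>2)"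
  using integral_\<mu>_\<Phi>[of "\<lambda>_. 1" g u] integral_\<mu>_const[of "\<Phi> g u" 1] by simp

lemma integral_\<mu>_E:
  assumes "bounded_borel f" "B \<in> sets borel" "u \<in> \<H>"
  shows "(LINT s|\<mu> (E B u). f s) = (LINT s|\<mu> u. f s * indicator B s)"
proof -
  have "complex_of_real (LINT s|\<mu> (E B u). f s) = SI f (E B u) (E B u)"
    using assms by (simp add: SI_self)
  also have "\<dots> = SI (\<lambda>s. f s * indicator B s * indicator B s) u u"
    using assms by (simp add: SI_E_left SI_E_right)
  also have "\<dots> = of_real (LINT s|\<mu> u. f s * indicator B s)"
    using assms by (subst SI_self) (auto simp: mult.assoc indicator_inter_arith[symmetric])
  finally show ?thesis by (simp only: of_real_eq_iff)
qed

lemma measure_\<mu>_E: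
  "B \<in> sets borel \<Longrightarrow> C \<in> sets borel \<Longrightarrow> u \<in> \<H> \<Longrightarrow> measure (\<mu> (E B u)) C = measure (\<mu> u) (B \<inter> C)"
  using integral_\<mu>_E[of "indicator C" B u] by (simp add: indicator_inter_arith[symmetric] Int_commute)

end

section \<open>Unbounded functions and uniqueness of the spectral measure\<close>

text \<open>Cutting \<open>f\<close> off to 0, rather than to \<open>n\<close>, makes \<open>trunc f n\<close> equal to \<open>f\<close> times an indicator, which commutes with
  spectral projections.\<close>

definition trunc :: "(real \<Rightarrow> real) \<Rightarrow> nat \<Rightarrow> real \<Rightarrow> real"
  where "trunc f n s = (if \<bar>f s\<bar> \<le> real n then f s else 0)"

lemma bounded_borel_trunc [simp]:
  assumes "f \<in> borel_measurable borel" shows "bounded_borel (trunc f n)"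
proof (rule bounded_borelI[of _ "real n"])
  show "trunc f n \<in> borel_measurable borel" unfolding trunc_def using assms by measurable
qed (auto simp: trunc_def)

lemma trunc_tendsto: "(\<lambda>n. trunc f n s) \<longlonglongrightarrow> f s"
proof (rule tendsto_eventually)
  show "\<forall>\<^sub>F n in sequentially. trunc f n s = f s"
    using eventually_ge_at_top[of "nat \<lceil>\<bar>f s\<bar>\<rceil>"]
  proof eventually_elim
    case (elim n)
    then have "\<bar>f s\<bar> \<le> real n" by linarith
    then show ?case by (simp add: trunc_def)
  qed
qed

lemma abs_trunc_le: "\<bar>trunc f n s\<bar> \<le> \<bar>f s\<bar>"
  by (simp add: trunc_def)

context pvm begin

abbreviation dom :: "(real \<Rightarrow> real) \<Rightarrow> 'a fn set"
  where "dom f \<equiv> spectral_domain \<sigma> E f"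

abbreviation graph :: "(real \<Rightarrow> real) \<Rightarrow> 'a graph"
  where "graph f \<equiv> spectral_integral \<sigma> E f"

lemma dom_iff: "u \<in> dom f \<longleftrightarrow> u \<in> \<H> \<and> integrable (\<mu> u) (\<lambda>s. (f s)\<^sup>2)"
  by (simp add: spectral_domain_def)

lemma graph_iff: "(u, v) \<in> graph f \<longleftrightarrow> u \<in> dom f \<and> v \<in> \<H> \<and> (\<forall>w\<in>dom f. ip v w = SI f u w)"
  by (simp add: spectral_integral_def SI_def)

text \<open>By monotone convergence.  In this form, bounds proved within the bounded calculus show that a vector lies in
  the domain.\<close>

lemma dom_char:
  assumes f [measurable]: "f \<in> borel_measurable borel" and u: "u \<in> \<H>"
  shows "u \<in> dom f \<longleftrightarrow> (\<exists>C. \<forall>n. (LINT s|\<mu> u. (trunc f n s)\<^sup>2) \<le> C)"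
proof
  assume "u \<in> dom f"
  then have i: "integrable (\<mu> u) (\<lambda>s. (f s)\<^sup>2)" by (simp add: dom_iff)
  have "(LINT s|\<mu> u. (trunc f n s)\<^sup>2) \<le> (LINT s|\<mu> u. (f s)\<^sup>2)" for n
    by (intro integral_mono integrable_\<mu> u bounded_borel_power2 bounded_borel_trunc f i)
      (simp add: trunc_def)
  then show "\<exists>C. \<forall>n. (LINT s|\<mu> u. (trunc f n s)\<^sup>2) \<le> C" by blast
next
  assume "\<exists>C. \<forall>n. (LINT s|\<mu> u. (trunc f n s)\<^sup>2) \<le> C"
  then obtain C where C: "\<And>n. (LINT s|\<mu> u. (trunc f n s)\<^sup>2) \<le> C" by blast
  have mono: "(trunc f m s)\<^sup>2 \<le> (trunc f n s)\<^sup>2" if "m \<le> n" for m n s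
    using that by (auto simp: trunc_def)
  have i: "integrable (\<mu> u) (\<lambda>s. (trunc f n s)\<^sup>2)" for n
    by (intro integrable_\<mu> u bounded_borel_power2 bounded_borel_trunc f)
  have inc: "incseq (\<lambda>n. LINT s|\<mu> u. (trunc f n s)\<^sup>2)"
    by (intro incseq_def[THEN iffD2] allI impI integral_mono i mono)
  obtain L where L: "(\<lambda>n. LINT s|\<mu> u. (trunc f n s)\<^sup>2) \<longlonglongrightarrow> L"
    using incseq_convergent[OF inc, of C] C by blast
  have "integrable (\<mu> u) (\<lambda>s. (f s)\<^sup>2)"
  proof (rule integrable_monotone_convergence[OF i _ _ L])
    show "AE x in \<mu> u. mono (\<lambda>n. (trunc f n x)\<^sup>2)" by (intro AE_I2 monoI mono)
    show "AE x in \<mu> u. (\<lambda>i. (trunc f i x)\<^sup>2) \<longlonglongrightarrow> (f x)\<^sup>2"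
      by (intro AE_I2 tendsto_power trunc_tendsto)
  qed simp
  with u show "u \<in> dom f" by (simp add: dom_iff)
qed

lemma dom_subset: "u \<in> dom f \<Longrightarrow> u \<in> \<H>"
  by (simp add: dom_iff)

lemma dom_scale:
  assumes f: "f \<in> borel_measurable borel" and u: "u \<in> dom f"
  shows "fscale c u \<in> dom f"
proof -
  note uH = dom_subset[OF u]
  obtain C where C: "\<And>n. (LINT s|\<mu> u. (trunc f n s)\<^sup>2) \<le> C" using u uH dom_char[OF f uH] by blast
  have "(LINT s|\<mu> (fscale c u). (trunc f n s)\<^sup>2) \<le> (cmod c)\<^sup>2 * C" for n
  proof -
    interpret Q: sip fscale \<H> "SI (\<lambda>s. (trunc f n s)\<^sup>2)" by (rule sip_SI) (auto simp: f)
    have q: "(Q.nrm u)\<^sup>2 = (LINT s|\<mu> u. (trunc f n s)\<^sup>2)" if "u \<in> \<H>" for u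
      using that f by (simp add: Q.nrm_sq SI_self)
    have "(LINT s|\<mu> (fscale c u). (trunc f n s)\<^sup>2) = (cmod c)\<^sup>2 * (LINT s|\<mu> u. (trunc f n s)\<^sup>2)"
      using q[OF uH] q[of "fscale c u"] uH by (simp add: Q.nrm_scale power_mult_distrib)
    then show ?thesis using C[of n] by (simp only: mult_left_mono zero_le_power2)
  qed
  then show ?thesis using dom_char[OF f, of "fscale c u"] uH by auto
qed

lemma dom_add:
  assumes f: "f \<in> borel_measurable borel" and u: "u \<in> dom f" and v: "v \<in> dom f"
  shows "u + v \<in> dom f"
proof -
  note uH = dom_subset[OF u] and vH = dom_subset[OF v]
  obtain C D where C: "\<And>n. (LINT s|\<mu> u. (trunc f n s)\<^sup>2) \<le> C" and D: "\<And>n. (LINT s|\<mu> v. (trunc f n s)\<^sup>2) \<le> D"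
    using u v dom_char[OF f uH] dom_char[OF f vH] by blast
  have "(LINT s|\<mu> (u + v). (trunc f n s)\<^sup>2) \<le> 2 * C + 2 * D" for n
  proof -
    interpret Q: sip fscale \<H> "SI (\<lambda>s. (trunc f n s)\<^sup>2)" by (rule sip_SI) (auto simp: f)
    have q: "(Q.nrm u)\<^sup>2 = (LINT s|\<mu> u. (trunc f n s)\<^sup>2)" if "u \<in> \<H>" for u
      using that f by (simp add: Q.nrm_sq SI_self)
    have "(Q.nrm (u + v))\<^sup>2 \<le> 2 * (Q.nrm u)\<^sup>2 + 2 * (Q.nrm v)\<^sup>2"
      using Q.nrm_sq_parallelogram[OF uH vH] zero_le_power2[of "Q.nrm (u - v)"] by linarith
    then show ?thesis using q[OF uH] q[OF vH] q[of "u + v"] C[of n] D[of n] uH vH by simp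
  qed
  then show ?thesis using dom_char[OF f, of "u + v"] uH vH by auto
qed

lemma dom_polar:
  "f \<in> borel_measurable borel \<Longrightarrow> u \<in> dom f \<Longrightarrow> w \<in> dom f \<Longrightarrow> (\<lambda>x. u x + c * w x) \<in> dom f"
  unfolding polar_arg by (intro dom_add dom_scale)

lemma dom_integrable:
  assumes f [measurable]: "f \<in> borel_measurable borel" and u: "u \<in> dom f"
  shows "integrable (\<mu> u) f"
proof (rule Bochner_Integration.integrable_bound)
  show "integrable (\<mu> u) (\<lambda>s. 1 + (f s)\<^sup>2)"
    using u integrable_\<mu>[of u "\<lambda>_. 1"] unfolding dom_iff
    by (intro Bochner_Integration.integrable_add) auto
  show "AE s in \<mu> u. norm (f s) \<le> norm (1 + (f s)\<^sup>2)"
  proof (rule AE_I2)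
    fix s
    have "0 \<le> (\<bar>f s\<bar> - 1)\<^sup>2" by simp
    then have "2 * \<bar>f s\<bar> \<le> 1 + (f s)\<^sup>2" by (simp add: power2_diff)
    then show "norm (f s) \<le> norm (1 + (f s)\<^sup>2)" by simp
  qed
qed simp

lemma integral_trunc_tendsto:
  assumes f [measurable]: "f \<in> borel_measurable borel" and u: "u \<in> dom f"
  shows "(\<lambda>n. LINT s|\<mu> u. trunc f n s) \<longlonglongrightarrow> (LINT s|\<mu> u. f s)"
proof (rule integral_dominated_convergence[where w="\<lambda>s. \<bar>f s\<bar>"])
  show "integrable (\<mu> u) (\<lambda>s. \<bar>f s\<bar>)" using dom_integrable[OF f u] by simp
  show "AE s in \<mu> u. (\<lambda>n. trunc f n s) \<longlonglongrightarrow> f s" using trunc_tendsto by simp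
  show "AE s in \<mu> u. norm (trunc f n s) \<le> \<bar>f s\<bar>" for n using abs_trunc_le by simp
qed (use f bounded_borel_measurable[OF bounded_borel_trunc[OF f]] in simp_all)

lemma SI_trunc_tendsto:
  assumes f: "f \<in> borel_measurable borel" and u: "u \<in> dom f" and w: "w \<in> dom f"
  shows "(\<lambda>n. SI (trunc f n) u w) \<longlonglongrightarrow> SI f u w"
  unfolding SI_def
  by (intro tendsto_divide tendsto_sum tendsto_mult tendsto_of_real tendsto_const
      integral_trunc_tendsto f dom_polar u w) simp

lemma SI_self_dom:
  assumes f: "f \<in> borel_measurable borel" and u: "u \<in> dom f"
  shows "SI f u u = of_real (LINT s|\<mu> u. f s)"
proof (rule LIMSEQ_unique[OF SI_trunc_tendsto[OF f u u]])
  have "SI (trunc f n) u u = of_real (LINT s|\<mu> u. trunc f n s)" for n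
    using f dom_subset[OF u] by (simp add: SI_self)
  then show "(\<lambda>n. SI (trunc f n) u u) \<longlonglongrightarrow> of_real (LINT s|\<mu> u. f s)"
    using tendsto_of_real[OF integral_trunc_tendsto[OF f u]] by simp
qed

text \<open>On vectors whose scalar measure lives on a set where \<open>f\<close> is bounded, \<open>f(A)\<close> reduces to the bounded
  calculus.\<close>

lemma AE_\<mu>_supp: "u \<in> \<H> \<Longrightarrow> B \<in> sets borel \<Longrightarrow> measure (\<mu> u) (- B) = 0 \<Longrightarrow> AE s in \<mu> u. s \<in> B"
  by (rule AE_I[of _ _ "- B"]) (auto simp: finite_measure.emeasure_eq_measure)

lemma dom_supp:
  assumes f: "f \<in> borel_measurable borel" and B: "B \<in> sets borel" "\<And>s. s \<in> B \<Longrightarrow> \<bar>f s\<bar> \<le> K"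
    and u: "u \<in> \<H>" "measure (\<mu> u) (- B) = 0"
  shows "u \<in> dom f"
  unfolding dom_iff
proof
  show "integrable (\<mu> u) (\<lambda>s. (f s)\<^sup>2)"
  proof (rule finite_measure.integrable_const_bound[OF finite_\<mu>[OF u(1)], of _ "K\<^sup>2"])
    show "AE s in \<mu> u. norm ((f s)\<^sup>2) \<le> K\<^sup>2"
      using AE_\<mu>_supp[OF u(1) B(1) u(2)]
    proof eventually_elim
      case (elim s)
      then have "\<bar>f s\<bar>\<^sup>2 \<le> K\<^sup>2" using B(2) by (intro power_mono) auto
      then show ?case by simp
    qed
  qed (use f in simp)
qed (rule u(1))

lemma dom_E:
  assumes "f \<in> borel_measurable borel" "B \<in> sets borel" "\<And>s. s \<in> B \<Longrightarrow> \<bar>f s\<bar> \<le> K" "u \<in> \<H>"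
  shows "E B u \<in> dom f"
  by (rule dom_supp[OF assms(1-3)]) (use assms in \<open>auto simp: measure_\<mu>_E\<close>)

lemma SI_supp:
  assumes g: "bounded_borel g" and B: "B \<in> sets borel" and u: "u \<in> \<H>" "measure (\<mu> u) (- B) = 0"
    and w: "w \<in> \<H>"
  shows "SI g u w = SI (\<lambda>s. g s * indicator B s) u w"
proof -
  have cB: "- B \<in> sets borel" using B by simp
  obtain K where K: "\<And>u w. u \<in> \<H> \<Longrightarrow> w \<in> \<H> \<Longrightarrow> cmod (SI g u w) \<le> K * nrm u * nrm w"
    using SI_bound[OF g] by blast
  have "nrm (E (- B) u) = 0" using measure_\<mu>[OF u(1) cB] u(2) by simp
  then have "SI g (E (- B) u) w = 0" using K[of "E (- B) u" w] u cB w by simp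
  then have z: "SI (\<lambda>s. g s * indicator (- B) s) u w = 0" using SI_E_left[OF g cB u(1) w] by simp
  have "SI (\<lambda>s. g s * indicator B s + g s * indicator (- B) s) u w
      = SI (\<lambda>s. g s * indicator B s) u w + SI (\<lambda>s. g s * indicator (- B) s) u w"
    using g B u w by (intro SI_add) auto
  moreover have "(\<lambda>s. g s * indicator B s + g s * indicator (- B) s) = g"
    by (auto simp: fun_eq_iff indicator_def)
  ultimately show ?thesis using z by simp
qed

lemma bounded_borel_on:
  assumes "f \<in> borel_measurable borel" "B \<in> sets borel" "\<And>s. s \<in> B \<Longrightarrow> \<bar>f s\<bar> \<le> K"
  shows "bounded_borel (\<lambda>s. f s * indicator B s)"
proof (rule bounded_borelI[of _ "\<bar>K\<bar>"])
  show "\<bar>f s * indicator B s\<bar> \<le> \<bar>K\<bar>" for s using assms(3)[of s] by (auto simp: indicator_def)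
qed (use assms in auto)

lemma SI_trunc_indicator:
  assumes "\<And>s. s \<in> B \<Longrightarrow> \<bar>f s\<bar> \<le> K"
  shows "(\<lambda>n. SI (\<lambda>s. trunc f n s * indicator B s) u w) \<longlonglongrightarrow> SI (\<lambda>s. f s * indicator B s) u w"
proof (rule tendsto_eventually)
  show "\<forall>\<^sub>F n in sequentially. SI (\<lambda>s. trunc f n s * indicator B s) u w = SI (\<lambda>s. f s * indicator B s) u w"
    using eventually_ge_at_top[of "nat \<lceil>K\<rceil>"]
  proof eventually_elim
    case (elim n)
    have "(\<lambda>s. trunc f n s * indicator B s) = (\<lambda>s. f s * indicator B s)"
    proof
      fix s
      have "\<bar>f s\<bar> \<le> real n" if "s \<in> B" using assms[OF that] elim by linarith
      then show "trunc f n s * indicator B s = f s * indicator B s"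
        by (auto simp: trunc_def indicator_def)
    qed
    then show ?case by simp
  qed
qed

lemma graph_supp:
  assumes f: "f \<in> borel_measurable borel" and B: "B \<in> sets borel" "\<And>s. s \<in> B \<Longrightarrow> \<bar>f s\<bar> \<le> K"
    and u: "u \<in> \<H>" "measure (\<mu> u) (- B) = 0"
  shows "(u, \<Phi> (\<lambda>s. f s * indicator B s) u) \<in> graph f"
proof -
  have bb: "bounded_borel (\<lambda>s. f s * indicator B s)" by (rule bounded_borel_on[OF f B])
  have ud: "u \<in> dom f" by (rule dom_supp[OF f B u])
  have "SI f u w = SI (\<lambda>s. f s * indicator B s) u w" if w: "w \<in> dom f" for w
  proof (rule LIMSEQ_unique[OF SI_trunc_tendsto[OF f ud w]])
    have "SI (trunc f n) u w = SI (\<lambda>s. trunc f n s * indicator B s) u w" for n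
      using SI_supp[OF _ B(1) u dom_subset[OF w]] f by simp
    then show "(\<lambda>n. SI (trunc f n) u w) \<longlonglongrightarrow> SI (\<lambda>s. f s * indicator B s) u w"
      using SI_trunc_indicator[where f=f and K=K, OF B(2)] by simp
  qed
  then show ?thesis using bb ud u by (auto simp: graph_iff \<Phi>_ip dom_subset)
qed

text \<open>Membership in the graph of \<open>f\<close> is tested against vectors of the domain only.  Testing against vectors \<open>E B w\<close> for
  sets \<open>B\<close> on which \<open>f\<close> is bounded brings the bounded calculus back.\<close>

lemma graph_E:
  assumes f: "f \<in> borel_measurable borel" and uv: "(u, v) \<in> graph f"
    and B: "B \<in> sets borel" "\<And>s. s \<in> B \<Longrightarrow> \<bar>f s\<bar> \<le> K" and w: "w \<in> \<H>"
  shows "ip (E B v) w = SI (\<lambda>s. f s * indicator B s) u w"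
proof -
  have ud: "u \<in> dom f" and vH: "v \<in> \<H>" using uv by (auto simp: graph_iff)
  have wd: "E B w \<in> dom f" by (rule dom_E[OF f B w])
  have "ip (E B v) w = SI f u (E B w)" using uv wd vH w B by (simp add: graph_iff E_sym)
  also have "\<dots> = SI (\<lambda>s. f s * indicator B s) u w"
  proof (rule LIMSEQ_unique[OF SI_trunc_tendsto[OF f ud wd]])
    have "SI (trunc f n) u (E B w) = SI (\<lambda>s. trunc f n s * indicator B s) u w" for n
      using f B w dom_subset[OF ud] by (simp add: SI_E_right)
    then show "(\<lambda>n. SI (trunc f n) u (E B w)) \<longlonglongrightarrow> SI (\<lambda>s. f s * indicator B s) u w"
      using SI_trunc_indicator[where f=f and K=K, OF B(2)] by simp
  qed
  finally show ?thesis .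
qed

text \<open>\<open>\<parallel>E B f(A) u\<parallel>\<^sup>2 = \<integral>\<^sub>B f\<^sup>2 d\<mu>\<^sub>u\<close>: on \<open>B \<inter> {\<bar>f\<bar> \<le> n}\<close> this belongs to the bounded calculus, and both sides are
  continuous as \<open>n\<close> grows.\<close>

lemma graph_measure:
  assumes f: "f \<in> borel_measurable borel" and uv: "(u, v) \<in> graph f" and B: "B \<in> sets borel"
  shows "measure (\<mu> v) B = (LINT s|\<mu> u. (f s)\<^sup>2 * indicator B s)"
proof -
  have ud: "u \<in> dom f" and vH: "v \<in> \<H>" using uv by (auto simp: graph_iff)
  note uH = dom_subset[OF ud]
  note [measurable] = f
  define C where "C n = B \<inter> {s. \<bar>f s\<bar> \<le> real n}" for n :: nat
  have CB [measurable]: "C n \<in> sets borel" for n unfolding C_def using B by measurable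
  have bC: "\<bar>f s\<bar> \<le> real n" if "s \<in> C n" for s n using that by (simp add: C_def)
  have *: "measure (\<mu> v) (C n) = (LINT s|\<mu> u. (f s)\<^sup>2 * indicator (C n) s)" for n
  proof -
    have bb: "bounded_borel (\<lambda>s. f s * indicator (C n) s)" by (rule bounded_borel_on[OF f CB bC])
    have "nrm (E (C n) v) = nrm (\<Phi> (\<lambda>s. f s * indicator (C n) s) u)"
      using graph_E[OF f uv CB bC] bb vH uH by (intro L2.nrm_eq_if_weak) (auto simp: \<Phi>_ip)
    then have "measure (\<mu> v) (C n) = (LINT s|\<mu> u. (f s * indicator (C n) s)\<^sup>2)"
      using measure_\<mu>[OF vH CB] nrm_\<Phi>[OF bb uH] by simp
    also have "(\<lambda>s. (f s * indicator (C n) s)\<^sup>2) = (\<lambda>s. (f s)\<^sup>2 * indicator (C n) s)"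
      by (auto simp: fun_eq_iff indicator_def)
    finally show ?thesis .
  qed
  have UC: "(\<Union>n. C n) = B"
  proof -
    have "\<exists>n. \<bar>f s\<bar> \<le> real n" for s using real_arch_simple by blast
    then show ?thesis by (auto simp: C_def)
  qed
  interpret fm: finite_measure "\<mu> v" using vH by simp
  have "(\<lambda>n. measure (\<mu> v) (C n)) \<longlonglongrightarrow> measure (\<mu> v) (\<Union>n. C n)"
  proof (rule fm.finite_Lim_measure_incseq)
    show "range C \<subseteq> sets (\<mu> v)" using CB by auto
  qed (auto simp: C_def incseq_def)
  moreover have "(\<lambda>n. LINT s|\<mu> u. (f s)\<^sup>2 * indicator (C n) s) \<longlonglongrightarrow> (LINT s|\<mu> u. (f s)\<^sup>2 * indicator B s)"
  proof (rule integral_dominated_convergence[where w="\<lambda>s. (f s)\<^sup>2"])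
    show "integrable (\<mu> u) (\<lambda>s. (f s)\<^sup>2)" using ud by (simp add: dom_iff)
    show "AE s in \<mu> u. (\<lambda>n. (f s)\<^sup>2 * indicator (C n) s) \<longlonglongrightarrow> (f s)\<^sup>2 * indicator B s"
    proof (intro AE_I2 tendsto_mult tendsto_const)
      fix s
      have "incseq C" by (auto simp: C_def incseq_def)
      then have "(\<lambda>n. indicator (C n) s :: real) \<longlonglongrightarrow> indicator (\<Union>n. C n) s"
        by (rule LIMSEQ_indicator_incseq)
      then show "(\<lambda>n. indicator (C n) s :: real) \<longlonglongrightarrow> indicator B s" by (simp add: UC)
    qed
    show "AE s in \<mu> u. norm ((f s)\<^sup>2 * indicator (C n) s) \<le> (f s)\<^sup>2" for n
      by (intro AE_I2) (auto simp: indicator_def)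
  qed (use B in simp_all)
  ultimately show ?thesis unfolding * UC by (rule LIMSEQ_unique)
qed

lemma graph_nrm:
  assumes "f \<in> borel_measurable borel" "(u, v) \<in> graph f"
  shows "(nrm v)\<^sup>2 = (LINT s|\<mu> u. (f s)\<^sup>2)"
  using graph_measure[OF assms, of UNIV] assms(2) by (simp add: measure_\<mu>_UNIV graph_iff)

lemma SI_linear_dom:
  assumes f: "f \<in> borel_measurable borel" and u: "u \<in> dom f" and v: "v \<in> dom f" and w: "w \<in> dom f"
  shows "SI f (fscale c u + v) w = c * SI f u w + SI f v w"
proof (rule LIMSEQ_unique)
  show "(\<lambda>n. SI (trunc f n) (fscale c u + v) w) \<longlonglongrightarrow> SI f (fscale c u + v) w"
    by (intro SI_trunc_tendsto dom_add dom_scale f u v w)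
  have "SI (trunc f n) (fscale c u + v) w = c * SI (trunc f n) u w + SI (trunc f n) v w" for n
    using assms by (simp add: SI_add_left SI_scale_left dom_subset)
  then show "(\<lambda>n. SI (trunc f n) (fscale c u + v) w) \<longlonglongrightarrow> c * SI f u w + SI f v w"
    by (simp only:) (intro tendsto_intros SI_trunc_tendsto f u v w)
qed

lemma graph_linear:
  assumes f: "f \<in> borel_measurable borel" and a: "(u, u') \<in> graph f" and b: "(v, v') \<in> graph f"
  shows "(fscale c u + v, fscale c u' + v') \<in> graph f"
  using a b unfolding graph_iff
  by (auto simp: dom_add dom_scale f L2.ip_add_left L2.ip_scale_left dom_subset SI_linear_dom)

lemma graph_diff:
  assumes f: "f \<in> borel_measurable borel" and a: "(u, u') \<in> graph f" and b: "(v, v') \<in> graph f"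
  shows "(u - v, u' - v') \<in> graph f"
proof -
  have "fscale (-1) w + z = z - w" for w z :: "'a fn" by (simp add: fun_eq_iff)
  then show ?thesis using graph_linear[OF f b a, of "-1"] by simp
qed

lemma integral_\<mu>_null: "u \<in> \<H> \<Longrightarrow> nrm u = 0 \<Longrightarrow> (LINT s|\<mu> u. f s) = 0"
proof -
  assume u: "u \<in> \<H>" "nrm u = 0"
  have "emeasure (\<mu> u) (space (\<mu> u)) = 0"
    using finite_measure.emeasure_eq_measure[OF finite_\<mu>[OF u(1)], of UNIV] measure_\<mu>_UNIV[OF u(1)] u(2) by simp
  then have "AE s in \<mu> u. False" by (intro AE_I[of _ _ "space (\<mu> u)"]) auto
  then have "AE s in \<mu> u. f s = 0" by eventually_elim simp
  then show ?thesis by (rule integral_eq_zero_AE)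
qed

lemma graph_null:
  assumes f: "f \<in> borel_measurable borel" and uv: "(u, v) \<in> graph f" and "nrm u = 0"
  shows "nrm v = 0"
proof -
  have "u \<in> \<H>" using uv by (auto simp: graph_iff dom_subset)
  then show ?thesis using graph_nrm[OF f uv] integral_\<mu>_null[of u "\<lambda>s. (f s)\<^sup>2"] assms(3) by simp
qed

lemma dom_shift: "u \<in> dom (\<lambda>s. s) \<longleftrightarrow> u \<in> dom (\<lambda>s. s - m)"
proof -
  have "integrable (\<mu> u) (\<lambda>s. s\<^sup>2) \<longleftrightarrow> integrable (\<mu> u) (\<lambda>s. (s - m)\<^sup>2)" if u: "u \<in> \<H>"
  proof
    assume i: "integrable (\<mu> u) (\<lambda>s. s\<^sup>2)"
    show "integrable (\<mu> u) (\<lambda>s. (s - m)\<^sup>2)"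
    proof (rule Bochner_Integration.integrable_bound)
      show "integrable (\<mu> u) (\<lambda>s. 2 * s\<^sup>2 + 2 * m\<^sup>2)" using i integrable_\<mu>[OF u, of "\<lambda>_. 2 * m\<^sup>2"] by simp
      show "AE s in \<mu> u. norm ((s - m)\<^sup>2) \<le> norm (2 * s\<^sup>2 + 2 * m\<^sup>2)"
      proof (rule AE_I2)
        fix s :: real
        have "0 \<le> (s + m)\<^sup>2" by simp
        then have "(s - m)\<^sup>2 \<le> 2 * s\<^sup>2 + 2 * m\<^sup>2" by (simp add: power2_diff power2_sum)
        then show "norm ((s - m)\<^sup>2) \<le> norm (2 * s\<^sup>2 + 2 * m\<^sup>2)" by simp
      qed
    qed simp
  next
    assume i: "integrable (\<mu> u) (\<lambda>s. (s - m)\<^sup>2)"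
    show "integrable (\<mu> u) (\<lambda>s. s\<^sup>2)"
    proof (rule Bochner_Integration.integrable_bound)
      show "integrable (\<mu> u) (\<lambda>s. 2 * (s - m)\<^sup>2 + 2 * m\<^sup>2)"
        using i integrable_\<mu>[OF u, of "\<lambda>_. 2 * m\<^sup>2"] by simp
      show "AE s in \<mu> u. norm (s\<^sup>2) \<le> norm (2 * (s - m)\<^sup>2 + 2 * m\<^sup>2)"
      proof (rule AE_I2)
        fix s :: real
        have "0 \<le> (s - 2 * m)\<^sup>2" by simp
        then have "s\<^sup>2 \<le> 2 * (s - m)\<^sup>2 + 2 * m\<^sup>2" by (simp add: power2_diff power_mult_distrib)
        then show "norm (s\<^sup>2) \<le> norm (2 * (s - m)\<^sup>2 + 2 * m\<^sup>2)" by simp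
      qed
    qed simp
  qed
  then show ?thesis by (auto simp: dom_iff)
qed

lemma SI_shift:
  assumes u: "u \<in> dom (\<lambda>s. s)" and w: "w \<in> dom (\<lambda>s. s)"
  shows "SI (\<lambda>s. s - m) u w = SI (\<lambda>s. s) u w - of_real m * ip u w"
proof -
  let ?z = "\<lambda>k x. u x + \<i> ^ k * w x"
  have zd: "?z k \<in> dom (\<lambda>s. s)" for k by (intro dom_polar u w) simp
  have zH: "?z k \<in> \<H>" for k using zd dom_subset by blast
  have "(LINT s|\<mu> (?z k). s - m) = (LINT s|\<mu> (?z k). s) - m * (LINT s|\<mu> (?z k). 1)" for k
    using dom_integrable[OF _ zd[of k]] zH[of k] integrable_\<mu>[of "?z k" "\<lambda>_. m"]
    by (subst Bochner_Integration.integral_diff) auto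
  then have "SI (\<lambda>s. s - m) u w = SI (\<lambda>s. s) u w - of_real m * SI (\<lambda>_. 1) u w"
    unfolding SI_def by (simp only: sum_distrib_left sum_subtractf[symmetric] diff_divide_distrib[symmetric]
        of_real_diff of_real_mult right_diff_distrib times_divide_eq_right mult.left_commute)
  then show ?thesis using u w by (simp add: SI_one dom_subset)
qed

lemma graph_shift:
  "(u, v) \<in> graph (\<lambda>s. s) \<longleftrightarrow> u \<in> \<H> \<and> (u, v - fscale (of_real m) u) \<in> graph (\<lambda>s. s - m)"
proof -
  have "v \<in> \<H> \<longleftrightarrow> v - fscale (of_real m) u \<in> \<H>" if u: "u \<in> \<H>"
  proof
    assume "v - fscale (of_real m) u \<in> \<H>"
    then have "(v - fscale (of_real m) u) + fscale (of_real m) u \<in> \<H>" using u by (intro L2.add_mem) auto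
    then show "v \<in> \<H>" by (simp add: fun_diff_def plus_fun_def)
  qed (use u in auto)
  then show ?thesis unfolding graph_iff
    by (auto simp: dom_shift[of _ m, symmetric] dom_subset SI_shift L2.ip_diff_left L2.ip_scale_left)
qed

end

text \<open>If \<open>x\<close> lies in the spectral subspace of \<open>E\<close> for \<open>[m - r, m + r]\<close>, then
  \<open>\<parallel>(A - m)\<^sup>n x\<parallel> \<le> r\<^sup>n \<parallel>x\<parallel>\<close> for all \<open>n\<close>.  If \<open>F\<close> is another spectral measure of \<open>A\<close>, a part of \<open>x\<close> that
  \<open>F\<close> sees at distance at least \<open>r' > r\<close> from \<open>m\<close> would grow like \<open>r'\<^sup>n\<close>.\<close>

lemma spectral_subspace_transfer:
  fixes m r :: real
  assumes "pvm \<sigma> E" "pvm \<sigma> F"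
    and eq: "spectral_integral \<sigma> E (\<lambda>s. s) = spectral_integral \<sigma> F (\<lambda>s. s)"
    and y: "y \<in> Lp \<sigma> 2" and r: "r \<ge> 0"
  defines "I \<equiv> {m - r..m + r}"
  shows "L2.nrm \<sigma> (F (- I) (E I y)) = 0"
proof -
  interpret E: pvm \<sigma> E by fact
  interpret F: pvm \<sigma> F by fact
  have IB [simp]: "I \<in> sets borel" by (simp add: I_def)
  have cIB [simp]: "- I \<in> sets borel" using borel_comp[OF IB] .
  define g where "g s = (s - m) * indicator I s" for s
  have Ib: "\<bar>s - m\<bar> \<le> r" if "s \<in> I" for s using that by (auto simp: I_def)
  have gb: "bounded_borel g" unfolding g_def by (rule E.bounded_borel_on[OF _ IB Ib]) auto
  define x where "x n = (E.\<Phi> g ^^ n) (E I y)" for n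
  have x0: "x 0 = E I y" and xS: "x (Suc n) = E.\<Phi> g (x n)" for n by (simp_all add: x_def)
  have x: "x n \<in> Lp \<sigma> 2 \<and> measure (E.\<mu> (x n)) (- I) = 0" for n
  proof (induction n)
    case 0
    show ?case using y by (simp add: x0 E.measure_\<mu>_E)
  next
    case (Suc n)
    have "measure (E.\<mu> (x (Suc n))) (- I) = (LINT s|E.\<mu> (x n). indicator (- I) s * (g s)\<^sup>2)"
      using E.integral_\<mu>_\<Phi>[of "indicator (- I)" g "x n"] Suc gb by (simp add: xS)
    also have "(\<lambda>s. indicator (- I) s * (g s)\<^sup>2) = (\<lambda>_. 0)"
      by (auto simp: fun_eq_iff g_def indicator_def)
    finally show ?case using Suc gb by (simp add: xS)
  qed
  have step: "(x n, x (Suc n)) \<in> spectral_integral \<sigma> F (\<lambda>s. s - m)" for n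
  proof -
    have gr: "(x n, x (Suc n)) \<in> spectral_integral \<sigma> E (\<lambda>s. s - m)"
      unfolding xS g_def using x[of n] by (intro E.graph_supp[OF _ IB Ib]) auto
    define z where "z = x (Suc n) + fscale (of_real m) (x n)"
    have zz: "x (Suc n) = z - fscale (of_real m) (x n)" by (simp add: z_def fun_eq_iff)
    have "(x n, z) \<in> spectral_integral \<sigma> E (\<lambda>s. s)"
      using gr x[of n] unfolding E.graph_shift[of _ _ m] zz[symmetric] by blast
    then show ?thesis unfolding eq F.graph_shift[of _ _ m] zz[symmetric] by blast
  qed
  have up: "(L2.nrm \<sigma> (x n))\<^sup>2 \<le> (r\<^sup>2) ^ n * (L2.nrm \<sigma> (E I y))\<^sup>2" for n
  proof (induction n)
    case (Suc n)
    have "(L2.nrm \<sigma> (x (Suc n)))\<^sup>2 = (LINT s|E.\<mu> (x n). (g s)\<^sup>2)"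
      unfolding xS using x[of n] gb by (intro E.nrm_\<Phi>) auto
    also have "\<dots> \<le> r\<^sup>2 * (L2.nrm \<sigma> (x n))\<^sup>2"
    proof (rule E.integral_\<mu>_le)
      show "(g s)\<^sup>2 \<le> r\<^sup>2" for s
        using Ib[of s] r by (auto simp: g_def indicator_def abs_le_square_iff[symmetric])
    qed (use gb x[of n] in auto)
    also have "\<dots> \<le> r\<^sup>2 * ((r\<^sup>2) ^ n * (L2.nrm \<sigma> (E I y))\<^sup>2)" by (intro mult_left_mono Suc) auto
    finally show ?case by simp
  qed (simp add: x0)
  have null: "measure (F.\<mu> (x 0)) J = 0" if J: "J \<in> sets borel" "\<And>s. s \<in> J \<Longrightarrow> r' \<le> \<bar>s - m\<bar>" and r': "r' > r" for J r'
  proof -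
    have lo: "(r'\<^sup>2) ^ n * measure (F.\<mu> (x 0)) J \<le> measure (F.\<mu> (x n)) J" for n
    proof (induction n)
      case (Suc n)
      have xd: "x n \<in> F.dom (\<lambda>s. s - m)" using step[of n] by (simp add: F.graph_iff)
      have "(r'\<^sup>2) ^ Suc n * measure (F.\<mu> (x 0)) J \<le> r'\<^sup>2 * measure (F.\<mu> (x n)) J"
        using Suc by (simp add: mult_left_mono mult.assoc)
      also have "\<dots> = (LINT s|F.\<mu> (x n). r'\<^sup>2 * indicator J s)" using J by simp
      also have "\<dots> \<le> (LINT s|F.\<mu> (x n). (s - m)\<^sup>2 * indicator J s)"
      proof (rule integral_mono)
        show "integrable (F.\<mu> (x n)) (\<lambda>s. r'\<^sup>2 * indicator J s)"
          using x[of n] J by (intro F.integrable_\<mu> bounded_borel_mult) auto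
        have i: "integrable (F.\<mu> (x n)) (\<lambda>s. (s - m)\<^sup>2)" using xd by (simp add: F.dom_iff)
        show "integrable (F.\<mu> (x n)) (\<lambda>s. (s - m)\<^sup>2 * indicator J s)"
          by (rule integrable_real_mult_indicator[OF _ i]) (use J in simp)
        fix s
        show "r'\<^sup>2 * indicator J s \<le> (s - m)\<^sup>2 * indicator J s"
          using J(2)[of s] r' r by (auto simp: indicator_def abs_le_square_iff[symmetric])
      qed
      also have "\<dots> = measure (F.\<mu> (x (Suc n))) J"
        by (rule F.graph_measure[symmetric, OF _ step J(1)]) simp
      finally show ?case .
    qed (simp add: x0)
    have q: "measure (F.\<mu> (x 0)) J \<le> (L2.nrm \<sigma> (E I y))\<^sup>2 * ((r / r')\<^sup>2) ^ n" for n
    proof -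
      have "measure (F.\<mu> (x n)) J \<le> measure (F.\<mu> (x n)) UNIV"
        using x[of n] J by (intro finite_measure.finite_measure_mono) auto
      also have "\<dots> = (L2.nrm \<sigma> (x n))\<^sup>2" using x[of n] by (simp add: F.measure_\<mu>_UNIV)
      finally have "(r'\<^sup>2) ^ n * measure (F.\<mu> (x 0)) J \<le> (r\<^sup>2) ^ n * (L2.nrm \<sigma> (E I y))\<^sup>2"
        using up[of n] lo[of n] by linarith
      moreover have "(r'\<^sup>2) ^ n > 0" using r' r by simp
      ultimately have "measure (F.\<mu> (x 0)) J \<le> (r\<^sup>2) ^ n * (L2.nrm \<sigma> (E I y))\<^sup>2 / (r'\<^sup>2) ^ n"
        by (simp add: pos_le_divide_eq mult.commute)
      then show ?thesis by (simp add: power_divide mult.commute)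
    qed
    have "(r / r')\<^sup>2 < 1" using r r' by (simp add: power2_eq_square mult_strict_mono power_divide divide_less_eq_1)
    then have "(\<lambda>n. (L2.nrm \<sigma> (E I y))\<^sup>2 * ((r / r')\<^sup>2) ^ n) \<longlonglongrightarrow> (L2.nrm \<sigma> (E I y))\<^sup>2 * 0"
      by (intro tendsto_mult tendsto_const LIMSEQ_realpow_zero) auto
    then have "measure (F.\<mu> (x 0)) J \<le> 0"
      using q by (intro LIMSEQ_le_const) auto
    then show ?thesis using measure_nonneg[of "F.\<mu> (x 0)" J] by linarith
  qed
  define J where "J n = {s. r + 1 / real (Suc n) \<le> \<bar>s - m\<bar>}" for n
  have JB [measurable]: "J n \<in> sets borel" for n unfolding J_def by measurable
  have UJ: "(\<Union>n. J n) = - I"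
  proof (intro set_eqI iffI)
    fix s assume "s \<in> (\<Union>n. J n)"
    then obtain n where "r + 1 / real (Suc n) \<le> \<bar>s - m\<bar>" by (auto simp: J_def)
    moreover have "1 / real (Suc n) > 0" by simp
    ultimately have "r < \<bar>s - m\<bar>" by linarith
    then show "s \<in> - I" by (auto simp: I_def abs_if split: if_splits)
  next
    fix s assume "s \<in> - I"
    then have "\<bar>s - m\<bar> - r > 0" by (auto simp: I_def)
    then obtain n where "inverse (real (Suc n)) < \<bar>s - m\<bar> - r" using reals_Archimedean by blast
    then show "s \<in> (\<Union>n. J n)" by (auto simp: J_def inverse_eq_divide intro!: exI[of _ n])
  qed
  have "F.\<mu> (x 0) (\<Union>n. J n) = 0"
  proof (rule emeasure_UN_eq_0)
    show "emeasure (F.\<mu> (x 0)) (J i) = 0" for i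
      using null[of "J i" "r + 1 / real (Suc i)"] x[of 0]
      by (simp add: J_def[of i, symmetric] finite_measure.emeasure_eq_measure) (auto simp: J_def)
  qed auto
  then have "measure (F.\<mu> (x 0)) (- I) = 0" by (simp add: UJ measure_def)
  then show ?thesis using F.measure_\<mu>[of "x 0" "- I"] x[of 0] by (simp add: x0)
qed

text \<open>By the preceding lemma, applied in both directions, \<open>E I\<close> and \<open>F I\<close> have the same range for every compact interval
  \<open>I\<close>.  Being orthogonal projections they agree, and such intervals generate the Borel sets.\<close>

lemma spectral_measure_unique:
  assumes E: "pvm \<sigma> E" and F: "pvm \<sigma> F"
    and eq: "spectral_integral \<sigma> E (\<lambda>s. s) = spectral_integral \<sigma> F (\<lambda>s. s)"
    and u: "u \<in> Lp \<sigma> 2"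
  shows "scalar_measure \<sigma> E u = scalar_measure \<sigma> F u"
proof -
  interpret E: pvm \<sigma> E by fact
  interpret F: pvm \<sigma> F by fact
  have sub: "L2_inner \<sigma> (G I (G' I y)) w = L2_inner \<sigma> (G' I y) w"
    if "pvm \<sigma> G" "pvm \<sigma> G'" "spectral_integral \<sigma> G' (\<lambda>s. s) = spectral_integral \<sigma> G (\<lambda>s. s)"
      and I: "I = {m - r..m + r}" "r \<ge> 0" and H: "y \<in> Lp \<sigma> 2" "w \<in> Lp \<sigma> 2" for G G' I m r y w
  proof -
    interpret G: pvm \<sigma> G by fact
    interpret G': pvm \<sigma> G' by fact
    have IB [simp]: "I \<in> sets borel" by (simp add: I)
    let ?x = "G' I y"
    have x: "?x \<in> Lp \<sigma> 2" using H by simp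
    have "L2.nrm \<sigma> (G (- I) ?x) = 0"
      unfolding I(1) by (rule spectral_subspace_transfer[OF that(2,1,3) H(1) I(2)])
    moreover have "- I \<in> sets borel" using borel_comp[OF IB] .
    ultimately have "measure (G.\<mu> ?x) (- I) = 0" using G.measure_\<mu>[OF x, of "- I"] by simp
    then have "G.SI (\<lambda>_. 1) ?x w = G.SI (\<lambda>s. 1 * indicator I s) ?x w"
      using G.SI_supp[OF _ IB x _ H(2), of "\<lambda>_. 1"] by simp
    then show ?thesis using x H(2) by (simp add: G.SI_one G.SI_indicator)
  qed
  have interval: "L2_inner \<sigma> (E {a..b} u) u = L2_inner \<sigma> (F {a..b} u) u" for a b
  proof (cases "a \<le> b")
    case False
    then have "{a..b} = {}" by simp
    then show ?thesis using E.E_empty[OF u] F.E_empty[OF u] u by (simp add: E.E_self F.E_self)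
  next
    case True
    let ?I = "{a..b}"
    define m where "m = (a + b) / 2"
    define r where "r = (b - a) / 2"
    have I: "?I = {m - r..m + r}" "r \<ge> 0" using True by (auto simp: m_def r_def field_simps)
    have "L2_inner \<sigma> (F ?I u) u = L2_inner \<sigma> (E ?I (F ?I u)) u"
      by (rule sub[OF E F eq[symmetric] I u u, symmetric])
    also have "\<dots> = L2_inner \<sigma> u (F ?I (E ?I u))" using u by (simp add: E.E_sym F.E_sym)
    also have "\<dots> = cnj (L2_inner \<sigma> (F ?I (E ?I u)) u)" using u by (intro L2.ip_commute) auto
    also have "\<dots> = cnj (L2_inner \<sigma> (E ?I u) u)" by (simp only: sub[OF F E eq I u u])
    also have "\<dots> = L2_inner \<sigma> (E ?I u) u" using u by (simp add: E.E_self)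
    finally show ?thesis by simp
  qed
  show ?thesis
  proof (rule measure_eqI_generator_eq[where E="range (\<lambda>(a, b). {a..b :: real})" and \<Omega>=UNIV and A="\<lambda>n. {- real n..real n}"])
    show "Int_stable (range (\<lambda>(a, b). {a..b :: real}))"
      by (auto simp: Int_stable_def Int_atLeastAtMost)
    show "emeasure (E.\<mu> u) X = emeasure (F.\<mu> u) X" if X: "X \<in> range (\<lambda>(a, b). {a..b})" for X
    proof -
      obtain a b where "X = {a..b}" using X by auto
      then show ?thesis using interval[of a b] u
        by (simp add: E.emeasure_\<mu> F.emeasure_\<mu> E.E_self F.E_self del: of_real_power)
    qed
    show "sets (E.\<mu> u) = sigma_sets UNIV (range (\<lambda>(a, b). {a..b}))"
      unfolding E.sets_\<mu> by (subst borel_eq_atLeastAtMost) (simp add: sets_measure_of)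
    then show "sets (F.\<mu> u) = sigma_sets UNIV (range (\<lambda>(a, b). {a..b}))" by simp
    show "(\<Union>i. {- real i..real i}) = UNIV"
    proof -
      have "\<exists>i. - real i \<le> s \<and> s \<le> real i" for s
      proof -
        obtain i where "\<bar>s\<bar> \<le> real i" using real_arch_simple by blast
        then have "- real i \<le> s \<and> s \<le> real i" by linarith
        then show ?thesis by blast
      qed
      then show ?thesis by auto
    qed
    show "emeasure (E.\<mu> u) {- real i..real i} \<noteq> \<infinity>" for i
      using u by (simp add: E.emeasure_\<mu>)
  qed auto
qed

lemma spectral_integral_unique:
  assumes E: "pvm \<sigma> E" and F: "pvm \<sigma> F"
    and eq: "spectral_integral \<sigma> E (\<lambda>s. s) = spectral_integral \<sigma> F (\<lambda>s. s)"
    and f: "f \<in> borel_measurable borel"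
  shows "spectral_integral \<sigma> E f = spectral_integral \<sigma> F f"
proof -
  interpret E: pvm \<sigma> E by fact
  interpret F: pvm \<sigma> F by fact
  note m = spectral_measure_unique[OF E F eq]
  have d: "E.dom f = F.dom f" by (auto simp: E.dom_iff F.dom_iff m)
  have SI: "E.SI f u w = F.SI f u w" if "u \<in> E.dom f" "w \<in> E.dom f" for u w
    unfolding E.SI_def F.SI_def using m[OF E.dom_subset[OF E.dom_polar[OF f that]]] by simp
  have "(u, v) \<in> E.graph f \<longleftrightarrow> (u, v) \<in> F.graph f" for u v
  proof -
    have "(\<forall>w\<in>E.dom f. L2_inner \<sigma> v w = E.SI f u w) \<longleftrightarrow> (\<forall>w\<in>E.dom f. L2_inner \<sigma> v w = F.SI f u w)"
      if "u \<in> E.dom f" by (rule ball_cong[OF refl]) (simp only: SI[OF that])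
    then show ?thesis unfolding E.graph_iff F.graph_iff d[symmetric] by blast
  qed
  then show ?thesis by (intro equalityI subrelI) blast+
qed

lemma fun_calc_eq:
  assumes E: "pvm \<sigma> E" and A: "A = spectral_integral \<sigma> E (\<lambda>s. s)" and f: "f \<in> borel_measurable borel"
  shows "fun_calc \<sigma> A f = spectral_integral \<sigma> E f"
proof -
  have "spectral_integral \<sigma> F f = spectral_integral \<sigma> E f"
    if "projection_valued_measure \<sigma> F" "A = spectral_integral \<sigma> F (\<lambda>s. s)" for F
  proof (rule spectral_integral_unique[OF _ E _ f])
    show "pvm \<sigma> F" using that(1) by (rule pvm.intro)
    show "spectral_integral \<sigma> F (\<lambda>s. s) = spectral_integral \<sigma> E (\<lambda>s. s)"
      by (simp only: that(2)[symmetric] A[symmetric])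
  qed
  note * = this
  show ?thesis
  proof (intro set_eqI iffI)
    fix z assume "z \<in> fun_calc \<sigma> A f"
    then obtain F where "projection_valued_measure \<sigma> F" "A = spectral_integral \<sigma> F (\<lambda>s. s)"
      "z \<in> spectral_integral \<sigma> F f" unfolding fun_calc_def by blast
    then show "z \<in> spectral_integral \<sigma> E f" by (simp only: *)
  next
    fix z assume "z \<in> spectral_integral \<sigma> E f"
    moreover have "projection_valued_measure \<sigma> E" using E by (rule pvm.pvm)
    ultimately show "z \<in> fun_calc \<sigma> A f" using A unfolding fun_calc_def by blast
  qed
qed

section \<open>Spectral projections bounded from \<open>L\<^sup>1\<close> to \<open>L\<^sup>2\<close>\<close>

context pvm begin

lemma SI_sq_tendsto:
  assumes f: "f \<in> borel_measurable borel" and u: "u \<in> dom f" and w: "w \<in> dom f"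
  shows "(\<lambda>n. SI (\<lambda>s. (trunc f n s)\<^sup>2) u w) \<longlonglongrightarrow> SI (\<lambda>s. (f s)\<^sup>2) u w"
proof -
  have "(\<lambda>n. LINT s|\<mu> z. (trunc f n s)\<^sup>2) \<longlonglongrightarrow> (LINT s|\<mu> z. (f s)\<^sup>2)" if z: "z \<in> dom f" for z
  proof (rule integral_dominated_convergence[where w="\<lambda>s. (f s)\<^sup>2"])
    show "integrable (\<mu> z) (\<lambda>s. (f s)\<^sup>2)" using z by (simp add: dom_iff)
    show "AE s in \<mu> z. (\<lambda>n. (trunc f n s)\<^sup>2) \<longlonglongrightarrow> (f s)\<^sup>2"
      by (intro AE_I2 tendsto_power trunc_tendsto)
    show "AE s in \<mu> z. norm ((trunc f n s)\<^sup>2) \<le> (f s)\<^sup>2" for n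
      by (intro AE_I2) (simp add: trunc_def)
    show "(\<lambda>s. (trunc f n s)\<^sup>2) \<in> borel_measurable (\<mu> z)" for n
      using bounded_borel_measurable[OF bounded_borel_trunc[OF f]] by simp
  qed (use f in simp)
  then show ?thesis unfolding SI_def
    by (intro tendsto_divide tendsto_sum tendsto_mult tendsto_of_real tendsto_const) (auto intro!: dom_polar f u w)
qed

lemma sip_dom:
  assumes f: "f \<in> borel_measurable borel" shows "sip fscale (dom f) (SI (\<lambda>s. (f s)\<^sup>2))"
proof -
  interpret vector_space "fscale :: complex \<Rightarrow> 'a fn \<Rightarrow> 'a fn" by (rule vector_space_fscale)
  note bb = bounded_borel_power2[OF bounded_borel_trunc[OF f]]
  note lim = SI_sq_tendsto[OF f]
  show ?thesis
  proof
    show "0 \<in> dom f"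
      using dom_char[OF f L2.zero_mem] by (auto simp: integral_\<mu>_null[OF L2.zero_mem L2.nrm_zero])
    fix u v w :: "'a fn" and c :: complex
    assume u: "u \<in> dom f"
    show "fscale c u \<in> dom f" by (rule dom_scale[OF f u])
    have "SI (\<lambda>s. (f s)\<^sup>2) u u = of_real (LINT s|\<mu> u. (f s)\<^sup>2)"
    proof (rule LIMSEQ_unique[OF lim[OF u u]])
      have "(\<lambda>n. LINT s|\<mu> u. (trunc f n s)\<^sup>2) \<longlonglongrightarrow> (LINT s|\<mu> u. (f s)\<^sup>2)"
      proof (rule integral_dominated_convergence[where w="\<lambda>s. (f s)\<^sup>2"])
        show "integrable (\<mu> u) (\<lambda>s. (f s)\<^sup>2)" using u by (simp add: dom_iff)
        show "AE s in \<mu> u. (\<lambda>n. (trunc f n s)\<^sup>2) \<longlonglongrightarrow> (f s)\<^sup>2"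
          by (intro AE_I2 tendsto_power trunc_tendsto)
        show "AE s in \<mu> u. norm ((trunc f n s)\<^sup>2) \<le> (f s)\<^sup>2" for n
          by (intro AE_I2) (simp add: trunc_def)
        show "(\<lambda>s. (trunc f n s)\<^sup>2) \<in> borel_measurable (\<mu> u)" for n
          using bounded_borel_measurable[OF bounded_borel_trunc[OF f]] by simp
      qed (use f in simp)
      then show "(\<lambda>n. SI (\<lambda>s. (trunc f n s)\<^sup>2) u u) \<longlonglongrightarrow> of_real (LINT s|\<mu> u. (f s)\<^sup>2)"
        unfolding SI_self[OF bb dom_subset[OF u]] by (rule tendsto_of_real)
    qed
    then show "0 \<le> Re (SI (\<lambda>s. (f s)\<^sup>2) u u)" by simp
    assume w: "w \<in> dom f"
    show "u + w \<in> dom f" by (rule dom_add[OF f u w])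
    show "SI (\<lambda>s. (f s)\<^sup>2) (fscale c u) w = c * SI (\<lambda>s. (f s)\<^sup>2) u w"
    proof (rule LIMSEQ_unique[OF lim[OF dom_scale[OF f u] w]])
      show "(\<lambda>n. SI (\<lambda>s. (trunc f n s)\<^sup>2) (fscale c u) w) \<longlonglongrightarrow> c * SI (\<lambda>s. (f s)\<^sup>2) u w"
        unfolding SI_scale_left[OF bb dom_subset[OF u] dom_subset[OF w]]
        by (intro tendsto_intros lim u w)
    qed
    show "SI (\<lambda>s. (f s)\<^sup>2) w u = cnj (SI (\<lambda>s. (f s)\<^sup>2) u w)"
    proof (rule LIMSEQ_unique[OF lim[OF w u]])
      show "(\<lambda>n. SI (\<lambda>s. (trunc f n s)\<^sup>2) w u) \<longlonglongrightarrow> cnj (SI (\<lambda>s. (f s)\<^sup>2) u w)"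
        unfolding SI_commute[OF bb dom_subset[OF u] dom_subset[OF w]]
        by (intro tendsto_cnj lim u w)
    qed
    assume v: "v \<in> dom f"
    show "SI (\<lambda>s. (f s)\<^sup>2) (u + v) w = SI (\<lambda>s. (f s)\<^sup>2) u w + SI (\<lambda>s. (f s)\<^sup>2) v w"
    proof (rule LIMSEQ_unique[OF lim[OF dom_add[OF f u v] w]])
      show "(\<lambda>n. SI (\<lambda>s. (trunc f n s)\<^sup>2) (u + v) w) \<longlonglongrightarrow> SI (\<lambda>s. (f s)\<^sup>2) u w + SI (\<lambda>s. (f s)\<^sup>2) v w"
        unfolding SI_add_left[OF bb dom_subset[OF u] dom_subset[OF v] dom_subset[OF w]]
        by (intro tendsto_intros lim u v w)
    qed
  qed
qed

lemma sqrt_measurable [simp]: "sqrt \<in> borel_measurable borel"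
  by measurable

lemma sqrt_sq: "(sqrt s)\<^sup>2 = \<bar>s\<bar>"
proof (cases "s \<ge> 0")
  case False
  then have "sqrt s = - sqrt (- s)" by (simp add: real_sqrt_minus)
  then show ?thesis using False by simp
qed simp

sublocale En: sip fscale "dom sqrt" "SI (\<lambda>s. (sqrt s)\<^sup>2)"
  by (rule sip_dom) simp

text \<open>The quadratic form of \<open>A\<close>.  The function \<open>sqrt\<close> is odd, so its square is \<open>\<bar>s\<bar>\<close>; negative \<open>s\<close> do not contribute
  once \<open>E_pos\<close> is available.\<close>

definition energy :: "'a fn \<Rightarrow> real"
  where "energy u = (LINT s|\<mu> u. \<bar>s\<bar>)"

lemma energy_integrable: "u \<in> dom sqrt \<Longrightarrow> integrable (\<mu> u) (\<lambda>s. \<bar>s\<bar>)"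
  by (simp add: dom_iff sqrt_sq)

lemma energy_nonneg [simp]: "0 \<le> energy u"
  by (simp add: energy_def)

lemma En_nrm_sq: "u \<in> dom sqrt \<Longrightarrow> (En.nrm u)\<^sup>2 = energy u"
proof -
  assume u: "u \<in> dom sqrt"
  have "SI (\<lambda>s. (sqrt s)\<^sup>2) u u = of_real (LINT s|\<mu> u. (sqrt s)\<^sup>2)"
  proof (rule LIMSEQ_unique[OF SI_sq_tendsto[OF sqrt_measurable u u]])
    have "(\<lambda>n. LINT s|\<mu> u. (trunc sqrt n s)\<^sup>2) \<longlonglongrightarrow> (LINT s|\<mu> u. (sqrt s)\<^sup>2)"
    proof (rule integral_dominated_convergence[where w="\<lambda>s. (sqrt s)\<^sup>2"])
      show "integrable (\<mu> u) (\<lambda>s. (sqrt s)\<^sup>2)" using u by (simp only: dom_iff)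
      show "AE s in \<mu> u. (\<lambda>n. (trunc sqrt n s)\<^sup>2) \<longlonglongrightarrow> (sqrt s)\<^sup>2"
        by (intro AE_I2 tendsto_power trunc_tendsto)
      show "AE s in \<mu> u. norm ((trunc sqrt n s)\<^sup>2) \<le> (sqrt s)\<^sup>2" for n
        by (intro AE_I2) (simp add: trunc_def)
      show "(\<lambda>s. (trunc sqrt n s)\<^sup>2) \<in> borel_measurable (\<mu> u)" for n
        using bounded_borel_measurable[OF bounded_borel_trunc[OF sqrt_measurable]] by simp
    qed simp
    then show "(\<lambda>n. SI (\<lambda>s. (trunc sqrt n s)\<^sup>2) u u) \<longlonglongrightarrow> of_real (LINT s|\<mu> u. (sqrt s)\<^sup>2)"
      unfolding SI_self[OF bounded_borel_power2[OF bounded_borel_trunc[OF sqrt_measurable]] dom_subset[OF u]]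
      by (rule tendsto_of_real)
  qed
  then have "Re (SI (\<lambda>s. (sqrt s)\<^sup>2) u u) = (LINT s|\<mu> u. (sqrt s)\<^sup>2)" by (simp only: Re_complex_of_real)
  then show ?thesis unfolding En.nrm_sq[OF u] by (simp only: energy_def sqrt_sq)
qed

lemma nrm_diff_E:
  assumes B: "B \<in> sets borel" and u: "u \<in> \<H>"
  shows "(nrm (u - E B u))\<^sup>2 = measure (\<mu> u) (- B)"
proof -
  have cB: "- B \<in> sets borel" using B by (rule borel_comp)
  have "(nrm (u - E B u))\<^sup>2 = (nrm u)\<^sup>2 - 2 * Re (ip u (E B u)) + (nrm (E B u))\<^sup>2"
    using B u by (intro L2.nrm_sq_diff) auto
  also have "ip u (E B u) = of_real ((nrm (E B u))\<^sup>2)" using E_self[OF B u] E_sym[OF B u u] by simp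
  finally have "(nrm (u - E B u))\<^sup>2 = measure (\<mu> u) UNIV - measure (\<mu> u) B"
    using measure_\<mu>[OF u B] measure_\<mu>_UNIV[OF u] unfolding Re_complex_of_real by linarith
  also have "\<dots> = measure (\<mu> u) (UNIV - B)"
    using finite_measure.finite_measure_Diff[OF finite_\<mu>[OF u], of UNIV B] B by simp
  finally show ?thesis by (simp add: Compl_eq_Diff_UNIV)
qed

lemma E_sum_AE:
  assumes B: "B \<in> sets borel" and f: "\<And>i. i < (N::nat) \<Longrightarrow> f i \<in> \<H>"
  shows "AE x in \<sigma>. E B (\<Sum>i<N. fscale (c i) (f i)) x = (\<Sum>i<N. c i * E B (f i) x)"
proof -
  let ?z = "\<Sum>i<N. fscale (c i) (f i)" and ?y = "\<Sum>i<N. fscale (c i) (E B (f i))"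
  have zH: "?z \<in> \<H>" and yH: "?y \<in> \<H>" using f B by (auto intro!: L2.sum_mem)
  have "nrm (E B ?z - ?y) = 0"
  proof (rule L2.nrm_eq_0_if_weak)
    fix w assume w: "w \<in> \<H>"
    have "ip (E B ?z) w = (\<Sum>i<N. c i * ip (f i) (E B w))"
      using B w zH f by (simp add: E_sym) (subst L2.ip_sum_left, auto simp: L2.ip_scale_left)
    also have "\<dots> = (\<Sum>i<N. c i * ip (E B (f i)) w)"
      using B w f by (intro sum.cong refl) (simp add: E_sym)
    also have "\<dots> = ip ?y w"
      using B w f by (subst L2.ip_sum_left) (auto simp: L2.ip_scale_left)
    finally show "ip (E B ?z - ?y) w = 0" using B w zH yH by (simp add: L2.ip_diff_left)
  qed (use B zH yH in simp)
  then have "AE x in \<sigma>. (E B ?z - ?y) x = 0"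
    using L2_nrm_eq_0[of "E B ?z - ?y" \<sigma>] B zH yH by simp
  then show ?thesis by eventually_elim (simp add: sum_fun_apply)
qed

end

text \<open>A function in \<open>L\<^sup>2\<close> that acts boundedly on \<open>L\<^sup>1 \<inter> L\<^sup>2\<close> is bounded: test it against its own
  phase on a set of finite measure where it is large.\<close>

lemma AE_bounded_by_duality:
  assumes sf: "sigma_finite_measure \<sigma>" and u: "u \<in> Lp \<sigma> 2" and K: "K \<ge> 0"
    and dual: "\<And>g. g \<in> Lp \<sigma> 1 \<Longrightarrow> g \<in> Lp \<sigma> 2 \<Longrightarrow> cmod (L2_inner \<sigma> u g) \<le> K * (LINT x|\<sigma>. cmod (g x))"
  shows "AE x in \<sigma>. cmod (u x) \<le> K"
proof -
  interpret sigma_finite_measure \<sigma> by fact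
  have um [measurable]: "u \<in> borel_measurable \<sigma>" using u by (rule Lp_measurable)
  obtain F :: "nat \<Rightarrow> 'a set" where F: "range F \<subseteq> sets \<sigma>" "(\<Union>i. F i) = space \<sigma>" "\<And>i. emeasure \<sigma> (F i) \<noteq> \<infinity>"
    using sigma_finite by blast
  have "AE x in \<sigma>. x \<in> F i \<longrightarrow> cmod (u x) \<le> K" for i
  proof -
    have Fi [measurable]: "F i \<in> sets \<sigma>" using F by auto
    define S where "S = {x \<in> space \<sigma>. x \<in> F i \<and> K < cmod (u x)}"
    have S [measurable]: "S \<in> sets \<sigma>" unfolding S_def by measurable
    have SF: "S \<subseteq> F i" by (auto simp: S_def)
    have Sfin: "emeasure \<sigma> S < \<infinity>"
      using F(3)[of i] emeasure_mono[OF SF Fi] by (simp add: less_top[symmetric] top_unique) (metis top_unique)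
    \<comment> \<open>The phase of \<open>u\<close>, so that \<open>u\<close> times the conjugate of \<open>g\<close> is \<open>\<bar>u\<bar>\<close> on \<open>S\<close>.\<close>
    define g where "g x = indicator S x * sgn (u x)" for x
    have gm [measurable]: "g \<in> borel_measurable \<sigma>" unfolding g_def by measurable
    have gn: "cmod (g x) = indicator S x" for x
      using K by (auto simp: g_def indicator_def norm_mult norm_sgn S_def)
    have Si: "integrable \<sigma> (indicator S :: 'a \<Rightarrow> real)" using Sfin S by (simp add: integrable_indicator_iff)
    have gp: "g \<in> Lp \<sigma> p" if "p > 0" for p
    proof -
      have "(\<lambda>x. cmod (g x) powr p) = indicator S" using that by (auto simp: gn indicator_def fun_eq_iff)
      then show ?thesis using Si by (simp add: Lp_def)
    qed
    have ug: "u x * cnj (g x) = of_real (cmod (u x) * indicator S x)" for x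
      by (auto simp: g_def indicator_def sgn_div_norm scaleR_conv_of_real complex_norm_square[symmetric]
          power2_eq_square divide_simps)
    have ig: "integrable \<sigma> (\<lambda>x. cmod (u x) * indicator S x)"
    proof -
      have "integrable \<sigma> (\<lambda>x. complex_of_real (cmod (u x) * indicator S x))"
        using L2_integrable_mult[OF u gp[of 2]] by (simp add: ug del: of_real_mult)
      then show ?thesis by (simp only: complex_of_real_integrable_eq)
    qed
    have "L2_inner \<sigma> u g = of_real (LINT x|\<sigma>. cmod (u x) * indicator S x)"
      unfolding L2_inner_def ug by (rule integral_complex_of_real)
    then have "(LINT x|\<sigma>. cmod (u x) * indicator S x) \<le> K * (LINT x|\<sigma>. indicator S x)"
      using dual[OF gp gp] by (simp add: gn abs_of_nonneg Bochner_Integration.integral_nonneg del: integral_indicator)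
    then have le: "(LINT x|\<sigma>. (cmod (u x) - K) * indicator S x) \<le> 0"
      using ig Si by (simp add: left_diff_distrib del: integral_indicator)
    have i2: "integrable \<sigma> (\<lambda>x. (cmod (u x) - K) * indicator S x)"
      using ig Si by (simp add: left_diff_distrib)
    have nn: "0 \<le> (cmod (u x) - K) * indicator S x" for x by (auto simp: indicator_def S_def)
    have "(LINT x|\<sigma>. (cmod (u x) - K) * indicator S x) = 0"
      using le Bochner_Integration.integral_nonneg[OF nn] by (rule antisym)
    then have "AE x in \<sigma>. (cmod (u x) - K) * indicator S x = 0"
      using Bochner_Integration.integral_nonneg_eq_0_iff_AE[OF i2] nn by simp
    then show ?thesis using AE_space
      by eventually_elim (auto simp: S_def indicator_def split: if_splits)
  qed
  then have "AE x in \<sigma>. \<forall>i. x \<in> F i \<longrightarrow> cmod (u x) \<le> K"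
    by (subst AE_all_countable) blast
  then show ?thesis using AE_space by eventually_elim (use F(2) in auto)
qed

text \<open>A geometric sum is at most twice its largest term, and here that term is below \<open>s\<close>.\<close>

lemma sum_powers_of_two_below:
  fixes I :: "int set"
  assumes "finite I"
  shows "(\<Sum>k\<in>I. if 2 powr real_of_int k < s then 2 powr real_of_int k else 0) \<le> 2 * \<bar>s\<bar>"
proof -
  define J where "J = {k\<in>I. 2 powr real_of_int k < s}"
  have fJ: "finite J" using assms by (simp add: J_def)
  have "(\<Sum>k\<in>I. if 2 powr real_of_int k < s then 2 powr real_of_int k else 0) = (\<Sum>k\<in>J. 2 powr real_of_int k)"
    using assms by (simp add: J_def sum.If_cases Int_def)
  also have "\<dots> \<le> 2 * \<bar>s\<bar>"
  proof (cases "J = {}")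
    case False
    define m where "m = Max J"
    have m: "m \<in> J" "\<And>k. k \<in> J \<Longrightarrow> k \<le> m" using fJ False by (auto simp: m_def)
    have "(\<Sum>k\<in>J. 2 powr real_of_int k) = (\<Sum>k\<in>J. 2 powr real_of_int m * (1/2) ^ nat (m - k))"
    proof (rule sum.cong[OF refl])
      fix k assume k: "k \<in> J"
      have "2 powr real_of_int k = 2 powr (real_of_int m - real (nat (m - k)))" using m(2)[OF k] by simp
      also have "\<dots> = 2 powr real_of_int m / 2 ^ nat (m - k)" by (simp add: powr_diff powr_realpow)
      finally show "2 powr real_of_int k = 2 powr real_of_int m * (1/2) ^ nat (m - k)" by (simp add: power_divide)
    qed
    also have "\<dots> = 2 powr real_of_int m * (\<Sum>k\<in>J. (1/2) ^ nat (m - k))" by (simp add: sum_distrib_left)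
    also have "(\<Sum>k\<in>J. (1/2::real) ^ nat (m - k)) = (\<Sum>j\<in>(\<lambda>k. nat (m - k)) ` J. (1/2) ^ j)"
    proof (subst sum.reindex)
      show "inj_on (\<lambda>k. nat (m - k)) J"
      proof (rule inj_onI)
        fix x y assume "x \<in> J" "y \<in> J" "nat (m - x) = nat (m - y)"
        then show "x = y" using m(2)[of x] m(2)[of y] by linarith
      qed
    qed simp
    also have "\<dots> \<le> (\<Sum>j. (1/2::real) ^ j)"
      using fJ by (intro sum_le_suminf) (auto intro: summable_geometric)
    also have "\<dots> = 2" by (subst suminf_geometric) auto
    finally have "(\<Sum>k\<in>J. 2 powr real_of_int k) \<le> 2 powr real_of_int m * 2" by simp
    moreover have "2 powr real_of_int m < s" using m(1) by (simp add: J_def)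
    ultimately show ?thesis by linarith
  qed simp
  finally show ?thesis .
qed

text \<open>Pairings with vectors from a countable dense set determine the norm of a vector.  Countability is what allows
  these pairings to be estimated at almost every point simultaneously.\<close>

lemma vector_norm_le_by_dense:
  assumes D: "\<And>X. open X \<Longrightarrow> X \<noteq> {} \<Longrightarrow> \<exists>d\<in>D. d \<in> (X :: complex set)" and M: "M \<ge> 0"
    and bd: "\<And>c. c \<in> PiE {..<N::nat} (\<lambda>_. D) \<Longrightarrow> cmod (\<Sum>i<N. c i * z i) \<le> M * sqrt (\<Sum>i<N. (cmod (c i))\<^sup>2)"
  shows "(\<Sum>i<N. (cmod (z i))\<^sup>2) \<le> M\<^sup>2"
proof -
  have "\<forall>n i. \<exists>d\<in>D. d \<in> ball (cnj (z i)) (1 / real (Suc n))" for z :: "nat \<Rightarrow> complex"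
    by (intro allI D) auto
  then obtain d where d: "\<And>n i. d n i \<in> D" "\<And>n i. dist (cnj (z i)) (d n i) < 1 / real (Suc n)"
    by (metis mem_ball)
  define c where "c n = restrict (d n) {..<N}" for n
  have lim: "(\<lambda>n. c n i) \<longlonglongrightarrow> cnj (z i)" if "i < N" for i
  proof -
    have "(\<lambda>n. dist (c n i) (cnj (z i))) \<longlonglongrightarrow> 0"
    proof (rule tendsto_sandwich[OF _ _ tendsto_const LIMSEQ_Suc[OF lim_inverse_n']])
      show "\<forall>\<^sub>F n in sequentially. dist (c n i) (cnj (z i)) \<le> 1 / real (Suc n)"
        using less_imp_le[OF d(2)] that by (intro always_eventually) (simp add: c_def dist_commute del: of_nat_Suc)
    qed simp
    then show ?thesis by (rule tendsto_dist_iff[THEN iffD2])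
  qed
  let ?S = "\<Sum>i<N. (cmod (z i))\<^sup>2"
  have l1: "(\<lambda>n. cmod (\<Sum>i<N. c n i * z i)) \<longlonglongrightarrow> cmod (\<Sum>i<N. cnj (z i) * z i)"
    by (intro tendsto_norm tendsto_sum tendsto_mult tendsto_const lim) auto
  have l2: "(\<lambda>n. M * sqrt (\<Sum>i<N. (cmod (c n i))\<^sup>2)) \<longlonglongrightarrow> M * sqrt (\<Sum>i<N. (cmod (cnj (z i)))\<^sup>2)"
    by (intro tendsto_mult tendsto_const tendsto_real_sqrt tendsto_sum tendsto_power tendsto_norm lim) auto
  have l3: "cmod (\<Sum>i<N. c n i * z i) \<le> M * sqrt (\<Sum>i<N. (cmod (c n i))\<^sup>2)" for n
    by (rule bd) (auto simp: c_def d(1) split: if_splits)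
  have "cmod (\<Sum>i<N. cnj (z i) * z i) \<le> M * sqrt (\<Sum>i<N. (cmod (cnj (z i)))\<^sup>2)"
    by (rule LIMSEQ_le[OF l1 l2]) (use l3 in blast)
  moreover have "(\<Sum>i<N. cnj (z i) * z i) = of_real ?S"
    by (simp add: complex_norm_square mult.commute del: of_real_power)
  ultimately have le: "?S \<le> M * sqrt ?S" by (simp add: sum_nonneg del: of_real_sum)
  show ?thesis
  proof (cases "?S = 0")
    case False
    then have S: "?S > 0" using sum_nonneg[of "{..<N}" "\<lambda>i. (cmod (z i))\<^sup>2"] by fastforce
    have "sqrt ?S * sqrt ?S \<le> M * sqrt ?S" using le S by simp
    then have "sqrt ?S \<le> M" by (rule mult_right_le_imp_le) (use S in simp)
    then have "(sqrt ?S)\<^sup>2 \<le> M\<^sup>2" using S by (intro power_mono) auto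
    then show ?thesis using S by simp
  qed simp
qed

text \<open>The last assumption says that \<open>E(-\<infinity>, \<Lambda>]\<close> maps \<open>L\<^sup>1\<close> to \<open>L\<^sup>2\<close> with norm at most \<open>(C \<Lambda>\<^bsup>d/2\<^esup>)\<^bsup>1/2\<^esup>\<close>, or dually \<open>L\<^sup>2\<close> to
  \<open>L\<^sup>\<infinity>\<close>.  It is the only information about the heat kernel that is used in the sequel.\<close>

locale spectral_bound = pvm +
  fixes d C :: real
  assumes sigma_finite: "sigma_finite_measure \<sigma>"
    and d: "d > 2" and C: "C > 0"
    and low_energy: "\<And>\<Lambda> g. \<Lambda> > 0 \<Longrightarrow> g \<in> Lp \<sigma> 1 \<Longrightarrow> g \<in> Lp \<sigma> 2 \<Longrightarrow>
      measure (\<mu> g) {..\<Lambda>} \<le> C * \<Lambda> powr (d / 2) * (LINT x|\<sigma>. cmod (g x))\<^sup>2"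
begin

lemma ip_E_le:
  assumes B: "B \<in> sets borel" "B \<subseteq> {..\<Lambda>}" and l: "\<Lambda> > 0" and u: "u \<in> \<H>" and g: "g \<in> Lp \<sigma> 1" "g \<in> Lp \<sigma> 2"
  shows "cmod (ip (E B u) g) \<le> sqrt (measure (\<mu> u) B) * (sqrt C * \<Lambda> powr (d / 4) * (LINT x|\<sigma>. cmod (g x)))"
proof -
  have n: "nrm (E B z) = sqrt (measure (\<mu> z) B)" if "z \<in> \<H>" for z
    using that B by (simp add: measure_\<mu>)
  have "ip (E B u) g = ip (E B u) (E B g)" using B u g E_ip_E[of B B u g] by simp
  then have "cmod (ip (E B u) g) \<le> sqrt (measure (\<mu> u) B) * sqrt (measure (\<mu> g) B)"
    using L2.cauchy_schwarz[of "E B u" \<sigma> "E B g"] B u g n[OF u] n[OF g(2)] by simp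
  also have "\<dots> \<le> sqrt (measure (\<mu> u) B) * (sqrt C * \<Lambda> powr (d / 4) * (LINT x|\<sigma>. cmod (g x)))"
  proof (intro mult_left_mono)
    have "measure (\<mu> g) B \<le> measure (\<mu> g) {..\<Lambda>}"
      using B g by (intro finite_measure.finite_measure_mono) auto
    also have "\<dots> \<le> C * \<Lambda> powr (d / 2) * (LINT x|\<sigma>. cmod (g x))\<^sup>2" by (rule low_energy[OF l g])
    finally have "sqrt (measure (\<mu> g) B) \<le> sqrt (C * \<Lambda> powr (d / 2) * (LINT x|\<sigma>. cmod (g x))\<^sup>2)" by simp
    also have "\<Lambda> powr (d / 2) = (\<Lambda> powr (d / 4))\<^sup>2"
      using l by (simp add: powr_powr power2_eq_square powr_add[symmetric])
    finally show "sqrt (measure (\<mu> g) B) \<le> sqrt C * \<Lambda> powr (d / 4) * (LINT x|\<sigma>. cmod (g x))"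
      by (simp add: real_sqrt_mult Bochner_Integration.integral_nonneg)
  qed simp
  finally show ?thesis .
qed

text \<open>Letting \<open>\<Lambda>\<close> tend to 0 in the bound shows that \<open>E(-\<infinity>, 0] u\<close> is bounded by 0.\<close>

lemma E_nonpos:
  assumes u: "u \<in> \<H>" shows "measure (\<mu> u) {..0} = 0"
proof -
  have "cmod (ip (E {..0} u) g) \<le> 0 * (LINT x|\<sigma>. cmod (g x))" if g: "g \<in> Lp \<sigma> 1" "g \<in> Lp \<sigma> 2" for g :: "'a fn"
  proof -
    let ?c = "sqrt (measure (\<mu> u) {..0}) * sqrt C * (LINT x|\<sigma>. cmod (g x))"
    have "cmod (ip (E {..0} u) g) \<le> ?c * (inverse (real (Suc n))) powr (d / 4)" for n
      using ip_E_le[of "{..0}" "inverse (real (Suc n))" u g] u g by (simp add: mult_ac)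
    moreover have "(\<lambda>n. ?c * (inverse (real (Suc n))) powr (d / 4)) \<longlonglongrightarrow> ?c * 0 powr (d / 4)"
      using d by (intro tendsto_mult tendsto_const tendsto_powr2 LIMSEQ_inverse_real_of_nat) auto
    ultimately have "cmod (ip (E {..0} u) g) \<le> ?c * 0 powr (d / 4)"
      by (intro LIMSEQ_le_const) auto
    then show ?thesis by simp
  qed
  then have "AE x in \<sigma>. cmod (E {..0} u x) \<le> 0"
    by (intro AE_bounded_by_duality[OF sigma_finite]) (use u in auto)
  then have "nrm (E {..0} u) = 0" using L2_nrm_eq_0[of "E {..0} u" \<sigma>] u by simp
  then show ?thesis using u by (simp add: measure_\<mu>)
qed

lemma E_pos:
  assumes u: "u \<in> \<H>" shows "AE s in \<mu> u. s > 0"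
  using AE_\<mu>_supp[OF u, of "{0<..}"] E_nonpos[OF u] by (simp add: Compl_greaterThan)

text \<open>The sum of the geometric series in \<open>low_energy_bounded\<close>.\<close>

definition K0 :: real where "K0 = sqrt (2 * C) / (1 - 2 powr (- ((d - 2) / 4)))"

lemma K0_pos: "K0 > 0"
proof -
  have "2 powr (- ((d - 2) / 4)) < 2 powr 0" using d by (intro powr_less_mono) auto
  then show ?thesis using C by (simp add: K0_def)
qed

text \<open>The low-energy part of a function of finite energy is bounded: on the band
  \<open>(\<Lambda> 2\<^sup>-\<^sup>i\<^sup>-\<^sup>1, \<Lambda> 2\<^sup>-\<^sup>i]\<close> the \<open>L\<^sup>2\<close> norm is controlled by the energy, and the resulting geometric series
  converges because \<open>d > 2\<close>.\<close>

lemma low_energy_bounded: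
  assumes l: "\<Lambda> > 0" and u: "u \<in> dom sqrt"
  shows "AE x in \<sigma>. cmod (E {..\<Lambda>} u x) \<le> K0 * \<Lambda> powr ((d - 2) / 4) * sqrt (energy u)"
proof (rule AE_bounded_by_duality[OF sigma_finite])
  note uH = dom_subset[OF u]
  show "E {..\<Lambda>} u \<in> \<H>" using uH by simp
  show "0 \<le> K0 * \<Lambda> powr ((d - 2) / 4) * sqrt (energy u)" using K0_pos by simp
  fix g :: "'a fn" assume g: "g \<in> Lp \<sigma> 1" "g \<in> Lp \<sigma> 2"
  define G where "G = (LINT x|\<sigma>. cmod (g x))"
  have G0: "0 \<le> G" by (simp add: G_def)
  define l where "l i = \<Lambda> / 2 ^ i" for i :: nat
  have lpos: "l i > 0" for i using \<open>\<Lambda> > 0\<close> by (simp add: l_def)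
  define \<rho> where "\<rho> = 2 powr (- ((d - 2) / 4))"
  have \<rho>: "0 < \<rho>" "\<rho> < 1"
  proof -
    show "0 < \<rho>" by (simp add: \<rho>_def)
    have "2 powr (- ((d - 2) / 4)) < 2 powr 0" using d by (intro powr_less_mono) auto
    then show "\<rho> < 1" by (simp add: \<rho>_def)
  qed
  have lpow: "l i powr a = \<Lambda> powr a * (2 powr (- a)) ^ i" for i a
  proof -
    have "l i powr a = \<Lambda> powr a / (2 ^ i) powr a" using \<open>\<Lambda> > 0\<close> by (simp add: l_def powr_divide)
    also have "(2 ^ i) powr a = 2 powr (a * real i)"
      using powr_powr[of 2 "real i" a] by (simp add: powr_realpow mult.commute)
    also have "\<Lambda> powr a / 2 powr (a * real i) = \<Lambda> powr a * 2 powr (- a * real i)"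
      using powr_minus_divide[of 2 "a * real i"] by simp
    also have "2 powr (- a * real i) = (2 powr (- a)) ^ i"
      using powr_powr[of 2 "- a" "real i"] powr_realpow[of "2 powr (- a)" i] by simp
    finally show ?thesis .
  qed
  have band: "cmod (ip (E {l (Suc i)<..l i} u) g)
      \<le> sqrt (2 * C) * \<Lambda> powr ((d - 2) / 4) * sqrt (energy u) * G * \<rho> ^ i" for i
  proof -
    let ?I = "{l (Suc i)<..l i}"
    have "l (Suc i) * measure (\<mu> u) ?I = (LINT s|\<mu> u. l (Suc i) * indicator ?I s)" by simp
    also have "\<dots> \<le> energy u" unfolding energy_def
    proof (rule integral_mono[OF integrable_\<mu>[OF uH] energy_integrable[OF u]])
      show "l (Suc i) * indicator ?I s \<le> \<bar>s\<bar>" for s using lpos[of "Suc i"] by (auto simp: indicator_def)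
    qed simp
    finally have "measure (\<mu> u) ?I \<le> energy u / l (Suc i)"
      using lpos[of "Suc i"] by (simp add: pos_le_divide_eq mult.commute)
    also have "\<dots> = 2 * energy u / l i" by (simp add: l_def)
    finally have m: "sqrt (measure (\<mu> u) ?I) \<le> sqrt (2 * energy u / l i)" by simp
    have "cmod (ip (E ?I u) g) \<le> sqrt (measure (\<mu> u) ?I) * (sqrt C * l i powr (d / 4) * G)"
      unfolding G_def by (rule ip_E_le[OF _ _ lpos uH g]) auto
    also have "\<dots> \<le> sqrt (2 * energy u / l i) * (sqrt C * l i powr (d / 4) * G)"
      using m G0 C by (intro mult_right_mono) auto
    also have "\<dots> = sqrt (2 * C) * sqrt (energy u) * G * (l i powr (d / 4) / sqrt (l i))"
      by (simp add: real_sqrt_mult real_sqrt_divide)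
    also have "l i powr (d / 4) / sqrt (l i) = l i powr ((d - 2) / 4)"
      using lpos[of i] by (simp add: powr_half_sqrt[symmetric] powr_diff[symmetric] diff_divide_distrib)
    also have "\<dots> = \<Lambda> powr ((d - 2) / 4) * \<rho> ^ i" by (simp add: lpow \<rho>_def)
    finally show ?thesis by (simp add: mult_ac)
  qed
  have split: "ip (E {..l i} u) g = ip (E {..l (Suc i)} u) g + ip (E {l (Suc i)<..l i} u) g" for i
  proof -
    have U: "{..l (Suc i)} \<union> {l (Suc i)<..l i} = {..l i}"
      using lpos[of i] by (auto simp: l_def intro: order_trans)
    have "SI (\<lambda>s. indicator {..l (Suc i)} s + indicator {l (Suc i)<..l i} s) u g
      = SI (indicator {..l (Suc i)}) u g + SI (indicator {l (Suc i)<..l i}) u g"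
      using uH g by (intro SI_add) auto
    moreover have "(\<lambda>s. indicator {..l (Suc i)} s + indicator {l (Suc i)<..l i} s) = (indicator {..l i} :: real \<Rightarrow> real)"
      by (subst U[symmetric]) (auto simp: fun_eq_iff indicator_def)
    ultimately show ?thesis using uH g by (simp add: SI_indicator)
  qed
  have tele: "ip (E {..\<Lambda>} u) g = ip (E {..l n} u) g + (\<Sum>i<n. ip (E {l (Suc i)<..l i} u) g)" for n
  proof (induction n)
    case 0
    then show ?case by (simp add: l_def)
  next
    case (Suc n)
    then show ?case using split[of n] by simp
  qed
  let ?R = "K0 * \<Lambda> powr ((d - 2) / 4) * sqrt (energy u) * G"
  let ?e = "\<lambda>n. sqrt (measure (\<mu> u) UNIV) * (sqrt C * \<Lambda> powr (d / 4) * G) * (2 powr (- (d / 4))) ^ n"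
  have "cmod (ip (E {..\<Lambda>} u) g) \<le> ?e n + ?R" for n
  proof -
    have "cmod (ip (E {..l n} u) g) \<le> sqrt (measure (\<mu> u) {..l n}) * (sqrt C * l n powr (d / 4) * G)"
      unfolding G_def by (rule ip_E_le[OF _ _ lpos uH g]) auto
    also have "\<dots> \<le> sqrt (measure (\<mu> u) UNIV) * (sqrt C * l n powr (d / 4) * G)"
      using G0 C uH by (intro mult_right_mono real_sqrt_le_mono finite_measure.finite_measure_mono) auto
    finally have a: "cmod (ip (E {..l n} u) g) \<le> ?e n" by (simp add: lpow mult_ac)
    have "cmod (\<Sum>i<n. ip (E {l (Suc i)<..l i} u) g)
        \<le> (\<Sum>i<n. sqrt (2 * C) * \<Lambda> powr ((d - 2) / 4) * sqrt (energy u) * G * \<rho> ^ i)"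
      by (intro sum_norm_le band)
    also have "\<dots> = sqrt (2 * C) * \<Lambda> powr ((d - 2) / 4) * sqrt (energy u) * G * (\<Sum>i<n. \<rho> ^ i)"
      by (simp add: sum_distrib_left)
    also have "\<dots> \<le> sqrt (2 * C) * \<Lambda> powr ((d - 2) / 4) * sqrt (energy u) * G * (1 / (1 - \<rho>))"
    proof (intro mult_left_mono)
      have "(\<Sum>i<n. \<rho> ^ i) \<le> (\<Sum>i. \<rho> ^ i)" using \<rho> by (intro sum_le_suminf) (auto intro: summable_geometric)
      also have "\<dots> = 1 / (1 - \<rho>)" using \<rho> by (intro suminf_geometric) auto
      finally show "(\<Sum>i<n. \<rho> ^ i) \<le> 1 / (1 - \<rho>)" .
    qed (use G0 C in auto)
    also have "\<dots> = ?R" by (simp add: K0_def \<rho>_def)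
    finally have b: "cmod (\<Sum>i<n. ip (E {l (Suc i)<..l i} u) g) \<le> ?R" .
    show ?thesis using a b norm_triangle_ineq[of "ip (E {..l n} u) g" "\<Sum>i<n. ip (E {l (Suc i)<..l i} u) g"]
      unfolding tele[of n] by linarith
  qed
  moreover have "(\<lambda>n. ?e n + ?R) \<longlonglongrightarrow>
      sqrt (measure (\<mu> u) UNIV) * (sqrt C * \<Lambda> powr (d / 4) * G) * 0 + ?R"
  proof (intro tendsto_add tendsto_mult tendsto_const LIMSEQ_realpow_zero)
    have "2 powr (- (d / 4)) < 2 powr 0" using d by (intro powr_less_mono) auto
    then show "2 powr (- (d / 4)) < 1" by simp
  qed simp
  ultimately have "cmod (ip (E {..\<Lambda>} u) g)
      \<le> sqrt (measure (\<mu> u) UNIV) * (sqrt C * \<Lambda> powr (d / 4) * G) * 0 + ?R"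
    by (intro LIMSEQ_le_const) auto
  then show "cmod (ip (E {..\<Lambda>} u) g)
      \<le> K0 * \<Lambda> powr ((d - 2) / 4) * sqrt (energy u) * (LINT x|\<sigma>. cmod (g x))"
    by (simp add: G_def)
qed

end

section \<open>The Rumin--Frank inequality\<close>

context spectral_bound begin

text \<open>Apply \<open>low_energy_bounded\<close> to \<open>\<Sum> c\<^sub>i f\<^sub>i\<close> and choose the best \<open>c\<close> separately at every point.  This gains over adding
  up the \<open>N\<close> individual bounds: the result is independent of \<open>N\<close>.\<close>

lemma low_energy_bounded_family:
  assumes l: "\<Lambda> > 0" and f: "\<And>i. i < (N::nat) \<Longrightarrow> f i \<in> dom sqrt"
    and gram: "\<And>c. energy (\<Sum>i<N. fscale (c i) (f i)) \<le> 2 * (\<Sum>i<N. (cmod (c i))\<^sup>2)"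
  shows "AE x in \<sigma>. (\<Sum>i<N. (cmod (E {..\<Lambda>} (f i) x))\<^sup>2) \<le> 2 * K0\<^sup>2 * \<Lambda> powr ((d - 2) / 2)"
proof -
  define M where "M = K0 * \<Lambda> powr ((d - 2) / 4) * sqrt 2"
  have M0: "M \<ge> 0" using K0_pos by (simp add: M_def)
  have M2: "M\<^sup>2 = 2 * K0\<^sup>2 * \<Lambda> powr ((d - 2) / 2)"
  proof -
    have "(\<Lambda> powr ((d - 2) / 4))\<^sup>2 = \<Lambda> powr ((d - 2) / 2)"
      using l by (simp add: power2_eq_square powr_add[symmetric])
    then show ?thesis by (simp add: M_def power_mult_distrib)
  qed
  obtain D :: "complex set" where D: "countable D" "\<And>X. open X \<Longrightarrow> X \<noteq> {} \<Longrightarrow> \<exists>d\<in>D. d \<in> X"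
    using countable_dense_exists by blast
  define P where "P = PiE {..<N} (\<lambda>_. D)"
  have cP: "countable P" unfolding P_def using D(1) by (intro countable_PiE) auto
  have fH: "f i \<in> \<H>" if "i < N" for i using f[OF that] by (rule dom_subset)
  have "AE x in \<sigma>. cmod (\<Sum>i<N. c i * E {..\<Lambda>} (f i) x) \<le> M * sqrt (\<Sum>i<N. (cmod (c i))\<^sup>2)" for c
  proof -
    let ?z = "\<Sum>i<N. fscale (c i) (f i)"
    have zd: "?z \<in> dom sqrt" using f by (intro En.sum_mem En.scale_mem) auto
    have "sqrt (energy ?z) \<le> sqrt 2 * sqrt (\<Sum>i<N. (cmod (c i))\<^sup>2)"
      using gram[of c] by (simp add: real_sqrt_mult[symmetric])
    then have le: "K0 * \<Lambda> powr ((d - 2) / 4) * sqrt (energy ?z)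
        \<le> K0 * \<Lambda> powr ((d - 2) / 4) * (sqrt 2 * sqrt (\<Sum>i<N. (cmod (c i))\<^sup>2))"
      using K0_pos by (intro mult_left_mono) auto
    have "AE x in \<sigma>. E {..\<Lambda>} ?z x = (\<Sum>i<N. c i * E {..\<Lambda>} (f i) x)"
      by (rule E_sum_AE) (use fH in auto)
    with low_energy_bounded[OF l zd] show ?thesis
      by eventually_elim (use le in \<open>simp add: M_def mult.assoc\<close>)
  qed
  then have "AE x in \<sigma>. \<forall>c\<in>P. cmod (\<Sum>i<N. c i * E {..\<Lambda>} (f i) x) \<le> M * sqrt (\<Sum>i<N. (cmod (c i))\<^sup>2)"
    using cP by (simp add: AE_ball_countable)
  then show ?thesis
  proof eventually_elim
    case (elim x)
    have "(\<Sum>i<N. (cmod (E {..\<Lambda>} (f i) x))\<^sup>2) \<le> M\<^sup>2"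
      by (rule vector_norm_le_by_dense[OF D(2) M0]) (use elim in \<open>auto simp: P_def\<close>)
    then show ?case by (simp only: M2)
  qed
qed

text \<open>\<open>\<Sum>\<^sub>k 2\<^sup>k \<parallel>u - E(-\<infinity>, 2\<^sup>k] u\<parallel>\<^sup>2\<close> is the integral of \<open>\<Sum>\<^sub>k 2\<^sup>k 1(s > 2\<^sup>k) \<le> 2 \<bar>s\<bar>\<close> against the measure of \<open>u\<close>.  The
  integers \<open>k\<close> are enumerated by \<open>int_decode\<close>.\<close>

lemma high_energy_sum:
  assumes u: "u \<in> dom sqrt"
  shows "(\<Sum>n. ennreal (2 powr real_of_int (int_decode n) *
    (nrm (u - E {..2 powr real_of_int (int_decode n)} u))\<^sup>2)) \<le> ennreal (2 * energy u)"
proof (rule suminf_le_const)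
  note uH = dom_subset[OF u]
  let ?p = "\<lambda>n. 2 powr real_of_int (int_decode n)"
  fix m :: nat
  have term_eq: "?p n * (nrm (u - E {..?p n} u))\<^sup>2 = (LINT s|\<mu> u. ?p n * indicator {?p n<..} s)" for n
  proof -
    have "- {..?p n} = {?p n<..}" by auto
    then show ?thesis using nrm_diff_E[OF _ uH, of "{..?p n}"] by simp
  qed
  have i: "integrable (\<mu> u) (\<lambda>s. ?p n * indicator {?p n<..} s)" for n
    using uH by (intro integrable_\<mu> bounded_borel_mult) auto
  have "(\<Sum>n<m. ?p n * (nrm (u - E {..?p n} u))\<^sup>2) = (LINT s|\<mu> u. (\<Sum>n<m. ?p n * indicator {?p n<..} s))"
    unfolding term_eq using i by (subst Bochner_Integration.integral_sum) auto
  also have "\<dots> \<le> (LINT s|\<mu> u. 2 * \<bar>s\<bar>)"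
  proof (rule integral_mono)
    show "integrable (\<mu> u) (\<lambda>s. \<Sum>n<m. ?p n * indicator {?p n<..} s)"
      by (intro Bochner_Integration.integrable_sum i)
    show "integrable (\<mu> u) (\<lambda>s. 2 * \<bar>s\<bar>)" using energy_integrable[OF u] by simp
    fix s :: real
    have "(\<Sum>n<m. ?p n * indicator {?p n<..} s) = (\<Sum>n<m. if ?p n < s then ?p n else 0)"
      by (intro sum.cong refl) (simp add: indicator_def)
    also have "\<dots> = (\<Sum>k\<in>int_decode ` {..<m}. if 2 powr real_of_int k < s then 2 powr real_of_int k else 0)"
      by (subst sum.reindex) (auto simp: inj_int_decode)
    also have "\<dots> \<le> 2 * \<bar>s\<bar>" by (rule sum_powers_of_two_below) simp
    finally show "(\<Sum>n<m. ?p n * indicator {?p n<..} s) \<le> 2 * \<bar>s\<bar>" .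
  qed
  also have "\<dots> = 2 * energy u" by (simp add: energy_def)
  finally show "(\<Sum>n<m. ennreal (?p n * (nrm (u - E {..?p n} u))\<^sup>2)) \<le> ennreal (2 * energy u)"
    by (subst sum_ennreal) (auto intro: ennreal_leI)
qed simp

text \<open>The dyadic energy \<open>2\<^sup>k\<close> is chosen such that the low-energy part accounts for at most a quarter
  of \<open>\<rho>\<close>; then the high-energy part carries a fixed share of it.\<close>

lemma high_energy_dominates:
  fixes \<rho> B :: real and low high :: "int \<Rightarrow> real"
  assumes B: "B > 0" and \<rho>: "\<rho> > 0"
    and low: "\<And>k. low k \<le> B * (2 powr real_of_int k) powr ((d - 2) / 2)"
    and split: "\<And>k. \<rho> \<le> 2 * high k + 2 * low k"
  shows "\<exists>k. \<rho> powr (d / (d - 2)) \<le> 8 * (4 * B) powr (2 / (d - 2)) * (2 powr real_of_int k * high k)"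
proof -
  define \<theta> where "\<theta> = 2 / (d - 2)"
  have \<theta>: "\<theta> > 0" "\<theta> * ((d - 2) / 2) = 1" "d / (d - 2) = 1 + \<theta>"
    using d by (auto simp: \<theta>_def field_simps)
  define y where "y = (\<rho> / (4 * B)) powr \<theta>"
  have y: "y > 0" using \<rho> B by (simp add: y_def)
  \<comment> \<open>At the energy \<open>y\<close> the bound for the low-energy part would be exactly \<open>\<rho> / 4\<close>; rounding down to a power of 2
    costs a factor 2.\<close>
  define k where "k = \<lfloor>log 2 y\<rfloor>"
  have k1: "2 powr real_of_int k \<le> y"
  proof -
    have "2 powr real_of_int k \<le> 2 powr (log 2 y)" by (intro powr_mono) (auto simp: k_def)
    then show ?thesis using y by simp
  qed
  have k2: "y < 2 * 2 powr real_of_int k"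
  proof -
    have "2 powr (log 2 y) < 2 powr (real_of_int k + 1)" by (intro powr_less_mono) (auto simp: k_def)
    then show ?thesis using y by (simp add: powr_add)
  qed
  have "(2 powr real_of_int k) powr ((d - 2) / 2) \<le> y powr ((d - 2) / 2)"
    using k1 d by (intro powr_mono2) auto
  also have "\<dots> = \<rho> / (4 * B)" using \<theta>(2) \<rho> B by (simp add: y_def powr_powr)
  finally have "low k \<le> B * (\<rho> / (4 * B))" using low[of k] B by (smt (verit) mult_left_mono)
  then have "low k \<le> \<rho> / 4" using B by simp
  then have hk: "\<rho> \<le> 4 * high k" using split[of k] by linarith
  have "\<rho> powr (d / (d - 2)) = \<rho> powr \<theta> * \<rho>" using \<rho> by (simp add: \<theta>(3) powr_add)
  also have "\<rho> powr \<theta> = (4 * B) powr \<theta> * y" using \<rho> B by (simp add: y_def powr_divide)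
  also have "(4 * B) powr \<theta> * y * \<rho> \<le> (4 * B) powr \<theta> * (2 * 2 powr real_of_int k) * (4 * high k)"
    using k2 hk y \<rho> by (intro mult_mono) auto
  finally have "\<rho> powr (d / (d - 2)) \<le> 8 * (4 * B) powr (2 / (d - 2)) * (2 powr real_of_int k * high k)"
    by (simp add: \<theta>_def mult_ac)
  then show ?thesis by blast
qed

text \<open>With \<open>B = 2 K0\<^sup>2\<close>, the constant of \<open>high_energy_dominates\<close> is \<open>8 (8 K0\<^sup>2)\<^bsup>2/(d-2)\<^esup>\<close>.  A further factor 4 arises because
  each function has energy at most 2, and hence a high-energy sum of at most 4.\<close>

definition CLR_const :: real where "CLR_const = 32 * (8 * K0\<^sup>2) powr (2 / (d - 2))"

lemma CLR_const_pos: "CLR_const > 0"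
  using K0_pos by (simp add: CLR_const_def)

text \<open>Up to a constant, \<open>\<rho>\<^bsup>d/(d-2)\<^esup>\<close> is at each point at most \<open>2\<^sup>k\<close> times the high-energy part of \<open>\<rho>\<close> above \<open>2\<^sup>k\<close>, for some \<open>k\<close>
  that depends on the point.  Summing over all \<open>k\<close> removes this dependence and leaves \<open>\<Sum> high_energy_sum\<close>.
  For a system that is orthonormal in energy the Gram hypothesis holds with 1 in place of 2; the slack admits
  systems that only approximate an orthonormal one.\<close>

theorem rumin_frank:
  assumes f: "\<And>i. i < (N::nat) \<Longrightarrow> f i \<in> dom sqrt"
    and gram: "\<And>c. energy (\<Sum>i<N. fscale (c i) (f i)) \<le> 2 * (\<Sum>i<N. (cmod (c i))\<^sup>2)"
  shows "(\<integral>\<^sup>+ x. ennreal ((\<Sum>i<N. (cmod (f i x))\<^sup>2) powr (d / (d - 2))) \<partial>\<sigma>) \<le> ennreal (CLR_const * real N)"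
proof -
  let ?p = "\<lambda>k. 2 powr real_of_int k"
  define low where "low k x = (\<Sum>i<N. (cmod (E {..?p k} (f i) x))\<^sup>2)" for k x
  define high where "high k x = (\<Sum>i<N. (cmod (f i x - E {..?p k} (f i) x))\<^sup>2)" for k x
  define \<rho> where "\<rho> x = (\<Sum>i<N. (cmod (f i x))\<^sup>2)" for x
  define c where "c = 8 * (8 * K0\<^sup>2) powr (2 / (d - 2))"
  have c0: "c > 0" using K0_pos by (simp add: c_def)
  have fH: "f i \<in> \<H>" if "i < N" for i using f[OF that] by (rule dom_subset)
  have hm [measurable]: "(\<lambda>x. cmod (f i x - E {..?p k} (f i) x)) \<in> borel_measurable \<sigma>" if "i < N" for i k
  proof -
    have "f i - E {..?p k} (f i) \<in> \<H>" using fH[OF that] by (intro L2.diff_mem) auto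
    then have "(\<lambda>x. f i x - E {..?p k} (f i) x) \<in> borel_measurable \<sigma>"
      using Lp_measurable by (fastforce simp: fun_diff_def)
    then show ?thesis by measurable
  qed
  have lowb: "AE x in \<sigma>. low k x \<le> 2 * K0\<^sup>2 * ?p k powr ((d - 2) / 2)" for k
    unfolding low_def by (rule low_energy_bounded_family[OF _ f gram]) auto
  have split: "\<rho> x \<le> 2 * high k x + 2 * low k x" for k x
  proof -
    have "(cmod (f i x))\<^sup>2 \<le> 2 * (cmod (f i x - E {..?p k} (f i) x))\<^sup>2 + 2 * (cmod (E {..?p k} (f i) x))\<^sup>2" for i
    proof -
      let ?a = "cmod (f i x - E {..?p k} (f i) x)" and ?b = "cmod (E {..?p k} (f i) x)"
      have "cmod (f i x) \<le> ?a + ?b"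
        using norm_triangle_ineq[of "f i x - E {..?p k} (f i) x" "E {..?p k} (f i) x"] by simp
      then have "(cmod (f i x))\<^sup>2 \<le> (?a + ?b)\<^sup>2" by (intro power_mono) auto
      also have "\<dots> \<le> 2 * ?a\<^sup>2 + 2 * ?b\<^sup>2"
        using zero_le_power2[of "?a - ?b"] by (simp add: power2_sum power2_diff)
      finally show ?thesis .
    qed
    then have "\<rho> x \<le> (\<Sum>i<N. 2 * (cmod (f i x - E {..?p k} (f i) x))\<^sup>2 + 2 * (cmod (E {..?p k} (f i) x))\<^sup>2)"
      unfolding \<rho>_def by (intro sum_mono) auto
    then show ?thesis by (simp add: high_def low_def sum.distrib sum_distrib_left)
  qed
  have "AE x in \<sigma>. \<forall>k. low k x \<le> 2 * K0\<^sup>2 * ?p k powr ((d - 2) / 2)"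
    using lowb by (subst AE_all_countable) blast
  then have pt: "AE x in \<sigma>. ennreal (\<rho> x powr (d / (d - 2)))
      \<le> ennreal c * (\<Sum>n. ennreal (?p (int_decode n) * high (int_decode n) x))"
  proof eventually_elim
    case (elim x)
    show ?case
    proof (cases "\<rho> x = 0")
      case False
      then have r0: "\<rho> x > 0" using sum_nonneg[of "{..<N}" "\<lambda>i. (cmod (f i x))\<^sup>2"] by (fastforce simp: \<rho>_def)
      obtain k where k: "\<rho> x powr (d / (d - 2)) \<le> 8 * (4 * (2 * K0\<^sup>2)) powr (2 / (d - 2)) * (?p k * high k x)"
        using high_energy_dominates[of "2 * K0\<^sup>2" "\<rho> x" "\<lambda>k. low k x" "\<lambda>k. high k x"] K0_pos r0 elim split by auto
      then have "ennreal (\<rho> x powr (d / (d - 2))) \<le> ennreal (c * (?p k * high k x))"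
        by (intro ennreal_leI) (simp add: c_def)
      also have "\<dots> = ennreal c * ennreal (?p k * high k x)"
        using c0 by (intro ennreal_mult) (auto simp: high_def intro!: mult_nonneg_nonneg sum_nonneg)
      also have "ennreal (?p k * high k x) \<le> (\<Sum>n. ennreal (?p (int_decode n) * high (int_decode n) x))"
        using sum_le_suminf[of "\<lambda>n. ennreal (?p (int_decode n) * high (int_decode n) x)" "{int_encode k}"] by simp
      finally show ?thesis by (simp add: mult_left_mono)
    qed simp
  qed
  have hmm [measurable]: "high k \<in> borel_measurable \<sigma>" for k
    unfolding high_def by (intro borel_measurable_sum borel_measurable_power hm) auto
  have int_high: "(\<integral>\<^sup>+ x. ennreal (?p k * high k x) \<partial>\<sigma>) = (\<Sum>i<N. ennreal (?p k * (nrm (f i - E {..?p k} (f i)))\<^sup>2))" for k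
  proof -
    have hi: "has_bochner_integral \<sigma> (\<lambda>x. (cmod (f i x - E {..?p k} (f i) x))\<^sup>2) ((nrm (f i - E {..?p k} (f i)))\<^sup>2)"
      if "i < N" for i
    proof -
      have "f i - E {..?p k} (f i) \<in> \<H>" using fH[OF that] by (intro L2.diff_mem) auto
      from L2_integrable_sq[OF this] show ?thesis by (simp add: has_bochner_integral_iff L2_nrm_sq)
    qed
    have "has_bochner_integral \<sigma> (\<lambda>x. ?p k * high k x) (?p k * (\<Sum>i<N. (nrm (f i - E {..?p k} (f i)))\<^sup>2))"
      unfolding high_def by (intro has_bochner_integral_mult_right has_bochner_integral_sum hi) auto
    then have "(\<integral>\<^sup>+ x. ennreal (?p k * high k x) \<partial>\<sigma>) = ennreal (?p k * (\<Sum>i<N. (nrm (f i - E {..?p k} (f i)))\<^sup>2))"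
      by (subst nn_integral_eq_integral) (auto simp: has_bochner_integral_iff high_def intro!: mult_nonneg_nonneg sum_nonneg)
    then show ?thesis by (subst sum_ennreal) (auto simp: sum_distrib_left)
  qed
  have "(\<integral>\<^sup>+ x. ennreal (\<rho> x powr (d / (d - 2))) \<partial>\<sigma>)
      \<le> (\<integral>\<^sup>+ x. ennreal c * (\<Sum>n. ennreal (?p (int_decode n) * high (int_decode n) x)) \<partial>\<sigma>)"
    by (rule nn_integral_mono_AE[OF pt])
  also have "\<dots> = ennreal c * (\<Sum>n. \<integral>\<^sup>+ x. ennreal (?p (int_decode n) * high (int_decode n) x) \<partial>\<sigma>)"
    by (subst nn_integral_cmult) (auto intro!: arg_cong2[where f="(*)"] nn_integral_suminf)
  also have "(\<Sum>n. \<integral>\<^sup>+ x. ennreal (?p (int_decode n) * high (int_decode n) x) \<partial>\<sigma>)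
      = (\<Sum>i<N. \<Sum>n. ennreal (?p (int_decode n) * (nrm (f i - E {..?p (int_decode n)} (f i)))\<^sup>2))"
    unfolding int_high by (rule suminf_sum) auto
  also have "\<dots> \<le> (\<Sum>i<N. ennreal 4)"
  proof (rule sum_mono)
    fix i assume "i \<in> {..<N}"
    then have i: "i < N" by simp
    have "(\<Sum>j<N. fscale (if j = i then 1 else 0) (f j)) = f i"
      using i by (simp add: fun_eq_iff sum_fun_apply if_distrib[of "\<lambda>c. c * _"] cong: if_cong)
    then have "energy (f i) \<le> 2 * (\<Sum>j<N. (cmod (if j = i then 1 else 0))\<^sup>2)"
      using gram[of "\<lambda>j. if j = i then 1 else 0"] by simp
    also have "(\<Sum>j<N. (cmod (if j = i then 1 else 0))\<^sup>2) = (\<Sum>j<N. if j = i then 1 else 0)"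
      by (intro sum.cong) auto
    also have "\<dots> = 1" using i by simp
    finally have "ennreal (2 * energy (f i)) \<le> ennreal 4" by (intro ennreal_leI) simp
    then show "(\<Sum>n. ennreal (?p (int_decode n) * (nrm (f i - E {..?p (int_decode n)} (f i)))\<^sup>2)) \<le> ennreal 4"
      using high_energy_sum[OF f[OF i]] by (rule order_trans[rotated])
  qed
  also have "\<dots> = ennreal (4 * real N)" by (simp add: ennreal_of_nat_eq_real_of_nat ennreal_mult' mult.commute)
  also have "ennreal c * ennreal (4 * real N) = ennreal (CLR_const * real N)"
    using c0 by (subst ennreal_mult[symmetric]) (auto simp: c_def CLR_const_def)
  finally show ?thesis by (simp add: \<rho>_def mult_left_mono)
qed

text \<open>The case \<open>N = 1\<close>, after dividing by the root of the energy.\<close>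

lemma sobolev:
  assumes f: "f \<in> dom sqrt" and e: "e > 0" "energy f \<le> e"
  shows "Lp_int \<sigma> (2 * d / (d - 2)) f \<le> ennreal (CLR_const * e powr (d / (d - 2)))"
proof -
  let ?q = "d / (d - 2)"
  define g where "g = fscale (of_real (1 / sqrt e)) f"
  have gd: "g \<in> dom sqrt" unfolding g_def by (rule En.scale_mem[OF f])
  have en: "energy (fscale c g) \<le> (cmod c)\<^sup>2" for c
  proof -
    have "energy (fscale c g) = (cmod c)\<^sup>2 * (energy f / e)"
      using e f gd by (simp add: En_nrm_sq[symmetric] En.nrm_scale g_def norm_divide power_mult_distrib power_divide)
    also have "\<dots> \<le> (cmod c)\<^sup>2 * 1" using e by (intro mult_left_mono) auto
    finally show ?thesis by simp
  qed
  have "(\<integral>\<^sup>+ x. ennreal ((\<Sum>i<Suc 0. (cmod (g x))\<^sup>2) powr ?q) \<partial>\<sigma>) \<le> ennreal (CLR_const * real (Suc 0))"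
  proof (rule rumin_frank)
    show "energy (\<Sum>i<Suc 0. fscale (c i) g) \<le> 2 * (\<Sum>i<Suc 0. (cmod (c i))\<^sup>2)" for c
    proof -
      have "energy (fscale (c 0) g) \<le> 2 * (cmod (c 0))\<^sup>2" by (rule order_trans[OF en]) simp
      then show ?thesis by simp
    qed
  qed (use gd in simp)
  moreover have "((cmod (g x))\<^sup>2) powr ?q = cmod (g x) powr (2 * d / (d - 2))" for x
    by (simp add: powr_powr flip: powr_numeral)
  ultimately have 1: "Lp_int \<sigma> (2 * d / (d - 2)) g \<le> ennreal CLR_const" by (simp add: Lp_int_def)
  have fg: "f = fscale (of_real (sqrt e)) g" using e by (simp add: g_def fun_eq_iff)
  have "Lp_int \<sigma> (2 * d / (d - 2)) f = ennreal (sqrt e powr (2 * d / (d - 2))) * Lp_int \<sigma> (2 * d / (d - 2)) g"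
    using e Lp_measurable[OF dom_subset[OF gd]] by (subst fg, subst Lp_int_fscale) auto
  also have "sqrt e powr (2 * d / (d - 2)) = e powr ?q"
    using e by (simp add: powr_half_sqrt[symmetric] powr_powr)
  also have "ennreal (e powr ?q) * Lp_int \<sigma> (2 * d / (d - 2)) g \<le> ennreal (e powr ?q) * ennreal CLR_const"
    using 1 by (rule mult_left_mono) simp
  also have "\<dots> = ennreal (CLR_const * e powr ?q)"
    using CLR_const_pos by (simp add: ennreal_mult[symmetric] mult.commute)
  finally show ?thesis .
qed

end

section \<open>From the heat kernel to spectral projections\<close>

text \<open>On \<open>s \<le> 1/t\<close> one has \<open>1 \<le> e e\<^bsup>-ts\<^esup>\<close>, so the left-hand side is at most \<open>e \<langle>e\<^bsup>-tA\<^esup> g, g\<rangle>\<close>, which a kernel bounded by \<open>K\<close>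
  bounds by \<open>e K \<parallel>g\<parallel>\<^sub>1\<^sup>2\<close>.\<close>

lemma heat_bound_low_energy:
  fixes g :: "'a fn"
  assumes sf: "sigma_finite_measure \<sigma>" and E: "pvm \<sigma> E" and A: "A = spectral_integral \<sigma> E (\<lambda>s. s)"
    and t: "t > 0" and hb: "heat_bound \<sigma> A t < ennreal K" and K: "K > 0"
    and g: "g \<in> Lp \<sigma> 1" "g \<in> Lp \<sigma> 2"
  shows "measure (scalar_measure \<sigma> E g) {..1 / t} \<le> exp 1 * K * (LINT x|\<sigma>. cmod (g x))\<^sup>2"
proof -
  interpret pvm \<sigma> E by fact
  interpret sigma_finite_measure \<sigma> by fact
  interpret pair_sigma_finite \<sigma> \<sigma> ..
  define G where "G = (LINT x|\<sigma>. cmod (g x))"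
  have gi: "integrable \<sigma> (\<lambda>x. cmod (g x))" using g(1) by (simp add: Lp_def)
  let ?f = "\<lambda>s. exp (- t * s)"
  have fm: "?f \<in> borel_measurable borel" by measurable
  have ex: "exp_op \<sigma> A t = graph ?f" unfolding exp_op_def by (rule fun_calc_eq[OF E A fm])
  obtain P where P: "integral_kernel \<sigma> (exp_op \<sigma> A t) P"
    and Pb: "esssup (\<sigma> \<Otimes>\<^sub>M \<sigma>) (\<lambda>z. ennreal (norm (P z))) < ennreal K"
    using hb unfolding heat_bound_def INF_less_iff by blast
  define v where "v x = (LINT y|\<sigma>. P (x, y) * g y)" for x
  have gv: "(g, v) \<in> graph ?f" using P g unfolding integral_kernel_def ex v_def by blast
  have vH: "v \<in> \<H>" and gd: "g \<in> dom ?f" using gv by (auto simp: graph_iff)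
  have "AE z in \<sigma> \<Otimes>\<^sub>M \<sigma>. norm (P z) \<le> K"
    using esssup_AE[of "\<lambda>z. ennreal (norm (P z))" "\<sigma> \<Otimes>\<^sub>M \<sigma>"]
  proof eventually_elim
    case (elim z)
    then have "ennreal (norm (P z)) \<le> ennreal K" using Pb by (meson le_less_trans less_imp_le)
    then show ?case using K by simp
  qed
  then have "AE x in \<sigma>. AE y in \<sigma>. norm (P (x, y)) \<le> K" by (rule AE_pair)
  then have vb: "AE x in \<sigma>. cmod (v x) \<le> K * G"
  proof eventually_elim
    case (elim x)
    show ?case
    proof (cases "integrable \<sigma> (\<lambda>y. P (x, y) * g y)")
      case True
      have "cmod (v x) \<le> (LINT y|\<sigma>. cmod (P (x, y) * g y))" unfolding v_def by (rule integral_norm_bound)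
      also have "\<dots> \<le> (LINT y|\<sigma>. K * cmod (g y))"
      proof (rule integral_mono_AE)
        show "AE y in \<sigma>. cmod (P (x, y) * g y) \<le> K * cmod (g y)"
          using elim by eventually_elim (simp add: norm_mult mult_right_mono)
      qed (use True gi in auto)
      finally show ?thesis by (simp add: G_def)
    next
      case False
      then show ?thesis using K by (simp add: v_def not_integrable_integral_eq G_def)
    qed
  qed
  have "complex_of_real (LINT s|\<mu> g. ?f s) = ip v g"
    using gv gd SI_self_dom[OF fm gd] by (simp add: graph_iff)
  then have "(LINT s|\<mu> g. ?f s) \<le> cmod (ip v g)"
    by (metis abs_ge_self norm_of_real)
  also have "\<dots> \<le> (LINT x|\<sigma>. cmod (v x * cnj (g x)))"
    unfolding L2_inner_def by (rule integral_norm_bound)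
  also have "\<dots> \<le> (LINT x|\<sigma>. K * G * cmod (g x))"
  proof (rule integral_mono_AE)
    show "integrable \<sigma> (\<lambda>x. cmod (v x * cnj (g x)))"
      using L2_integrable_mult[OF vH g(2)] by (rule integrable_norm)
    show "AE x in \<sigma>. cmod (v x * cnj (g x)) \<le> K * G * cmod (g x)"
      using vb by eventually_elim (simp add: norm_mult mult_right_mono)
  qed (use gi in simp)
  also have "\<dots> = K * G\<^sup>2" by (simp add: G_def power2_eq_square)
  finally have up: "(LINT s|\<mu> g. ?f s) \<le> K * G\<^sup>2" .
  have "exp (-1) * measure (\<mu> g) {..1 / t} = (LINT s|\<mu> g. exp (-1) * indicator {..1 / t} s)" by simp
  also have "\<dots> \<le> (LINT s|\<mu> g. ?f s)"
  proof (rule integral_mono)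
    show "integrable (\<mu> g) (\<lambda>s. exp (- 1 :: real) * indicator {..1 / t} s)"
      using g(2) by (intro integrable_\<mu> bounded_borel_mult) auto
    show "integrable (\<mu> g) ?f" by (rule dom_integrable[OF fm gd])
    fix s
    show "exp (- 1) * indicator {..1 / t} s \<le> ?f s"
    proof (cases "s \<le> 1 / t")
      case True
      then have "t * s \<le> 1" using t by (simp add: field_simps)
      then show ?thesis using True by simp
    qed simp
  qed
  finally have "exp (-1) * measure (\<mu> g) {..1 / t} \<le> K * G\<^sup>2" using up by linarith
  then have "exp 1 * (exp (-1) * measure (\<mu> g) {..1 / t}) \<le> exp 1 * (K * G\<^sup>2)" by (intro mult_left_mono) auto
  moreover have "exp 1 * (exp (-1) * measure (\<mu> g) {..1 / t}) = measure (\<mu> g) {..1 / t}"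
    by (simp add: mult.assoc[symmetric] exp_add[symmetric])
  ultimately show ?thesis by (simp add: G_def mult.assoc)
qed

text \<open>Since \<open>\<delta> \<le> d \<le> D\<close>, the two asymptotic bounds give \<open>O(\<Lambda>\<^bsup>d/2\<^esup>)\<close> for high and for low
  energies \<open>\<Lambda> = 1/t\<close>; in between the left-hand side is increasing in \<open>\<Lambda>\<close>.\<close>

lemma heat_bounds_spectral_bound:
  fixes \<sigma> :: "'a measure"
  assumes sf: "sigma_finite_measure \<sigma>" and E: "pvm \<sigma> E" and A: "A = spectral_integral \<sigma> E (\<lambda>s. s)"
    and short: "\<exists>C. \<forall>\<^sub>F t in at_right 0. heat_bound \<sigma> A t \<le> ennreal (C * t powr (- \<delta> / 2))"
    and long: "\<exists>C. \<forall>\<^sub>F t in at_top. heat_bound \<sigma> A t \<le> ennreal (C * t powr (- D / 2))"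
    and d: "\<delta> \<le> d" "d \<le> D" "d > 2"
  shows "\<exists>C. spectral_bound \<sigma> E d C"
proof -
  interpret pvm \<sigma> E by fact
  obtain C0 where "\<forall>\<^sub>F t in at_right 0. heat_bound \<sigma> A t \<le> ennreal (C0 * t powr (- \<delta> / 2))"
    using short by blast
  then obtain t0 where t0: "t0 > 0"
    "\<And>t. 0 < t \<Longrightarrow> t < t0 \<Longrightarrow> heat_bound \<sigma> A t \<le> ennreal (C0 * t powr (- \<delta> / 2))"
    unfolding eventually_at_right_field by blast
  obtain C1 where "\<forall>\<^sub>F t in at_top. heat_bound \<sigma> A t \<le> ennreal (C1 * t powr (- D / 2))"
    using long by blast
  then obtain t1 where t1: "\<And>t. t \<ge> t1 \<Longrightarrow> heat_bound \<sigma> A t \<le> ennreal (C1 * t powr (- D / 2))"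
    unfolding eventually_at_top_linorder by blast
  define a where "a = max 2 (2 / t0)"
  \<comment> \<open>Energies above \<open>a \<ge> 1\<close> are high, those below \<open>b \<le> 1\<close> are low; the powers of \<open>\<Lambda>\<close> with different exponents compare
    accordingly.\<close>
  define b where "b = min 1 (1 / max 1 t1)"
  define M where "M = max 1 (max C0 C1) + 1"
  have M: "M > 0" "C0 < M" "C1 < M" by (auto simp: M_def)
  have a: "a > 1" "1 / a < t0"
  proof -
    show "a > 1" by (simp add: a_def)
    have "2 / t0 \<le> a" by (simp add: a_def)
    then have "1 / t0 < a" using t0(1) by (smt (verit) divide_strict_right_mono)
    then show "1 / a < t0" using t0(1) \<open>a > 1\<close> by (simp add: field_simps)
  qed
  have b: "0 < b" "b \<le> 1" by (auto simp: b_def)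
  have main: "measure (\<mu> g) {..\<Lambda>} \<le> exp 1 * (M * \<Lambda> powr (d / 2)) * (LINT x|\<sigma>. cmod (g x))\<^sup>2"
    if L: "\<Lambda> > 0" "\<Lambda> \<ge> a \<or> \<Lambda> \<le> b" and g: "g \<in> Lp \<sigma> 1" "g \<in> Lp \<sigma> 2" for \<Lambda> and g :: "'a fn"
  proof -
    have lt: "ennreal (c * (1 / \<Lambda>) powr (- e / 2)) < ennreal (M * \<Lambda> powr (d / 2))"
      if "c < M" "\<Lambda> powr (e / 2) \<le> \<Lambda> powr (d / 2)" for c e
    proof (rule ennreal_lessI)
      have "(1 / \<Lambda>) powr (- e / 2) = \<Lambda> powr (e / 2)"
        using L(1) by (simp add: powr_divide powr_minus field_simps)
      moreover have "c * \<Lambda> powr (e / 2) < M * \<Lambda> powr (e / 2)" using that(1) L(1) by simp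
      moreover have "M * \<Lambda> powr (e / 2) \<le> M * \<Lambda> powr (d / 2)" using that(2) M(1) by simp
      ultimately show "c * (1 / \<Lambda>) powr (- e / 2) < M * \<Lambda> powr (d / 2)" by simp
    qed (use M L(1) in simp)
    have hb: "heat_bound \<sigma> A (1 / \<Lambda>) < ennreal (M * \<Lambda> powr (d / 2))"
    proof (cases "\<Lambda> \<ge> a")
      case True
      have "1 / \<Lambda> \<le> 1 / a" using True a(1) by (intro divide_left_mono) auto
      then have "heat_bound \<sigma> A (1 / \<Lambda>) \<le> ennreal (C0 * (1 / \<Lambda>) powr (- \<delta> / 2))"
        using a(2) L(1) by (intro t0(2)) auto
      also have "\<dots> < ennreal (M * \<Lambda> powr (d / 2))"
        using True a(1) d by (intro lt M powr_mono) auto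
      finally show ?thesis .
    next
      case False
      then have Lb: "\<Lambda> \<le> b" using L(2) by simp
      have "\<Lambda> \<le> 1 / max 1 t1" using Lb by (simp add: b_def)
      moreover have "max 1 t1 > 0" by simp
      ultimately have "max 1 t1 * \<Lambda> \<le> 1" by (simp only: pos_le_divide_eq mult.commute)
      then have "max 1 t1 \<le> 1 / \<Lambda>" using L(1) by (simp only: pos_le_divide_eq)
      then have "heat_bound \<sigma> A (1 / \<Lambda>) \<le> ennreal (C1 * (1 / \<Lambda>) powr (- D / 2))"
        by (intro t1) simp
      also have "\<dots> < ennreal (M * \<Lambda> powr (d / 2))"
        using Lb b L(1) d by (intro lt M powr_mono') auto
      finally show ?thesis .
    qed
    have "measure (\<mu> g) {..1 / (1 / \<Lambda>)} \<le> exp 1 * (M * \<Lambda> powr (d / 2)) * (LINT x|\<sigma>. cmod (g x))\<^sup>2"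
      by (rule heat_bound_low_energy[OF sf E A _ hb _ g]) (use L(1) M(1) in auto)
    then show ?thesis by simp
  qed
  define C where "C = exp 1 * M * max 1 ((a / b) powr (d / 2))"
  have MC: "exp 1 * M \<le> C" "exp 1 * M * (a / b) powr (d / 2) \<le> C"
    using M by (simp_all add: C_def)
  have low: "measure (\<mu> g) {..\<Lambda>} \<le> C * \<Lambda> powr (d / 2) * (LINT x|\<sigma>. cmod (g x))\<^sup>2"
    if L: "\<Lambda> > 0" and g: "g \<in> Lp \<sigma> 1" "g \<in> Lp \<sigma> 2" for \<Lambda> and g :: "'a fn"
  proof (cases "\<Lambda> \<ge> a \<or> \<Lambda> \<le> b")
    case True
    have "exp 1 * (M * \<Lambda> powr (d / 2)) * (LINT x|\<sigma>. cmod (g x))\<^sup>2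
        \<le> C * \<Lambda> powr (d / 2) * (LINT x|\<sigma>. cmod (g x))\<^sup>2"
      using MC(1) unfolding mult.assoc[symmetric] by (intro mult_right_mono) auto
    then show ?thesis using main[OF L True g] by linarith
  next
    case False
    then have L2: "b < \<Lambda>" "\<Lambda> < a" by auto
    have "measure (\<mu> g) {..\<Lambda>} \<le> measure (\<mu> g) {..a}"
      using L2 g by (intro finite_measure.finite_measure_mono) auto
    also have "\<dots> \<le> exp 1 * (M * a powr (d / 2)) * (LINT x|\<sigma>. cmod (g x))\<^sup>2"
      using a(1) g by (intro main) auto
    also have "\<dots> \<le> C * \<Lambda> powr (d / 2) * (LINT x|\<sigma>. cmod (g x))\<^sup>2"
    proof (intro mult_right_mono)
      have "a powr (d / 2) \<le> (a / b * \<Lambda>) powr (d / 2)"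
        using a b L2 d by (intro powr_mono2) (auto simp: field_simps)
      also have "\<dots> = (a / b) powr (d / 2) * \<Lambda> powr (d / 2)" using a b L by (intro powr_mult) 
      finally have "exp 1 * M * a powr (d / 2) \<le> exp 1 * M * ((a / b) powr (d / 2) * \<Lambda> powr (d / 2))"
        using M(1) by (intro mult_left_mono) auto
      also have "\<dots> \<le> C * \<Lambda> powr (d / 2)"
        using MC(2) mult_right_mono[of "exp 1 * M * (a / b) powr (d / 2)" C "\<Lambda> powr (d / 2)"] by (simp add: mult.assoc)
      finally show "exp 1 * (M * a powr (d / 2)) \<le> C * \<Lambda> powr (d / 2)" by (simp add: mult.assoc)
    qed simp
    finally show ?thesis .
  qed
  have C0: "C > 0" by (rule less_le_trans[OF _ MC(1)]) (use M(1) in simp)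
  have "spectral_bound \<sigma> E d C"
    by (rule spectral_bound.intro[OF E spectral_bound_axioms.intro[OF sf d(3) C0 low]])
  then show ?thesis by blast
qed

section \<open>Closability of the energy with respect to \<open>L\<^sup>p\<close>\<close>

definition of_re :: "'a fn \<Rightarrow> 'a fn" where "of_re u = (\<lambda>x. of_real (Re (u x)))"
definition of_im :: "'a fn \<Rightarrow> 'a fn" where "of_im u = (\<lambda>x. of_real (Im (u x)))"
definition of_abs :: "'a fn \<Rightarrow> 'a fn" where "of_abs u = (\<lambda>x. of_real (cmod (u x)))"

lemma L2_parts [simp]:
  assumes "u \<in> Lp \<sigma> 2" shows "of_re u \<in> Lp \<sigma> 2" "of_im u \<in> Lp \<sigma> 2" "of_abs u \<in> Lp \<sigma> 2"
proof -
  note [measurable] = Lp_measurable[OF assms]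
  show "of_re u \<in> Lp \<sigma> 2"
  proof (rule Lp_bound[OF _ assms])
    show "of_re u \<in> borel_measurable \<sigma>" unfolding of_re_def by measurable
  qed (auto simp: of_re_def abs_Re_le_cmod)
  show "of_im u \<in> Lp \<sigma> 2"
  proof (rule Lp_bound[OF _ assms])
    show "of_im u \<in> borel_measurable \<sigma>" unfolding of_im_def by measurable
  qed (auto simp: of_im_def abs_Im_le_cmod)
  show "of_abs u \<in> Lp \<sigma> 2"
  proof (rule Lp_bound[OF _ assms])
    show "of_abs u \<in> borel_measurable \<sigma>" unfolding of_abs_def by measurable
  qed (auto simp: of_abs_def)
qed

lemma L2_inner_nonneg_Reals:
  assumes u: "u \<in> Lp \<sigma> 2" and v: "v \<in> Lp \<sigma> 2"
    and "AE x in \<sigma>. u x \<in> nonneg_Reals" "AE x in \<sigma>. v x \<in> nonneg_Reals"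
  shows "0 \<le> Re (L2_inner \<sigma> u v)"
proof -
  have "Re (L2_inner \<sigma> u v) = (LINT x|\<sigma>. Re (u x * cnj (v x)))"
    unfolding L2_inner_def using L2_integrable_mult[OF u v] by (rule integral_Re[symmetric])
  also have "\<dots> \<ge> 0"
  proof (rule integral_nonneg_AE)
    show "AE x in \<sigma>. 0 \<le> Re (u x * cnj (v x))"
      using assms(3,4) by eventually_elim (auto simp: complex_nonneg_Reals_iff)
  qed
  finally show ?thesis .
qed

lemma L2_inner_real:
  assumes "AE x in \<sigma>. Im (u x) = 0" "AE x in \<sigma>. Im (v x) = 0" "u \<in> Lp \<sigma> 2" "v \<in> Lp \<sigma> 2"
  shows "Im (L2_inner \<sigma> u v) = 0"
proof -
  have "Im (L2_inner \<sigma> u v) = (LINT x|\<sigma>. Im (u x * cnj (v x)))"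
    unfolding L2_inner_def using L2_integrable_mult[OF assms(3,4)] by (rule integral_Im[symmetric])
  also have "\<dots> = 0"
    by (rule integral_eq_zero_AE) (use assms(1,2) in \<open>eventually_elim, simp\<close>)
  finally show ?thesis .
qed

lemma L2_AE_eq:
  assumes "u \<in> Lp \<sigma> 2" "v \<in> Lp \<sigma> 2" "\<And>w. w \<in> Lp \<sigma> 2 \<Longrightarrow> L2_inner \<sigma> u w = L2_inner \<sigma> v w"
  shows "AE x in \<sigma>. u x = v x"
proof -
  have "L2.nrm \<sigma> (u - v) = 0"
    by (rule L2.nrm_eq_0_if_weak) (use assms in \<open>auto simp: L2.ip_diff_left\<close>)
  then have "AE x in \<sigma>. (u - v) x = 0" using L2_nrm_eq_0[of "u - v" \<sigma>] assms by simp
  then show ?thesis by eventually_elim simp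
qed

locale positive_semigroup = spectral_bound +
  assumes positive: "\<And>t. t > 0 \<Longrightarrow> positivity_preserving \<sigma> (graph (\<lambda>s. exp (- t * s)))"
begin

text \<open>The symbol of \<open>e\<^bsup>-tA\<^esup>\<close>, made bounded by cutting off the negative half-line, which the spectral measure does not
  charge.\<close>

definition h :: "real \<Rightarrow> real \<Rightarrow> real"
  where "h t s = exp (- t * s) * indicator {0<..} s"

lemma h_bounds: "t > 0 \<Longrightarrow> 0 \<le> h t s" "t > 0 \<Longrightarrow> h t s \<le> 1"
  by (auto simp: h_def indicator_def)

lemma h_bounded [simp]: "t > 0 \<Longrightarrow> bounded_borel (h t)"
proof (rule bounded_borelI[of _ 1])
  assume "t > 0"
  then show "\<bar>h t s\<bar> \<le> 1" for s using h_bounds[of t s] by simp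
  show "h t \<in> borel_measurable borel" unfolding h_def by measurable
qed

abbreviation T :: "real \<Rightarrow> 'a fn \<Rightarrow> 'a fn" where "T t \<equiv> \<Phi> (h t)"

lemma T_linear:
  assumes "t > 0" "u \<in> \<H>" "v \<in> \<H>"
  shows "AE x in \<sigma>. T t (fscale c u + v) x = c * T t u x + T t v x"
proof -
  have "AE x in \<sigma>. T t (fscale c u + v) x = (fscale c (T t u) + T t v) x"
    by (rule L2_AE_eq[of "T t (fscale c u + v)" \<sigma> "fscale c (T t u) + T t v"])
      (use assms in \<open>auto simp: \<Phi>_ip SI_add_left SI_scale_left L2.ip_add_left L2.ip_scale_left\<close>)
  then show ?thesis by simp
qed

lemma T_nonneg:
  assumes t: "t > 0" and u: "u \<in> \<H>" and nn: "AE x in \<sigma>. u x \<in> nonneg_Reals"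
  shows "AE x in \<sigma>. T t u x \<in> nonneg_Reals"
proof -
  have "(u, \<Phi> (\<lambda>s. exp (- t * s) * indicator {0<..} s) u) \<in> graph (\<lambda>s. exp (- t * s))"
    using t u E_nonpos[OF u] by (intro graph_supp[where K=1]) (auto simp: Compl_greaterThan)
  moreover have "(\<lambda>s. exp (- t * s) * indicator {0<..} s) = h t" by (simp add: h_def fun_eq_iff)
  ultimately have "(u, T t u) \<in> graph (\<lambda>s. exp (- t * s))" by simp
  then show ?thesis using positive[OF t] nn unfolding positivity_preserving_def by blast
qed

text \<open>Positivity is applied to \<open>m + w\<close> and \<open>m - w\<close>.\<close>

lemma T_dominates:
  assumes t: "t > 0" and w: "w \<in> \<H>" and m: "m \<in> \<H>"
    and wr: "\<And>x. Im (w x) = 0" and mr: "\<And>x. Im (m x) = 0" and le: "\<And>x. \<bar>Re (w x)\<bar> \<le> Re (m x)"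
  shows "AE x in \<sigma>. Im (T t w x) = 0 \<and> cmod (T t w x) \<le> cmod (T t m x)"
proof -
  have "m x + w x \<in> nonneg_Reals" "m x - w x \<in> nonneg_Reals" for x
    using wr[of x] mr[of x] le[of x] by (auto simp: complex_nonneg_Reals_iff)
  then have p: "(fscale 1 w + m) x \<in> nonneg_Reals" "(fscale (-1) w + m) x \<in> nonneg_Reals" for x
    by (simp_all add: add.commute)
  have pH: "fscale 1 w + m \<in> \<H>" "fscale (-1) w + m \<in> \<H>"
    by (rule L2.add_mem[OF L2.scale_mem[OF w] m])+
  have "AE x in \<sigma>. T t (fscale 1 w + m) x \<in> nonneg_Reals" "AE x in \<sigma>. T t (fscale (-1) w + m) x \<in> nonneg_Reals"
    by (rule T_nonneg[OF t pH(1) AE_I2[OF p(1)]]) (rule T_nonneg[OF t pH(2) AE_I2[OF p(2)]])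
  then show ?thesis using T_linear[OF t w m, of 1] T_linear[OF t w m, of "-1"]
  proof eventually_elim
    case (elim x)
    then have "T t m x + T t w x \<in> nonneg_Reals" "T t m x - T t w x \<in> nonneg_Reals"
      by (simp_all add: add.commute)
    then have a: "0 \<le> Re (T t m x) + Re (T t w x)" "0 \<le> Re (T t m x) - Re (T t w x)"
      "Im (T t m x) + Im (T t w x) = 0" "Im (T t m x) - Im (T t w x) = 0"
      by (auto simp: complex_nonneg_Reals_iff)
    then have i: "Im (T t w x) = 0" "Im (T t m x) = 0" by linarith+
    then have "cmod (T t w x) = \<bar>Re (T t w x)\<bar>" "cmod (T t m x) = \<bar>Re (T t m x)\<bar>"
      by (auto simp: cmod_def)
    then show ?case using a i by auto
  qed
qed

text \<open>Real and imaginary part are dominated separately, which costs the factor 2.\<close>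

lemma T_majorant:
  assumes t: "t > 0" and w: "w \<in> \<H>" and m: "m \<in> \<H>"
    and mr: "\<And>x. Im (m x) = 0" and le: "\<And>x. cmod (w x) \<le> Re (m x)"
  shows "AE x in \<sigma>. cmod (T t w x) \<le> 2 * cmod (T t m x)"
proof -
  have "AE x in \<sigma>. cmod (T t (of_re w) x) \<le> cmod (T t m x)"
    using T_dominates[OF t L2_parts(1)[OF w] m _ mr] order_trans[OF abs_Re_le_cmod le]
    by (auto simp: of_re_def)
  moreover have "AE x in \<sigma>. cmod (T t (of_im w) x) \<le> cmod (T t m x)"
    using T_dominates[OF t L2_parts(2)[OF w] m _ mr] order_trans[OF abs_Im_le_cmod le]
    by (auto simp: of_im_def)
  moreover have "w = fscale \<i> (of_im w) + of_re w"
    by (simp add: fun_eq_iff of_re_def of_im_def complex_eq_iff)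
  then have "AE x in \<sigma>. T t w x = \<i> * T t (of_im w) x + T t (of_re w) x"
    using T_linear[OF t L2_parts(2)[OF w] L2_parts(1)[OF w], of \<i>] by simp
  ultimately show ?thesis
  proof eventually_elim
    case (elim x)
    then show ?case
      using norm_triangle_ineq[of "\<i> * T t (of_im w) x" "T t (of_re w) x"] by (simp add: norm_mult)
  qed
qed

text \<open>The form \<open>\<langle>(1 - e\<^bsup>-tA\<^esup>) u, u\<rangle>\<close>.  Divided by \<open>t\<close> it approximates the energy as \<open>t\<close> tends to 0, and unlike the
  energy it is expressed by the semigroup, so that positivity applies to it.\<close>

definition deficit :: "real \<Rightarrow> 'a fn \<Rightarrow> real"
  where "deficit t u = (LINT s|\<mu> u. 1 - h t s)"

lemma deficit_eq:
  assumes t: "t > 0" and u: "u \<in> \<H>"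
  shows "deficit t u = (nrm u)\<^sup>2 - Re (ip (T t u) u)"
proof -
  have "deficit t u = (LINT s|\<mu> u. 1) - (LINT s|\<mu> u. h t s)"
    unfolding deficit_def using t u by (intro Bochner_Integration.integral_diff integrable_\<mu>) auto
  then show ?thesis using t u by (simp add: measure_\<mu>_UNIV \<Phi>_ip SI_self)
qed

lemma deficit_le_energy:
  assumes t: "t > 0" and u: "u \<in> dom sqrt" shows "deficit t u \<le> t * energy u"
proof -
  note uH = dom_subset[OF u]
  have "deficit t u \<le> (LINT s|\<mu> u. t * \<bar>s\<bar>)" unfolding deficit_def
  proof (rule integral_mono_AE)
    show "integrable (\<mu> u) (\<lambda>s. 1 - h t s)" using t uH by (intro integrable_\<mu>) auto
    show "integrable (\<mu> u) (\<lambda>s. t * \<bar>s\<bar>)" using energy_integrable[OF u] by simp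
    show "AE s in \<mu> u. 1 - h t s \<le> t * \<bar>s\<bar>"
      using E_pos[OF uH]
    proof eventually_elim
      case (elim s)
      then show ?case using exp_ge_add_one_self[of "- t * s"] by (simp add: h_def)
    qed
  qed
  then show ?thesis by (simp add: energy_def)
qed

text \<open>For \<open>0 < s \<le> 1/t\<close> one has \<open>1 - e\<^bsup>-ts\<^esup> \<ge> t s / 2\<close>, so a uniform bound on \<open>deficit t u / t\<close> bounds the energies of all
  truncations.\<close>

lemma energy_le_if_deficit_le:
  assumes u: "u \<in> \<H>" and le: "\<And>t. t > 0 \<Longrightarrow> deficit t u \<le> t * C'"
  shows "u \<in> dom sqrt" "energy u \<le> 2 * C'"
proof -
  have "(LINT s|\<mu> u. (trunc sqrt n s)\<^sup>2) \<le> 2 * C'" for n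
  proof -
    \<comment> \<open>Then \<open>t s \<le> 1\<close> wherever the truncation does not vanish.\<close>
    define t where "t = 1 / (real n + 1)\<^sup>2"
    have t: "t > 0" by (simp add: t_def)
    have "(LINT s|\<mu> u. (trunc sqrt n s)\<^sup>2) \<le> (LINT s|\<mu> u. 2 / t * (1 - h t s))"
    proof (rule integral_mono_AE)
      show "integrable (\<mu> u) (\<lambda>s. (trunc sqrt n s)\<^sup>2)" by (intro integrable_\<mu> u) auto
      show "integrable (\<mu> u) (\<lambda>s. 2 / t * (1 - h t s))"
        using t u by (intro integrable_mult_right integrable_\<mu>) auto
      show "AE s in \<mu> u. (trunc sqrt n s)\<^sup>2 \<le> 2 / t * (1 - h t s)"
        using E_pos[OF u]
      proof eventually_elim
        case (elim s)
        show ?case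
        proof (cases "\<bar>sqrt s\<bar> \<le> real n")
          case True
          have "s = (sqrt s)\<^sup>2" using elim by simp
          also have "\<dots> \<le> (real n + 1)\<^sup>2" using True elim by (intro power_mono) auto
          finally have y: "t * s \<le> 1" by (simp add: t_def)
          have y0: "0 < t * s" using t elim by simp
          have "exp (- (t * s)) \<le> 1 / (1 + t * s)"
            using exp_ge_add_one_self[of "t * s"] y0 by (simp add: exp_minus inverse_eq_divide frac_le)
          also have "1 / (1 + t * s) \<le> 1 - t * s / 2"
          proof -
            have "1 \<le> (1 - t * s / 2) * (1 + t * s)"
              using mult_nonneg_nonneg[of "t * s" "1 - t * s"] y y0 by (simp add: algebra_simps)
            then show ?thesis using y0 by (simp add: pos_divide_le_eq)
          qed
          finally have "t * s / 2 \<le> 1 - h t s" using elim by (simp add: h_def)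
          then have "s \<le> 2 / t * (1 - h t s)" using t by (simp add: field_simps)
          then show ?thesis using elim True by (simp add: trunc_def)
        next
          case False
          then show ?thesis using h_bounds(2)[OF t, of s] t by (simp add: trunc_def)
        qed
      qed
    qed
    also have "\<dots> = 2 / t * deficit t u" unfolding deficit_def by (rule integral_mult_right_zero)
    also have "\<dots> \<le> 2 / t * (t * C')" using t le[OF t] by (intro mult_left_mono) auto
    finally show ?thesis using t by simp
  qed note b = this
  show d: "u \<in> dom sqrt" using dom_char[OF sqrt_measurable u] b by blast
  have "(\<lambda>n. SI (\<lambda>s. (trunc sqrt n s)\<^sup>2) u u) \<longlonglongrightarrow> SI (\<lambda>s. (sqrt s)\<^sup>2) u u"
    by (rule SI_sq_tendsto[OF sqrt_measurable d d])
  then have "(\<lambda>n. Re (SI (\<lambda>s. (trunc sqrt n s)\<^sup>2) u u)) \<longlonglongrightarrow> Re (SI (\<lambda>s. (sqrt s)\<^sup>2) u u)"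
    by (rule tendsto_Re)
  moreover have "Re (SI (\<lambda>s. (trunc sqrt n s)\<^sup>2) u u) \<le> 2 * C'" for n
    using b[of n] u by (simp add: SI_self)
  ultimately have "Re (SI (\<lambda>s. (sqrt s)\<^sup>2) u u) \<le> 2 * C'" by (intro LIMSEQ_le_const2) auto
  then show "energy u \<le> 2 * C'" using En_nrm_sq[OF d] En.nrm_sq[OF d] by simp
qed

text \<open>The functions \<open>p = \<bar>x\<bar> - x\<close> and \<open>q = \<bar>x\<bar> + x\<close> are non-negative, hence \<open>\<langle>T p, q\<rangle> + \<langle>T q, p\<rangle> \<ge> 0\<close>; this sum is
  \<open>2 (\<langle>T \<bar>x\<bar>, \<bar>x\<bar>\<rangle> - \<langle>T x, x\<rangle>)\<close>.\<close>

lemma deficit_abs_le: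
  assumes t: "t > 0" and x: "x \<in> \<H>" and r: "\<And>y. Im (x y) = 0"
  shows "deficit t (of_abs x) \<le> deficit t x"
proof -
  let ?a = "of_abs x"
  let ?p = "?a - x" and ?q = "?a + x"
  have aH: "?a \<in> \<H>" using x by simp
  have pH: "?p \<in> \<H>" and qH: "?q \<in> \<H>" using x by auto
  have "?p y \<in> nonneg_Reals" "?q y \<in> nonneg_Reals" for y
    using r[of y] abs_Re_le_cmod[of "x y"] by (auto simp: complex_nonneg_Reals_iff of_abs_def)
  then have p0: "AE y in \<sigma>. ?p y \<in> nonneg_Reals" and q0: "AE y in \<sigma>. ?q y \<in> nonneg_Reals" by auto
  have "0 \<le> Re (SI (h t) ?p ?q)"
    unfolding \<Phi>_ip[OF h_bounded[OF t] pH qH, symmetric]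
    by (rule L2_inner_nonneg_Reals[OF _ qH T_nonneg[OF t pH p0] q0]) (rule \<Phi>_mem[OF h_bounded[OF t] pH])
  moreover have "0 \<le> Re (SI (h t) ?q ?p)"
    unfolding \<Phi>_ip[OF h_bounded[OF t] qH pH, symmetric]
    by (rule L2_inner_nonneg_Reals[OF _ pH T_nonneg[OF t qH q0] p0]) (rule \<Phi>_mem[OF h_bounded[OF t] qH])
  moreover have "SI (h t) ?p ?q + SI (h t) ?q ?p = 2 * (SI (h t) ?a ?a - SI (h t) x x)"
  proof -
    interpret S: sip fscale \<H> "SI (h t)" by (rule sip_SI) (use t h_bounds in auto)
    show ?thesis using x aH
      by (simp add: S.ip_add_left S.ip_add_right S.ip_diff_left S.ip_diff_right)
  qed
  ultimately have "Re (SI (h t) x x) \<le> Re (SI (h t) ?a ?a)"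
    by (metis (no_types, opaque_lifting) Re_complex_of_real add_nonneg_nonneg diff_ge_0_iff_ge minus_complex.simps(1)
        plus_complex.simps(1) mult_2 add_le_same_cancel1 zero_le_double_add_iff_zero_le_single_add)
  moreover have "nrm ?a = nrm x"
    by (simp add: L2.nrm_def L2_inner_self of_abs_def)
  ultimately show ?thesis using t x aH by (simp add: deficit_eq \<Phi>_ip)
qed

lemma T_real:
  assumes t: "t > 0" and x: "x \<in> \<H>" and r: "\<And>y. Im (x y) = 0"
  shows "AE y in \<sigma>. Im (T t x y) = 0"
proof -
  have "AE y in \<sigma>. Im (T t x y) = 0 \<and> cmod (T t x y) \<le> cmod (T t (of_abs x) y)"
    by (rule T_dominates[OF t x L2_parts(3)[OF x] r]) (auto simp: of_abs_def abs_Re_le_cmod)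
  then show ?thesis by eventually_elim simp
qed

text \<open>The semigroup maps real functions to real functions, so \<open>Re u\<close> and \<open>i Im u\<close> have no real cross term and the
  deficits of the parts add up to that of \<open>u\<close>.\<close>

lemma deficit_parts:
  assumes t: "t > 0" and u: "u \<in> \<H>"
  shows "deficit t (of_re u) \<le> deficit t u" "deficit t (of_im u) \<le> deficit t u"
proof -
  have g: "bounded_borel (\<lambda>s. 1 - h t s)" using t by simp
  have g0: "0 \<le> 1 - h t s" for s using h_bounds(2)[OF t] by simp
  interpret S: sip fscale \<H> "SI (\<lambda>s. 1 - h t s)" by (rule sip_SI[OF g g0])
  let ?x = "of_re u" and ?y = "of_im u"
  have H: "?x \<in> \<H>" "?y \<in> \<H>" using u by auto
  have "SI (\<lambda>s. 1 + (- 1) * h t s) ?x ?y = SI (\<lambda>_. 1) ?x ?y + SI (\<lambda>s. (- 1) * h t s) ?x ?y"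
    by (rule SI_add[OF bounded_borel_const bounded_borel_mult[OF bounded_borel_const h_bounded[OF t]] H])
  also have "SI (\<lambda>s. (- 1) * h t s) ?x ?y = of_real (-1) * SI (h t) ?x ?y"
    by (rule SI_scale[OF h_bounded[OF t] H])
  finally have e: "SI (\<lambda>s. 1 - h t s) ?x ?y = ip ?x ?y - ip (T t ?x) ?y"
    using t H by (simp add: SI_one \<Phi>_ip)
  have "Im (ip ?x ?y) = 0" by (rule L2_inner_real) (use H in \<open>simp_all, simp_all add: of_re_def of_im_def\<close>)
  moreover have "Im (ip (T t ?x) ?y) = 0"
  proof (rule L2_inner_real)
    show "AE x in \<sigma>. Im (T t ?x x) = 0" by (rule T_real[OF t H(1)]) (simp add: of_re_def)
    show "AE x in \<sigma>. Im (?y x) = 0" by (simp add: of_im_def)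
  qed (use H t in auto)
  ultimately have "Im (SI (\<lambda>s. 1 - h t s) ?x ?y) = 0" by (simp add: e)
  then have z: "Re (SI (\<lambda>s. 1 - h t s) ?x (fscale \<i> ?y)) = 0"
    using H by (simp add: S.ip_scale_right)
  have "u = ?x + fscale \<i> ?y" by (simp add: fun_eq_iff of_re_def of_im_def complex_eq_iff)
  then have "(S.nrm u)\<^sup>2 = (S.nrm ?x)\<^sup>2 + (S.nrm ?y)\<^sup>2"
    using S.nrm_sq_add[of ?x "fscale \<i> ?y"] z H by (simp add: S.nrm_scale)
  moreover have "(S.nrm w)\<^sup>2 = deficit t w" if "w \<in> \<H>" for w
    using that g by (simp add: S.nrm_sq SI_self deficit_def)
  ultimately have s: "deficit t u = deficit t ?x + deficit t ?y" using u H by simp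
  have nn: "0 \<le> deficit t w" for w unfolding deficit_def using g0 by (intro Bochner_Integration.integral_nonneg)
  show "deficit t (of_re u) \<le> deficit t u" "deficit t (of_im u) \<le> deficit t u"
    using s nn[of ?x] nn[of ?y] by linarith+
qed

text \<open>\<open>\<bar>Re v\<bar> + \<bar>Im v\<bar>\<close> serves as a majorant of \<open>\<bar>v\<bar>\<close>, so that inequalities for real functions suffice.\<close>

definition majorant :: "'a fn \<Rightarrow> 'a fn"
  where "majorant v = of_abs (of_re v) + of_abs (of_im v)"

text \<open>Positivity does not let \<open>\<bar>v\<bar>\<close> have much more energy than \<open>v\<close>.\<close>

lemma majorant:
  assumes v: "v \<in> dom sqrt"
  shows "majorant v \<in> dom sqrt" "energy (majorant v) \<le> 8 * energy v"
    "Im (majorant v x) = 0" "cmod (v x) \<le> Re (majorant v x)"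
proof -
  note vH = dom_subset[OF v]
  have re: "deficit t (of_abs (of_re v)) \<le> t * energy v" if t: "t > 0" for t
  proof -
    have "deficit t (of_abs (of_re v)) \<le> deficit t (of_re v)"
      by (rule deficit_abs_le[OF t L2_parts(1)[OF vH]]) (simp add: of_re_def)
    then show ?thesis using deficit_parts(1)[OF t vH] deficit_le_energy[OF t v] by linarith
  qed
  have im: "deficit t (of_abs (of_im v)) \<le> t * energy v" if t: "t > 0" for t
  proof -
    have "deficit t (of_abs (of_im v)) \<le> deficit t (of_im v)"
      by (rule deficit_abs_le[OF t L2_parts(2)[OF vH]]) (simp add: of_im_def)
    then show ?thesis using deficit_parts(2)[OF t vH] deficit_le_energy[OF t v] by linarith
  qed
  let ?x = "of_abs (of_re v)" and ?y = "of_abs (of_im v)"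
  have H: "?x \<in> \<H>" "?y \<in> \<H>" using vH by auto
  note x = energy_le_if_deficit_le[OF H(1) re] and y = energy_le_if_deficit_le[OF H(2) im]
  show "majorant v \<in> dom sqrt" unfolding majorant_def by (rule En.add_mem[OF x(1) y(1)])
  have "(En.nrm (?x + ?y))\<^sup>2 \<le> 2 * (En.nrm ?x)\<^sup>2 + 2 * (En.nrm ?y)\<^sup>2"
    using En.nrm_sq_parallelogram[OF x(1) y(1)] zero_le_power2[of "En.nrm (?x - ?y)"] by linarith
  then show "energy (majorant v) \<le> 8 * energy v"
    using x y En.add_mem[OF x(1) y(1)] unfolding majorant_def by (simp add: En_nrm_sq)
  show "Im (majorant v x) = 0" by (simp add: majorant_def of_abs_def)
  show "cmod (v x) \<le> Re (majorant v x)"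
    using cmod_le[of "v x"] by (simp add: majorant_def of_abs_def of_re_def of_im_def)
qed

lemma T_energy:
  assumes t: "t > 0" and u: "u \<in> dom sqrt"
  shows "T t u \<in> dom sqrt" "energy (T t u) \<le> energy u"
proof -
  note uH = dom_subset[OF u]
  have TH: "T t u \<in> \<H>" using t uH by simp
  have b: "(LINT s|\<mu> (T t u). (trunc sqrt n s)\<^sup>2) \<le> energy u" for n
  proof -
    have "(LINT s|\<mu> (T t u). (trunc sqrt n s)\<^sup>2) = (LINT s|\<mu> u. (trunc sqrt n s)\<^sup>2 * (h t s)\<^sup>2)"
      using t uH by (intro integral_\<mu>_\<Phi>) auto
    also have "\<dots> \<le> energy u" unfolding energy_def
    proof (rule integral_mono)
      show "integrable (\<mu> u) (\<lambda>s. (trunc sqrt n s)\<^sup>2 * (h t s)\<^sup>2)" using t uH by (intro integrable_\<mu>) auto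
      show "integrable (\<mu> u) abs" using energy_integrable[OF u] by simp
      fix s
      have "(h t s)\<^sup>2 \<le> 1" using h_bounds[OF t, of s] by (simp add: power_le_one)
      then have "(trunc sqrt n s)\<^sup>2 * (h t s)\<^sup>2 \<le> (trunc sqrt n s)\<^sup>2 * 1" by (intro mult_left_mono) auto
      also have "\<dots> \<le> \<bar>s\<bar>" using sqrt_sq[of s] by (simp add: trunc_def)
      finally show "(trunc sqrt n s)\<^sup>2 * (h t s)\<^sup>2 \<le> \<bar>s\<bar>" .
    qed
    finally show ?thesis .
  qed
  show d: "T t u \<in> dom sqrt" using dom_char[OF sqrt_measurable TH] b by blast
  have "(\<lambda>n. Re (SI (\<lambda>s. (trunc sqrt n s)\<^sup>2) (T t u) (T t u))) \<longlonglongrightarrow> Re (SI (\<lambda>s. (sqrt s)\<^sup>2) (T t u) (T t u))"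
    by (intro tendsto_Re SI_sq_tendsto[OF sqrt_measurable d d])
  moreover have "Re (SI (\<lambda>s. (trunc sqrt n s)\<^sup>2) (T t u) (T t u)) \<le> energy u" for n
    using b[of n] TH by (simp add: SI_self)
  ultimately have "Re (SI (\<lambda>s. (sqrt s)\<^sup>2) (T t u) (T t u)) \<le> energy u" by (intro LIMSEQ_le_const2) auto
  then show "energy (T t u) \<le> energy u" using En_nrm_sq[OF d] En.nrm_sq[OF d] by simp
qed

abbreviation pexp :: real where "pexp \<equiv> 2 * d / (d - 2)"

lemma pexp_pos: "pexp > 0"
  using d by simp

lemma dom_sqrt_Lp: "u \<in> dom sqrt \<Longrightarrow> u \<in> Lp \<sigma> pexp"
  using sobolev[of u "energy u + 1"] Lp_measurable[OF dom_subset[of u sqrt]] energy_nonneg[of u]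
  by (auto simp: Lp_iff intro: le_less_trans)

lemma nrm_T_le: "t > 0 \<Longrightarrow> u \<in> \<H> \<Longrightarrow> nrm (T t u) \<le> nrm u"
proof -
  assume t: "t > 0" and u: "u \<in> \<H>"
  have "(nrm (T t u))\<^sup>2 = (LINT s|\<mu> u. (h t s)\<^sup>2)" using t u by (simp add: nrm_\<Phi>)
  also have "\<dots> \<le> 1 * (nrm u)\<^sup>2"
    by (rule integral_\<mu>_le) (use t u h_bounds[OF t] in \<open>auto simp: power_le_one\<close>)
  finally have "(nrm (T t u))\<^sup>2 \<le> (nrm u)\<^sup>2" by simp
  then show "nrm (T t u) \<le> nrm u" by (rule power2_le_imp_le) (use u in simp)
qed

text \<open>Where \<open>\<bar>v\<bar> > 2 \<bar>w\<bar>\<close>, \<open>v\<close> is dominated by \<open>2 (v - w)\<close>, whose energy is small when \<open>v\<close> and \<open>w\<close> are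
  late members of a Cauchy sequence; elsewhere \<open>v\<close> is dominated by the fixed function \<open>2 w\<close>.\<close>

definition tail :: "'a fn \<Rightarrow> 'a fn \<Rightarrow> 'a fn"
  where "tail w v = (\<lambda>x. if cmod (v x) \<le> 2 * cmod (w x) then 0 else v x)"

lemma tail_mem: "v \<in> \<H> \<Longrightarrow> w \<in> \<H> \<Longrightarrow> tail w v \<in> \<H>"
proof -
  assume v: "v \<in> \<H>" and w: "w \<in> \<H>"
  note [measurable] = Lp_measurable[OF v] Lp_measurable[OF w]
  show ?thesis
  proof (rule Lp_bound[OF _ v])
    show "tail w v \<in> borel_measurable \<sigma>" unfolding tail_def by measurable
  qed (auto simp: tail_def)
qed

text \<open>The tail is dominated by the majorant of \<open>2 (v - w)\<close>, which has energy at most \<open>8 * 4 e\<close>.  The operator \<open>T\<close>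
  preserves the domination, does not increase the energy, and the Sobolev inequality applies.\<close>

lemma T_tail_bound:
  assumes v: "v \<in> dom sqrt" and w: "w \<in> dom sqrt" and e: "e > 0" "energy (v - w) \<le> e"
  shows "Lp_int \<sigma> pexp (T 1 (tail w v)) \<le> ennreal (2 powr pexp * (CLR_const * (32 * e) powr (d / (d - 2))))"
proof -
  let ?z = "fscale 2 (v - w)"
  have zd: "?z \<in> dom sqrt" by (intro En.scale_mem En.diff_mem v w)
  have "energy ?z = 4 * energy (v - w)"
    using zd En.diff_mem[OF v w] by (simp add: En_nrm_sq[symmetric] En.nrm_scale power_mult_distrib)
  then have ez: "energy (majorant ?z) \<le> 32 * e" using majorant(2)[OF zd] e(2) by linarith
  note mz = majorant(1)[OF zd]
  have TH: "T 1 (majorant ?z) \<in> dom sqrt" "energy (T 1 (majorant ?z)) \<le> 32 * e"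
    using T_energy(1)[OF zero_less_one mz] order_trans[OF T_energy(2)[OF zero_less_one mz] ez] by auto
  have "AE x in \<sigma>. cmod (T 1 (tail w v) x) \<le> 2 * cmod (T 1 (majorant ?z) x)"
  proof (rule T_majorant)
    show "cmod (tail w v x) \<le> Re (majorant ?z x)" for x
    proof (cases "cmod (v x) \<le> 2 * cmod (w x)")
      case True
      then show ?thesis using majorant(4)[OF zd, of x] norm_ge_zero[of "?z x"]
        unfolding tail_def by (simp only: if_True norm_zero)
    next
      case False
      have "cmod (v x) \<le> cmod (v x - w x) + cmod (w x)"
        using norm_triangle_ineq[of "v x - w x" "w x"] by simp
      moreover have "?z x = 2 * (v x - w x)" by simp
      then have "cmod (?z x) = 2 * cmod (v x - w x)" by (simp only: norm_mult norm_numeral)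
      ultimately have "cmod (v x) \<le> cmod (?z x)" using False by linarith
      then show ?thesis using False majorant(4)[OF zd, of x] by (simp add: tail_def)
    qed
  qed (use tail_mem dom_subset[OF v] dom_subset[OF w] dom_subset[OF mz] majorant(3)[OF zd] in auto)
  then have "Lp_int \<sigma> pexp (T 1 (tail w v)) \<le> Lp_int \<sigma> pexp (fscale 2 (T 1 (majorant ?z)))"
    using pexp_pos by (intro Lp_int_mono) (auto simp: norm_mult)
  also have "\<dots> = ennreal (2 powr pexp) * Lp_int \<sigma> pexp (T 1 (majorant ?z))"
    using Lp_measurable[OF dom_subset[OF TH(1)]] by (simp add: Lp_int_fscale)
  also have "\<dots> \<le> ennreal (2 powr pexp) * ennreal (CLR_const * (32 * e) powr (d / (d - 2)))"
    using e by (intro mult_left_mono sobolev TH) auto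
  also have "\<dots> = ennreal (2 powr pexp * (CLR_const * (32 * e) powr (d / (d - 2))))"
    using CLR_const_pos by (intro ennreal_mult[symmetric]) auto
  finally show ?thesis .
qed

text \<open>The energy of \<open>Z n\<close> in a band of energies bounded away from 0 and infinity is controlled by
  \<open>(1 - e\<^sup>-\<^sup>A) Z n\<close> in \<open>L\<^sup>2\<close> and hence tends to 0.  As the sequence is Cauchy in energy, late members have little
  energy in every band, with a bound that does not depend on the band.\<close>

lemma closable_if_weak:
  assumes Z: "\<And>n. Z n \<in> dom sqrt"
    and cauchy: "\<And>\<epsilon>. \<epsilon> > 0 \<Longrightarrow> \<exists>N. \<forall>m\<ge>N. \<forall>n\<ge>N. energy (Z m - Z n) < \<epsilon>"
    and weak: "(\<lambda>n. nrm (\<Phi> (\<lambda>s. 1 - h 1 s) (Z n))) \<longlonglongrightarrow> 0"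
  shows "(\<lambda>n. energy (Z n)) \<longlonglongrightarrow> 0"
proof -
  have ZH: "Z n \<in> \<H>" for n using Z by (rule dom_subset)
  have "\<exists>N. \<forall>n\<ge>N. energy (Z n) \<le> \<epsilon>" if \<epsilon>: "\<epsilon> > 0" for \<epsilon>
  proof -
    obtain N where N: "\<And>m n. m \<ge> N \<Longrightarrow> n \<ge> N \<Longrightarrow> energy (Z m - Z n) < \<epsilon>" using cauchy[OF \<epsilon>] by blast
    have "energy (Z n) \<le> \<epsilon>" if n: "n \<ge> N" for n
    proof -
      define g where "g k s = sqrt s * indicator {1 / real (Suc k)<..real (Suc k)} s" for k s
      have gb: "bounded_borel (\<lambda>s. (g k s)\<^sup>2)" for k
      proof (rule bounded_borelI[of _ "real (Suc k)"])
        show "(\<lambda>s. (g k s)\<^sup>2) \<in> borel_measurable borel" unfolding g_def by measurable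
        show "\<bar>(g k s)\<^sup>2\<bar> \<le> real (Suc k)" for s
        proof (cases "s \<in> {1 / real (Suc k)<..real (Suc k)}")
          case True
          then have "1 / real (Suc k) < s" "s \<le> real (Suc k)" by auto
          moreover have "0 < 1 / real (Suc k)" by simp
          ultimately have "0 < s" "s \<le> real (Suc k)" by linarith+
          then show ?thesis by (simp add: g_def power_mult_distrib indicator_def)
        qed (simp add: g_def)
      qed
      have gle: "(g k s)\<^sup>2 \<le> \<bar>s\<bar>" for k s by (auto simp: g_def indicator_def sqrt_sq)
      have band: "(LINT s|\<mu> (Z n). (g k s)\<^sup>2) \<le> \<epsilon>" for k
      proof -
        interpret G: sip fscale \<H> "SI (\<lambda>s. (g k s)\<^sup>2)" by (rule sip_SI[OF gb]) simp
        have Gn: "(G.nrm u)\<^sup>2 = (LINT s|\<mu> u. (g k s)\<^sup>2)" if "u \<in> \<H>" for u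
          using that gb by (simp add: G.nrm_sq SI_self)
        define r where "r = 1 / real (Suc k)"
        \<comment> \<open>On the band, \<open>s \<le> k + 1\<close> and \<open>1 - e\<^sup>-\<^sup>s \<ge> 1 - e\<^sup>-\<^sup>r\<close>.\<close>
        define c where "c = real (Suc k) / (1 - exp (- r))\<^sup>2"
        have r: "r > 0" by (simp add: r_def)
        have c0: "c > 0" using r by (simp add: c_def)
        have b1: "G.nrm (Z m) \<le> sqrt c * nrm (\<Phi> (\<lambda>s. 1 - h 1 s) (Z m))" for m
        proof -
          have "(G.nrm (Z m))\<^sup>2 \<le> (LINT s|\<mu> (Z m). c * (1 - h 1 s)\<^sup>2)"
            unfolding Gn[OF ZH]
          proof (rule integral_mono)
            show "integrable (\<mu> (Z m)) (\<lambda>s. (g k s)\<^sup>2)" by (intro integrable_\<mu> ZH gb)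
            show "integrable (\<mu> (Z m)) (\<lambda>s. c * (1 - h 1 s)\<^sup>2)"
              by (intro integrable_mult_right integrable_\<mu> ZH) auto
            fix s
            show "(g k s)\<^sup>2 \<le> c * (1 - h 1 s)\<^sup>2"
            proof (cases "s \<in> {r<..real (Suc k)}")
              case True
              then have "1 - exp (- r) \<le> 1 - h 1 s" using r by (simp add: h_def)
              then have "(1 - exp (- r))\<^sup>2 \<le> (1 - h 1 s)\<^sup>2" using r by (intro power_mono) auto
              then have "c * (1 - exp (- r))\<^sup>2 \<le> c * (1 - h 1 s)\<^sup>2" using c0 by (intro mult_left_mono) auto
              moreover have "c * (1 - exp (- r))\<^sup>2 = real (Suc k)" using r by (simp add: c_def)
              moreover have "(g k s)\<^sup>2 \<le> real (Suc k)" using True r by (simp add: g_def sqrt_sq indicator_def)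
              ultimately show ?thesis by linarith
            next
              case False
              then have "indicator {1 / real (Suc k)<..real (Suc k)} s = (0::real)"
                unfolding r_def by (rule indicator_simps(2))
              then have "g k s = 0" by (simp only: g_def mult_zero_right)
              then show ?thesis using c0 by simp
            qed
          qed
          also have "\<dots> = (sqrt c * nrm (\<Phi> (\<lambda>s. 1 - h 1 s) (Z m)))\<^sup>2"
            using c0 ZH by (simp add: nrm_\<Phi> power_mult_distrib)
          finally show ?thesis by (rule power2_le_imp_le) (use c0 ZH in auto)
        qed
        have b2: "G.nrm (Z n - Z m) \<le> sqrt \<epsilon>" if m: "m \<ge> N" for m
        proof -
          have "(G.nrm (Z n - Z m))\<^sup>2 \<le> energy (Z n - Z m)"
            unfolding Gn[OF L2.diff_mem[OF ZH ZH]] energy_def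
            by (rule integral_mono[OF integrable_\<mu>[OF L2.diff_mem[OF ZH ZH] gb] energy_integrable[OF En.diff_mem[OF Z Z]] gle])
          also have "\<dots> \<le> (sqrt \<epsilon>)\<^sup>2" using N[OF n m] \<epsilon> by simp
          finally show ?thesis by (rule power2_le_imp_le) (use \<epsilon> in simp)
        qed
        have b3: "G.nrm (Z n) \<le> sqrt \<epsilon> + sqrt c * nrm (\<Phi> (\<lambda>s. 1 - h 1 s) (Z m))" if m: "m \<ge> N" for m
          using G.nrm_triangle[of "Z n - Z m" "Z m"] b1[of m] b2[OF m] ZH by simp
        have "(\<lambda>m. sqrt \<epsilon> + sqrt c * nrm (\<Phi> (\<lambda>s. 1 - h 1 s) (Z m))) \<longlonglongrightarrow> sqrt \<epsilon> + sqrt c * 0"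
          by (intro tendsto_intros weak)
        then have "G.nrm (Z n) \<le> sqrt \<epsilon> + sqrt c * 0"
          by (rule LIMSEQ_le_const) (use b3 in blast)
        then have "(G.nrm (Z n))\<^sup>2 \<le> (sqrt \<epsilon>)\<^sup>2" using ZH by (intro power_mono) auto
        then show ?thesis using Gn[OF ZH[of n]] \<epsilon> by simp
      qed
      have "(\<lambda>k. LINT s|\<mu> (Z n). (g k s)\<^sup>2) \<longlonglongrightarrow> (LINT s|\<mu> (Z n). \<bar>s\<bar>)"
      proof (rule integral_dominated_convergence[where w=abs])
        show "integrable (\<mu> (Z n)) abs" using energy_integrable[OF Z] by simp
        show "AE s in \<mu> (Z n). (\<lambda>k. (g k s)\<^sup>2) \<longlonglongrightarrow> \<bar>s\<bar>"
          using E_pos[OF ZH]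
        proof eventually_elim
          case (elim s)
          have "\<forall>\<^sub>F k in sequentially. (g k s)\<^sup>2 = \<bar>s\<bar>"
            using eventually_ge_at_top[of "nat \<lceil>max s (1 / s)\<rceil>"]
          proof eventually_elim
            case (elim k)
            then have k: "max s (1 / s) \<le> real k" by linarith
            then have "1 / s < real (Suc k)" "s \<le> real (Suc k)" by auto
            then have "s \<in> {1 / real (Suc k)<..real (Suc k)}" using \<open>0 < s\<close> by (simp add: field_simps)
            then show ?case by (simp add: g_def sqrt_sq)
          qed
          then show ?case by (rule tendsto_eventually)
        qed
        show "AE s in \<mu> (Z n). norm ((g k s)\<^sup>2) \<le> \<bar>s\<bar>" for k using gle by simp
        show "(\<lambda>s. (g k s)\<^sup>2) \<in> borel_measurable (\<mu> (Z n))" for k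
          using bounded_borel_measurable[OF gb] by simp
      qed simp
      then show ?thesis unfolding energy_def by (rule LIMSEQ_le_const2) (use band in blast)
    qed
    then show ?thesis by blast
  qed note * = this
  show ?thesis
  proof (rule LIMSEQ_I)
    fix e :: real assume "e > 0"
    then obtain N where "\<forall>n\<ge>N. energy (Z n) \<le> e / 2" using *[of "e / 2"] by auto
    then show "\<exists>N. \<forall>n\<ge>N. norm (energy (Z n) - 0) < e"
      using \<open>e > 0\<close> by (intro exI[of _ N]) (auto intro: le_less_trans)
  qed
qed

text \<open>The functions \<open>y\<^sub>n = (1 - e\<^sup>-\<^sup>A) Z\<^sub>n\<close> converge in \<open>L\<^sup>2\<close>, as their norms are controlled by the energy.  By
  \<open>closable_if_weak\<close> it remains to see that their limit \<open>z\<close> is 0.  Split \<open>Z\<^sub>n = c\<^sub>n + b\<^sub>n\<close>, where \<open>b\<^sub>n\<close> is the tail of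
  \<open>Z\<^sub>n\<close> relative to a fixed member \<open>Z\<^sub>N\<close>.  Then \<open>c\<^sub>n\<close> is dominated by \<open>2 \<bar>Z\<^sub>N\<bar>\<close> and tends to 0 in \<open>L\<^sup>2\<close>, while \<open>T b\<^sub>n\<close>
  is small in \<open>L\<^sup>p\<close>.  Along a subsequence \<open>T b\<^sub>n = Z\<^sub>n - T c\<^sub>n - y\<^sub>n\<close> tends to \<open>- z\<close> almost everywhere, and Fatou's
  lemma bounds \<open>z\<close> in \<open>L\<^sup>p\<close> by a quantity that is arbitrarily small.\<close>

theorem closable:
  assumes Z: "\<And>n. Z n \<in> dom sqrt"
    and cauchy: "\<And>\<epsilon>. \<epsilon> > 0 \<Longrightarrow> \<exists>N. \<forall>m\<ge>N. \<forall>n\<ge>N. energy (Z m - Z n) < \<epsilon>"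
    and lim: "(\<lambda>n. Lp_int \<sigma> pexp (Z n)) \<longlonglongrightarrow> 0"
  shows "(\<lambda>n. energy (Z n)) \<longlonglongrightarrow> 0"
proof -
  have ZH: "Z n \<in> \<H>" for n using Z by (rule dom_subset)
  define g where "g s = 1 - h 1 s" for s
  have gb: "bounded_borel g" unfolding g_def by simp
  have g01: "0 \<le> g s" "g s \<le> 1" for s using h_bounds[of 1 s] by (auto simp: g_def)
  define y where "y n = \<Phi> g (Z n)" for n
  have yH: "y n \<in> \<H>" for n unfolding y_def using gb ZH by simp
  have g_energy: "(nrm (\<Phi> g u))\<^sup>2 \<le> energy u" if u: "u \<in> dom sqrt" for u
  proof -
    have "(nrm (\<Phi> g u))\<^sup>2 = (LINT s|\<mu> u. (g s)\<^sup>2)" using gb dom_subset[OF u] by (simp add: nrm_\<Phi>)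
    also have "\<dots> \<le> (LINT s|\<mu> u. g s)"
    proof (rule integral_mono)
      show "integrable (\<mu> u) (\<lambda>s. (g s)\<^sup>2)" "integrable (\<mu> u) g"
        using gb dom_subset[OF u] by (auto intro!: integrable_\<mu>)
      show "(g s)\<^sup>2 \<le> g s" for s using g01[of s] by (simp add: power2_eq_square mult_left_le)
    qed
    also have "\<dots> = deficit 1 u" by (simp add: deficit_def g_def)
    also have "\<dots> \<le> energy u" using deficit_le_energy[OF _ u, of 1] by simp
    finally show ?thesis .
  qed
  have ydiff: "nrm (y m - y n) = nrm (\<Phi> g (Z m - Z n))" for m n
  proof (rule L2.nrm_eq_if_weak)
    fix w assume w: "w \<in> \<H>"
    have "SI g (Z m + fscale (-1) (Z n)) w = SI g (Z m) w + (-1) * SI g (Z n) w"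
      unfolding SI_add_left[OF gb ZH L2.scale_mem[OF ZH] w] SI_scale_left[OF gb ZH w] ..
    moreover have "Z m + fscale (-1) (Z n) = Z m - Z n" by (simp add: fun_eq_iff)
    ultimately have "SI g (Z m - Z n) w = SI g (Z m) w - SI g (Z n) w" by simp
    then show "ip (y m - y n) w = ip (\<Phi> g (Z m - Z n)) w"
      using gb ZH w L2.diff_mem[OF ZH ZH, of m n] yH
      by (simp add: L2.ip_diff_left \<Phi>_ip y_def)
  qed (use yH gb ZH in auto)
  have ycauchy: "\<exists>N. \<forall>m\<ge>N. \<forall>n\<ge>N. nrm (y m - y n) < e" if e: "e > 0" for e
  proof -
    obtain N where N: "\<And>m n. m \<ge> N \<Longrightarrow> n \<ge> N \<Longrightarrow> energy (Z m - Z n) < e\<^sup>2" using cauchy[of "e\<^sup>2"] e by auto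
    have "nrm (y m - y n) < e" if "m \<ge> N" "n \<ge> N" for m n
    proof -
      have "(nrm (y m - y n))\<^sup>2 < e\<^sup>2"
        using g_energy[OF En.diff_mem[OF Z Z], of m n] N[OF that] by (simp add: ydiff)
      then show ?thesis by (rule power2_less_imp_less) (use e in simp)
    qed
    then show ?thesis by blast
  qed
  obtain z where z: "z \<in> \<H>" and yz: "(\<lambda>n. nrm (y n - z)) \<longlonglongrightarrow> 0"
    using L2.complete[OF yH ycauchy] by blast
  have y_AE: "AE x in \<sigma>. y n x = Z n x - T 1 (Z n) x" for n
  proof -
    have "AE x in \<sigma>. y n x = (Z n - T 1 (Z n)) x"
    proof (rule L2_AE_eq[OF yH, of "Z n - T 1 (Z n)"])
      fix w assume w: "w \<in> \<H>"
      have "SI (\<lambda>s. 1 + (-1) * h 1 s) (Z n) w = SI (\<lambda>_. 1) (Z n) w + SI (\<lambda>s. (-1) * h 1 s) (Z n) w"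
        using w ZH by (intro SI_add bounded_borel_mult) auto
      also have "SI (\<lambda>s. (-1) * h 1 s) (Z n) w = of_real (-1) * SI (h 1) (Z n) w"
        using w ZH by (intro SI_scale) auto
      finally have "SI g (Z n) w = ip (Z n) w - ip (T 1 (Z n)) w"
        unfolding g_def using w ZH by (simp add: SI_one \<Phi>_ip)
      then show "ip (y n) w = ip (Z n - T 1 (Z n)) w"
        using gb w ZH by (simp add: y_def \<Phi>_ip L2.ip_diff_left)
    qed (use ZH in auto)
    then show ?thesis by simp
  qed
  obtain r1 where r1: "strict_mono (r1::nat \<Rightarrow> nat)" "AE x in \<sigma>. (\<lambda>k. (y (r1 k) - z) x) \<longlonglongrightarrow> 0"
  proof -
    have "(\<lambda>n. Lp_int \<sigma> 2 (y n - z)) \<longlonglongrightarrow> 0" using yz L2_tendsto_Lp_int[OF yH z] by simp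
    then have "\<exists>r::nat\<Rightarrow>nat. strict_mono r \<and> (AE x in \<sigma>. (\<lambda>k. (y (r k) - z) x) \<longlonglongrightarrow> 0)"
      by (intro Lp_tendsto_AE_subseq[of "\<lambda>n. y n - z" \<sigma> 2]) (use yH z in auto)
    then show ?thesis using that by blast
  qed
  obtain r2 where r2: "strict_mono (r2::nat \<Rightarrow> nat)" "AE x in \<sigma>. (\<lambda>k. Z (r1 (r2 k)) x) \<longlonglongrightarrow> 0"
  proof -
    have "(\<lambda>k. Lp_int \<sigma> pexp (Z (r1 k))) \<longlonglongrightarrow> 0"
      using LIMSEQ_subseq_LIMSEQ[OF lim r1(1)] by (simp add: o_def)
    then have "\<exists>r::nat\<Rightarrow>nat. strict_mono r \<and> (AE x in \<sigma>. (\<lambda>k. Z (r1 (r k)) x) \<longlonglongrightarrow> 0)"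
      by (intro Lp_tendsto_AE_subseq[of "\<lambda>k. Z (r1 k)" \<sigma> pexp]) (use dom_sqrt_Lp Z pexp_pos in auto)
    then show ?thesis using that by blast
  qed
  define r where "r k = r1 (r2 k)" for k
  have r: "strict_mono r" using r1(1) r2(1) by (auto simp: r_def strict_mono_def)
  have bound: "Lp_int \<sigma> pexp z \<le> ennreal (2 powr pexp * (CLR_const * (32 * e) powr (d / (d - 2))))"
    if e: "e > 0" for e
  proof -
    obtain N where N: "\<And>m. m \<ge> N \<Longrightarrow> energy (Z m - Z N) < e" using cauchy[OF e] by blast
    define b where "b n = tail (Z N) (Z n)" for n
    define c where "c n = Z n - b n" for n
    have bH: "b n \<in> \<H>" for n unfolding b_def by (rule tail_mem[OF ZH ZH])
    have cH: "c n \<in> \<H>" for n unfolding c_def using ZH bH by simp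
    have cle: "cmod (c n x) \<le> cmod (Z n x)" "cmod (c n x) \<le> 2 * cmod (Z N x)" for n x
      by (auto simp: c_def b_def tail_def)
    note [measurable] = Lp_measurable[OF cH] Lp_measurable[OF ZH]
    have c_lim: "(\<lambda>k. Lp_int \<sigma> 2 (c (r k))) \<longlonglongrightarrow> 0"
    proof -
      have "(\<lambda>k. \<integral>\<^sup>+ x. ennreal (cmod (c (r k) x) powr 2) \<partial>\<sigma>) \<longlonglongrightarrow> (\<integral>\<^sup>+ x. 0 \<partial>\<sigma>)"
      proof (rule nn_integral_dominated_convergence[where w="\<lambda>x. ennreal (cmod (fscale 2 (Z N) x) powr 2)"])
        show "AE x in \<sigma>. ennreal (cmod (c (r k) x) powr 2) \<le> ennreal (cmod (fscale 2 (Z N) x) powr 2)" for k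
          using cle(2)[of "r k"] by (intro AE_I2 ennreal_leI powr_mono2) (auto simp: norm_mult)
        show "(\<integral>\<^sup>+ x. ennreal (cmod (fscale 2 (Z N) x) powr 2) \<partial>\<sigma>) < \<infinity>"
          using Lp_fscale[OF ZH, of 2 N] by (simp only: Lp_iff Lp_int_def)
        show "AE x in \<sigma>. (\<lambda>k. ennreal (cmod (c (r k) x) powr 2)) \<longlonglongrightarrow> 0"
          using r2(2)
        proof eventually_elim
          case (elim x)
          have "(\<lambda>k. c (r k) x) \<longlonglongrightarrow> 0"
            by (rule Lim_null_comparison[where g="\<lambda>k. cmod (Z (r k) x)"])
              (use elim cle(1) in \<open>auto simp: r_def intro: tendsto_norm_zero\<close>)
          then have "(\<lambda>k. cmod (c (r k) x) powr 2) \<longlonglongrightarrow> 0 powr 2"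
            by (intro tendsto_powr2 tendsto_const tendsto_norm_zero) auto
          then show ?case using tendsto_ennrealI by fastforce
        qed
      qed measurable
      then show ?thesis by (simp add: Lp_int_def)
    qed
    have TcH: "T 1 (c n) \<in> \<H>" for n using cH by simp
    have "(\<lambda>k. Lp_int \<sigma> 2 (T 1 (c (r k)))) \<longlonglongrightarrow> 0"
    proof (rule tendsto_sandwich[OF _ _ tendsto_const c_lim])
      show "\<forall>\<^sub>F k in sequentially. Lp_int \<sigma> 2 (T 1 (c (r k))) \<le> Lp_int \<sigma> 2 (c (r k))"
      proof (intro always_eventually allI)
        fix k
        have "(nrm (T 1 (c (r k))))\<^sup>2 \<le> (nrm (c (r k)))\<^sup>2"
          using nrm_T_le[of 1 "c (r k)"] cH TcH by (intro power_mono) auto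
        then show "Lp_int \<sigma> 2 (T 1 (c (r k))) \<le> Lp_int \<sigma> 2 (c (r k))"
          by (simp add: L2_nrm_Lp_int[OF cH] L2_nrm_Lp_int[OF TcH] ennreal_leI)
      qed
    qed simp
    then have "\<exists>q::nat\<Rightarrow>nat. strict_mono q \<and> (AE x in \<sigma>. (\<lambda>k. T 1 (c (r (q k))) x) \<longlonglongrightarrow> 0)"
      by (intro Lp_tendsto_AE_subseq[of "\<lambda>k. T 1 (c (r k))" \<sigma> 2] TcH) auto
    then obtain q where q: "strict_mono (q::nat \<Rightarrow> nat)" "AE x in \<sigma>. (\<lambda>k. T 1 (c (r (q k))) x) \<longlonglongrightarrow> 0"
      by blast
    have decomp: "AE x in \<sigma>. \<forall>n. T 1 (b n) x = Z n x - T 1 (c n) x - y n x"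
    proof (subst AE_all_countable, rule allI)
      fix n
      have "fscale 1 (c n) + b n = Z n" by (simp add: c_def fun_eq_iff)
      then have "AE x in \<sigma>. T 1 (Z n) x = T 1 (c n) x + T 1 (b n) x"
        using T_linear[OF _ cH bH, of 1 1 n n] by simp
      with y_AE[of n] show "AE x in \<sigma>. T 1 (b n) x = Z n x - T 1 (c n) x - y n x"
        by eventually_elim (simp add: algebra_simps)
    qed
    have "Lp_int \<sigma> pexp (- z) \<le> ennreal (2 powr pexp * (CLR_const * (32 * e) powr (d / (d - 2))))"
    proof (rule Lp_int_limit_le[where W="\<lambda>k. T 1 (b (r (q k)))"])
      show "T 1 (b (r (q k))) \<in> borel_measurable \<sigma>" for k
        using bH by (intro Lp_measurable[where p=2]) auto
      show "- z \<in> borel_measurable \<sigma>" using z by (intro Lp_measurable[where p=2]) auto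
      show "AE x in \<sigma>. (\<lambda>k. T 1 (b (r (q k))) x) \<longlonglongrightarrow> (- z) x"
        using decomp r1(2) r2(2) q(2)
      proof eventually_elim
        case (elim x)
        have sub: "(\<lambda>k. f (q k)) \<longlonglongrightarrow> (0::complex)" if "f \<longlonglongrightarrow> 0" for f
          using LIMSEQ_subseq_LIMSEQ[OF that q(1)] by (simp add: o_def)
        have a: "(\<lambda>k. Z (r (q k)) x) \<longlonglongrightarrow> 0" using sub[OF elim(3)] by (simp add: r_def)
        have "(\<lambda>k. (y (r1 (r2 k)) - z) x) \<longlonglongrightarrow> 0"
          using LIMSEQ_subseq_LIMSEQ[OF elim(2) r2(1)] by (simp add: o_def)
        from sub[OF this] have bb: "(\<lambda>k. y (r (q k)) x - z x) \<longlonglongrightarrow> 0" by (simp add: r_def)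
        have "(\<lambda>k. Z (r (q k)) x - T 1 (c (r (q k))) x - (y (r (q k)) x - z x) - z x) \<longlonglongrightarrow> 0 - 0 - 0 - z x"
          by (intro tendsto_diff a bb elim(4) tendsto_const)
        moreover have "(\<lambda>k. T 1 (b (r (q k))) x)
            = (\<lambda>k. Z (r (q k)) x - T 1 (c (r (q k))) x - (y (r (q k)) x - z x) - z x)"
          using elim(1) by (simp add: fun_eq_iff)
        ultimately show ?case by simp
      qed
      show "\<forall>\<^sub>F k in sequentially. Lp_int \<sigma> pexp (T 1 (b (r (q k))))
          \<le> ennreal (2 powr pexp * (CLR_const * (32 * e) powr (d / (d - 2))))"
        using eventually_ge_at_top[of N]
      proof eventually_elim
        case (elim k)
        have "N \<le> r (q k)" using elim seq_suble[OF q(1), of k] seq_suble[OF r, of "q k"] by linarith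
        then show ?case unfolding b_def using N e by (intro T_tail_bound[OF Z Z]) (auto intro: less_imp_le)
      qed
    qed (rule pexp_pos)
    then show ?thesis by (simp add: Lp_int_uminus)
  qed
  have "Lp_int \<sigma> pexp z \<le> 0"
  proof (rule LIMSEQ_le_const)
    have "(\<lambda>n. 2 powr pexp * (CLR_const * (32 * inverse (real (Suc n))) powr (d / (d - 2))))
      \<longlonglongrightarrow> 2 powr pexp * (CLR_const * (32 * 0) powr (d / (d - 2)))"
      using d by (intro tendsto_mult tendsto_const tendsto_powr2 LIMSEQ_inverse_real_of_nat) auto
    then show "(\<lambda>n. ennreal (2 powr pexp * (CLR_const * (32 * inverse (real (Suc n))) powr (d / (d - 2))))) \<longlonglongrightarrow> 0"
      using tendsto_ennrealI by fastforce
    show "\<exists>N. \<forall>n\<ge>N. Lp_int \<sigma> pexp z \<le> ennreal (2 powr pexp * (CLR_const * (32 * inverse (real (Suc n))) powr (d / (d - 2))))"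
      using bound by auto
  qed
  then have "AE x in \<sigma>. z x = 0" using Lp_int_eq_0[OF Lp_measurable[OF z], of pexp] by simp
  then have z0: "nrm z = 0" using L2_nrm_eq_0[OF z] by simp
  have "(\<lambda>n. nrm (y n)) \<longlonglongrightarrow> 0"
    using L2.nrm_tendsto[OF yH z yz] z0 by simp
  then show ?thesis using closable_if_weak[OF Z cauchy] unfolding y_def g_def by blast
qed

end

section \<open>The form and its completion\<close>

context sip begin

lemma cauchy_bounded:
  assumes U: "\<And>n. U n \<in> H" and c: "\<And>\<epsilon>. \<epsilon> > 0 \<Longrightarrow> \<exists>N. \<forall>m\<ge>N. \<forall>n\<ge>N. nrm (U m - U n) < \<epsilon>"
  shows "\<exists>B. \<forall>n::nat. nrm (U n) \<le> B"
proof -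
  obtain N where N: "\<And>m n. m \<ge> N \<Longrightarrow> n \<ge> N \<Longrightarrow> nrm (U m - U n) < 1" using c[of 1] by auto
  have "nrm (U n) \<le> (\<Sum>k\<le>N. nrm (U k)) + 1" for n
  proof (cases "n \<le> N")
    case True
    then have "nrm (U n) \<le> (\<Sum>k\<le>N. nrm (U k))" using U by (intro member_le_sum) auto
    then show ?thesis by simp
  next
    case False
    then have "nrm (U n) \<le> nrm (U n - U N) + nrm (U N)" using nrm_triangle[of "U n - U N" "U N"] U by simp
    moreover have "nrm (U n - U N) < 1" using N False by simp
    moreover have "nrm (U N) \<le> (\<Sum>k\<le>N. nrm (U k))" using U by (intro member_le_sum) auto
    ultimately show ?thesis by linarith
  qed
  then show ?thesis by blast
qed

lemma ip_diff_le:
  assumes "u \<in> H" "u' \<in> H" "w \<in> H" "w' \<in> H"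
  shows "cmod (ip u w - ip u' w') \<le> nrm (u - u') * nrm w + nrm u' * nrm (w - w')"
proof -
  have "ip u w - ip u' w' = ip (u - u') w + ip u' (w - w')"
    using assms by (simp add: ip_diff_left ip_diff_right)
  then have "cmod (ip u w - ip u' w') \<le> cmod (ip (u - u') w) + cmod (ip u' (w - w'))"
    using norm_triangle_ineq by metis
  also have "\<dots> \<le> nrm (u - u') * nrm w + nrm u' * nrm (w - w')"
    using assms by (intro add_mono cauchy_schwarz) auto
  finally show ?thesis .
qed

lemma ip_convergent:
  assumes U: "\<And>n. U n \<in> H" and cU: "\<And>\<epsilon>. \<epsilon> > 0 \<Longrightarrow> \<exists>N. \<forall>m\<ge>N. \<forall>n\<ge>N. nrm (U m - U n) < \<epsilon>"
    and W: "\<And>n. W n \<in> H" and cW: "\<And>\<epsilon>. \<epsilon> > 0 \<Longrightarrow> \<exists>N. \<forall>m\<ge>N. \<forall>n\<ge>N. nrm (W m - W n) < \<epsilon>"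
  shows "convergent (\<lambda>n::nat. ip (U n) (W n))"
proof -
  obtain B where B: "\<And>n. nrm (U n) \<le> B" using cauchy_bounded[OF U cU] by blast
  obtain B' where B': "\<And>n. nrm (W n) \<le> B'" using cauchy_bounded[OF W cW] by blast
  have B0: "0 \<le> B" "0 \<le> B'" using B[of 0] B'[of 0] U W nrm_nonneg order_trans by blast+
  have "Cauchy (\<lambda>n. ip (U n) (W n))"
  proof (rule metric_CauchyI)
    fix e :: real assume e: "e > 0"
    obtain N where N: "\<And>m n. m \<ge> N \<Longrightarrow> n \<ge> N \<Longrightarrow> nrm (U m - U n) < e / (2 * (B' + 1))"
      using cU[of "e / (2 * (B' + 1))"] e B0 by auto
    obtain N' where N': "\<And>m n. m \<ge> N' \<Longrightarrow> n \<ge> N' \<Longrightarrow> nrm (W m - W n) < e / (2 * (B + 1))"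
      using cW[of "e / (2 * (B + 1))"] e B0 by auto
    have "dist (ip (U m) (W m)) (ip (U n) (W n)) < e" if mn: "m \<ge> max N N'" "n \<ge> max N N'" for m n
    proof -
      have "cmod (ip (U m) (W m) - ip (U n) (W n)) \<le> nrm (U m - U n) * nrm (W m) + nrm (U n) * nrm (W m - W n)"
        by (rule ip_diff_le[OF U U W W])
      also have "\<dots> \<le> e / (2 * (B' + 1)) * B' + B * (e / (2 * (B + 1)))"
        using N[of m n] N'[of m n] mn B B' B0 e U W by (intro add_mono mult_mono) (auto intro: less_imp_le)
      also have "\<dots> < e / 2 + e / 2"
        using e B0 by (intro add_strict_mono) (auto simp: field_simps)
      finally show ?thesis by (simp add: dist_norm)
    qed
    then show "\<exists>M. \<forall>m\<ge>M. \<forall>n\<ge>M. dist (ip (U m) (W m)) (ip (U n) (W n)) < e" by blast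
  qed
  then show ?thesis by (rule Cauchy_convergent)
qed

lemma ip_asymptotic:
  assumes U: "\<And>n::nat. U n \<in> H" "\<And>n. U' n \<in> H" and W: "\<And>n. W n \<in> H" "\<And>n. W' n \<in> H"
    and B: "\<And>n. nrm (U' n) \<le> B" "\<And>n. nrm (W n) \<le> B'"
    and dU: "(\<lambda>n. nrm (U n - U' n)) \<longlonglongrightarrow> 0" and dW: "(\<lambda>n. nrm (W n - W' n)) \<longlonglongrightarrow> 0"
  shows "(\<lambda>n. ip (U n) (W n) - ip (U' n) (W' n)) \<longlonglongrightarrow> 0"
proof (rule Lim_null_comparison)
  show "\<forall>\<^sub>F n in sequentially. norm (ip (U n) (W n) - ip (U' n) (W' n))
      \<le> nrm (U n - U' n) * B' + B * nrm (W n - W' n)"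
  proof (intro always_eventually allI)
    fix n
    have "norm (ip (U n) (W n) - ip (U' n) (W' n)) \<le> nrm (U n - U' n) * nrm (W n) + nrm (U' n) * nrm (W n - W' n)"
      by (rule ip_diff_le[OF U W])
    also have "\<dots> \<le> nrm (U n - U' n) * B' + B * nrm (W n - W' n)"
      using B U W by (intro add_mono mult_left_mono mult_right_mono) auto
    finally show "norm (ip (U n) (W n) - ip (U' n) (W' n)) \<le> nrm (U n - U' n) * B' + B * nrm (W n - W' n)" .
  qed
  have "(\<lambda>n. nrm (U n - U' n) * B' + B * nrm (W n - W' n)) \<longlonglongrightarrow> 0 * B' + B * 0"
    by (intro tendsto_intros dU dW)
  then show "(\<lambda>n. nrm (U n - U' n) * B' + B * nrm (W n - W' n)) \<longlonglongrightarrow> 0" by simp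
qed

end

locale form_setting = positive_semigroup +
  fixes A :: "'a graph"
  assumes A: "A = spectral_integral \<sigma> E (\<lambda>s. s)"
begin

lemma fun_calc_sqrt: "fun_calc \<sigma> A sqrt = graph sqrt"
  by (rule fun_calc_eq[OF pvm_axioms A]) simp

abbreviation "FD \<equiv> form_domain \<sigma> A"

lemma form_domain_iff: "u \<in> FD \<longleftrightarrow> (\<exists>u'. (u, u') \<in> graph sqrt)"
  by (auto simp: form_domain_def fun_calc_sqrt)

lemma form_domain_dom: "u \<in> FD \<Longrightarrow> u \<in> dom sqrt"
  by (auto simp: form_domain_iff graph_iff)

text \<open>The second components are determined up to norm 0, which does not affect their inner product.\<close>

lemma form_eq:
  assumes u: "(u, u') \<in> graph sqrt" and v: "(v, v') \<in> graph sqrt"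
  shows "form \<sigma> A u v = ip u' v'"
  unfolding form_def fun_calc_sqrt
proof (rule the_equality)
  show "\<exists>x y. (u, x) \<in> graph sqrt \<and> (v, y) \<in> graph sqrt \<and> ip u' v' = ip x y" using u v by blast
next
  fix c assume "\<exists>x y. (u, x) \<in> graph sqrt \<and> (v, y) \<in> graph sqrt \<and> c = ip x y"
  then obtain x y where xy: "(u, x) \<in> graph sqrt" "(v, y) \<in> graph sqrt" "c = ip x y" by blast
  have H: "u' \<in> \<H>" "v' \<in> \<H>" "x \<in> \<H>" "y \<in> \<H>" using u v xy by (auto simp: graph_iff)
  have "nrm (x - u') = 0"
    by (rule graph_null[OF sqrt_measurable graph_diff[OF sqrt_measurable xy(1) u]]) simp
  moreover have "nrm (y - v') = 0"
    by (rule graph_null[OF sqrt_measurable graph_diff[OF sqrt_measurable xy(2) v]]) simp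
  ultimately have "cmod (ip x y - ip u' v') \<le> 0" using L2.ip_diff_le[OF H(3,1,4,2)] by simp
  then show "c = ip u' v'" using xy(3) by simp
qed

lemma sip_form: "sip fscale FD (form \<sigma> A)"
proof -
  interpret vector_space "fscale :: complex \<Rightarrow> 'a fn \<Rightarrow> 'a fn" by (rule vector_space_fscale)
  have lin: "(fscale c u + v, fscale c u' + v') \<in> graph sqrt"
    if "(u, u') \<in> graph sqrt" "(v, v') \<in> graph sqrt" for c u u' v v'
    using that by (rule graph_linear[OF sqrt_measurable])
  have zero: "(0, \<Phi> (\<lambda>s. sqrt s * indicator {} s) 0) \<in> graph sqrt"
    by (rule graph_supp[where K=0]) (auto simp: measure_\<mu>_UNIV)
  have zero': "(0, 0) \<in> graph sqrt" using graph_diff[OF sqrt_measurable zero zero] by simp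
  have sc: "(fscale c u, fscale c u') \<in> graph sqrt" if "(u, u') \<in> graph sqrt" for c u u'
    using lin[OF that zero', of c] by simp
  have ad: "(u + v, u' + v') \<in> graph sqrt" if "(u, u') \<in> graph sqrt" "(v, v') \<in> graph sqrt" for u u' v v'
    using lin[OF that, of 1] by simp
  show ?thesis
  proof
    show "0 \<in> FD" using zero by (auto simp: form_domain_iff)
    fix u v w :: "'a fn" and c :: complex
    assume u: "u \<in> FD"
    then obtain u' where u': "(u, u') \<in> graph sqrt" by (auto simp: form_domain_iff)
    then have uH: "u' \<in> \<H>" by (simp add: graph_iff)
    show "fscale c u \<in> FD" using sc[OF u'] by (auto simp: form_domain_iff)
    show "0 \<le> Re (form \<sigma> A u u)" using form_eq[OF u' u'] L2.ip_nonneg[OF uH] by simp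
    assume "w \<in> FD"
    then obtain w' where w': "(w, w') \<in> graph sqrt" by (auto simp: form_domain_iff)
    then have wH: "w' \<in> \<H>" by (simp add: graph_iff)
    show "u + w \<in> FD" using ad[OF u' w'] by (auto simp: form_domain_iff)
    show "form \<sigma> A (fscale c u) w = c * form \<sigma> A u w"
      using form_eq[OF sc[OF u'] w'] form_eq[OF u' w'] uH wH by (simp add: L2.ip_scale_left)
    show "form \<sigma> A w u = cnj (form \<sigma> A u w)"
      using form_eq[OF w' u'] form_eq[OF u' w'] L2.ip_commute[OF uH wH] by simp
    assume "v \<in> FD"
    then obtain v' where v': "(v, v') \<in> graph sqrt" by (auto simp: form_domain_iff)
    then have vH: "v' \<in> \<H>" by (simp add: graph_iff)
    show "form \<sigma> A (u + v) w = form \<sigma> A u w + form \<sigma> A v w"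
      using form_eq[OF ad[OF u' v'] w'] form_eq[OF u' w'] form_eq[OF v' w'] uH vH wH
      by (simp add: L2.ip_add_left)
  qed
qed

sublocale F: sip fscale FD "form \<sigma> A"
  by (rule sip_form)

lemma F_nrm_sq: "u \<in> FD \<Longrightarrow> (F.nrm u)\<^sup>2 = energy u"
proof -
  assume u: "u \<in> FD"
  then obtain u' where u': "(u, u') \<in> graph sqrt" by (auto simp: form_domain_iff)
  then have uH: "u' \<in> \<H>" by (simp add: graph_iff)
  have "(F.nrm u)\<^sup>2 = (nrm u')\<^sup>2" using F.nrm_sq[OF u] form_eq[OF u' u'] L2.nrm_sq[OF uH] by simp
  also have "\<dots> = energy u" using graph_nrm[OF sqrt_measurable u'] by (simp add: energy_def sqrt_sq)
  finally show ?thesis .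
qed

lemma ip_norm_form: "ip_norm (form \<sigma> A) = F.nrm"
  by (auto simp: ip_norm_def F.nrm_def)

lemma form_domain_Lp: "u \<in> FD \<Longrightarrow> u \<in> Lp \<sigma> pexp"
  by (intro dom_sqrt_Lp form_domain_dom)

abbreviation "approx \<equiv> form_approx \<sigma> A pexp"
abbreviation "FS \<equiv> form_space \<sigma> A pexp"
abbreviation "fip \<equiv> form_space_inner \<sigma> A pexp"

lemma approx_iff: "approx U u \<longleftrightarrow> (\<forall>n. U n \<in> FD) \<and>
    (\<forall>\<epsilon>>0. \<exists>N. \<forall>m\<ge>N. \<forall>n\<ge>N. F.nrm (U m - U n) < \<epsilon>) \<and> u \<in> Lp \<sigma> pexp \<and>
    (\<lambda>n. Lp_int \<sigma> pexp (U n - u)) \<longlonglongrightarrow> 0"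
  by (simp add: form_approx_def ip_norm_form Lp_int_def fun_diff_def)

lemma approxD:
  assumes "approx U u"
  shows "U n \<in> FD" "\<epsilon> > 0 \<Longrightarrow> \<exists>N. \<forall>m\<ge>N. \<forall>n\<ge>N. F.nrm (U m - U n) < \<epsilon>" "u \<in> Lp \<sigma> pexp"
    "(\<lambda>n. Lp_int \<sigma> pexp (U n - u)) \<longlonglongrightarrow> 0"
  using assms by (auto simp: approx_iff)

lemma approx_const: "u \<in> FD \<Longrightarrow> approx (\<lambda>_. u) u"
  by (simp add: approx_iff form_domain_Lp)

lemma Lp_lim_add:
  assumes "\<And>n. U n \<in> Lp \<sigma> pexp" "\<And>n. W n \<in> Lp \<sigma> pexp"
    and "(\<lambda>n. Lp_int \<sigma> pexp (U n)) \<longlonglongrightarrow> 0" "(\<lambda>n. Lp_int \<sigma> pexp (W n)) \<longlonglongrightarrow> 0"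
  shows "(\<lambda>n. Lp_int \<sigma> pexp (U n + W n)) \<longlonglongrightarrow> 0"
proof (rule tendsto_sandwich[OF _ _ tendsto_const])
  show "\<forall>\<^sub>F n in sequentially. Lp_int \<sigma> pexp (U n + W n)
      \<le> ennreal (2 powr pexp) * (Lp_int \<sigma> pexp (U n) + Lp_int \<sigma> pexp (W n))"
    using assms(1,2) pexp_pos by (intro always_eventually allI Lp_int_add) (auto intro: Lp_measurable)
  have "(\<lambda>n. ennreal (2 powr pexp) * (Lp_int \<sigma> pexp (U n) + Lp_int \<sigma> pexp (W n)))
      \<longlonglongrightarrow> ennreal (2 powr pexp) * (0 + 0)"
    by (intro ennreal_tendsto_cmult tendsto_add assms ennreal_less_top)
  then show "(\<lambda>n. ennreal (2 powr pexp) * (Lp_int \<sigma> pexp (U n) + Lp_int \<sigma> pexp (W n))) \<longlonglongrightarrow> 0"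
    by simp
qed simp

lemma Lp_lim_scale:
  assumes "\<And>n. U n \<in> Lp \<sigma> pexp" "(\<lambda>n. Lp_int \<sigma> pexp (U n)) \<longlonglongrightarrow> 0"
  shows "(\<lambda>n. Lp_int \<sigma> pexp (fscale c (U n))) \<longlonglongrightarrow> 0"
proof -
  have "(\<lambda>n. ennreal (cmod c powr pexp) * Lp_int \<sigma> pexp (U n)) \<longlonglongrightarrow> ennreal (cmod c powr pexp) * 0"
    by (intro ennreal_tendsto_cmult assms ennreal_less_top)
  moreover have "Lp_int \<sigma> pexp (fscale c (U n)) = ennreal (cmod c powr pexp) * Lp_int \<sigma> pexp (U n)" for n
    by (rule Lp_int_fscale[OF Lp_measurable[OF assms(1)]])
  ultimately show ?thesis by simp
qed

lemma cauchy_add: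
  fixes U W :: "nat \<Rightarrow> 'a fn"
  assumes "\<And>n. U n \<in> FD" "\<And>n. W n \<in> FD"
    and "\<And>\<epsilon>. \<epsilon> > 0 \<Longrightarrow> \<exists>N. \<forall>m\<ge>N. \<forall>n\<ge>N. F.nrm (U m - U n) < \<epsilon>"
    and "\<And>\<epsilon>. \<epsilon> > 0 \<Longrightarrow> \<exists>N. \<forall>m\<ge>N. \<forall>n\<ge>N. F.nrm (W m - W n) < \<epsilon>" and e: "\<epsilon> > 0"
  shows "\<exists>N. \<forall>m\<ge>N. \<forall>n\<ge>N. F.nrm ((fscale c (U m) + W m) - (fscale c (U n) + W n)) < \<epsilon>"
proof -
  obtain N where N: "\<And>m n. m \<ge> N \<Longrightarrow> n \<ge> N \<Longrightarrow> F.nrm (U m - U n) < \<epsilon> / (2 * (cmod c + 1))"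
    using assms(3)[of "\<epsilon> / (2 * (cmod c + 1))"] e by (auto simp: add_nonneg_pos)
  obtain N' where N': "\<And>m n. m \<ge> N' \<Longrightarrow> n \<ge> N' \<Longrightarrow> F.nrm (W m - W n) < \<epsilon> / 2"
    using assms(4)[of "\<epsilon> / 2"] e by auto
  have "F.nrm ((fscale c (U m) + W m) - (fscale c (U n) + W n)) < \<epsilon>"
    if mn: "m \<ge> max N N'" "n \<ge> max N N'" for m n
  proof -
    have eq: "(fscale c (U m) + W m) - (fscale c (U n) + W n) = fscale c (U m - U n) + (W m - W n)"
      by (simp add: fun_eq_iff algebra_simps)
    have "F.nrm ((fscale c (U m) + W m) - (fscale c (U n) + W n))
        \<le> cmod c * F.nrm (U m - U n) + F.nrm (W m - W n)"
      unfolding eq using F.nrm_triangle[of "fscale c (U m - U n)" "W m - W n"] assms(1,2) by (simp add: F.nrm_scale)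
    also have "\<dots> < \<epsilon> / 2 + \<epsilon> / 2"
    proof (rule add_le_less_mono)
      have "cmod c * F.nrm (U m - U n) \<le> cmod c * (\<epsilon> / (2 * (cmod c + 1)))"
        by (intro mult_left_mono less_imp_le[OF N]) (use mn in simp_all)
      also have "\<dots> = cmod c * \<epsilon> / (2 * (cmod c + 1))" by simp
      also have "\<dots> \<le> \<epsilon> / 2"
      proof -
        have "0 < 2 * (cmod c + 1)" by (simp add: add_nonneg_pos)
        then show ?thesis using e by (simp only: pos_divide_le_eq) (simp add: algebra_simps)
      qed
      finally show "cmod c * F.nrm (U m - U n) \<le> \<epsilon> / 2" .
    qed (use N' mn in auto)
    finally show ?thesis by simp
  qed
  then show ?thesis by blast
qed

lemma approx_linear:
  assumes U: "approx U u" and W: "approx W w"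
  shows "approx (\<lambda>n. fscale c (U n) + W n) (fscale c u + w)"
  unfolding approx_iff
proof (intro conjI allI impI)
  show "fscale c (U n) + W n \<in> FD" for n using approxD(1)[OF U] approxD(1)[OF W] by simp
  show "\<exists>N. \<forall>m\<ge>N. \<forall>n\<ge>N. F.nrm ((fscale c (U m) + W m) - (fscale c (U n) + W n)) < \<epsilon>" if "\<epsilon> > 0" for \<epsilon>
    by (rule cauchy_add[OF approxD(1)[OF U] approxD(1)[OF W] approxD(2)[OF U] approxD(2)[OF W] that])
  show "fscale c u + w \<in> Lp \<sigma> pexp" using approxD(3)[OF U] approxD(3)[OF W] pexp_pos by (intro Lp_add Lp_fscale)
  have Lp: "U n - u \<in> Lp \<sigma> pexp" "W n - w \<in> Lp \<sigma> pexp" for n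
    using approxD(1,3)[OF U] approxD(1,3)[OF W] form_domain_Lp pexp_pos by (auto intro!: Lp_diff)
  have "(\<lambda>n. Lp_int \<sigma> pexp (fscale c (U n - u) + (W n - w))) \<longlonglongrightarrow> 0"
    by (intro Lp_lim_add Lp_lim_scale Lp Lp_fscale approxD(4)[OF U] approxD(4)[OF W])
  moreover have "fscale c (U n - u) + (W n - w) = fscale c (U n) + W n - (fscale c u + w)" for n
    by (simp add: fun_eq_iff algebra_simps)
  ultimately show "(\<lambda>n. Lp_int \<sigma> pexp (fscale c (U n) + W n - (fscale c u + w))) \<longlonglongrightarrow> 0" by simp
qed

text \<open>Closability, restated for the sequences that define the completion.\<close>

lemma approx_zero:
  assumes Z: "approx Z 0" shows "(\<lambda>n. F.nrm (Z n)) \<longlonglongrightarrow> 0"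
proof -
  note ZD = approxD(1)[OF Z]
  have "(\<lambda>n. energy (Z n)) \<longlonglongrightarrow> 0"
  proof (rule closable)
    show "Z n \<in> dom sqrt" for n by (rule form_domain_dom[OF ZD])
    show "(\<lambda>n. Lp_int \<sigma> pexp (Z n)) \<longlonglongrightarrow> 0" using approxD(4)[OF Z] by simp
    fix \<epsilon> :: real assume e: "\<epsilon> > 0"
    then obtain N where N: "\<And>m n. m \<ge> N \<Longrightarrow> n \<ge> N \<Longrightarrow> F.nrm (Z m - Z n) < sqrt \<epsilon>"
      using approxD(2)[OF Z, of "sqrt \<epsilon>"] by auto
    have "energy (Z m - Z n) < \<epsilon>" if "m \<ge> N" "n \<ge> N" for m n
    proof -
      have "(F.nrm (Z m - Z n))\<^sup>2 < (sqrt \<epsilon>)\<^sup>2" using N[OF that] ZD by (intro power_strict_mono) auto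
      then show ?thesis using e ZD by (simp add: F_nrm_sq)
    qed
    then show "\<exists>N. \<forall>m\<ge>N. \<forall>n\<ge>N. energy (Z m - Z n) < \<epsilon>" by blast
  qed
  then have "(\<lambda>n. sqrt ((F.nrm (Z n))\<^sup>2)) \<longlonglongrightarrow> sqrt 0"
    using ZD by (intro tendsto_real_sqrt) (simp add: F_nrm_sq)
  then show ?thesis using ZD by simp
qed

lemma approx_diff_null:
  assumes U: "approx U u" and U': "approx U' u" shows "(\<lambda>n. F.nrm (U n - U' n)) \<longlonglongrightarrow> 0"
proof -
  have "approx (\<lambda>n. fscale (-1) (U' n) + U n) (fscale (-1) u + u)" by (rule approx_linear[OF U' U])
  moreover have "fscale (-1) u + u = 0" by (simp add: fun_eq_iff)
  moreover have "fscale (-1) (U' n) + U n = U n - U' n" for n by (simp add: fun_eq_iff)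
  ultimately show ?thesis using approx_zero[of "\<lambda>n. U n - U' n"] by simp
qed

text \<open>Two approximating sequences of the same function differ by a sequence tending to 0 in energy, so the limit is
  independent of the choice and the description in \<open>form_space_inner\<close> is proper.\<close>

lemma fip_lim:
  assumes U: "approx U u" and W: "approx W w"
  shows "(\<lambda>n. form \<sigma> A (U n) (W n)) \<longlonglongrightarrow> fip u w"
proof -
  obtain c where c: "(\<lambda>n. form \<sigma> A (U n) (W n)) \<longlonglongrightarrow> c"
    using F.ip_convergent[OF approxD(1,2)[OF U] approxD(1,2)[OF W]] by (auto simp: convergent_def)
  have "c' = c" if U': "approx U' u" and W': "approx W' w" and c': "(\<lambda>n. form \<sigma> A (U' n) (W' n)) \<longlonglongrightarrow> c'" for U' W' c'
  proof -
    obtain B where B: "\<And>n. F.nrm (U n) \<le> B" using F.cauchy_bounded[OF approxD(1,2)[OF U]] by blast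
    obtain B' where B': "\<And>n. F.nrm (W' n) \<le> B'" using F.cauchy_bounded[OF approxD(1,2)[OF W']] by blast
    have "(\<lambda>n. form \<sigma> A (U' n) (W' n) - form \<sigma> A (U n) (W n)) \<longlonglongrightarrow> 0"
      by (rule F.ip_asymptotic[OF approxD(1)[OF U'] approxD(1)[OF U] approxD(1)[OF W'] approxD(1)[OF W]
          B B' approx_diff_null[OF U' U] approx_diff_null[OF W' W]])
    moreover have "(\<lambda>n. form \<sigma> A (U' n) (W' n) - form \<sigma> A (U n) (W n)) \<longlonglongrightarrow> c' - c"
      by (intro tendsto_diff c c')
    ultimately have "c' - c = 0" using LIMSEQ_unique by blast
    then show ?thesis by simp
  qed
  then have "fip u w = c" unfolding form_space_inner_def using U W c
    by (intro the_equality) blast+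
  then show ?thesis using c by simp
qed

lemma form_space_iff: "u \<in> FS \<longleftrightarrow> (\<exists>U. approx U u)"
  by (simp add: form_space_def)

lemma sip_form_space: "sip fscale FS fip"
proof -
  interpret vector_space "fscale :: complex \<Rightarrow> 'a fn \<Rightarrow> 'a fn" by (rule vector_space_fscale)
  have z: "approx (\<lambda>_. 0) 0" by (rule approx_const) simp
  have sc: "approx (\<lambda>n. fscale c (U n)) (fscale c u)" if "approx U u" for c U u
    using approx_linear[OF that z, of c] by simp
  have ad: "approx (\<lambda>n. U n + W n) (u + w)" if "approx U u" "approx W w" for U u W w
    using approx_linear[OF that, of 1] by simp
  show ?thesis
  proof
    show "0 \<in> FS" using z by (auto simp: form_space_iff)
    fix u v w :: "'a fn" and c :: complex
    assume "u \<in> FS"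
    then obtain U where U: "approx U u" by (auto simp: form_space_iff)
    show "fscale c u \<in> FS" using sc[OF U] by (auto simp: form_space_iff)
    have "(\<lambda>n. Re (form \<sigma> A (U n) (U n))) \<longlonglongrightarrow> Re (fip u u)" by (intro tendsto_Re fip_lim U)
    then show "0 \<le> Re (fip u u)"
      by (rule LIMSEQ_le_const) (use F.ip_nonneg approxD(1)[OF U] in blast)
    assume "w \<in> FS"
    then obtain W where W: "approx W w" by (auto simp: form_space_iff)
    show "u + w \<in> FS" using ad[OF U W] by (auto simp: form_space_iff)
    show "fip (fscale c u) w = c * fip u w"
    proof (rule LIMSEQ_unique[OF fip_lim[OF sc[OF U] W]])
      show "(\<lambda>n. form \<sigma> A (fscale c (U n)) (W n)) \<longlonglongrightarrow> c * fip u w"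
        using tendsto_mult_left[OF fip_lim[OF U W], of c] approxD(1)[OF U] approxD(1)[OF W]
        by (simp add: F.ip_scale_left)
    qed
    show "fip w u = cnj (fip u w)"
    proof (rule LIMSEQ_unique[OF fip_lim[OF W U]])
      have "form \<sigma> A (W n) (U n) = cnj (form \<sigma> A (U n) (W n))" for n
        by (rule F.ip_commute[OF approxD(1)[OF U] approxD(1)[OF W]])
      then show "(\<lambda>n. form \<sigma> A (W n) (U n)) \<longlonglongrightarrow> cnj (fip u w)"
        using tendsto_cnj[OF fip_lim[OF U W]] by presburger
    qed
    assume "v \<in> FS"
    then obtain V where V: "approx V v" by (auto simp: form_space_iff)
    show "fip (u + v) w = fip u w + fip v w"
    proof (rule LIMSEQ_unique[OF fip_lim[OF ad[OF U V] W]])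
      show "(\<lambda>n. form \<sigma> A (U n + V n) (W n)) \<longlonglongrightarrow> fip u w + fip v w"
        using tendsto_add[OF fip_lim[OF U W] fip_lim[OF V W]] approxD(1)[OF U] approxD(1)[OF V] approxD(1)[OF W]
        by (simp add: F.ip_add_left)
    qed
  qed
qed

sublocale FS: sip fscale FS fip
  by (rule sip_form_space)

lemma FS_nrm_lim: "approx U u \<Longrightarrow> (\<lambda>n. F.nrm (U n)) \<longlonglongrightarrow> FS.nrm u"
  unfolding F.nrm_def FS.nrm_def by (intro tendsto_real_sqrt tendsto_Re fip_lim)

lemma form_domain_subset: "u \<in> FD \<Longrightarrow> u \<in> FS"
  using approx_const form_space_iff by blast

lemma form_space_Lp: "u \<in> FS \<Longrightarrow> u \<in> Lp \<sigma> pexp"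
  using form_space_iff approxD(3) by blast

lemma approx_dense:
  assumes U: "approx U u" and e: "\<epsilon> > 0"
  shows "\<exists>N. \<forall>n\<ge>N. FS.nrm (U n - u) \<le> \<epsilon>"
proof -
  obtain N where N: "\<And>m n. m \<ge> N \<Longrightarrow> n \<ge> N \<Longrightarrow> F.nrm (U m - U n) < \<epsilon>" using approxD(2)[OF U e] by blast
  have "FS.nrm (U n - u) \<le> \<epsilon>" if n: "n \<ge> N" for n
  proof -
    have "approx (\<lambda>k. fscale (-1) (U k) + U n) (fscale (-1) u + U n)"
      by (rule approx_linear[OF U approx_const[OF approxD(1)[OF U]]])
    moreover have "fscale (-1) z + U n = U n - z" for z by (simp add: fun_eq_iff)
    ultimately have "(\<lambda>k. F.nrm (U n - U k)) \<longlonglongrightarrow> FS.nrm (U n - u)" using FS_nrm_lim by simp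
    then show ?thesis by (rule LIMSEQ_le_const2) (use N[OF n] less_imp_le in blast)
  qed
  then show ?thesis by blast
qed

text \<open>The strict inequality leaves room for approximants in the form domain, whose energy is only close to that of
  \<open>u\<close>.\<close>

lemma sobolev_form_space:
  assumes u: "u \<in> FS" and e: "(FS.nrm u)\<^sup>2 < e"
  shows "Lp_int \<sigma> pexp u \<le> ennreal (CLR_const * e powr (d / (d - 2)))"
proof -
  obtain U where U: "approx U u" using u by (auto simp: form_space_iff)
  have e0: "e > 0" using e zero_le_power2[of "FS.nrm u"] by linarith
  have Lp: "U n - u \<in> Lp \<sigma> pexp" "U n \<in> Lp \<sigma> pexp" for n
    using approxD(1,3)[OF U] form_domain_Lp pexp_pos by (auto intro!: Lp_diff)
  obtain r where r: "strict_mono (r::nat \<Rightarrow> nat)" "AE x in \<sigma>. (\<lambda>k. (U (r k) - u) x) \<longlonglongrightarrow> 0"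
    using Lp_tendsto_AE_subseq[OF Lp(1) approxD(4)[OF U] pexp_pos] by blast
  have "(\<lambda>n. (F.nrm (U n))\<^sup>2) \<longlonglongrightarrow> (FS.nrm u)\<^sup>2" by (intro tendsto_power FS_nrm_lim U)
  from LIMSEQ_subseq_LIMSEQ[OF this r(1)] have "(\<lambda>k. (F.nrm (U (r k)))\<^sup>2) \<longlonglongrightarrow> (FS.nrm u)\<^sup>2"
    by (simp add: o_def)
  then have ev: "\<forall>\<^sub>F k in sequentially. (F.nrm (U (r k)))\<^sup>2 < e" using e by (rule order_tendstoD)
  show ?thesis
  proof (rule Lp_int_limit_le[OF _ _ _ _ pexp_pos])
    show "U (r k) \<in> borel_measurable \<sigma>" for k using Lp(2) by (rule Lp_measurable)
    show "u \<in> borel_measurable \<sigma>" using approxD(3)[OF U] by (rule Lp_measurable)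
    show "AE x in \<sigma>. (\<lambda>k. U (r k) x) \<longlonglongrightarrow> u x"
      using r(2) by eventually_elim (simp add: LIM_zero_cancel)
    show "\<forall>\<^sub>F k in sequentially. Lp_int \<sigma> pexp (U (r k)) \<le> ennreal (CLR_const * e powr (d / (d - 2)))"
      using ev
    proof eventually_elim
      case (elim k)
      then show ?case
        using sobolev[OF form_domain_dom[OF approxD(1)[OF U]] e0, of "r k"] F_nrm_sq[OF approxD(1)[OF U], of "r k"]
        by simp
    qed
  qed
qed

lemma Lp_cauchy_of_form_cauchy:
  assumes U: "\<And>n. U n \<in> FS" and c: "\<And>\<epsilon>. \<epsilon> > 0 \<Longrightarrow> \<exists>N. \<forall>m\<ge>N. \<forall>n\<ge>N. FS.nrm (U m - U n) < \<epsilon>" and e: "\<epsilon> > 0"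
  shows "\<exists>N. \<forall>m\<ge>N. \<forall>n\<ge>N. Lp_int \<sigma> pexp (U m - U n) < ennreal \<epsilon>"
proof -
  define \<eta> where "\<eta> = (\<epsilon> / (2 * CLR_const)) powr ((d - 2) / d)"
  have \<eta>: "\<eta> > 0" using e CLR_const_pos by (simp add: \<eta>_def)
  have \<eta>2: "CLR_const * \<eta> powr (d / (d - 2)) < \<epsilon>"
    using e CLR_const_pos d by (simp add: \<eta>_def powr_powr)
  obtain N where N: "\<And>m n. m \<ge> N \<Longrightarrow> n \<ge> N \<Longrightarrow> FS.nrm (U m - U n) < sqrt \<eta>" using c[of "sqrt \<eta>"] \<eta> by auto
  have "Lp_int \<sigma> pexp (U m - U n) < ennreal \<epsilon>" if "m \<ge> N" "n \<ge> N" for m n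
  proof -
    have "(FS.nrm (U m - U n))\<^sup>2 < (sqrt \<eta>)\<^sup>2" using N[OF that] U by (intro power_strict_mono) auto
    then have "Lp_int \<sigma> pexp (U m - U n) \<le> ennreal (CLR_const * \<eta> powr (d / (d - 2)))"
      using \<eta> U by (intro sobolev_form_space) auto
    also have "\<dots> < ennreal \<epsilon>" using \<eta>2 e by (rule ennreal_lessI[rotated])
    finally show ?thesis .
  qed
  then show ?thesis by blast
qed

lemma F_nrm_FS: "u \<in> FD \<Longrightarrow> FS.nrm u = F.nrm u"
  using FS_nrm_lim[OF approx_const[of u]] LIMSEQ_unique[OF _ tendsto_const] by blast

text \<open>Replace each \<open>u n\<close> by an element \<open>V n\<close> of the form domain at distance at most \<open>1/(n+1)\<close>.  By the Sobolev inequality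
  \<open>V\<close> converges in \<open>L\<^sup>p\<close>, and the limit is, by definition of the form space, the limit in energy.\<close>

lemma complete_form_space: "complete_sip fscale FS fip"
proof unfold_locales
  fix u :: "nat \<Rightarrow> 'a fn"
  assume u: "\<And>n. u n \<in> FS"
    and c: "\<And>\<epsilon>. \<epsilon> > 0 \<Longrightarrow> \<exists>N. \<forall>m\<ge>N. \<forall>n\<ge>N. FS.nrm (u m - u n) < \<epsilon>"
  have "\<exists>v\<in>FD. FS.nrm (v - u n) \<le> 1 / real (Suc n)" for n
  proof -
    obtain U where U: "approx U (u n)" using u[of n] by (auto simp: form_space_iff)
    obtain N where "\<forall>k\<ge>N. FS.nrm (U k - u n) \<le> 1 / real (Suc n)" using approx_dense[OF U, of "1 / real (Suc n)"] by auto
    then show ?thesis using approxD(1)[OF U] by blast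
  qed
  then obtain V where V: "\<And>n. V n \<in> FD" "\<And>n. FS.nrm (V n - u n) \<le> 1 / real (Suc n)" by metis
  have VS: "V n \<in> FS" for n by (rule form_domain_subset[OF V(1)])
  have Vc: "\<exists>N. \<forall>m\<ge>N. \<forall>n\<ge>N. FS.nrm (V m - V n) < \<epsilon>" if e: "\<epsilon> > 0" for \<epsilon>
  proof -
    obtain N where N: "\<And>m n. m \<ge> N \<Longrightarrow> n \<ge> N \<Longrightarrow> FS.nrm (u m - u n) < \<epsilon> / 3" using c[of "\<epsilon> / 3"] e by auto
    obtain M where M: "inverse (real (Suc M)) < \<epsilon> / 3" using reals_Archimedean[of "\<epsilon> / 3"] e by auto
    have "FS.nrm (V m - V n) < \<epsilon>" if mn: "m \<ge> max N M" "n \<ge> max N M" for m n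
    proof -
      have b: "FS.nrm (V k - u k) < \<epsilon> / 3" if "k \<ge> M" for k
      proof -
        have "1 / real (Suc k) \<le> 1 / real (Suc M)" using that by (simp add: frac_le)
        then show ?thesis using V(2)[of k] M by (simp add: inverse_eq_divide)
      qed
      have "FS.nrm (V m - V n) \<le> FS.nrm (V m - u m) + (FS.nrm (u m - u n) + FS.nrm (V n - u n))"
        using FS.nrm_triangle3[OF VS[of m] u[of m] VS[of n]] FS.nrm_triangle3[OF u[of m] u[of n] VS[of n]]
          FS.nrm_minus_commute[OF u[of n] VS[of n]] by linarith
      moreover have "FS.nrm (u m - u n) < \<epsilon> / 3" using N mn by simp
      moreover have "FS.nrm (V m - u m) < \<epsilon> / 3" "FS.nrm (V n - u n) < \<epsilon> / 3" using b mn by simp_all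
      ultimately show ?thesis by linarith
    qed
    then show ?thesis by blast
  qed
  obtain w where w: "w \<in> Lp \<sigma> pexp" "(\<lambda>n. Lp_int \<sigma> pexp (V n - w)) \<longlonglongrightarrow> 0"
    using Lp_complete[OF form_domain_Lp[OF V(1)] pexp_pos Lp_cauchy_of_form_cauchy[OF VS Vc]] by blast
  have aw: "approx V w" unfolding approx_iff
    using V(1) w Vc F_nrm_FS[OF F.diff_mem[OF V(1) V(1)]] by simp
  have wS: "w \<in> FS" using aw by (auto simp: form_space_iff)
  have "(\<lambda>n. FS.nrm (V n - w)) \<longlonglongrightarrow> 0"
  proof (rule LIMSEQ_I)
    fix e :: real assume "e > 0"
    then obtain N where "\<forall>n\<ge>N. FS.nrm (V n - w) \<le> e / 2" using approx_dense[OF aw, of "e / 2"] by auto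
    then show "\<exists>N. \<forall>n\<ge>N. norm (FS.nrm (V n - w) - 0) < e"
      using \<open>e > 0\<close> VS wS by (intro exI[of _ N]) (auto intro: le_less_trans)
  qed
  then have "(\<lambda>n. 1 / real (Suc n) + FS.nrm (V n - w)) \<longlonglongrightarrow> 0 + 0"
    by (intro tendsto_add LIMSEQ_Suc[OF lim_inverse_n'])
  then have lim: "(\<lambda>n. 1 / real (Suc n) + FS.nrm (V n - w)) \<longlonglongrightarrow> 0" by simp
  have "(\<lambda>n. FS.nrm (u n - w)) \<longlonglongrightarrow> 0"
  proof (rule tendsto_sandwich[OF _ _ tendsto_const lim])
    show "\<forall>\<^sub>F n in sequentially. FS.nrm (u n - w) \<le> 1 / real (Suc n) + FS.nrm (V n - w)"
    proof (intro always_eventually allI)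
      fix n
      show "FS.nrm (u n - w) \<le> 1 / real (Suc n) + FS.nrm (V n - w)"
        using FS.nrm_triangle3[OF u[of n] VS[of n] wS] FS.nrm_minus_commute[OF u[of n] VS[of n]] V(2)[of n]
        by linarith
    qed
  qed (use u wS in auto)
  then show "\<exists>w\<in>FS. (\<lambda>n. FS.nrm (u n - w)) \<longlonglongrightarrow> 0" using wS by blast
qed

sublocale FS: complete_sip fscale FS fip
  by (rule complete_form_space)

lemma Lp_lim_sum:
  assumes "\<And>i n. i < (N::nat) \<Longrightarrow> f i n \<in> Lp \<sigma> pexp"
    and "\<And>i. i < N \<Longrightarrow> (\<lambda>n. Lp_int \<sigma> pexp (f i n)) \<longlonglongrightarrow> 0"
  shows "(\<lambda>n. Lp_int \<sigma> pexp (\<Sum>i<N. f i n)) \<longlonglongrightarrow> 0 \<and> (\<forall>n. (\<Sum>i<N. f i n) \<in> Lp \<sigma> pexp)"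
  using assms
proof (induction N)
  case (Suc N)
  have IH: "(\<lambda>n. Lp_int \<sigma> pexp (\<Sum>i<N. f i n)) \<longlonglongrightarrow> 0" "\<And>n. (\<Sum>i<N. f i n) \<in> Lp \<sigma> pexp"
    using Suc.IH Suc.prems by simp_all
  have fN: "\<And>n. f N n \<in> Lp \<sigma> pexp" "(\<lambda>n. Lp_int \<sigma> pexp (f N n)) \<longlonglongrightarrow> 0"
    using Suc.prems by simp_all
  have "(\<lambda>n. Lp_int \<sigma> pexp ((\<Sum>i<N. f i n) + f N n)) \<longlonglongrightarrow> 0"
    by (rule Lp_lim_add[OF IH(2) fN(1) IH(1) fN(2)])
  moreover have "(\<Sum>i<N. f i n) + f N n \<in> Lp \<sigma> pexp" for n
    by (rule Lp_add[OF pexp_pos IH(2) fN(1)])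
  ultimately show ?case unfolding sum.lessThan_Suc by blast
qed simp

text \<open>A matrix whose entries differ from those of the identity by at most \<open>1/(N+1)\<close> has norm at most 2.\<close>

lemma gram_le:
  assumes G: "\<And>i j. i < N \<Longrightarrow> j < N \<Longrightarrow> cmod (form \<sigma> A (f i) (f j) - (if i = j then 1 else 0)) \<le> 1 / (real N + 1)"
    and f: "\<And>i. i < (N::nat) \<Longrightarrow> f i \<in> FD"
  shows "energy (\<Sum>i<N. fscale (c i) (f i)) \<le> 2 * (\<Sum>i<N. (cmod (c i))\<^sup>2)"
proof -
  let ?z = "\<Sum>i<N. fscale (c i) (f i)"
  let ?g = "\<lambda>i j. form \<sigma> A (f i) (f j)"
  let ?e = "\<lambda>i j. ?g i j - (if i = j then 1 else 0)"
  have zD: "?z \<in> FD" using f by (intro F.sum_mem F.scale_mem) auto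
  have "form \<sigma> A ?z ?z = (\<Sum>i<N. c i * form \<sigma> A (f i) ?z)"
    using f zD by (subst F.ip_sum_left) (auto simp: F.ip_scale_left intro!: sum.cong)
  also have "\<dots> = (\<Sum>i<N. c i * (\<Sum>j<N. cnj (c j) * ?g i j))"
  proof (rule sum.cong[OF refl])
    fix i assume "i \<in> {..<N}"
    then have "form \<sigma> A (f i) ?z = (\<Sum>j<N. form \<sigma> A (f i) (fscale (c j) (f j)))"
      using f by (intro F.ip_sum_right) auto
    also have "\<dots> = (\<Sum>j<N. cnj (c j) * ?g i j)"
      using f \<open>i \<in> {..<N}\<close> by (intro sum.cong refl F.ip_scale_right) auto
    finally show "c i * form \<sigma> A (f i) ?z = c i * (\<Sum>j<N. cnj (c j) * ?g i j)" by simp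
  qed
  also have "\<dots> = (\<Sum>i<N. \<Sum>j<N. c i * cnj (c j) * ?e i j) + (\<Sum>i<N. \<Sum>j<N. c i * cnj (c j) * (if i = j then 1 else 0))"
    by (simp add: sum_distrib_left sum.distrib[symmetric] algebra_simps)
  also have "(\<Sum>i<N. \<Sum>j<N. c i * cnj (c j) * (if i = j then 1 else 0)) = (\<Sum>i<N. c i * cnj (c i))"
    by (intro sum.cong refl) (simp add: if_distrib[of "\<lambda>x. _ * x"] cong: if_cong)
  also have "\<dots> = of_real (\<Sum>i<N. (cmod (c i))\<^sup>2)" by (simp add: complex_norm_square del: of_real_power)
  finally have eq: "form \<sigma> A ?z ?z = (\<Sum>i<N. \<Sum>j<N. c i * cnj (c j) * ?e i j) + of_real (\<Sum>i<N. (cmod (c i))\<^sup>2)" .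
  have "cmod (\<Sum>i<N. \<Sum>j<N. c i * cnj (c j) * ?e i j) \<le> (\<Sum>i<N. \<Sum>j<N. cmod (c i) * cmod (c j) * (1 / (real N + 1)))"
  proof (intro sum_norm_le)
    fix i j assume "i \<in> {..<N}" "j \<in> {..<N}"
    then show "cmod (c i * cnj (c j) * ?e i j) \<le> cmod (c i) * cmod (c j) * (1 / (real N + 1))"
      unfolding norm_mult complex_mod_cnj using G[of i j] by (intro mult_left_mono) auto
  qed
  also have "\<dots> = (\<Sum>i<N. cmod (c i))\<^sup>2 * (1 / (real N + 1))"
    unfolding power2_eq_square sum_product by (simp only: sum_distrib_right)
  also have "\<dots> \<le> ((\<Sum>i<N. (cmod (c i))\<^sup>2) * real N) * (1 / (real N + 1))"
    using sum_squared_le_sum_of_squares[of "\<lambda>i. cmod (c i)" "{..<N}"] by (intro mult_right_mono) auto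
  also have "\<dots> = (\<Sum>i<N. (cmod (c i))\<^sup>2) * (real N / (real N + 1))" by simp
  also have "\<dots> \<le> (\<Sum>i<N. (cmod (c i))\<^sup>2) * 1"
    by (intro mult_left_mono) (auto simp: sum_nonneg)
  finally have "Re (form \<sigma> A ?z ?z) \<le> 2 * (\<Sum>i<N. (cmod (c i))\<^sup>2)"
    unfolding eq using complex_Re_le_cmod[of "\<Sum>i<N. \<Sum>j<N. c i * cnj (c j) * ?e i j"] by simp
  then show ?thesis using F_nrm_sq[OF zD] F.nrm_sq[OF zD] by simp
qed

text \<open>Approximants from the form domain are eventually almost orthonormal, which \<open>rumin_frank\<close> tolerates; Fatou's lemma
  carries the bound to the limit.  The exponent \<open>d'\<close> is independent of the exponent \<open>d\<close> that fixes the space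
  \<open>L\<^sup>p\<close> in which the completion is realised.\<close>

theorem clr_form_space:
  assumes sb: "spectral_bound \<sigma> E d' C'" and on: "FS.orthonormal e N"
  shows "(\<integral>\<^sup>+ x. ennreal ((\<Sum>i<N. (cmod (e i x))\<^sup>2) powr (d' / (d' - 2))) \<partial>\<sigma>)
    \<le> ennreal (spectral_bound.CLR_const d' C' * real N)"
proof -
  interpret S: spectral_bound \<sigma> E d' C' by (rule sb)
  let ?q = "d' / (d' - 2)"
  have eS: "e i \<in> FS" if "i < N" for i using on that by (simp add: FS.orthonormal_def)
  then have "\<forall>i. \<exists>U. i < N \<longrightarrow> approx U (e i)" by (auto simp: form_space_iff)
  then obtain U where U: "\<And>i. i < N \<Longrightarrow> approx (U i) (e i)" by metis
  have UD: "U i n \<in> FD" if "i < N" for i n using approxD(1)[OF U[OF that]] .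
  have Lp: "U i n - e i \<in> Lp \<sigma> pexp" if "i < N" for i n
    using approxD(1,3)[OF U[OF that]] form_domain_Lp pexp_pos by (auto intro!: Lp_diff)
  have "\<forall>\<^sub>F n in sequentially. \<forall>i\<in>{..<N}. \<forall>j\<in>{..<N}.
      cmod (form \<sigma> A (U i n) (U j n) - (if i = j then 1 else 0)) \<le> 1 / (real N + 1)"
  proof (intro eventually_ball_finite ballI)
    fix i j assume ij: "i \<in> {..<N}" "j \<in> {..<N}"
    have "(\<lambda>n. form \<sigma> A (U i n) (U j n)) \<longlonglongrightarrow> (if i = j then 1 else 0)"
      using fip_lim[OF U U, of i j] ij on by (simp add: FS.orthonormal_def)
    then have "\<forall>\<^sub>F n in sequentially. dist (form \<sigma> A (U i n) (U j n)) (if i = j then 1 else 0) < 1 / (real N + 1)"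
      by (rule tendstoD) (simp add: add_nonneg_pos)
    then show "\<forall>\<^sub>F n in sequentially. cmod (form \<sigma> A (U i n) (U j n) - (if i = j then 1 else 0)) \<le> 1 / (real N + 1)"
      by eventually_elim (simp add: dist_norm)
  qed auto
  then obtain n0 where n0: "\<And>n i j. n \<ge> n0 \<Longrightarrow> i < N \<Longrightarrow> j < N \<Longrightarrow>
      cmod (form \<sigma> A (U i n) (U j n) - (if i = j then 1 else 0)) \<le> 1 / (real N + 1)"
    unfolding eventually_sequentially by (meson lessThan_iff)
  define D where "D i n = of_abs (U i n - e i)" for i n
  have "D i n \<in> Lp \<sigma> pexp \<and> Lp_int \<sigma> pexp (D i n) = Lp_int \<sigma> pexp (U i n - e i)" if i: "i < N" for i n
  proof
    note [measurable] = Lp_measurable[OF Lp[OF i, of n]]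
    show "D i n \<in> Lp \<sigma> pexp"
    proof (rule Lp_bound[OF _ Lp[OF i, of n]])
      show "D i n \<in> borel_measurable \<sigma>" unfolding D_def of_abs_def by measurable
      show "AE x in \<sigma>. cmod (D i n x) \<le> cmod ((U i n - e i) x)" by (simp add: D_def of_abs_def)
    qed (rule pexp_pos)
    show "Lp_int \<sigma> pexp (D i n) = Lp_int \<sigma> pexp (U i n - e i)" by (simp add: Lp_int_def D_def of_abs_def)
  qed
  then have Dlim: "(\<lambda>n. Lp_int \<sigma> pexp (\<Sum>i<N. D i n)) \<longlonglongrightarrow> 0" "\<And>n. (\<Sum>i<N. D i n) \<in> Lp \<sigma> pexp"
    using Lp_lim_sum[of N D] approxD(4)[OF U] by auto
  obtain r where r: "strict_mono (r::nat \<Rightarrow> nat)" "AE x in \<sigma>. (\<lambda>k. (\<Sum>i<N. D i (r k)) x) \<longlonglongrightarrow> 0"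
    using Lp_tendsto_AE_subseq[OF Dlim(2,1) pexp_pos] by blast
  have conv: "AE x in \<sigma>. \<forall>i<N. (\<lambda>k. U i (r k) x) \<longlonglongrightarrow> e i x"
    using r(2)
  proof eventually_elim
    case (elim x)
    have z: "(\<lambda>k. U i (r k) x - e i x) \<longlonglongrightarrow> 0" if i: "i < N" for i
    proof (rule Lim_null_comparison)
      have "(\<Sum>i<N. D i (r k)) x = of_real (\<Sum>i<N. cmod (U i (r k) x - e i x))" for k
        by (simp add: sum_fun_apply D_def of_abs_def)
      then have "(\<lambda>k. cmod (complex_of_real (\<Sum>i<N. cmod (U i (r k) x - e i x)))) \<longlonglongrightarrow> 0"
        using tendsto_norm_zero[OF elim] by simp
      then show "(\<lambda>k. \<Sum>i<N. cmod (U i (r k) x - e i x)) \<longlonglongrightarrow> 0"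
        by (simp add: sum_nonneg del: of_real_sum)
      show "\<forall>\<^sub>F k in sequentially. norm (U i (r k) x - e i x) \<le> (\<Sum>i<N. cmod (U i (r k) x - e i x))"
        using i by (intro always_eventually allI member_le_sum[of i "{..<N}" "\<lambda>i. cmod (U i _ x - e i x)"]) auto
    qed
    show ?case by (intro allI impI, rule LIM_zero_cancel, rule z)
  qed
  define rt where "rt f x = complex_of_real (sqrt (\<Sum>i<N. (cmod (f i x))\<^sup>2))" for f :: "nat \<Rightarrow> 'a fn" and x
  have rt: "cmod (rt f x) powr (2 * ?q) = (\<Sum>i<N. (cmod (f i x))\<^sup>2) powr ?q" for f x
    by (simp add: rt_def sum_nonneg powr_half_sqrt[symmetric] powr_powr)
  have rtm: "rt f \<in> borel_measurable \<sigma>" if "\<And>i. i < N \<Longrightarrow> f i \<in> borel_measurable \<sigma>" for f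
  proof -
    have "(\<lambda>x. \<Sum>i<N. (cmod (f i x))\<^sup>2) \<in> borel_measurable \<sigma>"
      using that by (intro borel_measurable_sum borel_measurable_power borel_measurable_norm) auto
    then show ?thesis unfolding rt_def by measurable
  qed
  have "Lp_int \<sigma> (2 * ?q) (rt e) \<le> ennreal (S.CLR_const * real N)"
  proof (rule Lp_int_limit_le[where W="\<lambda>k. rt (\<lambda>i. U i (r k))"])
    show "rt (\<lambda>i. U i (r k)) \<in> borel_measurable \<sigma>" for k
      using UD form_domain_Lp by (intro rtm Lp_measurable[where p=pexp]) auto
    show "rt e \<in> borel_measurable \<sigma>" using eS form_space_Lp by (intro rtm Lp_measurable[where p=pexp]) auto
    show "AE x in \<sigma>. (\<lambda>k. rt (\<lambda>i. U i (r k)) x) \<longlonglongrightarrow> rt e x"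
      using conv unfolding rt_def
      by eventually_elim (intro tendsto_of_real tendsto_real_sqrt tendsto_sum tendsto_power tendsto_norm, auto)
    show "\<forall>\<^sub>F k in sequentially. Lp_int \<sigma> (2 * ?q) (rt (\<lambda>i. U i (r k))) \<le> ennreal (S.CLR_const * real N)"
      using eventually_ge_at_top[of n0]
    proof eventually_elim
      case (elim k)
      then have k: "r k \<ge> n0" using seq_suble[OF r(1), of k] by linarith
      have "(\<integral>\<^sup>+ x. ennreal ((\<Sum>i<N. (cmod (U i (r k) x))\<^sup>2) powr ?q) \<partial>\<sigma>) \<le> ennreal (S.CLR_const * real N)"
      proof (rule S.rumin_frank)
        show "U i (r k) \<in> dom sqrt" if "i < N" for i by (rule form_domain_dom[OF UD[OF that]])
        show "energy (\<Sum>i<N. fscale (c i) (U i (r k))) \<le> 2 * (\<Sum>i<N. (cmod (c i))\<^sup>2)" for c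
          by (rule gram_le) (use n0[OF k] UD in auto)
      qed
      then show ?case unfolding Lp_int_def rt .
    qed
    show "2 * ?q > 0" using S.d by simp
  qed
  then show ?thesis unfolding Lp_int_def rt .
qed

end

section \<open>Hoelder's inequality and the potential\<close>

text \<open>One of the two summands alone is at least \<open>x y\<close>, depending on which factor is larger on the appropriate scale.\<close>

lemma young_unnormalised:
  fixes x y d :: real
  assumes d: "d > 2" and x: "x \<ge> 0" and y: "y \<ge> 0"
  shows "x * y \<le> x powr (d / 2) + y powr (d / (d - 2))"
proof (cases "x = 0 \<or> y = 0")
  case False
  then have xy: "x > 0" "y > 0" using x y by auto
  show ?thesis
  proof (cases "y \<le> x powr ((d - 2) / 2)")
    case True
    have "x * y \<le> x * x powr ((d - 2) / 2)" using True xy by simp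
    also have "\<dots> = x powr (1 + (d - 2) / 2)" using xy by (simp add: powr_add)
    also have "1 + (d - 2) / 2 = d / 2" by (simp add: field_simps)
    finally show ?thesis using powr_ge_zero[of y "d / (d - 2)"] by linarith
  next
    case False
    then have "(x powr ((d - 2) / 2)) powr (2 / (d - 2)) \<le> y powr (2 / (d - 2))"
      using d by (intro powr_mono2) auto
    moreover have "(d - 2) / 2 * (2 / (d - 2)) = 1" using d by simp
    ultimately have "x \<le> y powr (2 / (d - 2))" using xy by (simp only: powr_powr) simp
    then have "x * y \<le> y powr (2 / (d - 2)) * y" using xy by simp
    also have "\<dots> = y powr (2 / (d - 2) + 1)" using xy by (simp add: powr_add)
    also have "2 / (d - 2) + 1 = d / (d - 2)" using d by (simp add: field_simps)
    finally show ?thesis using powr_ge_zero[of x "d / 2"] by linarith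
  qed
qed auto

text \<open>Scaling the two factors against each other turns Young's inequality into Hoelder's, up to the
  factor 2.\<close>

lemma holder:
  fixes V \<rho> :: "'a \<Rightarrow> real"
  assumes d: "d > 2" and v: "v > 0" and w: "w > 0"
    and [measurable]: "V \<in> borel_measurable \<sigma>" "\<rho> \<in> borel_measurable \<sigma>"
    and V0: "AE x in \<sigma>. V x \<ge> 0" and \<rho>0: "\<And>x. \<rho> x \<ge> 0"
    and Vv: "(\<integral>\<^sup>+ x. ennreal (V x powr (d / 2)) \<partial>\<sigma>) \<le> ennreal v"
    and \<rho>w: "(\<integral>\<^sup>+ x. ennreal (\<rho> x powr (d / (d - 2))) \<partial>\<sigma>) \<le> ennreal w"
  shows "(\<integral>\<^sup>+ x. ennreal (V x * \<rho> x) \<partial>\<sigma>) \<le> ennreal (2 * v powr (2 / d) * w powr (1 - 2 / d))"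
proof -
  let ?r = "d / 2" and ?q = "d / (d - 2)"
  \<comment> \<open>The value for which \<open>\<tau>\<^sup>r v = \<tau>\<^sup>-\<^sup>q w\<close>.\<close>
  define \<tau> where "\<tau> = (w / v) powr (1 / (?r + ?q))"
  have \<tau>: "\<tau> > 0" using v w by (simp add: \<tau>_def)
  have rq: "?r / (?r + ?q) = 1 - 2 / d" "?q / (?r + ?q) = 2 / d"
  proof -
    have s: "?r + ?q = d\<^sup>2 / (2 * (d - 2))" using d by (simp add: field_simps power2_eq_square)
    show "?q / (?r + ?q) = 2 / d" unfolding s using d by (simp add: field_simps power2_eq_square)
    show "?r / (?r + ?q) = 1 - 2 / d" unfolding s using d by (simp add: field_simps power2_eq_square)
  qed
  have sum0: "?r + ?q > 0" using d by (simp add: add_pos_pos)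
  have e1: "\<tau> powr ?r * v = v powr (2 / d) * w powr (1 - 2 / d)"
  proof -
    have "\<tau> powr ?r = (w / v) powr (?r / (?r + ?q))"
      unfolding \<tau>_def powr_powr by (simp only: times_divide_eq_left mult_1)
    also have "\<dots> = (w / v) powr (1 - 2 / d)" by (simp only: rq(1))
    also have "\<dots> = w powr (1 - 2 / d) / v powr (1 - 2 / d)" using v w by (simp add: powr_divide)
    finally show ?thesis using v by (simp add: powr_diff field_simps)
  qed
  have e2: "(1 / \<tau>) powr ?q * w = v powr (2 / d) * w powr (1 - 2 / d)"
  proof -
    have "\<tau> powr ?q = (w / v) powr (?q / (?r + ?q))"
      unfolding \<tau>_def powr_powr by (simp only: times_divide_eq_left mult_1)
    also have "\<dots> = (w / v) powr (2 / d)" by (simp only: rq(2))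
    also have "\<dots> = w powr (2 / d) / v powr (2 / d)" using v w by (simp add: powr_divide)
    finally show ?thesis using v w \<tau> by (simp add: powr_divide powr_diff field_simps)
  qed
  have "(\<integral>\<^sup>+ x. ennreal (V x * \<rho> x) \<partial>\<sigma>)
      \<le> (\<integral>\<^sup>+ x. ennreal (\<tau> powr ?r) * ennreal (V x powr ?r) + ennreal ((1 / \<tau>) powr ?q) * ennreal (\<rho> x powr ?q) \<partial>\<sigma>)"
  proof (rule nn_integral_mono_AE)
    show "AE x in \<sigma>. ennreal (V x * \<rho> x)
        \<le> ennreal (\<tau> powr ?r) * ennreal (V x powr ?r) + ennreal ((1 / \<tau>) powr ?q) * ennreal (\<rho> x powr ?q)"
      using V0
    proof eventually_elim
      case (elim x)
      have "V x * \<rho> x = (\<tau> * V x) * (\<rho> x / \<tau>)" using \<tau> by simp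
      also have "\<dots> \<le> (\<tau> * V x) powr ?r + (\<rho> x / \<tau>) powr ?q"
        using \<tau> elim \<rho>0[of x] by (intro young_unnormalised d) auto
      also have "\<dots> = \<tau> powr ?r * V x powr ?r + (1 / \<tau>) powr ?q * \<rho> x powr ?q"
        using \<tau> elim \<rho>0[of x] by (simp add: powr_mult powr_divide)
      finally have "ennreal (V x * \<rho> x) \<le> ennreal (\<tau> powr ?r * V x powr ?r + (1 / \<tau>) powr ?q * \<rho> x powr ?q)"
        by (rule ennreal_leI)
      then show ?case by (simp add: ennreal_plus ennreal_mult)
    qed
  qed
  also have "\<dots> = ennreal (\<tau> powr ?r) * (\<integral>\<^sup>+ x. ennreal (V x powr ?r) \<partial>\<sigma>)
      + ennreal ((1 / \<tau>) powr ?q) * (\<integral>\<^sup>+ x. ennreal (\<rho> x powr ?q) \<partial>\<sigma>)"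
    by (subst nn_integral_add) (auto simp: nn_integral_cmult)
  also have "\<dots> \<le> ennreal (\<tau> powr ?r) * ennreal v + ennreal ((1 / \<tau>) powr ?q) * ennreal w"
    by (intro add_mono mult_left_mono Vv \<rho>w) auto
  also have "\<dots> = ennreal (\<tau> powr ?r * v + (1 / \<tau>) powr ?q * w)"
    using v w by (simp add: ennreal_mult ennreal_plus)
  also have "\<tau> powr ?r * v + (1 / \<tau>) powr ?q * w = 2 * v powr (2 / d) * w powr (1 - 2 / d)"
    unfolding e1 e2 by simp
  finally show ?thesis .
qed

locale schrodinger = form_setting +
  fixes V :: "'a \<Rightarrow> real" and d' C'
  assumes V0: "AE x in \<sigma>. V x \<ge> 0" and V: "V \<in> Lp \<sigma> (d / 2)"
    and short_time: "spectral_bound \<sigma> E d' C'" and d': "d' < d"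
begin

lemma d'_gt: "d' > 2"
  using short_time by (simp add: spectral_bound_def spectral_bound_axioms_def)

abbreviation "bV \<equiv> potential_form \<sigma> V"

lemma V_measurable [measurable]: "V \<in> borel_measurable \<sigma>"
  using V by (simp add: Lp_def)

lemma V_integrable: "integrable \<sigma> (\<lambda>x. \<bar>V x\<bar> powr (d / 2))"
  using V by (simp add: Lp_def)

lemma V_powr_AE: "AE x in \<sigma>. \<bar>V x\<bar> powr (d / 2) = V x powr (d / 2)"
  using V0 by eventually_elim simp

text \<open>Adding 1 makes the bound positive, so that one can divide by it even if \<open>V\<close> vanishes.\<close>

definition v0 :: real where "v0 = (LINT x|\<sigma>. \<bar>V x\<bar> powr (d / 2)) + 1"

lemma v0: "v0 > 0" "(\<integral>\<^sup>+ x. ennreal (V x powr (d / 2)) \<partial>\<sigma>) \<le> ennreal v0"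
proof -
  show "v0 > 0" by (simp add: v0_def add_nonneg_pos)
  have "(\<integral>\<^sup>+ x. ennreal (V x powr (d / 2)) \<partial>\<sigma>) = (\<integral>\<^sup>+ x. ennreal (\<bar>V x\<bar> powr (d / 2)) \<partial>\<sigma>)"
    by (rule nn_integral_cong_AE) (use V_powr_AE in \<open>eventually_elim, simp\<close>)
  also have "\<dots> = ennreal (LINT x|\<sigma>. \<bar>V x\<bar> powr (d / 2))"
    by (rule nn_integral_eq_integral[OF V_integrable]) simp
  also have "\<dots> \<le> ennreal v0" by (intro ennreal_leI) (simp add: v0_def)
  finally show "(\<integral>\<^sup>+ x. ennreal (V x powr (d / 2)) \<partial>\<sigma>) \<le> ennreal v0" .
qed

text \<open>Hoelder's constant for a single function: the case \<open>\<rho> = \<bar>u\<bar>\<^sup>2\<close> with the Sobolev inequality.\<close>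

definition KV :: real where "KV = 2 * v0 powr (2 / d) * CLR_const powr (1 - 2 / d)"

lemma KV_pos: "KV > 0"
  using v0(1) CLR_const_pos by (simp add: KV_def)

lemma exponent: "d / (d - 2) * (1 - 2 / d) = 1"
  using d by (simp add: field_simps)

lemma potential_le:
  assumes u: "u \<in> FS" and e: "(FS.nrm u)\<^sup>2 < e"
  shows "(\<integral>\<^sup>+ x. ennreal (V x * (cmod (u x))\<^sup>2) \<partial>\<sigma>) \<le> ennreal (KV * e)"
proof -
  have e0: "e > 0" using e zero_le_power2[of "FS.nrm u"] by linarith
  have [measurable]: "u \<in> borel_measurable \<sigma>" using form_space_Lp[OF u] by (rule Lp_measurable)
  have "((cmod (u x))\<^sup>2) powr (d / (d - 2)) = cmod (u x) powr pexp" for x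
    by (simp add: powr_powr flip: powr_numeral)
  then have "(\<integral>\<^sup>+ x. ennreal (((cmod (u x))\<^sup>2) powr (d / (d - 2))) \<partial>\<sigma>) \<le> ennreal (CLR_const * e powr (d / (d - 2)))"
    using sobolev_form_space[OF u e] by (simp add: Lp_int_def)
  then have "(\<integral>\<^sup>+ x. ennreal (V x * (cmod (u x))\<^sup>2) \<partial>\<sigma>)
      \<le> ennreal (2 * v0 powr (2 / d) * (CLR_const * e powr (d / (d - 2))) powr (1 - 2 / d))"
    using CLR_const_pos e0 by (intro holder[OF d v0(1) _ _ _ V0 _ v0(2)]) auto
  also have "(CLR_const * e powr (d / (d - 2))) powr (1 - 2 / d) = CLR_const powr (1 - 2 / d) * e"
  proof -
    have "(e powr (d / (d - 2))) powr (1 - 2 / d) = e"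
      by (simp only: powr_powr exponent) (use e0 in simp)
    then show ?thesis using CLR_const_pos e0 by (simp add: powr_mult)
  qed
  finally show ?thesis by (simp add: KV_def mult.assoc)
qed

lemma potential_integrable:
  assumes u: "u \<in> FS" shows "integrable \<sigma> (\<lambda>x. V x * (cmod (u x))\<^sup>2)"
proof -
  have [measurable]: "u \<in> borel_measurable \<sigma>" using form_space_Lp[OF u] by (rule Lp_measurable)
  have "(\<integral>\<^sup>+ x. ennreal (V x * (cmod (u x))\<^sup>2) \<partial>\<sigma>) \<le> ennreal (KV * ((FS.nrm u)\<^sup>2 + 1))"
    by (rule potential_le[OF u]) simp
  also have "\<dots> < \<infinity>" by simp
  finally have "(\<integral>\<^sup>+ x. ennreal (norm (V x * (cmod (u x))\<^sup>2)) \<partial>\<sigma>) < \<infinity>"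
    by (subst nn_integral_cong_AE[where v="\<lambda>x. ennreal (V x * (cmod (u x))\<^sup>2)"])
      (use V0 in \<open>eventually_elim, simp add: abs_mult\<close>, simp)
  then show ?thesis by (intro integrableI_bounded) auto
qed

lemma potential_mult_integrable:
  assumes u: "u \<in> FS" and w: "w \<in> FS" shows "integrable \<sigma> (\<lambda>x. of_real (V x) * u x * cnj (w x))"
proof (rule Bochner_Integration.integrable_bound)
  have [measurable]: "u \<in> borel_measurable \<sigma>" "w \<in> borel_measurable \<sigma>"
    using form_space_Lp[OF u] form_space_Lp[OF w] Lp_measurable by auto
  show "(\<lambda>x. of_real (V x) * u x * cnj (w x)) \<in> borel_measurable \<sigma>" by measurable
  show "integrable \<sigma> (\<lambda>x. V x * (cmod (u x))\<^sup>2 + V x * (cmod (w x))\<^sup>2)"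
    by (intro Bochner_Integration.integrable_add potential_integrable u w)
  show "AE x in \<sigma>. norm (of_real (V x) * u x * cnj (w x)) \<le> norm (V x * (cmod (u x))\<^sup>2 + V x * (cmod (w x))\<^sup>2)"
    using V0
  proof eventually_elim
    case (elim x)
    have "2 * (cmod (u x) * cmod (w x)) \<le> (cmod (u x))\<^sup>2 + (cmod (w x))\<^sup>2"
      using sum_squares_bound[of "cmod (u x)" "cmod (w x)"] by (simp add: mult.assoc)
    moreover have "0 \<le> cmod (u x) * cmod (w x)" by simp
    ultimately have "cmod (u x) * cmod (w x) \<le> (cmod (u x))\<^sup>2 + (cmod (w x))\<^sup>2" by linarith
    then have "V x * (cmod (u x) * cmod (w x)) \<le> V x * ((cmod (u x))\<^sup>2 + (cmod (w x))\<^sup>2)"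
      using elim by (rule mult_left_mono)
    then show ?case using elim by (simp add: norm_mult distrib_left mult.assoc)
  qed
qed

lemma potential_self: "bV u u = of_real (LINT x|\<sigma>. V x * (cmod (u x))\<^sup>2)"
proof -
  have "of_real (V x) * u x * cnj (u x) = complex_of_real (V x * (cmod (u x))\<^sup>2)" for x
    by (simp add: complex_norm_square mult.assoc del: of_real_power)
  then show ?thesis unfolding potential_form_def by (simp only: integral_complex_of_real)
qed

lemma sip_potential: "sip fscale FS bV"
proof -
  interpret vector_space "fscale :: complex \<Rightarrow> 'a fn \<Rightarrow> 'a fn" by (rule vector_space_fscale)
  show ?thesis
  proof
    show "0 \<in> FS" by simp
    fix u v w :: "'a fn" and c :: complex
    assume u: "u \<in> FS"
    show "fscale c u \<in> FS" using u by simp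
    show "0 \<le> Re (bV u u)" unfolding potential_self Re_complex_of_real
      by (rule integral_nonneg_AE) (use V0 in \<open>eventually_elim, simp\<close>)
    assume w: "w \<in> FS"
    show "u + w \<in> FS" using u w by simp
    show "bV (fscale c u) w = c * bV u w"
      unfolding potential_form_def by (subst integral_mult_right_zero[symmetric]) (simp add: mult_ac)
    show "bV w u = cnj (bV u w)"
      unfolding potential_form_def by (subst Bochner_Integration.integral_cnj[symmetric]) (simp add: mult_ac)
    assume v: "v \<in> FS"
    have "bV (u + v) w = (LINT x|\<sigma>. of_real (V x) * u x * cnj (w x) + of_real (V x) * v x * cnj (w x))"
      unfolding potential_form_def by (simp add: algebra_simps)
    also have "\<dots> = bV u w + bV v w"
      unfolding potential_form_def by (rule Bochner_Integration.integral_add[OF potential_mult_integrable[OF u w] potential_mult_integrable[OF v w]])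
    finally show "bV (u + v) w = bV u w + bV v w" .
  qed
qed

sublocale B: sip fscale FS bV
  by (rule sip_potential)

lemma B_nrm_sq: "u \<in> FS \<Longrightarrow> (B.nrm u)\<^sup>2 = (LINT x|\<sigma>. V x * (cmod (u x))\<^sup>2)"
  by (simp only: B.nrm_sq potential_self Re_complex_of_real)

lemma B_bounded:
  assumes u: "u \<in> FS" shows "B.nrm u \<le> sqrt KV * FS.nrm u"
proof -
  have "(B.nrm u)\<^sup>2 \<le> KV * e" if e: "(FS.nrm u)\<^sup>2 < e" for e
  proof -
    have e0: "e > 0" using e zero_le_power2[of "FS.nrm u"] by linarith
    have "ennreal ((B.nrm u)\<^sup>2) = (\<integral>\<^sup>+ x. ennreal (V x * (cmod (u x))\<^sup>2) \<partial>\<sigma>)"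
      unfolding B_nrm_sq[OF u]
      by (rule nn_integral_eq_integral[symmetric, OF potential_integrable[OF u]]) (use V0 in \<open>eventually_elim, simp\<close>)
    also have "\<dots> \<le> ennreal (KV * e)" by (rule potential_le[OF u e])
    finally show ?thesis using KV_pos e0 by (simp add: ennreal_le_iff)
  qed
  then have b: "(B.nrm u)\<^sup>2 \<le> KV * ((FS.nrm u)\<^sup>2 + inverse (real (Suc n)))" for n by simp
  have "(\<lambda>n. KV * ((FS.nrm u)\<^sup>2 + inverse (real (Suc n)))) \<longlonglongrightarrow> KV * ((FS.nrm u)\<^sup>2 + 0)"
    by (intro tendsto_intros LIMSEQ_inverse_real_of_nat)
  then have "(B.nrm u)\<^sup>2 \<le> KV * ((FS.nrm u)\<^sup>2 + 0)"
    by (rule LIMSEQ_le_const) (use b in blast)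
  also have "\<dots> = (sqrt KV * FS.nrm u)\<^sup>2" using KV_pos by (simp add: power_mult_distrib)
  finally show ?thesis by (rule power2_le_imp_le) (use KV_pos u in simp)
qed

text \<open>Hoelder's bound for a part of the potential with \<open>\<integral> V\<^bsup>d'/2\<^esup> \<le> v1\<close> plus that for a part with \<open>\<integral> V\<^bsup>d/2\<^esup> \<le> v2\<close>, against the
  density of \<open>n\<close> orthonormal vectors.\<close>

definition split_bound :: "real \<Rightarrow> real \<Rightarrow> nat \<Rightarrow> real"
  where "split_bound v1 v2 n =
    2 * v1 powr (2 / d') * (spectral_bound.CLR_const d' C' * real n) powr (1 - 2 / d')
    + 2 * v2 powr (2 / d) * (CLR_const * real n) powr (1 - 2 / d)"

text \<open>The part of \<open>V\<close> above a threshold lies in \<open>L\<^bsup>d'/2\<^esup>\<close>, for which the bound for \<open>d' < d\<close> is of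
  lower order in \<open>n\<close>; the part below has small norm in \<open>L\<^bsup>d/2\<^esup>\<close>.\<close>

lemma trace_split:
  assumes v2: "v2 > 0"
  shows "\<exists>v1>0. \<forall>n>0. \<forall>e. FS.orthonormal e n \<longrightarrow> (\<Sum>i<n. (B.nrm (e i))\<^sup>2) \<le> split_bound v1 v2 n"
proof -
  interpret S: spectral_bound \<sigma> E d' C' by (rule short_time)
  have "(\<lambda>m. LINT x|\<sigma>. \<bar>V x\<bar> powr (d / 2) * indicator {x. V x < inverse (real (Suc m))} x) \<longlonglongrightarrow> (LINT x|\<sigma>. 0)"
  proof (rule integral_dominated_convergence[OF _ _ V_integrable])
    show "(\<lambda>x. \<bar>V x\<bar> powr (d / 2) * indicator {x. V x < inverse (real (Suc m))} x) \<in> borel_measurable \<sigma>" for m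
    proof -
      have "(\<lambda>x. \<bar>V x\<bar> powr (d / 2) * (if V x < inverse (real (Suc m)) then 1 else 0)) \<in> borel_measurable \<sigma>"
        by measurable
      then show ?thesis by (simp add: indicator_def of_bool_def)
    qed
    show "AE x in \<sigma>. (\<lambda>m. \<bar>V x\<bar> powr (d / 2) * indicator {x. V x < inverse (real (Suc m))} x) \<longlonglongrightarrow> 0"
      using V0
    proof eventually_elim
      case (elim x)
      show ?case
      proof (cases "V x = 0")
        case False
        then have "V x > 0" using elim by simp
        then have "\<forall>\<^sub>F m in sequentially. inverse (real (Suc m)) < V x"
          by (rule order_tendstoD(2)[OF LIMSEQ_inverse_real_of_nat])
        then have "\<forall>\<^sub>F m in sequentially. \<bar>V x\<bar> powr (d / 2) * indicator {x. V x < inverse (real (Suc m))} x = 0"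
          by eventually_elim simp
        then show ?thesis by (rule tendsto_eventually)
      qed simp
    qed
    show "AE x in \<sigma>. norm (\<bar>V x\<bar> powr (d / 2) * indicator {x. V x < inverse (real (Suc m))} x) \<le> \<bar>V x\<bar> powr (d / 2)" for m
      by (intro AE_I2) (simp add: indicator_def)
  qed simp
  then have "\<forall>\<^sub>F m in sequentially. (LINT x|\<sigma>. \<bar>V x\<bar> powr (d / 2) * indicator {x. V x < inverse (real (Suc m))} x) < v2"
    using v2 by (intro order_tendstoD(2)) auto
  then obtain m where m: "(LINT x|\<sigma>. \<bar>V x\<bar> powr (d / 2) * indicator {x. V x < inverse (real (Suc m))} x) < v2"
    using eventually_happens' sequentially_bot by blast
  define \<eta> where "\<eta> = inverse (real (Suc m))"
  have \<eta>: "\<eta> > 0" by (simp add: \<eta>_def)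
  define V1 where "V1 x = (if V x < \<eta> then 0 else V x)" for x
  define V2 where "V2 x = (if V x < \<eta> then V x else 0)" for x
  have [measurable]: "V1 \<in> borel_measurable \<sigma>" "V2 \<in> borel_measurable \<sigma>"
    unfolding V1_def V2_def by measurable
  have V1p: "V1 x \<ge> 0" for x using \<eta> by (simp add: V1_def)
  have V2p: "AE x in \<sigma>. V2 x \<ge> 0" using V0 by eventually_elim (simp add: V2_def)
  have V2b: "(\<integral>\<^sup>+ x. ennreal (V2 x powr (d / 2)) \<partial>\<sigma>) \<le> ennreal v2"
  proof -
    have i: "integrable \<sigma> (\<lambda>x. \<bar>V x\<bar> powr (d / 2) * indicator {x. V x < \<eta>} x)"
    proof (rule Bochner_Integration.integrable_bound[OF V_integrable])
      have "(\<lambda>x. \<bar>V x\<bar> powr (d / 2) * (if V x < \<eta> then 1 else 0)) \<in> borel_measurable \<sigma>" by measurable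
      then show "(\<lambda>x. \<bar>V x\<bar> powr (d / 2) * indicator {x. V x < \<eta>} x) \<in> borel_measurable \<sigma>"
        by (simp add: indicator_def of_bool_def)
    qed (auto simp: indicator_def)
    have "(\<integral>\<^sup>+ x. ennreal (V2 x powr (d / 2)) \<partial>\<sigma>) = (\<integral>\<^sup>+ x. ennreal (\<bar>V x\<bar> powr (d / 2) * indicator {x. V x < \<eta>} x) \<partial>\<sigma>)"
      by (rule nn_integral_cong_AE) (use V0 in \<open>eventually_elim, simp add: V2_def indicator_def\<close>)
    also have "\<dots> = ennreal (LINT x|\<sigma>. \<bar>V x\<bar> powr (d / 2) * indicator {x. V x < \<eta>} x)"
      by (rule nn_integral_eq_integral[OF i]) simp
    also have "\<dots> \<le> ennreal v2" using m by (intro ennreal_leI) (simp add: \<eta>_def)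
    finally show ?thesis .
  qed
  \<comment> \<open>On \<open>V \<ge> \<eta>\<close> one has \<open>V\<^bsup>d'/2\<^esup> = V\<^bsup>(d'-d)/2\<^esup> V\<^bsup>d/2\<^esup>\<close> with a negative first exponent.\<close>
  define v1 where "v1 = \<eta> powr ((d' - d) / 2) * v0"
  have v1: "v1 > 0" using \<eta> v0 by (simp add: v1_def)
  have V1b: "(\<integral>\<^sup>+ x. ennreal (V1 x powr (d' / 2)) \<partial>\<sigma>) \<le> ennreal v1"
  proof -
    have "(\<integral>\<^sup>+ x. ennreal (V1 x powr (d' / 2)) \<partial>\<sigma>) \<le> (\<integral>\<^sup>+ x. ennreal (\<eta> powr ((d' - d) / 2)) * ennreal (V x powr (d / 2)) \<partial>\<sigma>)"
    proof (rule nn_integral_mono)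
      fix x
      show "ennreal (V1 x powr (d' / 2)) \<le> ennreal (\<eta> powr ((d' - d) / 2)) * ennreal (V x powr (d / 2))"
      proof (cases "V x < \<eta>")
        case False
        then have Vx: "V x > 0" "\<eta> \<le> V x" using \<eta> by auto
        have "V x powr (d' / 2) = V x powr ((d' - d) / 2) * V x powr (d / 2)"
          using Vx by (simp add: powr_add[symmetric] diff_divide_distrib)
        also have "\<dots> \<le> \<eta> powr ((d' - d) / 2) * V x powr (d / 2)"
          using Vx \<eta> d' by (intro mult_right_mono powr_mono2') auto
        finally show ?thesis using False by (simp add: V1_def ennreal_mult[symmetric] ennreal_leI)
      qed (simp add: V1_def)
    qed
    also have "\<dots> = ennreal (\<eta> powr ((d' - d) / 2)) * (\<integral>\<^sup>+ x. ennreal (V x powr (d / 2)) \<partial>\<sigma>)"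
      by (rule nn_integral_cmult) measurable
    also have "\<dots> \<le> ennreal (\<eta> powr ((d' - d) / 2)) * ennreal v0" by (intro mult_left_mono v0) auto
    also have "\<dots> = ennreal v1" using v0 by (simp add: v1_def ennreal_mult)
    finally show ?thesis .
  qed
  have "(\<Sum>i<n. (B.nrm (e i))\<^sup>2) \<le> split_bound v1 v2 n" if n: "n > 0" and on: "FS.orthonormal e n" for n e
  proof -
    define \<rho> where "\<rho> x = (\<Sum>i<n. (cmod (e i x))\<^sup>2)" for x
    have eS: "e i \<in> FS" if "i < n" for i using on that by (simp add: FS.orthonormal_def)
    have em: "e i \<in> borel_measurable \<sigma>" if "i < n" for i
      using form_space_Lp[OF eS[OF that]] by (rule Lp_measurable)
    have \<rho>m [measurable]: "\<rho> \<in> borel_measurable \<sigma>" unfolding \<rho>_def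
      using em by (intro borel_measurable_sum borel_measurable_power borel_measurable_norm) auto
    have \<rho>0: "\<rho> x \<ge> 0" for x by (simp add: \<rho>_def sum_nonneg)
    have int: "(\<integral>\<^sup>+ x. ennreal (V x * \<rho> x) \<partial>\<sigma>) = ennreal (\<Sum>i<n. (B.nrm (e i))\<^sup>2)"
    proof -
      have hi: "has_bochner_integral \<sigma> (\<lambda>x. V x * (cmod (e i x))\<^sup>2) ((B.nrm (e i))\<^sup>2)" if "i < n" for i
        using potential_integrable[OF eS[OF that]] B_nrm_sq[OF eS[OF that]] by (simp add: has_bochner_integral_iff)
      have "has_bochner_integral \<sigma> (\<lambda>x. \<Sum>i<n. V x * (cmod (e i x))\<^sup>2) (\<Sum>i<n. (B.nrm (e i))\<^sup>2)"
        by (intro has_bochner_integral_sum hi) auto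
      then have h: "has_bochner_integral \<sigma> (\<lambda>x. V x * \<rho> x) (\<Sum>i<n. (B.nrm (e i))\<^sup>2)"
        by (simp add: \<rho>_def sum_distrib_left)
      have "AE x in \<sigma>. 0 \<le> V x * \<rho> x" using V0 by eventually_elim (simp add: \<rho>0)
      then show ?thesis using h by (subst nn_integral_eq_integral) (auto simp: has_bochner_integral_iff)
    qed
    have "ennreal (\<Sum>i<n. (B.nrm (e i))\<^sup>2) = (\<integral>\<^sup>+ x. ennreal (V1 x * \<rho> x) + ennreal (V2 x * \<rho> x) \<partial>\<sigma>)"
      unfolding int[symmetric]
      by (rule nn_integral_cong) (simp add: V1_def V2_def)
    also have "\<dots> = (\<integral>\<^sup>+ x. ennreal (V1 x * \<rho> x) \<partial>\<sigma>) + (\<integral>\<^sup>+ x. ennreal (V2 x * \<rho> x) \<partial>\<sigma>)"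
      by (rule nn_integral_add) measurable
    also have "\<dots> \<le> ennreal (2 * v1 powr (2 / d') * (S.CLR_const * real n) powr (1 - 2 / d'))
        + ennreal (2 * v2 powr (2 / d) * (CLR_const * real n) powr (1 - 2 / d))"
    proof (rule add_mono)
      show "(\<integral>\<^sup>+ x. ennreal (V1 x * \<rho> x) \<partial>\<sigma>) \<le> ennreal (2 * v1 powr (2 / d') * (S.CLR_const * real n) powr (1 - 2 / d'))"
      proof (rule holder[OF d'_gt v1])
        show "(\<integral>\<^sup>+ x. ennreal (\<rho> x powr (d' / (d' - 2))) \<partial>\<sigma>) \<le> ennreal (S.CLR_const * real n)"
          unfolding \<rho>_def by (rule clr_form_space[OF short_time on])
      qed (use S.CLR_const_pos n V1p V1b \<rho>0 in auto)
      show "(\<integral>\<^sup>+ x. ennreal (V2 x * \<rho> x) \<partial>\<sigma>) \<le> ennreal (2 * v2 powr (2 / d) * (CLR_const * real n) powr (1 - 2 / d))"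
      proof (rule holder[OF d v2])
        show "(\<integral>\<^sup>+ x. ennreal (\<rho> x powr (d / (d - 2))) \<partial>\<sigma>) \<le> ennreal (CLR_const * real n)"
          unfolding \<rho>_def by (rule clr_form_space[OF spectral_bound_axioms on])
      qed (use CLR_const_pos n V2p V2b \<rho>0 in auto)
    qed
    also have "\<dots> = ennreal (split_bound v1 v2 n)"
      unfolding split_bound_def using v1 v2 by (intro ennreal_plus[symmetric]) auto
    finally show ?thesis
      using v1 v2 by (subst (asm) ennreal_le_iff) (auto simp: split_bound_def)
  qed
  then show ?thesis using v1 by blast
qed

text \<open>The element 0 is inserted for the case that the space has dimension less than \<open>n\<close>.\<close>

definition \<beta> :: "nat \<Rightarrow> real"
  where "\<beta> n = Sup (insert 0 {\<Sum>i<n. (B.nrm (e i))\<^sup>2 | e. FS.orthonormal e n})"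

lemma \<beta>_le:
  assumes "\<And>e. FS.orthonormal e n \<Longrightarrow> (\<Sum>i<n. (B.nrm (e i))\<^sup>2) \<le> b" "b \<ge> 0"
  shows "\<beta> n \<le> b"
  unfolding \<beta>_def using assms by (intro cSup_least) auto

lemma \<beta>_bdd: "bdd_above (insert 0 {\<Sum>i<n. (B.nrm (e i))\<^sup>2 | e. FS.orthonormal e n})"
proof -
  obtain v1 where v1: "\<And>n e. n > 0 \<Longrightarrow> FS.orthonormal e n \<Longrightarrow> (\<Sum>i<n. (B.nrm (e i))\<^sup>2) \<le> split_bound v1 1 n"
    using trace_split[of 1] by auto
  have "(\<Sum>i<n. (B.nrm (e i))\<^sup>2) \<le> max 0 (split_bound v1 1 n)" if "FS.orthonormal e n" for e
    using v1[OF _ that] by (cases "n = 0") auto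
  then show ?thesis by (intro bdd_aboveI[of _ "max 0 (split_bound v1 1 n)"]) auto
qed

lemma \<beta>_trace: "FS.orthonormal e n \<Longrightarrow> (\<Sum>i<n. (B.nrm (e i))\<^sup>2) \<le> \<beta> n"
  unfolding \<beta>_def by (rule cSup_upper[OF _ \<beta>_bdd]) auto

lemma \<beta>_nonneg: "0 \<le> \<beta> n"
  unfolding \<beta>_def by (rule cSup_upper[OF _ \<beta>_bdd]) auto

text \<open>In \<open>split_bound\<close>, the second term is \<open>c/2\<close> times \<open>n\<^bsup>1-2/d\<^esup>\<close> if \<open>v2\<close> is chosen suitably, and the first one is of lower order
  whatever the corresponding \<open>v1\<close> is.\<close>

lemma \<beta>_small:
  assumes c: "c > 0"
  shows "\<forall>\<^sub>F n in sequentially. \<beta> n / real n \<le> c * real n powr (- 2 / d)"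
proof -
  interpret S: spectral_bound \<sigma> E d' C' by (rule short_time)
  define k where "k = CLR_const powr (1 - 2 / d)"
  have k: "k > 0" using CLR_const_pos by (simp add: k_def)
  define v2 where "v2 = (c / (4 * k)) powr (d / 2)"
  have v2: "v2 > 0" using c k by (simp add: v2_def)
  have v2p: "2 * v2 powr (2 / d) * k = c / 2" using c k d by (simp add: v2_def powr_powr)
  obtain v1 where v1: "v1 > 0"
    "\<And>n e. n > 0 \<Longrightarrow> FS.orthonormal e n \<Longrightarrow> (\<Sum>i<n. (B.nrm (e i))\<^sup>2) \<le> split_bound v1 v2 n"
    using trace_split[OF v2] by auto
  define a where "a = 2 * v1 powr (2 / d') * S.CLR_const powr (1 - 2 / d')"
  have a0: "a \<ge> 0" by (simp add: a_def)
  have sb: "split_bound v1 v2 n = a * real n powr (1 - 2 / d') + c / 2 * real n powr (1 - 2 / d)" for n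
    using S.CLR_const_pos CLR_const_pos v2p
    by (simp add: split_bound_def a_def k_def powr_mult)
  have "2 / d - 2 / d' < 0" using d' d'_gt by (simp add: frac_less2)
  then have "(\<lambda>n. real n powr (2 / d - 2 / d')) \<longlonglongrightarrow> 0"
    by (rule tendsto_neg_powr[OF _ filterlim_real_sequentially])
  then have "(\<lambda>n. a * real n powr (2 / d - 2 / d')) \<longlonglongrightarrow> a * 0" by (intro tendsto_intros)
  then have "\<forall>\<^sub>F n in sequentially. a * real n powr (2 / d - 2 / d') < c / 2"
    using c by (intro order_tendstoD(2)) auto
  then show ?thesis using eventually_gt_at_top[of 0]
  proof eventually_elim
    case (elim n)
    have "\<beta> n \<le> split_bound v1 v2 n"
      using v1(2)[OF elim(2)] a0 c by (intro \<beta>_le) (auto simp: sb)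
    also have "\<dots> = real n powr (1 - 2 / d) * (a * real n powr (2 / d - 2 / d') + c / 2)"
    proof -
      have "real n powr (1 - 2 / d') = real n powr (1 - 2 / d) * real n powr (2 / d - 2 / d')"
        by (simp add: powr_add[symmetric])
      then show ?thesis unfolding sb by (simp add: algebra_simps)
    qed
    also have "\<dots> \<le> real n powr (1 - 2 / d) * c"
      using elim(1) by (intro mult_left_mono) auto
    also have "real n powr (1 - 2 / d) = real n * real n powr (- 2 / d)"
      using elim(2) by (simp add: powr_diff powr_minus divide_inverse)
    finally show ?case using elim(2) by (simp add: pos_divide_le_eq mult_ac)
  qed
qed

lemma \<beta>_average: "(\<lambda>n. \<beta> n / real n) \<longlonglongrightarrow> 0"
proof (rule tendsto_sandwich[OF _ _ tendsto_const])
  show "\<forall>\<^sub>F n in sequentially. 0 \<le> \<beta> n / real n" using \<beta>_nonneg by simp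
  show "\<forall>\<^sub>F n in sequentially. \<beta> n / real n \<le> 1 * real n powr (- 2 / d)" by (rule \<beta>_small) simp
  have "(\<lambda>n. real n powr (- 2 / d)) \<longlonglongrightarrow> 0"
    by (rule tendsto_neg_powr[OF _ filterlim_real_sequentially]) (use d in simp)
  then show "(\<lambda>n. 1 * real n powr (- 2 / d)) \<longlonglongrightarrow> 0" by simp
qed

sublocale BS: form_operator fscale FS fip bV "sqrt KV" \<beta>
  by unfold_locales (auto intro: B_bounded \<beta>_trace \<beta>_average)

lemma birman_schwinger_eq: "birman_schwinger \<sigma> A pexp V = BS.gen"
  by (auto simp: birman_schwinger_def BS.gen_def)

lemma ip_norm_fip: "ip_norm fip = FS.nrm"
  by (auto simp: ip_norm_def FS.nrm_def)

lemma compact_birman_schwinger: "compact_op FS fip BS.gen"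
  unfolding compact_op_def linear_op_def
proof (intro conjI)
  show "BS.gen \<subseteq> FS \<times> FS" by (auto simp: BS.gen_def)
  show "Domain BS.gen = FS" by (rule BS.Domain_gen)
  have "(\<lambda>x. c * u x + u' x, \<lambda>x. c * v x + v' x) \<in> BS.gen" if "(u, v) \<in> BS.gen" "(u', v') \<in> BS.gen" for c u v u' v'
    using BS.gen_linear[OF that, of c] by (simp add: plus_fun_def fscale_def)
  then show "\<forall>(u, v)\<in>BS.gen. \<forall>(u', v')\<in>BS.gen. \<forall>c. (\<lambda>x. c * u x + u' x, \<lambda>x. c * v x + v' x) \<in> BS.gen" by blast
  show "\<forall>(u, v)\<in>BS.gen. ip_norm fip u = 0 \<longrightarrow> ip_norm fip v = 0"
    using BS.gen_null unfolding ip_norm_fip by blast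
  show "\<forall>u v. (\<forall>n::nat. (u n, v n) \<in> BS.gen) \<and> (\<exists>C. \<forall>n. ip_norm fip (u n) \<le> C) \<longrightarrow>
      (\<exists>r w. strict_mono r \<and> w \<in> FS \<and> (\<lambda>n. ip_norm fip (\<lambda>x. v (r n) x - w x)) \<longlonglongrightarrow> 0)"
  proof (intro allI impI, elim conjE exE)
    fix u v :: "nat \<Rightarrow> 'a fn" and C
    assume "\<forall>n. (u n, v n) \<in> BS.gen" "\<forall>n. ip_norm fip (u n) \<le> C"
    then have "\<exists>r w. strict_mono (r::nat\<Rightarrow>nat) \<and> w \<in> FS \<and> (\<lambda>n. FS.nrm (v (r n) - w)) \<longlonglongrightarrow> 0"
      by (intro BS.gen_compact[of u v C]) (auto simp: ip_norm_fip)
    then show "\<exists>r w. strict_mono r \<and> w \<in> FS \<and> (\<lambda>n. ip_norm fip (\<lambda>x. v (r n) x - w x)) \<longlonglongrightarrow> 0"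
      by (simp add: ip_norm_fip fun_diff_def)
  qed
qed

text \<open>Eigenvectors for eigenvalues at least \<open>s\<^sup>2\<close> satisfy \<open>b\<^sub>V[e\<^sub>i] \<ge> s\<close> by \<open>gen_eigenvector\<close>; adding up \<open>n\<close> of them
  gives \<open>n s \<le> \<beta> n\<close>.\<close>

lemma singular_number_bounds:
  assumes n: "n > 0"
  shows "0 \<le> singular_number FS fip BS.gen n" "singular_number FS fip BS.gen n \<le> \<beta> n / real n"
proof -
  define S where "S = {s. s = 0 \<or> s > 0 \<and>
      (\<exists>e \<mu>. (\<forall>i<n. eigenvector_op fip (BS.gen O adjoint_op FS fip BS.gen) (\<mu> i) (e i) \<and> \<mu> i \<ge> s\<^sup>2) \<and>
             (\<forall>i<n. \<forall>j<n. fip (e i) (e j) = (if i = j then 1 else 0)))}"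
  have eq: "singular_number FS fip BS.gen n = Sup S" by (simp add: singular_number_def S_def)
  have ub: "s \<le> \<beta> n / real n" if sS: "s \<in> S" for s
  proof (cases "s = 0")
    case True
    then show ?thesis using \<beta>_nonneg by simp
  next
    case False
    then obtain e m where s: "s > 0"
      and all: "\<forall>i<n. eigenvector_op fip (BS.gen O adjoint_op FS fip BS.gen) (m i) (e i) \<and> m i \<ge> s\<^sup>2"
      and on: "\<forall>i<n. \<forall>j<n. fip (e i) (e j) = (if i = j then 1 else 0)"
      using sS unfolding S_def by blast
    have ev: "eigenvector_op fip (BS.gen O adjoint_op FS fip BS.gen) (m i) (e i)" and m: "m i \<ge> s\<^sup>2" if "i < n" for i
      using all that by blast+
    have main: "e i \<in> FS \<and> s \<le> (B.nrm (e i))\<^sup>2" if i: "i < n" for i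
    proof -
      have "(e i, \<lambda>x. of_real (m i) * e i x) \<in> BS.gen O adjoint_op FS fip BS.gen"
        using ev[OF i] by (simp add: eigenvector_op_def)
      then obtain y where y: "(e i, y) \<in> BS.gen" "(y, fscale (of_real (m i)) (e i)) \<in> adjoint_op FS fip BS.gen"
        by (auto simp: fscale_def)
      have eS: "e i \<in> FS" using y(1) by (auto simp: BS.gen_def)
      have mp: "m i > 0" using m[OF i] s by (meson less_le_trans zero_less_power)
      have "(B.nrm (e i))\<^sup>2 = sqrt (m i) * (FS.nrm (e i))\<^sup>2"
        by (rule BS.gen_eigenvector[OF y(1) mp]) (use y(2) in \<open>auto simp: adjoint_op_def\<close>)
      moreover have "(FS.nrm (e i))\<^sup>2 = 1" using on i FS.nrm_sq[OF eS] by simp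
      moreover have "s \<le> sqrt (m i)" using m[OF i] s by (intro real_le_rsqrt) auto
      ultimately show ?thesis using eS by simp
    qed
    have "FS.orthonormal e n" using main on by (auto simp: FS.orthonormal_def)
    then have "(\<Sum>i<n. (B.nrm (e i))\<^sup>2) \<le> \<beta> n" by (rule \<beta>_trace)
    moreover have "real n * s \<le> (\<Sum>i<n. (B.nrm (e i))\<^sup>2)"
      using sum_mono[of "{..<n}" "\<lambda>_. s" "\<lambda>i. (B.nrm (e i))\<^sup>2"] main by simp
    ultimately show ?thesis using n by (simp add: pos_le_divide_eq mult.commute)
  qed
  have z: "0 \<in> S" by (simp add: S_def)
  show "singular_number FS fip BS.gen n \<le> \<beta> n / real n"
    unfolding eq by (rule cSup_least) (use z ub in auto)
  show "0 \<le> singular_number FS fip BS.gen n"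
    unfolding eq by (rule cSup_upper[OF z]) (use ub in \<open>auto intro!: bdd_aboveI[of _ "\<beta> n / real n"]\<close>)
qed

theorem birman_schwinger_Sigma0: "birman_schwinger \<sigma> A pexp V \<in> Sigma0 FS fip (d / 2)"
proof -
  have "singular_number FS fip BS.gen \<in> o(\<lambda>n. real n powr (- 1 / (d / 2)))"
  proof (rule landau_o.smallI)
    fix c :: real assume c: "c > 0"
    show "\<forall>\<^sub>F n in sequentially. norm (singular_number FS fip BS.gen n) \<le> c * norm (real n powr (- 1 / (d / 2)))"
      using \<beta>_small[OF c] eventually_gt_at_top[of 0]
    proof eventually_elim
      case (elim n)
      then show ?case using singular_number_bounds[OF elim(2)] by simp
    qed
  qed
  then show ?thesis unfolding Sigma0_def birman_schwinger_eq using compact_birman_schwinger by simp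
qed

end

section \<open>The theorem\<close>

theorem theorem2p3:
  fixes \<sigma> :: "'a measure" and A :: "'a graph" and V :: "'a \<Rightarrow> real" and \<delta> D p :: real
  assumes "sigma_finite_measure \<sigma>"
    and "self_adjoint_op (Lp \<sigma> 2) (L2_inner \<sigma>) A"
    and "nonneg_op (L2_inner \<sigma>) A"
    and "\<And>t. t > 0 \<Longrightarrow> positivity_preserving \<sigma> (exp_op \<sigma> A t)"
    and "\<And>t. t > 0 \<Longrightarrow> bounded_L1_Linf \<sigma> (exp_op \<sigma> A t)"
    and "\<delta> \<ge> 0"
    and "\<exists>C. \<forall>\<^sub>F t in at_right 0. heat_bound \<sigma> A t \<le> ennreal (C * t powr (- \<delta> / 2))"
    and "\<exists>C. \<forall>\<^sub>F t in at_top. heat_bound \<sigma> A t \<le> ennreal (C * t powr (- D / 2))"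
    and "D > \<delta>" and "D > 2"
    and "p = 2 * D / (D - 2)"
    and "AE x in \<sigma>. V x \<ge> 0"
    and "V \<in> Lp \<sigma> (D / 2)"
  shows "birman_schwinger \<sigma> A p V \<in> Sigma0 (form_space \<sigma> A p) (form_space_inner \<sigma> A p) (D / 2)"
proof -
  \<comment> \<open>The graph of \<open>e\<^sup>-\<^sup>A\<close> is defined by means of spectral measures of \<open>A\<close>.  As it is not empty, such a measure exists.\<close>
  obtain v where "((0 :: 'a fn), v) \<in> exp_op \<sigma> A 1"
    using assms(5)[of 1] unfolding bounded_L1_Linf_def by fastforce
  then obtain E where E: "projection_valued_measure \<sigma> E" and A: "A = spectral_integral \<sigma> E (\<lambda>s. s)"
    unfolding exp_op_def fun_calc_def by blast
  have pE: "pvm \<sigma> E" by (rule pvm.intro[OF E])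
  \<comment> \<open>Any exponent strictly between \<open>max \<delta> 2\<close> and \<open>D\<close>.\<close>
  define d' where "d' = (max \<delta> 2 + D) / 2"
  have d': "\<delta> \<le> d'" "d' \<le> D" "d' > 2" "d' < D" using assms(9,10) by (auto simp: d'_def max_def)
  obtain C where C: "spectral_bound \<sigma> E D C"
    using heat_bounds_spectral_bound[OF assms(1) pE A assms(7,8), of D] assms(9,10) by auto
  obtain C' where C': "spectral_bound \<sigma> E d' C'"
    using heat_bounds_spectral_bound[OF assms(1) pE A assms(7,8) d'(1-3)] by blast
  have pos: "positivity_preserving \<sigma> (spectral_integral \<sigma> E (\<lambda>s. exp (- t * s)))" if t: "t > 0" for t
  proof -
    have "exp_op \<sigma> A t = spectral_integral \<sigma> E (\<lambda>s. exp (- t * s))"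
      unfolding exp_op_def by (rule fun_calc_eq[OF pE A]) measurable
    then show ?thesis using assms(4)[OF t] by simp
  qed
  interpret schrodinger \<sigma> E D C A V d' C'
    by (intro schrodinger.intro form_setting.intro positive_semigroup.intro positive_semigroup_axioms.intro
        form_setting_axioms.intro schrodinger_axioms.intro C C' pos A assms(12,13) d'(4))
  show ?thesis unfolding assms(11) by (rule birman_schwinger_Sigma0)
qed

end
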